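(* Let $(A,G,\psi)$ be an abstract kernel, i.e. $A$ is a semilattice of groups, $G$ is a group and $\psi:G\to\varsigma(A)$ is a unital partial homomorphism. For each $g\in G$ let $\mathcal D_g$ denote the common range of the isomorphisms in the class $\psi(g)$. (1) The center $C(A)$ can be uniquely regarded as a partial $G$-module via $\tilde\theta=\{\tilde\theta_g:C(\mathcal D_{g^{-1}})\to C(\mathcal D_g)\}_{g\in G}$, where $\theta_g\in\psi(g)$ and $\tilde\theta_g=\theta_g|_{C(\mathcal D_{g^{-1}})}$ (that is, $\tilde\theta$ is a partial action of $G$ on $C(A)$ which does not depend on the choice of the representatives $\theta_g\in\psi(g)$). (2) Taking the cohomology class of an obstruction $\beta$ to $(A,G,\psi)$ gives a well-defined element $\operatorname{Obs}(A,G,\psi)\in H^3(G,C(A))$ (independent of all choices made in the construction of $\beta$). (3) The abstract kernel $(A,G,\psi)$ has an admissible extension if and only if $\operatorname{Obs}(A,G,\psi)$ is trivial.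
   Context: Conventions. A semilattice of groups is an inverse semigroup whose idempotents are central. Ideals are non-empty and two-sided. $E(S)$ is the set of idempotents and $C(S)$ the center of a semigroup $S$. In an inverse semigroup every ideal is idempotent and $IJ=I\cap J$ for ideals $I,J$. Multipliers. A multiplier of a semigroup $S$ is a pair $m$ of maps $s\mapsto ms$, $s\mapsto sm$ from $S$ to $S$ with $m(st)=(ms)t$, $(st)m=s(tm)$, $s(mt)=(sm)t$ for all $s,t\in S$. They form a monoid $\mathcal M(S)$ with $(mn)s=m(ns)$, $s(mn)=(sm)n$. $\mathcal U(M)$ is the group of invertible elements of a monoid $M$. If $S^2=S$ then $(ms)n=m(sn)$, so $msn$ is unambiguous. Multipliers of an ideal $I$ of an inverse semigroup restrict to multipliers of ideals contained in $I$; restrictions are denoted by the same letter. For a semigroup isomorphism $\alpha:S\to T$ and $m\in\mathcal M(S)$, $m^\alpha\in\mathcal M(T)$ is given by $m^\alpha t=\alpha(m\,\alpha^{-1}(t))$, $t m^\alpha=\alpha(\alpha^{-1}(t)m)$. The monoid $\varsigma(A)$. $\Sigma(A)$ is the inverse monoid (under composition of partial maps) of all isomorphisms between ideals of $A$. For $\varphi,\psi\in\Sigma(A)$ put $\psi\sim\varphi$ iff $\operatorname{dom}\varphi=\operatorname{dom}\psi$, $\operatorname{ran}\varphi=\operatorname{ran}\psi$ and there is $m\in\mathcal U(\mathcal M(\operatorname{ran}\varphi))$ with $\psi(s)=m\varphi(s)m^{-1}$ for all $s\in\operatorname{dom}\varphi$. This is a congruence and $\varsigma(A)=\Sigma(A)/{\sim}$.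 A map $f:G\to S$ from a group to a monoid is a unital partial homomorphism if $f(1)=1$, $f(g^{-1})f(g)f(h)=f(g^{-1})f(gh)$ and $f(g)f(h)f(h^{-1})=f(gh)f(h^{-1})$ for all $g,h\in G$. Every $\theta_g\in\psi(g)$ is an isomorphism $\mathcal D_{g^{-1}}\to\mathcal D_g$. Partial actions and cohomology. A partial action of $G$ on a semigroup $B$ is a family of isomorphisms $\theta_g:B_{g^{-1}}\to B_g$ between two-sided ideals of $B$ with $B_1=B$, $\theta_1=\mathrm{id}_B$, $\theta_g(B_{g^{-1}}\cap B_h)=B_g\cap B_{gh}$, and $\theta_g\circ\theta_h=\theta_{gh}$ on $B_{h^{-1}}\cap B_{h^{-1}g^{-1}}$. A partial $G$-module is a semilattice of abelian groups $B$ (i.e. a commutative inverse semigroup) with a partial action $\theta$ of $G$ on $B$. For $n\ge1$, $C^n(G,B)$ is the abelian group (pointwise multiplication) of functions $f$ on $G^n$ with $f(x_1,\dots,x_n)\in\mathcal U(\mathcal M(B_{x_1}B_{x_1x_2}\cdots B_{x_1\cdots x_n}))$. The coboundary $\delta^n:C^n(G,B)\to C^{n+1}(G,B)$ is $$(\delta^nf)(x_1,\dots,x_{n+1})a=\theta_{x_1}\big(\theta_{x_1}^{-1}(a)f(x_2,\dots,x_{n+1})\big)\prod_{i=1}^nf(x_1,\dots,x_ix_{i+1},\dots,x_{n+1})^{(-1)^i}f(x_1,\dots,x_n)^{(-1)^{n+1}}$$ for $a\in B_{x_1}B_{x_1x_2}\cdots B_{x_1\cdots x_{n+1}}$. For $n\geq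 2$, $Z^n=\ker\delta^n$, $B^n=\operatorname{im}\delta^{n-1}$, $H^n=Z^n/B^n$. Obstruction. Choose $\theta_g\in\psi(g)$ for each $g$. There are $w_{g,h}\in\mathcal U(\mathcal M(\mathcal D_g\mathcal D_{gh}))$ with $\theta_g(\theta_h(a))=w_{g,h}\theta_{gh}(a)w_{g,h}^{-1}$ for all $a\in\mathcal D_{h^{-1}}\mathcal D_{h^{-1}g^{-1}}$; choose them. There are $\beta(g,h,k)\in\mathcal U(C(\mathcal M(\mathcal D_g\mathcal D_{gh}\mathcal D_{ghk})))$ with $w_{h,k}^{\theta_g}w_{g,hk}=\beta(g,h,k)w_{g,h}w_{gh,k}$ as multipliers of $\mathcal D_g\mathcal D_{gh}\mathcal D_{ghk}$, where $w_{h,k}^{\theta_g}$ is formed using the restriction $\theta_g:\mathcal D_{g^{-1}}\mathcal D_h\mathcal D_{hk}\to\mathcal D_g\mathcal D_{gh}\mathcal D_{ghk}$. The map $\beta$ is called an obstruction to (the extension of) $(A,G,\psi)$. Central multipliers of $\mathcal D_g\mathcal D_{gh}\mathcal D_{ghk}$ restrict to multipliers of its center $C(\mathcal D_g\mathcal D_{gh}\mathcal D_{ghk})=C(\mathcal D_g)C(\mathcal D_{gh})C(\mathcal D_{ghk})$, so $\beta$ is regarded as a $3$-cochain with values in $C(A)$. Extensions. An extension of $A$ by an inverse semigroup $S$ is an inverse semigroup $U$ with a monomorphism $i:A\to U$ and an idempotent-separating epimorphism $\pi:U\to S$ such that $i(A)=\pi^{-1}(E(S))$. An extension $A\xrightarrow{i}U\xrightarrow{j}G$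 of $A$ by the group $G$ is an inverse semigroup $U$ with a monomorphism $i$ and an epimorphism $j:U\to G$ such that $i(A)=j^{-1}(1)$. A refinement of it is $A\xrightarrow{i}U\xrightarrow{\pi}S\xrightarrow{\kappa}G$ with $S$ an $E$-unitary inverse semigroup, $A\xrightarrow{i}U\xrightarrow{\pi}S$ an extension of $A$ by $S$, $\kappa$ an epimorphism and $j=\kappa\circ\pi$. The extension is admissible if it has a refinement for which there is an order-preserving transversal of $\pi$: a map $\rho:S\to U$ with $\pi\circ\rho=\mathrm{id}_S$, $\rho(E(S))\subseteq E(U)$, preserving the natural partial orders. Given such data, put $\mathcal D_g=\{a\in A:\exists s\in S,\ \kappa(s)=g,\ \rho(ss^{-1})=i(aa^{-1})\}$ and $\theta_g:\mathcal D_{g^{-1}}\to\mathcal D_g$, $\theta_g(a)=i^{-1}(\rho(s)i(a)\rho(s)^{-1})$, where $s$ is the element with $\kappa(s)=g$ and $\rho(s^{-1}s)=i(aa^{-1})$. The abstract kernel of the admissible extension is the unital partial homomorphism $G\to\varsigma(A)$, $g\mapsto[\theta_g]$ (independent of the chosen refinement and transversal). An abstract kernel $(A,G,\psi)$ has an admissible extension if $\psi$ is the abstract kernel of some admissible extension of $A$ by $G$. *)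

theory Defs
  imports "HOL-Algebra.Coset"
begin

section \<open>Semigroups, ideals, centers\<close>

text \<open>
  Semigroups are given by a carrier and a multiplication; an ideal \<open>I\<close> of \<open>S\<close>, viewed as
  a semigroup, is \<open>S\<lparr>carrier := I\<rparr>\<close>. Groups and monoids are those of HOL-Algebra.
  Semigroups are assumed to be non-empty.
\<close>

record 'a semigrp = "'a partial_object" +
  smult :: "['a, 'a] \<Rightarrow> 'a" (infixl "\<cdot>\<index>" 70)

locale semigrp =
  fixes S :: "'a semigrp" (structure)
  assumes nonempty: "carrier S \<noteq> {}"
    and closed: "\<lbrakk>x \<in> carrier S; y \<in> carrier S\<rbrakk> \<Longrightarrow> x \<cdot> y \<in> carrier S"
    and assoc: "\<lbrakk>x \<in> carrier S; y \<in> carrier S; z \<in> carrier S\<rbrakk>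
          \<Longrightarrow> (x \<cdot> y) \<cdot> z = x \<cdot> (y \<cdot> z)"

definition is_sinv :: "'a semigrp \<Rightarrow> 'a \<Rightarrow> 'a \<Rightarrow> bool" where
  "is_sinv S x y \<longleftrightarrow> y \<in> carrier S \<and> x \<cdot>\<^bsub>S\<^esub> y \<cdot>\<^bsub>S\<^esub> x = x \<and> y \<cdot>\<^bsub>S\<^esub> x \<cdot>\<^bsub>S\<^esub> y = y"

definition sinv :: "'a semigrp \<Rightarrow> 'a \<Rightarrow> 'a" where
  "sinv S x = (THE y. is_sinv S x y)"

definition idems :: "'a semigrp \<Rightarrow> 'a set" where
  "idems S = {e \<in> carrier S. e \<cdot>\<^bsub>S\<^esub> e = e}"

definition center :: "'a semigrp \<Rightarrow> 'a set" where
  "center S = {c \<in> carrier S. \<forall>x \<in> carrier S. c \<cdot>\<^bsub>S\<^esub> x = x \<cdot>\<^bsub>S\<^esub> c}"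

locale inverse_semigrp = semigrp +
  assumes unique_inverse: "x \<in> carrier S \<Longrightarrow> \<exists>!y. is_sinv S x y"

locale semilattice_of_groups = inverse_semigrp +
  assumes idems_central: "idems S \<subseteq> center S"

locale comm_inverse_semigrp = inverse_semigrp +
  assumes commute: "\<lbrakk>x \<in> carrier S; y \<in> carrier S\<rbrakk> \<Longrightarrow> x \<cdot> y = y \<cdot> x"

definition nat_le :: "'a semigrp \<Rightarrow> 'a \<Rightarrow> 'a \<Rightarrow> bool" where
  "nat_le S s t \<longleftrightarrow> (\<exists>e \<in> idems S. s = e \<cdot>\<^bsub>S\<^esub> t)"

definition E_unitary :: "'a semigrp \<Rightarrow> bool" where
  "E_unitary S \<longleftrightarrow> inverse_semigrp S \<and>
     (\<forall>e \<in> idems S. \<forall>s \<in> carrier S. nat_le S e s \<longrightarrow> s \<in> idems S)"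

definition ideal_of :: "'a semigrp \<Rightarrow> 'a set \<Rightarrow> bool" where
  "ideal_of S I \<longleftrightarrow> I \<noteq> {} \<and> I \<subseteq> carrier S \<and>
     (\<forall>x \<in> carrier S. \<forall>a \<in> I. x \<cdot>\<^bsub>S\<^esub> a \<in> I \<and> a \<cdot>\<^bsub>S\<^esub> x \<in> I)"

fun ideal_prod :: "'a semigrp \<Rightarrow> 'a set list \<Rightarrow> 'a set" where
  "ideal_prod S [] = carrier S"
| "ideal_prod S [I] = I"
| "ideal_prod S (I # J # Js) = {a \<cdot>\<^bsub>S\<^esub> b | a b. a \<in> I \<and> b \<in> ideal_prod S (J # Js)}"

definition semigrp_of :: "('g, 'm) monoid_scheme \<Rightarrow> 'g semigrp" where
  "semigrp_of G = \<lparr>carrier = carrier G, smult = mult G\<rparr>"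

definition shom :: "'a semigrp \<Rightarrow> 'b semigrp \<Rightarrow> ('a \<Rightarrow> 'b) set" where
  "shom S T = {f \<in> carrier S \<rightarrow> carrier T.
     \<forall>x \<in> carrier S. \<forall>y \<in> carrier S. f (x \<cdot>\<^bsub>S\<^esub> y) = f x \<cdot>\<^bsub>T\<^esub> f y}"

definition smono :: "'a semigrp \<Rightarrow> 'b semigrp \<Rightarrow> ('a \<Rightarrow> 'b) set" where
  "smono S T = {f \<in> shom S T. inj_on f (carrier S)}"

definition sepi :: "'a semigrp \<Rightarrow> 'b semigrp \<Rightarrow> ('a \<Rightarrow> 'b) set" where
  "sepi S T = {f \<in> shom S T. f ` carrier S = carrier T}"


section \<open>Multipliers\<close>

text \<open>
  A multiplier is the pair of its left action \<open>s \<mapsto> ms\<close> and its right action \<open>s \<mapsto> sm\<close>, both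
  extensional on the carrier, so that equality of pairs is equality of multipliers.
\<close>

type_synonym 'a multiplier = "('a \<Rightarrow> 'a) \<times> ('a \<Rightarrow> 'a)"

abbreviation lact :: "'a multiplier \<Rightarrow> 'a \<Rightarrow> 'a" where
  "lact m s \<equiv> fst m s"

abbreviation ract :: "'a \<Rightarrow> 'a multiplier \<Rightarrow> 'a" where
  "ract s m \<equiv> snd m s"

definition multipliers :: "'a semigrp \<Rightarrow> 'a multiplier set" where
  "multipliers S = {m.
     fst m \<in> carrier S \<rightarrow>\<^sub>E carrier S \<and> snd m \<in> carrier S \<rightarrow>\<^sub>E carrier S \<and>
     (\<forall>s \<in> carrier S. \<forall>t \<in> carrier S.
        lact m (s \<cdot>\<^bsub>S\<^esub> t) = lact m s \<cdot>\<^bsub>S\<^esub> t \<and>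
        ract (s \<cdot>\<^bsub>S\<^esub> t) m = s \<cdot>\<^bsub>S\<^esub> ract t m \<and>
        s \<cdot>\<^bsub>S\<^esub> lact m t = ract s m \<cdot>\<^bsub>S\<^esub> t)}"

definition mult_monoid :: "'a semigrp \<Rightarrow> 'a multiplier monoid" where
  "mult_monoid S = \<lparr>carrier = multipliers S,
     mult = (\<lambda>m n. (\<lambda>s \<in> carrier S. lact m (lact n s), \<lambda>s \<in> carrier S. ract (ract s m) n)),
     one = (\<lambda>s \<in> carrier S. s, \<lambda>s \<in> carrier S. s)\<rparr>"

definition center_monoid :: "('a, 'm) monoid_scheme \<Rightarrow> ('a, 'm) monoid_scheme" where
  "center_monoid M = M\<lparr>carrier :=
     {c \<in> carrier M. \<forall>x \<in> carrier M. c \<otimes>\<^bsub>M\<^esub> x = x \<otimes>\<^bsub>M\<^esub> c}\<rparr>"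

definition mconj :: "'a semigrp \<Rightarrow> 'a multiplier \<Rightarrow> 'a \<Rightarrow> 'a" where
  "mconj S m s = ract (lact m s) (inv\<^bsub>mult_monoid S\<^esub> m)"

definition mrestrict :: "'a multiplier \<Rightarrow> 'a set \<Rightarrow> 'a multiplier" where
  "mrestrict m J = (restrict (fst m) J, restrict (snd m) J)"


section \<open>Partial maps and the monoid of classes of ideal isomorphisms\<close>

text \<open>
  Partial maps are \<open>'a \<rightharpoonup> 'a\<close>, with composition \<open>\<circ>\<^sub>m\<close> and restriction \<open>|`\<close>.
\<close>

definition pinv :: "('a \<rightharpoonup> 'a) \<Rightarrow> 'a \<Rightarrow> 'a" where
  "pinv \<phi> b = inv_into (dom \<phi>) (\<lambda>a. the (\<phi> a)) b"

definition ideal_iso :: "'a semigrp \<Rightarrow> 'a set \<Rightarrow> 'a set \<Rightarrow> ('a \<rightharpoonup> 'a) \<Rightarrow> bool" where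
  "ideal_iso S I J \<phi> \<longleftrightarrow> ideal_of S I \<and> ideal_of S J \<and> dom \<phi> = I \<and> ran \<phi> = J \<and>
     inj_on \<phi> I \<and>
     (\<forall>a \<in> I. \<forall>b \<in> I. the (\<phi> (a \<cdot>\<^bsub>S\<^esub> b)) = the (\<phi> a) \<cdot>\<^bsub>S\<^esub> the (\<phi> b))"

definition mtransport :: "('a \<rightharpoonup> 'a) \<Rightarrow> 'a multiplier \<Rightarrow> 'a multiplier" where
  "mtransport \<alpha> m =
     (\<lambda>t \<in> ran \<alpha>. the (\<alpha> (lact m (pinv \<alpha> t))),
      \<lambda>t \<in> ran \<alpha>. the (\<alpha> (ract (pinv \<alpha> t) m)))"

definition Sigma_monoid :: "'a semigrp \<Rightarrow> ('a \<rightharpoonup> 'a) monoid" where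
  "Sigma_monoid A = \<lparr>carrier = {\<phi>. \<exists>I J. ideal_iso A I J \<phi>},
     mult = (\<lambda>\<phi> \<psi>. \<phi> \<circ>\<^sub>m \<psi>),
     one = Some |` carrier A\<rparr>"

definition sim :: "'a semigrp \<Rightarrow> (('a \<rightharpoonup> 'a) \<times> ('a \<rightharpoonup> 'a)) set" where
  "sim A = {(\<psi>, \<phi>). \<psi> \<in> carrier (Sigma_monoid A) \<and> \<phi> \<in> carrier (Sigma_monoid A) \<and>
     dom \<psi> = dom \<phi> \<and> ran \<psi> = ran \<phi> \<and>
     (\<exists>m \<in> Units (mult_monoid (A\<lparr>carrier := ran \<phi>\<rparr>)). \<forall>s \<in> dom \<phi>.
        the (\<psi> s) = mconj (A\<lparr>carrier := ran \<phi>\<rparr>) m (the (\<phi> s)))}"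

definition varsigma :: "'a semigrp \<Rightarrow> ('a \<rightharpoonup> 'a) set monoid" where
  "varsigma A = \<lparr>carrier = carrier (Sigma_monoid A) // sim A,
     mult = (\<lambda>X Y. \<Union>\<phi> \<in> X. \<Union>\<psi> \<in> Y. sim A `` {\<phi> \<otimes>\<^bsub>Sigma_monoid A\<^esub> \<psi>}),
     one = sim A `` {\<one>\<^bsub>Sigma_monoid A\<^esub>}\<rparr>"

definition unital_partial_hom ::
    "('g, 'm) monoid_scheme \<Rightarrow> ('s, 'n) monoid_scheme \<Rightarrow> ('g \<Rightarrow> 's) \<Rightarrow> bool" where
  "unital_partial_hom G S f \<longleftrightarrow> f \<in> carrier G \<rightarrow> carrier S \<and> f \<one>\<^bsub>G\<^esub> = \<one>\<^bsub>S\<^esub> \<and>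
     (\<forall>g \<in> carrier G. \<forall>h \<in> carrier G.
        f (inv\<^bsub>G\<^esub> g) \<otimes>\<^bsub>S\<^esub> f g \<otimes>\<^bsub>S\<^esub> f h = f (inv\<^bsub>G\<^esub> g) \<otimes>\<^bsub>S\<^esub> f (g \<otimes>\<^bsub>G\<^esub> h) \<and>
        f g \<otimes>\<^bsub>S\<^esub> f h \<otimes>\<^bsub>S\<^esub> f (inv\<^bsub>G\<^esub> h) = f (g \<otimes>\<^bsub>G\<^esub> h) \<otimes>\<^bsub>S\<^esub> f (inv\<^bsub>G\<^esub> h))"

definition abstract_kernel ::
    "'a semigrp \<Rightarrow> ('g, 'm) monoid_scheme \<Rightarrow> ('g \<Rightarrow> ('a \<rightharpoonup> 'a) set) \<Rightarrow> bool" where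
  "abstract_kernel A G \<psi> \<longleftrightarrow>
     semilattice_of_groups A \<and> group G \<and> unital_partial_hom G (varsigma A) \<psi>"

text \<open>The common range of the members of \<open>\<psi> g\<close>.\<close>

definition kdom :: "('g \<Rightarrow> ('a \<rightharpoonup> 'a) set) \<Rightarrow> 'g \<Rightarrow> 'a set" where
  "kdom \<psi> g = the_elem (ran ` \<psi> g)"


section \<open>Partial modules and their cohomology\<close>

definition partial_action ::
    "('g, 'm) monoid_scheme \<Rightarrow> 'a semigrp \<Rightarrow> ('g \<Rightarrow> 'a set) \<Rightarrow> ('g \<Rightarrow> 'a \<rightharpoonup> 'a) \<Rightarrow> bool" where
  "partial_action G B D \<theta> \<longleftrightarrow>
     (\<forall>g \<in> carrier G. ideal_iso B (D (inv\<^bsub>G\<^esub> g)) (D g) (\<theta> g)) \<and>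
     D \<one>\<^bsub>G\<^esub> = carrier B \<and> \<theta> \<one>\<^bsub>G\<^esub> = Some |` carrier B \<and>
     (\<forall>g \<in> carrier G. \<forall>h \<in> carrier G.
        (\<lambda>a. the (\<theta> g a)) ` (D (inv\<^bsub>G\<^esub> g) \<inter> D h) = D g \<inter> D (g \<otimes>\<^bsub>G\<^esub> h) \<and>
        (\<forall>a \<in> D (inv\<^bsub>G\<^esub> h) \<inter> D (inv\<^bsub>G\<^esub> h \<otimes>\<^bsub>G\<^esub> inv\<^bsub>G\<^esub> g).
           the (\<theta> g (the (\<theta> h a))) = the (\<theta> (g \<otimes>\<^bsub>G\<^esub> h) a)))"

definition partial_module ::
    "('g, 'm) monoid_scheme \<Rightarrow> 'a semigrp \<Rightarrow> ('g \<Rightarrow> 'a set) \<Rightarrow> ('g \<Rightarrow> 'a \<rightharpoonup> 'a) \<Rightarrow> bool" where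
  "partial_module G B D \<theta> \<longleftrightarrow> comm_inverse_semigrp B \<and> partial_action G B D \<theta>"

text \<open>Elements of \<open>G\<^sup>n\<close> are lists of length \<open>n\<close>.\<close>

definition tuples :: "('g, 'm) monoid_scheme \<Rightarrow> nat \<Rightarrow> 'g list set" where
  "tuples G n = {xs. length xs = n \<and> set xs \<subseteq> carrier G}"

definition gprod :: "('g, 'm) monoid_scheme \<Rightarrow> 'g list \<Rightarrow> 'g" where
  "gprod G xs = foldr (mult G) xs \<one>\<^bsub>G\<^esub>"

text \<open>
  \<open>chain G B D [x\<^sub>1, \<dots>, x\<^sub>n]\<close> is the product of the ideals \<open>D x\<^sub>1\<close>, \<open>D (x\<^sub>1x\<^sub>2)\<close>, \<open>\<dots>\<close>,
  \<open>D (x\<^sub>1\<dots>x\<^sub>n)\<close> (for \<open>n \<ge> 1\<close>).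
\<close>

definition chain ::
    "('g, 'm) monoid_scheme \<Rightarrow> 'a semigrp \<Rightarrow> ('g \<Rightarrow> 'a set) \<Rightarrow> 'g list \<Rightarrow> 'a set" where
  "chain G B D xs = ideal_prod B (map (\<lambda>i. D (gprod G (take i xs))) [1..<Suc (length xs)])"

definition chain_mult ::
    "('g, 'm) monoid_scheme \<Rightarrow> 'a semigrp \<Rightarrow> ('g \<Rightarrow> 'a set) \<Rightarrow> 'g list \<Rightarrow> 'a multiplier monoid"
  where
  "chain_mult G B D xs = mult_monoid (B\<lparr>carrier := chain G B D xs\<rparr>)"

definition cochains ::
    "('g, 'm) monoid_scheme \<Rightarrow> 'a semigrp \<Rightarrow> ('g \<Rightarrow> 'a set) \<Rightarrow> nat
      \<Rightarrow> ('g list \<Rightarrow> 'a multiplier) monoid" where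
  "cochains G B D n = \<lparr>carrier = (\<Pi>\<^sub>E xs \<in> tuples G n. Units (chain_mult G B D xs)),
     mult = (\<lambda>f f'. \<lambda>xs \<in> tuples G n. f xs \<otimes>\<^bsub>chain_mult G B D xs\<^esub> f' xs),
     one = (\<lambda>xs \<in> tuples G n. \<one>\<^bsub>chain_mult G B D xs\<^esub>)\<rparr>"

text \<open>
  \<open>contract G i [x\<^sub>1, \<dots>, x\<^sub>m]\<close> replaces the entries \<open>x\<^sub>i, x\<^bsub>i+1\<^esub>\<close> (counted from 1) by their
  product.
\<close>

definition contract :: "('g, 'm) monoid_scheme \<Rightarrow> nat \<Rightarrow> 'g list \<Rightarrow> 'g list" where
  "contract G i xs = take (i - 1) xs @ [xs ! (i - 1) \<otimes>\<^bsub>G\<^esub> xs ! i] @ drop (Suc i) xs"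

text \<open>
  The value \<open>(\<delta>\<^sup>nf)(x\<^sub>1,\<dots>,x\<^bsub>n+1\<^esub>)\<close> is prescribed through its action on the elements \<open>a\<close> of the
  semigroup. In a commutative inverse semigroup \<open>ma = am\<close> for each multiplier \<open>m\<close>, so this
  action is used for both components.
\<close>

definition coboundary_act ::
    "('g, 'm) monoid_scheme \<Rightarrow> 'a semigrp \<Rightarrow> ('g \<Rightarrow> 'a set) \<Rightarrow> ('g \<Rightarrow> 'a \<rightharpoonup> 'a) \<Rightarrow> nat
      \<Rightarrow> ('g list \<Rightarrow> 'a multiplier) \<Rightarrow> 'g list \<Rightarrow> 'a \<Rightarrow> 'a" where
  "coboundary_act G B D \<theta> n f xs a =
     (let fpow = (\<lambda>ys i. f ys [^]\<^bsub>chain_mult G B D ys\<^esub> ((- 1) ^ i :: int));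
          s = the (\<theta> (hd xs) (ract (pinv (\<theta> (hd xs)) a) (f (tl xs))));
          t = foldl (\<lambda>s i. ract s (fpow (contract G i xs) i)) s [1..<Suc n]
      in ract t (fpow (butlast xs) (n + 1)))"

definition coboundary ::
    "('g, 'm) monoid_scheme \<Rightarrow> 'a semigrp \<Rightarrow> ('g \<Rightarrow> 'a set) \<Rightarrow> ('g \<Rightarrow> 'a \<rightharpoonup> 'a) \<Rightarrow> nat
      \<Rightarrow> ('g list \<Rightarrow> 'a multiplier) \<Rightarrow> ('g list \<Rightarrow> 'a multiplier)" where
  "coboundary G B D \<theta> n f = (\<lambda>xs \<in> tuples G (n + 1).
     (\<lambda>a \<in> chain G B D xs. coboundary_act G B D \<theta> n f xs a,
      \<lambda>a \<in> chain G B D xs. coboundary_act G B D \<theta> n f xs a))"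

definition cocycles ::
    "('g, 'm) monoid_scheme \<Rightarrow> 'a semigrp \<Rightarrow> ('g \<Rightarrow> 'a set) \<Rightarrow> ('g \<Rightarrow> 'a \<rightharpoonup> 'a) \<Rightarrow> nat
      \<Rightarrow> ('g list \<Rightarrow> 'a multiplier) set" where
  "cocycles G B D \<theta> n =
     kernel (cochains G B D n) (cochains G B D (n + 1)) (coboundary G B D \<theta> n)"

definition coboundaries ::
    "('g, 'm) monoid_scheme \<Rightarrow> 'a semigrp \<Rightarrow> ('g \<Rightarrow> 'a set) \<Rightarrow> ('g \<Rightarrow> 'a \<rightharpoonup> 'a) \<Rightarrow> nat
      \<Rightarrow> ('g list \<Rightarrow> 'a multiplier) set" where
  "coboundaries G B D \<theta> n =
     coboundary G B D \<theta> (n - 1) ` carrier (cochains G B D (n - 1))"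

text \<open>Meaningful for \<open>n \<ge> 2\<close> only.\<close>

definition cohomology ::
    "('g, 'm) monoid_scheme \<Rightarrow> 'a semigrp \<Rightarrow> ('g \<Rightarrow> 'a set) \<Rightarrow> ('g \<Rightarrow> 'a \<rightharpoonup> 'a) \<Rightarrow> nat
      \<Rightarrow> ('g list \<Rightarrow> 'a multiplier) set monoid" where
  "cohomology G B D \<theta> n =
     (cochains G B D n)\<lparr>carrier := cocycles G B D \<theta> n\<rparr> Mod coboundaries G B D \<theta> n"


section \<open>The partial module structure on the center\<close>

definition center_semigrp :: "'a semigrp \<Rightarrow> 'a semigrp" where
  "center_semigrp A = A\<lparr>carrier := center A\<rparr>"

definition center_dom :: "'a semigrp \<Rightarrow> ('g \<Rightarrow> ('a \<rightharpoonup> 'a) set) \<Rightarrow> 'g \<Rightarrow> 'a set" where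
  "center_dom A \<psi> g = center (A\<lparr>carrier := kdom \<psi> g\<rparr>)"

text \<open>The common restriction of the members of \<open>\<psi> g\<close> to the center of their domain.\<close>

definition center_action ::
    "'a semigrp \<Rightarrow> ('g, 'm) monoid_scheme \<Rightarrow> ('g \<Rightarrow> ('a \<rightharpoonup> 'a) set) \<Rightarrow> 'g \<Rightarrow> 'a \<rightharpoonup> 'a" where
  "center_action A G \<psi> g = the_elem ((\<lambda>\<theta>. \<theta> |` center_dom A \<psi> (inv\<^bsub>G\<^esub> g)) ` \<psi> g)"


section \<open>Obstructions\<close>

definition representatives ::
    "('g, 'm) monoid_scheme \<Rightarrow> ('g \<Rightarrow> ('a \<rightharpoonup> 'a) set) \<Rightarrow> ('g \<Rightarrow> 'a \<rightharpoonup> 'a) \<Rightarrow> bool" where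
  "representatives G \<psi> \<theta> \<longleftrightarrow> (\<forall>g \<in> carrier G. \<theta> g \<in> \<psi> g)"

definition twisting ::
    "'a semigrp \<Rightarrow> ('g, 'm) monoid_scheme \<Rightarrow> ('g \<Rightarrow> ('a \<rightharpoonup> 'a) set) \<Rightarrow> ('g \<Rightarrow> 'a \<rightharpoonup> 'a)
      \<Rightarrow> ('g \<Rightarrow> 'g \<Rightarrow> 'a multiplier) \<Rightarrow> bool" where
  "twisting A G \<psi> \<theta> w \<longleftrightarrow> (\<forall>g \<in> carrier G. \<forall>h \<in> carrier G.
     let D = kdom \<psi>; I = ideal_prod A [D g, D (g \<otimes>\<^bsub>G\<^esub> h)] in
       w g h \<in> Units (mult_monoid (A\<lparr>carrier := I\<rparr>)) \<and>
       (\<forall>a \<in> ideal_prod A [D (inv\<^bsub>G\<^esub> h), D (inv\<^bsub>G\<^esub> h \<otimes>\<^bsub>G\<^esub> inv\<^bsub>G\<^esub> g)].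
          the (\<theta> g (the (\<theta> h a))) =
            mconj (A\<lparr>carrier := I\<rparr>) (w g h) (the (\<theta> (g \<otimes>\<^bsub>G\<^esub> h) a))))"

definition associator ::
    "'a semigrp \<Rightarrow> ('g, 'm) monoid_scheme \<Rightarrow> ('g \<Rightarrow> ('a \<rightharpoonup> 'a) set) \<Rightarrow> ('g \<Rightarrow> 'a \<rightharpoonup> 'a)
      \<Rightarrow> ('g \<Rightarrow> 'g \<Rightarrow> 'a multiplier) \<Rightarrow> ('g \<Rightarrow> 'g \<Rightarrow> 'g \<Rightarrow> 'a multiplier) \<Rightarrow> bool" where
  "associator A G \<psi> \<theta> w \<beta> \<longleftrightarrow>
     (\<forall>g \<in> carrier G. \<forall>h \<in> carrier G. \<forall>k \<in> carrier G.
       let D = kdom \<psi>;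
           I = ideal_prod A [D g, D (g \<otimes>\<^bsub>G\<^esub> h), D (g \<otimes>\<^bsub>G\<^esub> h \<otimes>\<^bsub>G\<^esub> k)];
           J = ideal_prod A [D (inv\<^bsub>G\<^esub> g), D h, D (h \<otimes>\<^bsub>G\<^esub> k)];
           M = mult_monoid (A\<lparr>carrier := I\<rparr>)
       in \<beta> g h k \<in> Units (center_monoid M) \<and>
          mtransport (\<theta> g |` J) (mrestrict (w h k) J) \<otimes>\<^bsub>M\<^esub> mrestrict (w g (h \<otimes>\<^bsub>G\<^esub> k)) I =
          \<beta> g h k \<otimes>\<^bsub>M\<^esub> mrestrict (w g h) I \<otimes>\<^bsub>M\<^esub> mrestrict (w (g \<otimes>\<^bsub>G\<^esub> h) k) I)"

definition obstruction ::
    "'a semigrp \<Rightarrow> ('g, 'm) monoid_scheme \<Rightarrow> ('g \<Rightarrow> ('a \<rightharpoonup> 'a) set)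
      \<Rightarrow> ('g \<Rightarrow> 'g \<Rightarrow> 'g \<Rightarrow> 'a multiplier) \<Rightarrow> bool" where
  "obstruction A G \<psi> \<beta> \<longleftrightarrow>
     (\<exists>\<theta> w. representatives G \<psi> \<theta> \<and> twisting A G \<psi> \<theta> w \<and> associator A G \<psi> \<theta> w \<beta>)"

text \<open>
  An obstruction regarded as a 3-cochain with values in \<open>C(A)\<close>: central multipliers of
  \<open>D\<^sub>g D\<^bsub>gh\<^esub> D\<^bsub>ghk\<^esub>\<close> are restricted to \<open>C(D\<^sub>g) C(D\<^bsub>gh\<^esub>) C(D\<^bsub>ghk\<^esub>)\<close>.
\<close>

definition center_cochain ::
    "'a semigrp \<Rightarrow> ('g, 'm) monoid_scheme \<Rightarrow> ('g \<Rightarrow> ('a \<rightharpoonup> 'a) set)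
      \<Rightarrow> ('g \<Rightarrow> 'g \<Rightarrow> 'g \<Rightarrow> 'a multiplier) \<Rightarrow> 'g list \<Rightarrow> 'a multiplier" where
  "center_cochain A G \<psi> \<beta> = (\<lambda>xs \<in> tuples G 3.
     mrestrict (\<beta> (xs ! 0) (xs ! 1) (xs ! 2))
       (chain G (center_semigrp A) (center_dom A \<psi>) xs))"

definition center_cocycles ::
    "'a semigrp \<Rightarrow> ('g, 'm) monoid_scheme \<Rightarrow> ('g \<Rightarrow> ('a \<rightharpoonup> 'a) set) \<Rightarrow> nat
      \<Rightarrow> ('g list \<Rightarrow> 'a multiplier) set" where
  "center_cocycles A G \<psi> n =
     cocycles G (center_semigrp A) (center_dom A \<psi>) (center_action A G \<psi>) n"

definition center_cohomology ::
    "'a semigrp \<Rightarrow> ('g, 'm) monoid_scheme \<Rightarrow> ('g \<Rightarrow> ('a \<rightharpoonup> 'a) set) \<Rightarrow> nat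
      \<Rightarrow> ('g list \<Rightarrow> 'a multiplier) set monoid" where
  "center_cohomology A G \<psi> n =
     cohomology G (center_semigrp A) (center_dom A \<psi>) (center_action A G \<psi>) n"

definition obstruction_class ::
    "'a semigrp \<Rightarrow> ('g, 'm) monoid_scheme \<Rightarrow> ('g \<Rightarrow> ('a \<rightharpoonup> 'a) set)
      \<Rightarrow> ('g \<Rightarrow> 'g \<Rightarrow> 'g \<Rightarrow> 'a multiplier) \<Rightarrow> ('g list \<Rightarrow> 'a multiplier) set" where
  "obstruction_class A G \<psi> \<beta> =
     coboundaries G (center_semigrp A) (center_dom A \<psi>) (center_action A G \<psi>) 3
       #>\<^bsub>cochains G (center_semigrp A) (center_dom A \<psi>) 3\<^esub> center_cochain A G \<psi> \<beta>"

definition Obs ::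
    "'a semigrp \<Rightarrow> ('g, 'm) monoid_scheme \<Rightarrow> ('g \<Rightarrow> ('a \<rightharpoonup> 'a) set)
      \<Rightarrow> ('g list \<Rightarrow> 'a multiplier) set" where
  "Obs A G \<psi> = the_elem (obstruction_class A G \<psi> ` {\<beta>. obstruction A G \<psi> \<beta>})"


section \<open>Extensions\<close>

definition sext ::
    "'a semigrp \<Rightarrow> 's semigrp \<Rightarrow> 'u semigrp \<Rightarrow> ('a \<Rightarrow> 'u) \<Rightarrow> ('u \<Rightarrow> 's) \<Rightarrow> bool" where
  "sext A S U i p \<longleftrightarrow> inverse_semigrp U \<and> inverse_semigrp S \<and>
     i \<in> smono A U \<and> p \<in> sepi U S \<and> inj_on p (idems U) \<and>
     i ` carrier A = {u \<in> carrier U. p u \<in> idems S}"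

definition gext ::
    "'a semigrp \<Rightarrow> ('g, 'm) monoid_scheme \<Rightarrow> 'u semigrp \<Rightarrow> ('a \<Rightarrow> 'u) \<Rightarrow> ('u \<Rightarrow> 'g) \<Rightarrow> bool" where
  "gext A G U i j \<longleftrightarrow> inverse_semigrp U \<and>
     i \<in> smono A U \<and> j \<in> sepi U (semigrp_of G) \<and>
     i ` carrier A = {u \<in> carrier U. j u = \<one>\<^bsub>G\<^esub>}"

definition refinement ::
    "'a semigrp \<Rightarrow> ('g, 'm) monoid_scheme \<Rightarrow> 'u semigrp \<Rightarrow> ('a \<Rightarrow> 'u) \<Rightarrow> ('u \<Rightarrow> 'g)
      \<Rightarrow> 's semigrp \<Rightarrow> ('u \<Rightarrow> 's) \<Rightarrow> ('s \<Rightarrow> 'g) \<Rightarrow> bool" where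
  "refinement A G U i j S p \<kappa> \<longleftrightarrow> E_unitary S \<and> sext A S U i p \<and>
     \<kappa> \<in> sepi S (semigrp_of G) \<and> (\<forall>u \<in> carrier U. j u = \<kappa> (p u))"

definition order_transversal ::
    "'u semigrp \<Rightarrow> 's semigrp \<Rightarrow> ('u \<Rightarrow> 's) \<Rightarrow> ('s \<Rightarrow> 'u) \<Rightarrow> bool" where
  "order_transversal U S p \<rho> \<longleftrightarrow> \<rho> \<in> carrier S \<rightarrow> carrier U \<and>
     (\<forall>s \<in> carrier S. p (\<rho> s) = s) \<and> \<rho> ` idems S \<subseteq> idems U \<and>
     (\<forall>s \<in> carrier S. \<forall>t \<in> carrier S. nat_le S s t \<longrightarrow> nat_le U (\<rho> s) (\<rho> t))"

definition ext_dom ::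
    "'a semigrp \<Rightarrow> 's semigrp \<Rightarrow> ('a \<Rightarrow> 'u) \<Rightarrow> ('s \<Rightarrow> 'g) \<Rightarrow> ('s \<Rightarrow> 'u) \<Rightarrow> 'g \<Rightarrow> 'a set" where
  "ext_dom A S i \<kappa> \<rho> g = {a \<in> carrier A. \<exists>s \<in> carrier S. \<kappa> s = g \<and>
     \<rho> (s \<cdot>\<^bsub>S\<^esub> sinv S s) = i (a \<cdot>\<^bsub>A\<^esub> sinv A a)}"

definition ext_action ::
    "'a semigrp \<Rightarrow> ('g, 'm) monoid_scheme \<Rightarrow> 'u semigrp \<Rightarrow> 's semigrp \<Rightarrow> ('a \<Rightarrow> 'u)
      \<Rightarrow> ('s \<Rightarrow> 'g) \<Rightarrow> ('s \<Rightarrow> 'u) \<Rightarrow> 'g \<Rightarrow> 'a \<rightharpoonup> 'a" where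
  "ext_action A G U S i \<kappa> \<rho> g =
     (\<lambda>a. if a \<in> ext_dom A S i \<kappa> \<rho> (inv\<^bsub>G\<^esub> g)
       then let s = (THE s. s \<in> carrier S \<and> \<kappa> s = g \<and>
                       \<rho> (sinv S s \<cdot>\<^bsub>S\<^esub> s) = i (a \<cdot>\<^bsub>A\<^esub> sinv A a))
            in Some (inv_into (carrier A) i (\<rho> s \<cdot>\<^bsub>U\<^esub> i a \<cdot>\<^bsub>U\<^esub> sinv U (\<rho> s)))
       else None)"

text \<open>
  The type arguments say in which types the carriers of the extension \<open>U\<close> and of the
  \<open>E\<close>-unitary semigroup \<open>S\<close> of its refinement are sought, since HOL cannot quantify
  over types inside a formula. Up to isomorphism the carriers of \<open>U\<close> and \<open>S\<close> always fit into
  \<open>'a \<times> 'g\<close>: \<open>U\<close> is a crossed product of \<open>A\<close> and \<open>G\<close>, and \<open>S\<close> is a quotient of \<open>U\<close>.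
\<close>

definition has_admissible_extension ::
    "'u itself \<Rightarrow> 's itself \<Rightarrow> 'a semigrp \<Rightarrow> ('g, 'm) monoid_scheme
      \<Rightarrow> ('g \<Rightarrow> ('a \<rightharpoonup> 'a) set) \<Rightarrow> bool" where
  "has_admissible_extension _ _ A G \<psi> \<longleftrightarrow>
     (\<exists>(U :: 'u semigrp) i j (S :: 's semigrp) p \<kappa> \<rho>.
        gext A G U i j \<and> refinement A G U i j S p \<kappa> \<and> order_transversal U S p \<rho> \<and>
        (\<forall>g \<in> carrier G. \<psi> g = sim A `` {ext_action A G U S i \<kappa> \<rho> g}))"

end

theory Submission
  imports Defs
begin

text \<open>
  An invertible multiplier of an ideal \<open>I\<close> is a compatible family of elements \<open>u e\<close> of the maximal
  subgroups \<open>A\<^sub>e\<close>, where \<open>e\<close> runs over the idempotents of \<open>I\<close>. In these terms the equation that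
  defines an obstruction \<open>\<beta>\<close> holds in the group \<open>A\<^sub>e\<close> and reads
  \<open>\<theta>\<^sub>g(w(h,k)(\<theta>\<^sub>g\<inverse>e)) \<cdot> w(g,hk)(e) = \<beta>(g,h,k)(e) \<cdot> w(g,h)(e) \<cdot> w(gh,k)(e)\<close>, so that the cocycle
  identity and the effect of changing \<open>\<theta>\<close> and \<open>w\<close> are the computations of Eilenberg and Mac Lane,
  done idempotent by idempotent. Inner automorphisms are trivial on the center, hence there \<open>\<psi>\<close> is a
  unital partial homomorphism into partial injections, which is a partial action.

  If \<open>\<beta> = \<delta>z\<close>, then \<open>w\<close> divided by \<open>z\<close> satisfies the equation with \<open>\<beta> = 1\<close>. Once normalised, it
  makes the set of pairs \<open>(a, g)\<close> with \<open>a \<in> D\<^sub>g\<close> an admissible extension, which is refined by the pairs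
  \<open>(e, g)\<close> with \<open>e\<close> idempotent. Conversely, let \<open>r\<^sub>g(e) = \<rho> s\<close> for the element \<open>s\<close> of degree \<open>g\<close> with
  \<open>ss\<inverse>\<close> corresponding to \<open>e\<close>. The products \<open>r\<^sub>g(e) r\<^sub>h(\<theta>\<^sub>g\<inverse>e) = w(g,h)(e) r\<^bsub>gh\<^esub>(e)\<close> define a twisting,
  and associativity in the extension says that its obstruction is \<open>1\<close>.
\<close>

section \<open>Inverse semigroups\<close>

text \<open>Three obstacles shape the development. The isomorphisms \<theta>_g depend on choices, so
  domains and points of evaluation are tracked by the choice-free maps of the center, and
  representatives are applied only where a twisting or an associator needs them. Next, \<psi>
  compares \<theta>_g \<theta>_h with \<theta>_gh only after a further factor \<theta> at h^-1 or at
  g^-1; hence the domain of \<theta>_g and the ideal on which w(g,h) lives are not given but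
  recovered, which works because an ideal is determined by its idempotents and these are central.
  Finally, the central part of an ideal is in general not an ideal, so multipliers are studied for
  inverse subsemigroups. Centrality of \<beta>, like that of the quotient of two twistings, has one
  source: two elements conjugating x to the same T differ by an element that centralizes T, and T
  can be prescribed because the isomorphisms map maximal subgroups onto maximal subgroups. The
  normalisation needs only c = w(1,1), since for \<beta> = 1 the equations at (1,1,g) and (g,1,1)
  express w(1,g) and w(g,1) by c.\<close>

definition idpart :: "'a semigrp \<Rightarrow> 'a \<Rightarrow> 'a" where
  "idpart S x = x \<cdot>\<^bsub>S\<^esub> sinv S x"

text \<open>Ideals of \<open>A\<close> and their intersections with the center are both of this
  kind, while such an intersection is in general no ideal of \<open>A\<close>. The description of
  invertible multipliers, stated for this notion, serves the kernel and its partial module at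
  once.\<close>

definition inverse_subsemigrp :: "'a semigrp \<Rightarrow> 'a set \<Rightarrow> bool" where
  "inverse_subsemigrp S I \<longleftrightarrow> I \<noteq> {} \<and> I \<subseteq> carrier S \<and>
     (\<forall>x \<in> I. \<forall>y \<in> I. x \<cdot>\<^bsub>S\<^esub> y \<in> I) \<and> (\<forall>x \<in> I. sinv S x \<in> I)"

lemma ideal_ofD:
  assumes "ideal_of S I"
  shows "I \<noteq> {}" "I \<subseteq> carrier S"
    "\<lbrakk>x \<in> carrier S; a \<in> I\<rbrakk> \<Longrightarrow> x \<cdot>\<^bsub>S\<^esub> a \<in> I" "\<lbrakk>x \<in> carrier S; a \<in> I\<rbrakk> \<Longrightarrow> a \<cdot>\<^bsub>S\<^esub> x \<in> I"
  using assms by (auto simp: ideal_of_def)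

lemma shomD:
  assumes "f \<in> shom S T"
  shows "x \<in> carrier S \<Longrightarrow> f x \<in> carrier T"
    "\<lbrakk>x \<in> carrier S; y \<in> carrier S\<rbrakk> \<Longrightarrow> f (x \<cdot>\<^bsub>S\<^esub> y) = f x \<cdot>\<^bsub>T\<^esub> f y"
  using assms by (auto simp: shom_def)

text \<open>Two inverses y and z of x are compared through the idempotents yx, zx and xy, xz, which
  commute. Subsemigroups, the crossed product and its quotient are shown to be inverse semigroups in
  this way: one inverse is exhibited and the idempotents are seen to commute.\<close>

lemma (in semigrp) ex1_sinvI:
  assumes comm: "\<And>e f. \<lbrakk>e \<in> idems S; f \<in> idems S\<rbrakk> \<Longrightarrow> e \<cdot> f = f \<cdot> e"
    and x: "x \<in> carrier S" and ex: "\<exists>y. is_sinv S x y"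
  shows "\<exists>!y. is_sinv S x y"
proof (rule ex_ex1I[OF ex])
  fix y z assume y: "is_sinv S x y" and z: "is_sinv S x z"
  have c: "y \<in> carrier S" "z \<in> carrier S" and
    e: "x \<cdot> y \<cdot> x = x" "y \<cdot> x \<cdot> y = y" "x \<cdot> z \<cdot> x = x" "z \<cdot> x \<cdot> z = z"
    using y z by (auto simp: is_sinv_def)
  have id: "y \<cdot> x \<in> idems S" "z \<cdot> x \<in> idems S" "x \<cdot> y \<in> idems S" "x \<cdot> z \<in> idems S"
    using e c x by (auto simp: idems_def closed) (simp_all flip: assoc add: closed)
  have "y = y \<cdot> (x \<cdot> z \<cdot> x) \<cdot> y" using e by simp
  also have "\<dots> = (y \<cdot> x) \<cdot> (z \<cdot> x) \<cdot> y" using c x by (simp add: assoc closed)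
  also have "\<dots> = (z \<cdot> x) \<cdot> (y \<cdot> x) \<cdot> y" using comm id by simp
  also have "\<dots> = z \<cdot> (x \<cdot> y \<cdot> x) \<cdot> y" using c x by (simp add: assoc closed)
  also have "\<dots> = z \<cdot> (x \<cdot> y)" using c x e by (simp add: assoc closed)
  also have "\<dots> = z \<cdot> ((x \<cdot> z \<cdot> x) \<cdot> y)" using e by simp
  also have "\<dots> = z \<cdot> ((x \<cdot> z) \<cdot> (x \<cdot> y))" using c x by (simp add: assoc closed)
  also have "\<dots> = z \<cdot> ((x \<cdot> y) \<cdot> (x \<cdot> z))" using comm id by simp
  also have "\<dots> = z \<cdot> ((x \<cdot> y \<cdot> x) \<cdot> z)" using c x by (simp add: assoc closed)
  also have "\<dots> = z" using c x e by (simp add: assoc)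
  finally show "y = z" .
qed

context inverse_semigrp
begin

lemma is_sinv_sinv: "x \<in> carrier S \<Longrightarrow> is_sinv S x (sinv S x)"
  unfolding sinv_def by (rule theI') (rule unique_inverse)

lemma sinv_eqI: "\<lbrakk>x \<in> carrier S; is_sinv S x y\<rbrakk> \<Longrightarrow> sinv S x = y"
  using unique_inverse is_sinv_sinv by blast

lemma sinv_closed [simp]: "x \<in> carrier S \<Longrightarrow> sinv S x \<in> carrier S"
  using is_sinv_sinv by (auto simp: is_sinv_def)

lemma mult_sinv_mult: "x \<in> carrier S \<Longrightarrow> x \<cdot> sinv S x \<cdot> x = x"
  using is_sinv_sinv by (auto simp: is_sinv_def)

lemma sinv_mult_sinv: "x \<in> carrier S \<Longrightarrow> sinv S x \<cdot> x \<cdot> sinv S x = sinv S x"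
  using is_sinv_sinv by (auto simp: is_sinv_def)

lemma sinv_sinv [simp]: "x \<in> carrier S \<Longrightarrow> sinv S (sinv S x) = x"
  by (rule sinv_eqI) (auto simp: is_sinv_def mult_sinv_mult sinv_mult_sinv)

lemma idems_closed: "e \<in> idems S \<Longrightarrow> e \<in> carrier S"
  by (simp add: idems_def)

lemma idems_idem: "e \<in> idems S \<Longrightarrow> e \<cdot> e = e"
  by (simp add: idems_def)

lemma sinv_idem [simp]: "e \<in> idems S \<Longrightarrow> sinv S e = e"
  by (rule sinv_eqI) (auto simp: is_sinv_def idems_def)

text \<open>If x is the inverse of ef, then fxe is an inverse of ef too, so x = fxe. This makes x
  idempotent, hence its own inverse, and therefore equal to ef.\<close>

lemma mult_idems_closed:
  assumes e: "e \<in> idems S" and f: "f \<in> idems S"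
  shows "e \<cdot> f \<in> idems S"
proof -
  define x where "x = sinv S (e \<cdot> f)"
  have c: "e \<in> carrier S" "f \<in> carrier S" "x \<in> carrier S" "e \<cdot> f \<in> carrier S"
    using e f by (auto simp: idems_closed x_def closed)
  have ee: "e \<cdot> e = e" "f \<cdot> f = f" "\<And>z. z \<in> carrier S \<Longrightarrow> e \<cdot> (e \<cdot> z) = e \<cdot> z"
    "\<And>z. z \<in> carrier S \<Longrightarrow> f \<cdot> (f \<cdot> z) = f \<cdot> z"
    using e f c by (auto simp: idems_idem simp flip: assoc)
  have x1: "e \<cdot> (f \<cdot> (x \<cdot> (e \<cdot> f))) = e \<cdot> f" and x2: "x \<cdot> (e \<cdot> (f \<cdot> x)) = x"
    using mult_sinv_mult[OF c(4)] sinv_mult_sinv[OF c(4)] c unfolding x_def[symmetric]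
    by (simp_all add: assoc closed)
  have x2': "x \<cdot> (e \<cdot> (f \<cdot> (x \<cdot> e))) = x \<cdot> e"
    using arg_cong[OF x2, of "\<lambda>z. z \<cdot> e"] c by (simp add: assoc closed)
  have y: "is_sinv S (e \<cdot> f) (f \<cdot> (x \<cdot> e))"
    using c by (simp add: is_sinv_def assoc closed ee x1 x2')
  have yx: "x = f \<cdot> (x \<cdot> e)"
    using sinv_eqI[OF c(4) y] by (simp add: x_def)
  have "f \<cdot> (x \<cdot> e) \<cdot> (f \<cdot> (x \<cdot> e)) = f \<cdot> (x \<cdot> e)"
    using c by (simp add: assoc closed ee x2')
  then have "x \<in> idems S"
    using yx c by (simp add: idems_def)
  then have "sinv S x = x" by simp
  moreover have "sinv S x = e \<cdot> f" using c by (simp add: x_def)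
  ultimately show ?thesis using \<open>x \<in> idems S\<close> by simp
qed

text \<open>The product fe is an inverse of ef, and ef is its own inverse because it is
  idempotent.\<close>

lemma idems_commute:
  assumes e: "e \<in> idems S" and f: "f \<in> idems S"
  shows "e \<cdot> f = f \<cdot> e"
proof -
  have ef: "e \<cdot> f \<in> idems S" and fe: "f \<cdot> e \<in> idems S"
    using e f by (auto intro: mult_idems_closed)
  have c: "e \<in> carrier S" "f \<in> carrier S" using e f by (auto simp: idems_closed)
  have ee: "e \<cdot> e = e" "f \<cdot> f = f" "\<And>z. z \<in> carrier S \<Longrightarrow> e \<cdot> (e \<cdot> z) = e \<cdot> z"
    "\<And>z. z \<in> carrier S \<Longrightarrow> f \<cdot> (f \<cdot> z) = f \<cdot> z"
    using e f c by (auto simp: idems_idem simp flip: assoc)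
  have i: "e \<cdot> (f \<cdot> (e \<cdot> f)) = e \<cdot> f" "f \<cdot> (e \<cdot> (f \<cdot> e)) = f \<cdot> e"
    using ef fe c by (auto simp: idems_def assoc closed)
  have "is_sinv S (e \<cdot> f) (f \<cdot> e)"
    using c by (simp add: is_sinv_def assoc closed ee i)
  then have "sinv S (e \<cdot> f) = f \<cdot> e"
    using c by (auto intro: sinv_eqI closed)
  then show ?thesis using ef by simp
qed

lemma mult_sinv_idem [simp]: "x \<in> carrier S \<Longrightarrow> x \<cdot> sinv S x \<in> idems S"
  using mult_sinv_mult[of x] by (simp add: idems_def closed flip: assoc)

lemma sinv_mult_idem [simp]: "x \<in> carrier S \<Longrightarrow> sinv S x \<cdot> x \<in> idems S"
  using mult_sinv_idem[of "sinv S x"] by simp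

lemma sinv_mult:
  assumes x: "x \<in> carrier S" and y: "y \<in> carrier S"
  shows "sinv S (x \<cdot> y) = sinv S y \<cdot> sinv S x"
proof (rule sinv_eqI)
  let ?x = "sinv S x" and ?y = "sinv S y"
  have c: "?x \<in> carrier S" "?y \<in> carrier S" using x y by auto
  have com: "(y \<cdot> ?y) \<cdot> (?x \<cdot> x) = (?x \<cdot> x) \<cdot> (y \<cdot> ?y)"
    using x y by (intro idems_commute) auto
  have "x \<cdot> y \<cdot> (?y \<cdot> ?x) \<cdot> (x \<cdot> y) = x \<cdot> ((y \<cdot> ?y) \<cdot> (?x \<cdot> x)) \<cdot> y"
    using x y c by (simp add: assoc closed)
  also have "\<dots> = (x \<cdot> ?x \<cdot> x) \<cdot> (y \<cdot> ?y \<cdot> y)"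
    unfolding com using x y c by (simp add: assoc closed)
  also have "\<dots> = x \<cdot> y" using x y by (simp add: mult_sinv_mult)
  finally have 1: "x \<cdot> y \<cdot> (?y \<cdot> ?x) \<cdot> (x \<cdot> y) = x \<cdot> y" .
  have "?y \<cdot> ?x \<cdot> (x \<cdot> y) \<cdot> (?y \<cdot> ?x) = ?y \<cdot> ((?x \<cdot> x) \<cdot> (y \<cdot> ?y)) \<cdot> ?x"
    using x y c by (simp add: assoc closed)
  also have "\<dots> = (?y \<cdot> y \<cdot> ?y) \<cdot> (?x \<cdot> x \<cdot> ?x)"
    unfolding com[symmetric] using x y c by (simp add: assoc closed)
  also have "\<dots> = ?y \<cdot> ?x" using x y by (simp add: sinv_mult_sinv)
  finally show "is_sinv S (x \<cdot> y) (?y \<cdot> ?x)"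
    using 1 x y c by (simp add: is_sinv_def closed)
qed (use x y in \<open>simp add: closed\<close>)

lemma inverse_semigrp_subsemigrp:
  assumes "inverse_subsemigrp S I"
  shows "inverse_semigrp (S\<lparr>carrier := I\<rparr>)"
proof -
  interpret I: semigrp "S\<lparr>carrier := I\<rparr>"
    using assms by unfold_locales (auto simp: inverse_subsemigrp_def subset_iff assoc)
  show ?thesis
  proof unfold_locales
    fix x assume x: "x \<in> carrier (S\<lparr>carrier := I\<rparr>)"
    show "\<exists>!y. is_sinv (S\<lparr>carrier := I\<rparr>) x y"
    proof (rule I.ex1_sinvI[OF _ x])
      show "\<exists>y. is_sinv (S\<lparr>carrier := I\<rparr>) x y"
        using x assms by (intro exI[of _ "sinv S x"])
          (auto simp: is_sinv_def inverse_subsemigrp_def subset_iff mult_sinv_mult sinv_mult_sinv)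
      fix e f assume "e \<in> idems (S\<lparr>carrier := I\<rparr>)" "f \<in> idems (S\<lparr>carrier := I\<rparr>)"
      then have "e \<cdot> f = f \<cdot> e"
        using assms by (intro idems_commute) (auto simp: idems_def inverse_subsemigrp_def)
      then show "e \<cdot>\<^bsub>S\<lparr>carrier := I\<rparr>\<^esub> f = f \<cdot>\<^bsub>S\<lparr>carrier := I\<rparr>\<^esub> e"
        by simp
    qed
  qed
qed

lemma shom_sinv:
  assumes T: "inverse_semigrp T" and f: "f \<in> shom S T" and x: "x \<in> carrier S"
  shows "f (sinv S x) = sinv T (f x)"
proof -
  interpret T: inverse_semigrp T by fact
  have "is_sinv T (f x) (f (sinv S x))"
    using x mult_sinv_mult[OF x] sinv_mult_sinv[OF x]
    by (simp add: is_sinv_def shomD[OF f] closed flip: shomD(2)[OF f])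
  then show ?thesis
    using T.sinv_eqI[OF shomD(1)[OF f x]] by simp
qed

lemma shom_idems: "\<lbrakk>f \<in> shom S T; e \<in> idems S\<rbrakk> \<Longrightarrow> f e \<in> idems T"
  using shomD(2)[of f S T e e] by (auto simp: idems_def shomD)

end

section \<open>Semilattices of groups\<close>

context semilattice_of_groups
begin

abbreviation eps :: "'a \<Rightarrow> 'a" ("\<epsilon>") where "\<epsilon> \<equiv> idpart S"
abbreviation sv :: "'a \<Rightarrow> 'a" ("_\<^sup>\<dagger>" [1000] 999) where "x\<^sup>\<dagger> \<equiv> sinv S x"

lemma idem_comm: "\<lbrakk>e \<in> idems S; x \<in> carrier S\<rbrakk> \<Longrightarrow> e \<cdot> x = x \<cdot> e"
  using idems_central by (auto simp: center_def)

lemma eps_idems [simp]: "x \<in> carrier S \<Longrightarrow> \<epsilon> x \<in> idems S"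
  by (simp add: idpart_def)

lemma eps_closed [simp]: "x \<in> carrier S \<Longrightarrow> \<epsilon> x \<in> carrier S"
  by (simp add: idpart_def closed)

lemma eps_mult_left [simp]: "x \<in> carrier S \<Longrightarrow> \<epsilon> x \<cdot> x = x"
  by (simp add: idpart_def mult_sinv_mult)

lemma eps_mult_right [simp]: "x \<in> carrier S \<Longrightarrow> x \<cdot> \<epsilon> x = x"
  using idem_comm[of "\<epsilon> x" x] by simp

text \<open>Clifford's observation: as idempotents are central, each of
  \<open>x \<cdot> x\<^sup>\<dagger>\<close> and \<open>x\<^sup>\<dagger> \<cdot> x\<close> absorbs
  the other, so every element lies in a group with the single identity
  \<open>\<epsilon> x\<close>.\<close>

lemma sinv_mult_self [simp]: "x \<in> carrier S \<Longrightarrow> x\<^sup>\<dagger> \<cdot> x = \<epsilon> x"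
proof -
  assume x: "x \<in> carrier S"
  let ?e = "x \<cdot> x\<^sup>\<dagger>" and ?f = "x\<^sup>\<dagger> \<cdot> x"
  have c: "?e \<in> idems S" "?f \<in> idems S" "x\<^sup>\<dagger> \<in> carrier S" "?e \<in> carrier S" "?f \<in> carrier S"
    using x by (auto simp: closed)
  have "?e = x \<cdot> (?f \<cdot> x\<^sup>\<dagger>)" using x by (simp add: sinv_mult_sinv)
  also have "\<dots> = x \<cdot> (x\<^sup>\<dagger> \<cdot> ?f)" using idem_comm[OF c(2) c(3)] by simp
  also have "\<dots> = ?e \<cdot> ?f" using x c by (simp add: assoc)
  finally have 1: "?e = ?e \<cdot> ?f" .
  have "?f = x\<^sup>\<dagger> \<cdot> (?e \<cdot> x)" using x by (simp add: mult_sinv_mult)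
  also have "\<dots> = x\<^sup>\<dagger> \<cdot> (x \<cdot> ?e)" using idem_comm[OF c(1) x] by simp
  also have "\<dots> = ?f \<cdot> ?e" using x c by (simp add: assoc)
  also have "\<dots> = ?e \<cdot> ?f" using c by (simp add: idems_commute)
  finally show ?thesis using 1 by (simp add: idpart_def)
qed

lemma mult_sinv_self [simp]: "x \<in> carrier S \<Longrightarrow> x \<cdot> x\<^sup>\<dagger> = \<epsilon> x"
  by (simp add: idpart_def)

lemma eps_idem [simp]: "e \<in> idems S \<Longrightarrow> \<epsilon> e = e"
  by (simp add: idpart_def idems_idem)

lemma eps_sinv [simp]: "x \<in> carrier S \<Longrightarrow> \<epsilon> (x\<^sup>\<dagger>) = \<epsilon> x"
  by (simp add: idpart_def[of S "x\<^sup>\<dagger>"])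

text \<open>This is the structure homomorphism onto the semilattice of idempotents; its fibers are
  the maximal subgroups.\<close>

lemma eps_mult: "\<lbrakk>x \<in> carrier S; y \<in> carrier S\<rbrakk> \<Longrightarrow> \<epsilon> (x \<cdot> y) = \<epsilon> x \<cdot> \<epsilon> y"
proof -
  assume x: "x \<in> carrier S" and y: "y \<in> carrier S"
  have "\<epsilon> (x \<cdot> y) = x \<cdot> (y \<cdot> y\<^sup>\<dagger>) \<cdot> x\<^sup>\<dagger>"
    using x y by (simp add: idpart_def[of S "x \<cdot> y"] sinv_mult assoc closed del: mult_sinv_self)
  also have "\<dots> = x \<cdot> (\<epsilon> y \<cdot> x\<^sup>\<dagger>)" using x y by (simp add: assoc)
  also have "\<dots> = x \<cdot> x\<^sup>\<dagger> \<cdot> \<epsilon> y"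
    using x y idem_comm[of "\<epsilon> y" "x\<^sup>\<dagger>"] by (simp add: assoc del: mult_sinv_self)
  finally show ?thesis using x y by simp
qed

lemma eps_mult_same: "\<lbrakk>x \<in> carrier S; y \<in> carrier S; \<epsilon> x = e; \<epsilon> y = e\<rbrakk> \<Longrightarrow> \<epsilon> (x \<cdot> y) = e"
  using eps_mult[of x y] idems_idem[of e] eps_idems[of x] by auto

lemma idem_mult_idems [simp]: "\<lbrakk>e \<in> idems S; f \<in> idems S\<rbrakk> \<Longrightarrow> e \<cdot> f \<in> idems S"
  by (rule mult_idems_closed)

text \<open>The maximal subgroup with identity \<open>e\<close>, packaged as a group of HOL-Algebra
  so that word identities can be proved there by cancellation and read back in
  \<open>S\<close>.\<close>

definition grp_at :: "'a \<Rightarrow> 'a monoid" where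
  "grp_at e = \<lparr>carrier = {x \<in> carrier S. \<epsilon> x = e}, mult = smult S, one = e\<rparr>"

lemma carrier_grp_at [simp]: "carrier (grp_at e) = {x \<in> carrier S. \<epsilon> x = e}"
  and mult_grp_at [simp]: "x \<otimes>\<^bsub>grp_at e\<^esub> y = x \<cdot> y"
  and one_grp_at [simp]: "\<one>\<^bsub>grp_at e\<^esub> = e"
  by (simp_all add: grp_at_def)

lemma group_grp_at:
  assumes e: "e \<in> idems S"
  shows "group (grp_at e)"
proof (rule groupI)
  fix x assume x: "x \<in> carrier (grp_at e)"
  then show "\<exists>y\<in>carrier (grp_at e). y \<otimes>\<^bsub>grp_at e\<^esub> x = \<one>\<^bsub>grp_at e\<^esub>"
    by (intro bexI[of _ "x\<^sup>\<dagger>"]) auto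
qed (use e in \<open>auto simp: closed eps_mult idems_idem assoc idems_closed\<close>)

lemma inv_grp_at:
  assumes "x \<in> carrier S" "\<epsilon> x = e"
  shows "inv\<^bsub>grp_at e\<^esub> x = x\<^sup>\<dagger>"
proof -
  interpret group "grp_at e" using assms eps_idems[of x] by (auto intro: group_grp_at)
  show ?thesis by (rule inv_equality) (use assms in auto)
qed

text \<open>Ideals are unions of maximal subgroups, because \<open>a\<close> and
  \<open>\<epsilon> a\<close> are multiples of each other. Questions of membership in an ideal
  thereby become questions about idempotents.\<close>

lemma eps_mem:
  assumes "ideal_of S I" "a \<in> carrier S"
  shows "\<epsilon> a \<in> I \<longleftrightarrow> a \<in> I"
  using assms ideal_ofD(3)[OF assms(1), of a "\<epsilon> a"] ideal_ofD(4)[OF assms(1), of "a\<^sup>\<dagger>" a]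
  by (auto simp: closed simp flip: assoc)

section \<open>The center of a semilattice of groups and its products with ideals\<close>

lemma center_closed: "c \<in> center S \<Longrightarrow> c \<in> carrier S"
  by (simp add: center_def)

lemma center_commute: "\<lbrakk>c \<in> center S; x \<in> carrier S\<rbrakk> \<Longrightarrow> c \<cdot> x = x \<cdot> c"
  by (simp add: center_def)

lemma idems_center: "e \<in> idems S \<Longrightarrow> e \<in> center S"
  using idems_central by blast

lemma center_mult:
  assumes c: "c \<in> center S" "d \<in> center S" shows "c \<cdot> d \<in> center S"
proof -
  have "c \<cdot> d \<cdot> x = x \<cdot> (c \<cdot> d)" if "x \<in> carrier S" for x
  proof -
    have "c \<cdot> d \<cdot> x = c \<cdot> (x \<cdot> d)"
      using c that by (simp add: center_commute[of d] center_closed assoc)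
    also have "\<dots> = (x \<cdot> c) \<cdot> d" using c that by (simp add: center_commute[of c x] center_closed flip: assoc)
    finally show ?thesis using c that by (simp add: center_closed assoc)
  qed
  then show ?thesis using c closed unfolding center_def by blast
qed

text \<open>With \<open>\<epsilon> c = c \<cdot> c\<^sup>\<dagger>\<close> inserted, both
  \<open>c\<close> and the idempotent can be moved past \<open>x\<close>: \<open>c\<^sup>\<dagger> x
  = c\<^sup>\<dagger> x c c\<^sup>\<dagger> = c\<^sup>\<dagger> c x c\<^sup>\<dagger> = x
  c\<^sup>\<dagger>\<close>.\<close>

lemma center_sinv: assumes c: "c \<in> center S" shows "c\<^sup>\<dagger> \<in> center S"
proof -
  have "c\<^sup>\<dagger> \<cdot> x = x \<cdot> c\<^sup>\<dagger>" if x: "x \<in> carrier S" for x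
  proof -
    have c': "c \<in> carrier S" using c by (rule center_closed)
    have "c\<^sup>\<dagger> \<cdot> x = c\<^sup>\<dagger> \<cdot> \<epsilon> c \<cdot> x" using c' eps_mult_right[of "c\<^sup>\<dagger>"] by simp
    also have "\<dots> = c\<^sup>\<dagger> \<cdot> (x \<cdot> \<epsilon> c)" using c' x by (simp add: assoc idem_comm[of _ x])
    also have "\<dots> = c\<^sup>\<dagger> \<cdot> ((x \<cdot> c) \<cdot> c\<^sup>\<dagger>)" using c' x by (simp add: assoc closed)
    also have "\<dots> = c\<^sup>\<dagger> \<cdot> ((c \<cdot> x) \<cdot> c\<^sup>\<dagger>)" using center_commute[OF c x] by simp
    also have "\<dots> = (c\<^sup>\<dagger> \<cdot> c) \<cdot> (x \<cdot> c\<^sup>\<dagger>)"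
      using c' x by (simp add: assoc closed del: sinv_mult_self)
    also have "\<dots> = x \<cdot> (\<epsilon> c \<cdot> c\<^sup>\<dagger>)" using c' x idem_comm[of "\<epsilon> c" x]
      by (simp add: closed flip: assoc)
    also have "\<dots> = x \<cdot> c\<^sup>\<dagger>" using c' eps_mult_left[of "c\<^sup>\<dagger>"] by simp
    finally show ?thesis .
  qed
  then show ?thesis using c by (simp add: center_def)
qed

text \<open>An element \<open>c\<close> of \<open>I\<close> that commutes with \<open>I\<close>
  commutes with all of \<open>S\<close>, because
  \<open>c \<cdot> x = c \<cdot> (\<epsilon> c \<cdot> x)\<close> and
  \<open>\<epsilon> c \<cdot> x\<close> lies in \<open>I\<close>. Hence the centers of the ideals of
  a kernel sit inside the center of \<open>A\<close>.\<close>

lemma center_ideal: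
  assumes I: "ideal_of S I"
  shows "center (S\<lparr>carrier := I\<rparr>) = center S \<inter> I"
proof -
  have "c \<cdot> x = x \<cdot> c" if c: "c \<in> I" "\<forall>x \<in> I. c \<cdot> x = x \<cdot> c" and x: "x \<in> carrier S" for c x
  proof -
    note cc = subsetD[OF ideal_ofD(2)[OF I] c(1)]
    have e: "\<epsilon> c \<in> I" using I c(1) cc eps_mem by blast
    have "c \<cdot> x = c \<cdot> (\<epsilon> c \<cdot> x)" using x cc by (simp flip: assoc)
    also have "\<dots> = (\<epsilon> c \<cdot> x) \<cdot> c" using c(2) ideal_ofD(4)[OF I x e] by simp
    also have "\<dots> = x \<cdot> (\<epsilon> c \<cdot> c)" using x cc idem_comm[of "\<epsilon> c" x] by (simp add: assoc)
    finally show ?thesis using cc by simp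
  qed
  then show ?thesis using ideal_ofD(2)[OF I] by (auto simp: center_def)
qed

lemma center_subsemigrp: "inverse_subsemigrp S (center S)"
proof -
  obtain x where "x \<in> carrier S" using nonempty by blast
  then have "\<epsilon> x \<in> center S" by (simp add: idems_center)
  then show ?thesis
    by (auto simp: inverse_subsemigrp_def center_mult center_sinv intro: center_closed)
qed

lemma comm_inverse_semigrp_center: "comm_inverse_semigrp (center_semigrp S)"
proof -
  interpret C: inverse_semigrp "S\<lparr>carrier := center S\<rparr>"
    by (rule inverse_semigrp_subsemigrp[OF center_subsemigrp])
  show ?thesis unfolding center_semigrp_def
    by unfold_locales (simp add: center_commute center_closed)
qed

lemma ideal_subsemigrp: "ideal_of S I \<Longrightarrow> inverse_subsemigrp S I"
  using eps_mem[of I] sinv_closed eps_sinv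
  by (auto simp: inverse_subsemigrp_def ideal_of_def subset_iff)
     (metis eps_sinv sinv_closed)

lemma ideal_inter:
  assumes "ideal_of S I" "ideal_of S J" shows "ideal_of S (I \<inter> J)"
proof -
  obtain x y where "x \<in> I" "y \<in> J" using assms by (auto simp: ideal_of_def)
  then have "x \<cdot> y \<in> I \<inter> J" using assms by (auto simp: ideal_of_def)
  then show ?thesis using assms by (auto simp: ideal_of_def)
qed

lemma ideal_inter_center:
  assumes I: "ideal_of S I"
  shows "center S \<inter> I \<noteq> {}" "inverse_subsemigrp S (center S \<inter> I)"
proof -
  obtain x where x: "x \<in> I" using I by (auto simp: ideal_of_def)
  then have xc: "x \<in> carrier S" using I by (auto simp: ideal_of_def)
  then have "\<epsilon> x \<in> center S \<inter> I" using eps_mem[OF I xc] x by (simp add: idems_center)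
  then show ne: "center S \<inter> I \<noteq> {}" by blast
  then show "inverse_subsemigrp S (center S \<inter> I)"
    using ideal_subsemigrp[OF I]
    by (auto simp: inverse_subsemigrp_def center_mult center_sinv)
qed

text \<open>Every \<open>x\<close> in the intersection factors as
  \<open>x \<cdot> \<epsilon> x\<close>. With \<open>K\<close> the carrier this computes products of
  ideals of \<open>A\<close>, with \<open>K\<close> the center it computes products of ideals of the
  center.\<close>

lemma mult_set_inter:
  assumes K: "inverse_subsemigrp S K" and I: "ideal_of S I" and J: "ideal_of S J"
  shows "{a \<cdot> b | a b. a \<in> K \<inter> I \<and> b \<in> K \<inter> J} = K \<inter> (I \<inter> J)"
proof
  show "{a \<cdot> b | a b. a \<in> K \<inter> I \<and> b \<in> K \<inter> J} \<subseteq> K \<inter> (I \<inter> J)"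
    using I J K by (auto simp: inverse_subsemigrp_def ideal_of_def subset_iff)
  show "K \<inter> (I \<inter> J) \<subseteq> {a \<cdot> b | a b. a \<in> K \<inter> I \<and> b \<in> K \<inter> J}"
  proof
    fix x assume x: "x \<in> K \<inter> (I \<inter> J)"
    then have xc: "x \<in> carrier S" using I by (auto simp: ideal_of_def)
    have "\<epsilon> x \<in> K" using x K unfolding idpart_def inverse_subsemigrp_def by auto
    moreover have "\<epsilon> x \<in> J" using x J xc eps_mem by blast
    ultimately show "x \<in> {a \<cdot> b | a b. a \<in> K \<inter> I \<and> b \<in> K \<inter> J}"
      using x xc eps_mult_right[OF xc, symmetric] by blast
  qed
qed

end

section \<open>Multipliers\<close>

lemma (in semigrp) monoid_mult_monoid: "monoid (mult_monoid S)"
proof (rule monoidI)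
  fix m n assume "m \<in> carrier (mult_monoid S)" "n \<in> carrier (mult_monoid S)"
  then show "m \<otimes>\<^bsub>mult_monoid S\<^esub> n \<in> carrier (mult_monoid S)"
    by (auto simp: mult_monoid_def multipliers_def closed PiE_iff)
next
  fix l m n assume "l \<in> carrier (mult_monoid S)" "m \<in> carrier (mult_monoid S)" "n \<in> carrier (mult_monoid S)"
  then show "l \<otimes>\<^bsub>mult_monoid S\<^esub> m \<otimes>\<^bsub>mult_monoid S\<^esub> n = l \<otimes>\<^bsub>mult_monoid S\<^esub> (m \<otimes>\<^bsub>mult_monoid S\<^esub> n)"
    by (auto simp: mult_monoid_def multipliers_def PiE_iff fun_eq_iff)
next
  fix m assume "m \<in> carrier (mult_monoid S)"
  then show "\<one>\<^bsub>mult_monoid S\<^esub> \<otimes>\<^bsub>mult_monoid S\<^esub> m = m" "m \<otimes>\<^bsub>mult_monoid S\<^esub> \<one>\<^bsub>mult_monoid S\<^esub> = m"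
    by (auto simp: mult_monoid_def multipliers_def PiE_iff fun_eq_iff prod_eq_iff extensional_def)
qed (auto simp: mult_monoid_def multipliers_def closed assoc)

context semilattice_of_groups
begin

abbreviation MM :: "'a set \<Rightarrow> 'a multiplier monoid" where
  "MM I \<equiv> mult_monoid (S\<lparr>carrier := I\<rparr>)"

text \<open>
  An invertible multiplier \<open>m\<close> of \<open>I\<close> is determined by its values \<open>u e = m e\<close> on the idempotents:
  \<open>m s = u (s s\<^sup>\<dagger>) s\<close> and \<open>s m = s u (s s\<^sup>\<dagger>)\<close>, where \<open>u e\<close> lies in the maximal subgroup at \<open>e\<close>.
\<close>

definition sect :: "'a set \<Rightarrow> ('a \<Rightarrow> 'a) \<Rightarrow> bool" where
  "sect I u \<longleftrightarrow> (\<forall>e \<in> I \<inter> idems S. u e \<in> I \<and> \<epsilon> (u e) = e \<and>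
     (\<forall>f \<in> I \<inter> idems S. u (e \<cdot> f) = u e \<cdot> f))"

definition mk_mult :: "'a set \<Rightarrow> ('a \<Rightarrow> 'a) \<Rightarrow> 'a multiplier" where
  "mk_mult I u = (\<lambda>s \<in> I. u (\<epsilon> s) \<cdot> s, \<lambda>s \<in> I. s \<cdot> u (\<epsilon> s))"

lemma subsemigrpD:
  assumes "inverse_subsemigrp S I"
  shows "I \<noteq> {}" "I \<subseteq> carrier S" "x \<in> I \<Longrightarrow> x \<in> carrier S"
    "\<lbrakk>x \<in> I; y \<in> I\<rbrakk> \<Longrightarrow> x \<cdot> y \<in> I" "x \<in> I \<Longrightarrow> x\<^sup>\<dagger> \<in> I" "x \<in> I \<Longrightarrow> \<epsilon> x \<in> I"
  using assms by (auto simp: inverse_subsemigrp_def idpart_def simp del: mult_sinv_self)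

lemma sectD:
  assumes "sect I u" "e \<in> I" "e \<in> idems S"
  shows "u e \<in> I" "\<epsilon> (u e) = e" "\<lbrakk>f \<in> I; f \<in> idems S\<rbrakk> \<Longrightarrow> u (e \<cdot> f) = u e \<cdot> f"
  using assms by (auto simp: sect_def)

text \<open>Here \<open>f\<close> may lie outside \<open>I\<close>; since
  \<open>e \<cdot> f = e \<cdot> (e \<cdot> f)\<close>, it can be replaced by
  \<open>e \<cdot> f\<close>, to which the compatibility of \<open>u\<close> applies.\<close>

lemma sect_mult_le:
  assumes u: "sect I u" and I: "inverse_subsemigrp S I"
    and e: "e \<in> I" "e \<in> idems S" and f: "f \<in> idems S" "e \<cdot> f \<in> I"
  shows "u (e \<cdot> f) = u e \<cdot> f"
proof -
  have c: "e \<in> carrier S" "f \<in> carrier S" "u e \<in> carrier S"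
    using e f sectD[OF u e] subsemigrpD(3)[OF I] by (auto simp: idems_closed)
  have "e \<cdot> (e \<cdot> f) = e \<cdot> f" using c idems_idem[OF e(2)] by (simp flip: assoc)
  then have "u (e \<cdot> f) = u e \<cdot> (e \<cdot> f)"
    using sectD(3)[OF u e f(2)] e f by simp
  also have "\<dots> = (u e \<cdot> \<epsilon> (u e)) \<cdot> f"
    using c sectD(2)[OF u e] by (simp add: assoc del: eps_mult_right)
  finally show ?thesis using c by simp
qed

lemma mult_monoid_simps [simp]:
  "carrier (MM I) = multipliers (S\<lparr>carrier := I\<rparr>)"
  "\<one>\<^bsub>MM I\<^esub> = (\<lambda>s \<in> I. s, \<lambda>s \<in> I. s)"
  "m \<otimes>\<^bsub>MM I\<^esub> n = (\<lambda>s \<in> I. lact m (lact n s), \<lambda>s \<in> I. ract (ract s m) n)"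
  by (simp_all add: mult_monoid_def)

lemma monoid_MM: "inverse_subsemigrp S I \<Longrightarrow> monoid (MM I)"
  by (intro semigrp.monoid_mult_monoid inverse_semigrp.axioms inverse_semigrp_subsemigrp)

text \<open>The linking law s(mt) = (sm)t is the compatibility of \<open>u\<close> in disguise:
  \<open>u (\<epsilon> t) \<cdot> \<epsilon> s\<close> and
  \<open>u (\<epsilon> s) \<cdot> \<epsilon> t\<close> both equal
  \<open>u (\<epsilon> (s \<cdot> t))\<close>.\<close>

lemma mk_mult_closed:
  assumes I: "inverse_subsemigrp S I" and u: "sect I u"
  shows "mk_mult I u \<in> carrier (MM I)"
proof -
  note D = subsemigrpD[OF I]
  have *: "u (\<epsilon> (s \<cdot> t)) \<cdot> (s \<cdot> t) = u (\<epsilon> s) \<cdot> s \<cdot> t \<and> s \<cdot> t \<cdot> u (\<epsilon> (s \<cdot> t)) = s \<cdot> (t \<cdot> u (\<epsilon> t)) \<and>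
    s \<cdot> (u (\<epsilon> t) \<cdot> t) = s \<cdot> u (\<epsilon> s) \<cdot> t" if s: "s \<in> I" and t: "t \<in> I" for s t
  proof -
    have c: "s \<in> carrier S" "t \<in> carrier S" "\<epsilon> s \<in> idems S" "\<epsilon> t \<in> idems S" "\<epsilon> s \<in> I" "\<epsilon> t \<in> I"
      using s t D by auto
    have uc: "u (\<epsilon> s) \<in> carrier S" "u (\<epsilon> t) \<in> carrier S"
      using sectD[OF u] c D by auto
    have 1: "u (\<epsilon> (s \<cdot> t)) = u (\<epsilon> s) \<cdot> \<epsilon> t" "u (\<epsilon> (s \<cdot> t)) = u (\<epsilon> t) \<cdot> \<epsilon> s"
      using c sectD(3)[OF u, of "\<epsilon> s" "\<epsilon> t"] sectD(3)[OF u, of "\<epsilon> t" "\<epsilon> s"]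
      by (auto simp: eps_mult idems_commute[of "\<epsilon> s"])
    have com: "\<epsilon> t \<cdot> (s \<cdot> t) = s \<cdot> t" "u (\<epsilon> t) \<cdot> \<epsilon> s = \<epsilon> s \<cdot> u (\<epsilon> t)"
      "t \<cdot> \<epsilon> s = \<epsilon> s \<cdot> t" "\<epsilon> t \<cdot> t = t"
      using c uc idem_comm[of "\<epsilon> t" "s \<cdot> t"] idem_comm[of "\<epsilon> s" "u (\<epsilon> t)"] idem_comm[of "\<epsilon> s" t]
      by (simp_all add: closed assoc)
    have 2: "s \<cdot> t \<cdot> (u (\<epsilon> t) \<cdot> \<epsilon> s) = s \<cdot> (t \<cdot> u (\<epsilon> t))"
    proof -
      have "s \<cdot> t \<cdot> (u (\<epsilon> t) \<cdot> \<epsilon> s) = s \<cdot> (t \<cdot> \<epsilon> s) \<cdot> u (\<epsilon> t)"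
        unfolding com(2) using c uc by (simp add: assoc closed)
      also have "\<dots> = (s \<cdot> \<epsilon> s) \<cdot> t \<cdot> u (\<epsilon> t)"
        unfolding com(3) using c uc by (simp add: assoc closed del: eps_mult_right)
      finally show ?thesis using c uc by (simp add: assoc)
    qed
    have "s \<cdot> (u (\<epsilon> t) \<cdot> t) = (s \<cdot> \<epsilon> s) \<cdot> (u (\<epsilon> t) \<cdot> t)" using c by simp
    also have "\<dots> = s \<cdot> (u (\<epsilon> t) \<cdot> \<epsilon> s) \<cdot> t"
      unfolding com(2) using c uc by (simp add: assoc closed del: eps_mult_right)
    also have "\<dots> = s \<cdot> (u (\<epsilon> s) \<cdot> \<epsilon> t) \<cdot> t" using 1 by simp
    also have "\<dots> = s \<cdot> u (\<epsilon> s) \<cdot> (\<epsilon> t \<cdot> t)" using c uc by (simp add: assoc closed)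
    finally have 3: "s \<cdot> (u (\<epsilon> t) \<cdot> t) = s \<cdot> u (\<epsilon> s) \<cdot> t" using c by simp
    have 4: "u (\<epsilon> (s \<cdot> t)) \<cdot> (s \<cdot> t) = u (\<epsilon> s) \<cdot> s \<cdot> t"
      using c uc com(1) by (simp add: 1(1) assoc closed)
    show ?thesis using 2 3 4 by (simp add: 1(2)[symmetric])
  qed
  have "u (\<epsilon> s) \<in> I" if "s \<in> I" for s
    using that sectD[OF u] D by auto
  then show ?thesis
    using D * by (auto simp: mk_mult_def multipliers_def)
qed

lemma sect_eps_val:
  assumes "inverse_subsemigrp S I" "sect I u" "s \<in> I"
  shows "u (\<epsilon> s) \<in> I" "u (\<epsilon> s) \<in> carrier S" "\<epsilon> (u (\<epsilon> s)) = \<epsilon> s"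
    "\<epsilon> (u (\<epsilon> s) \<cdot> s) = \<epsilon> s" "\<epsilon> (s \<cdot> u (\<epsilon> s)) = \<epsilon> s"
proof -
  note D = subsemigrpD[OF assms(1)]
  have s: "s \<in> carrier S" "\<epsilon> s \<in> I" using assms D by auto
  show 1: "u (\<epsilon> s) \<in> I" "u (\<epsilon> s) \<in> carrier S" "\<epsilon> (u (\<epsilon> s)) = \<epsilon> s"
    using sectD[OF assms(2) s(2)] s D by auto
  show "\<epsilon> (u (\<epsilon> s) \<cdot> s) = \<epsilon> s" "\<epsilon> (s \<cdot> u (\<epsilon> s)) = \<epsilon> s"
    using 1 s by (auto intro: eps_mult_same)
qed

lemma sect_mult:
  assumes I: "inverse_subsemigrp S I" and u: "sect I u" and v: "sect I v"
  shows "sect I (\<lambda>e. u e \<cdot> v e)"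
proof -
  note D = subsemigrpD[OF I]
  have "u e \<cdot> v e \<in> I \<and> \<epsilon> (u e \<cdot> v e) = e \<and> u (e \<cdot> f) \<cdot> v (e \<cdot> f) = u e \<cdot> v e \<cdot> f"
    if "e \<in> I" "e \<in> idems S" "f \<in> I" "f \<in> idems S" for e f
  proof -
    note ue = sectD[OF u that(1,2)] and ve = sectD[OF v that(1,2)]
    have c: "u e \<in> carrier S" "v e \<in> carrier S" "f \<in> carrier S" using ue ve D that by auto
    have "u e \<cdot> f \<cdot> (v e \<cdot> f) = u e \<cdot> v e \<cdot> (f \<cdot> f)"
      using c that by (simp add: assoc closed idem_comm[of f "v e"])
         (simp add: closed idem_comm[of f "v e"] flip: assoc)
    then show ?thesis using ue ve c that D by (simp add: eps_mult_same idems_idem)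
  qed
  then show ?thesis unfolding sect_def by blast
qed

lemma sect_sinv:
  assumes I: "inverse_subsemigrp S I" and u: "sect I u"
  shows "sect I (\<lambda>e. (u e)\<^sup>\<dagger>)"
proof -
  note D = subsemigrpD[OF I]
  have "(u e)\<^sup>\<dagger> \<in> I \<and> \<epsilon> ((u e)\<^sup>\<dagger>) = e \<and> (u (e \<cdot> f))\<^sup>\<dagger> = (u e)\<^sup>\<dagger> \<cdot> f"
    if "e \<in> I" "e \<in> idems S" "f \<in> I" "f \<in> idems S" for e f
  proof -
    note ue = sectD[OF u that(1,2)]
    have c: "u e \<in> carrier S" "(u e)\<^sup>\<dagger> \<in> carrier S" "f \<in> carrier S" using ue D that by auto
    then have "(u (e \<cdot> f))\<^sup>\<dagger> = (u e)\<^sup>\<dagger> \<cdot> f"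
      using ue(3)[OF that(3,4)] that(4) idem_comm[of f "(u e)\<^sup>\<dagger>"] by (simp add: sinv_mult)
    then show ?thesis using ue(1,2) D(5) c by simp
  qed
  then show ?thesis unfolding sect_def by blast
qed

lemma sect_idem: "inverse_subsemigrp S I \<Longrightarrow> sect I (\<lambda>e. e)"
  by (auto simp: sect_def)

lemma mk_mult_mult:
  assumes I: "inverse_subsemigrp S I" and u: "sect I u" and v: "sect I v"
  shows "mk_mult I u \<otimes>\<^bsub>MM I\<^esub> mk_mult I v = mk_mult I (\<lambda>e. u e \<cdot> v e)"
  using sect_eps_val[OF I u] sect_eps_val[OF I v] subsemigrpD[OF I]
  by (auto simp: mk_mult_def fun_eq_iff assoc)

lemma mk_mult_cong:
  assumes I: "inverse_subsemigrp S I" and "\<And>e. \<lbrakk>e \<in> I; e \<in> idems S\<rbrakk> \<Longrightarrow> u e = v e"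
  shows "mk_mult I u = mk_mult I v"
  using assms subsemigrpD[OF I] by (auto simp: mk_mult_def fun_eq_iff)

lemma mk_mult_idem: "inverse_subsemigrp S I \<Longrightarrow> mk_mult I (\<lambda>e. e) = \<one>\<^bsub>MM I\<^esub>"
  using subsemigrpD[of I] by (auto simp: mk_mult_def fun_eq_iff)

lemma mk_mult_sinv:
  assumes I: "inverse_subsemigrp S I" and u: "sect I u"
  shows "mk_mult I u \<in> Units (MM I)" "inv\<^bsub>MM I\<^esub> mk_mult I u = mk_mult I (\<lambda>e. (u e)\<^sup>\<dagger>)"
proof -
  interpret monoid "MM I" by (rule monoid_MM[OF I])
  note c = mk_mult_closed[OF I u] mk_mult_closed[OF I sect_sinv[OF I u]]
  have e: "u e \<cdot> (u e)\<^sup>\<dagger> = e" "(u e)\<^sup>\<dagger> \<cdot> u e = e" if "e \<in> I" "e \<in> idems S" for e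
    using sectD[OF u that] subsemigrpD[OF I] by auto
  have 1: "mk_mult I u \<otimes>\<^bsub>MM I\<^esub> mk_mult I (\<lambda>e. (u e)\<^sup>\<dagger>) = \<one>\<^bsub>MM I\<^esub>"
    "mk_mult I (\<lambda>e. (u e)\<^sup>\<dagger>) \<otimes>\<^bsub>MM I\<^esub> mk_mult I u = \<one>\<^bsub>MM I\<^esub>"
    unfolding mk_mult_mult[OF I u sect_sinv[OF I u]] mk_mult_mult[OF I sect_sinv[OF I u] u]
      mk_mult_idem[OF I, symmetric]
    using e by (auto intro!: mk_mult_cong[OF I])
  show "mk_mult I u \<in> Units (MM I)" unfolding Units_def using c 1 by blast
  show "inv\<^bsub>MM I\<^esub> mk_mult I u = mk_mult I (\<lambda>e. (u e)\<^sup>\<dagger>)"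
    by (rule inv_unique'[symmetric]) (use c 1 in blast)+
qed

lemma fst_mk_mult:
  assumes I: "inverse_subsemigrp S I" and u: "sect I u" and e: "e \<in> I" "e \<in> idems S"
  shows "fst (mk_mult I u) e = u e"
  using sectD[OF u e] subsemigrpD(3)[OF I] e eps_mult_right[of "u e"] by (simp add: mk_mult_def)

text \<open>Invertibility is what puts \<open>m e\<close> into the maximal subgroup at
  \<open>e\<close>. Applying the inverse of \<open>m\<close> to
  \<open>m e = m e \<cdot> \<epsilon> (m e)\<close> gives
  \<open>e = e \<cdot> \<epsilon> (m e)\<close>, and \<open>m e = m e \<cdot> e\<close> gives the
  opposite inequality. The linking law then identifies the right action on \<open>e\<close> with the
  left one, and every \<open>s = \<epsilon> s \<cdot> s\<close> is reached from its
  idempotent.\<close>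

lemma Units_MM:
  assumes I: "inverse_subsemigrp S I" and m: "m \<in> Units (MM I)"
  shows "sect I (fst m)" "m = mk_mult I (fst m)"
proof -
  interpret monoid "MM I" by (rule monoid_MM[OF I])
  note D = subsemigrpD[OF I]
  define n where "n = inv\<^bsub>MM I\<^esub> m"
  have mc: "m \<in> multipliers (S\<lparr>carrier := I\<rparr>)" and nc: "n \<in> multipliers (S\<lparr>carrier := I\<rparr>)"
    using Units_closed[OF m] Units_inv_closed[OF m] by (auto simp: n_def)
  have nm: "lact n (lact m s) = s" if "s \<in> I" for s
    using Units_l_inv[OF m] that unfolding n_def[symmetric] by (auto simp: fun_eq_iff split: if_splits)
  have mcl: "lact m s \<in> I" "ract s m \<in> I" if "s \<in> I" for s
    using mc that by (auto simp: multipliers_def)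
  have mm: "lact m (s \<cdot> t) = lact m s \<cdot> t" "lact n (s \<cdot> t) = lact n s \<cdot> t"
    "ract (s \<cdot> t) m = s \<cdot> ract t m" "s \<cdot> lact m t = ract s m \<cdot> t" if "s \<in> I" "t \<in> I" for s t
    using mc nc that by (auto simp: multipliers_def)
  have val: "\<epsilon> (lact m e) = e" "ract e m = lact m e" if e: "e \<in> I" "e \<in> idems S" for e
  proof -
    let ?x = "lact m e" and ?y = "ract e m"
    have c: "?x \<in> I" "?x \<in> carrier S" "e \<in> carrier S" "\<epsilon> ?x \<in> I" "?y \<in> carrier S" "?y \<in> I"
      using mcl e D by auto
    have xe: "?x \<cdot> e = ?x" using mm(1)[OF e(1) e(1)] e by (simp add: idems_idem)
    have "e \<cdot> \<epsilon> ?x = lact n (?x \<cdot> \<epsilon> ?x)" using mm(2)[OF c(1) c(4)] nm[OF e(1)] by simp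
    also have "\<dots> = e" using c nm e by simp
    finally have 1: "e \<cdot> \<epsilon> ?x = e" .
    have "\<epsilon> ?x = \<epsilon> ?x \<cdot> e" using eps_mult[OF c(2,3)] xe e by simp
    also have "\<dots> = e \<cdot> \<epsilon> ?x" using e c by (simp add: idem_comm)
    finally show 2: "\<epsilon> ?x = e" using 1 by simp
    have "?y = e \<cdot> ?y" using mm(3)[OF e(1) e(1)] e by (simp add: idems_idem)
    also have "\<dots> = ?y \<cdot> e" using idem_comm[OF e(2) c(5)] by simp
    also have "\<dots> = e \<cdot> ?x" using mm(4)[OF e(1) e(1)] by simp
    also have "\<dots> = ?x" using eps_mult_left[OF c(2)] 2 by simp
    finally show "?y = ?x" .
  qed
  show s: "sect I (fst m)"
    unfolding sect_def using mcl mm val by auto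
  have l: "lact m s = lact m (\<epsilon> s) \<cdot> s" "ract s m = s \<cdot> lact m (\<epsilon> s)" if "s \<in> I" for s
    using mm(1)[of "\<epsilon> s" s] mm(3)[of s "\<epsilon> s"] val[of "\<epsilon> s"] that D by auto
  then show "m = mk_mult I (fst m)"
    using mc by (auto simp: mk_mult_def prod_eq_iff fun_eq_iff multipliers_def PiE_iff extensional_def)
qed

lemma MM_action:
  assumes I: "inverse_subsemigrp S I" and m: "m \<in> Units (MM I)" and s: "s \<in> I"
  shows "lact m s = lact m (\<epsilon> s) \<cdot> s" "ract s m = s \<cdot> lact m (\<epsilon> s)"
    "ract s (inv\<^bsub>MM I\<^esub> m) = s \<cdot> (lact m (\<epsilon> s))\<^sup>\<dagger>"
    "mconj (S\<lparr>carrier := I\<rparr>) m s = lact m (\<epsilon> s) \<cdot> s \<cdot> (lact m (\<epsilon> s))\<^sup>\<dagger>"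
proof -
  note u = Units_MM[OF I m]
  show 1: "lact m s = lact m (\<epsilon> s) \<cdot> s" "ract s m = s \<cdot> lact m (\<epsilon> s)"
    by (subst u(2), use s in \<open>simp add: mk_mult_def\<close>)+
  have *: "ract s (inv\<^bsub>MM I\<^esub> m) = s \<cdot> (lact m (\<epsilon> s))\<^sup>\<dagger>" if s: "s \<in> I" for s
  proof -
    have "inv\<^bsub>MM I\<^esub> m = mk_mult I (\<lambda>e. (lact m e)\<^sup>\<dagger>)"
      using mk_mult_sinv(2)[OF I u(1)] u(2) by simp
    then show ?thesis using s by (simp add: mk_mult_def)
  qed
  show "ract s (inv\<^bsub>MM I\<^esub> m) = s \<cdot> (lact m (\<epsilon> s))\<^sup>\<dagger>" by (rule *[OF s])
  have "lact m s \<in> I" "\<epsilon> (lact m s) = \<epsilon> s"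
    using sect_eps_val[OF I u(1) s] subsemigrpD(4)[OF I _ s] 1(1) by auto
  then show "mconj (S\<lparr>carrier := I\<rparr>) m s = lact m (\<epsilon> s) \<cdot> s \<cdot> (lact m (\<epsilon> s))\<^sup>\<dagger>"
    using *[of "lact m s"] 1(1) by (simp add: mconj_def)
qed

lemma mrestrict_mk_mult: "J \<subseteq> I \<Longrightarrow> mrestrict (mk_mult I u) J = mk_mult J u"
  by (auto simp: mrestrict_def mk_mult_def fun_eq_iff)

lemma mult_sinv_mult_sinv_left [simp]:
  "\<lbrakk>x \<in> carrier S; y \<in> carrier S\<rbrakk> \<Longrightarrow> x \<cdot> (x\<^sup>\<dagger> \<cdot> y) = \<epsilon> x \<cdot> y"
  "\<lbrakk>x \<in> carrier S; y \<in> carrier S\<rbrakk> \<Longrightarrow> x\<^sup>\<dagger> \<cdot> (x \<cdot> y) = \<epsilon> x \<cdot> y"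
  by (simp_all flip: assoc)

lemma sect_ideal_restrict:
  assumes I: "ideal_of S I" and J: "ideal_of S J" and "J \<subseteq> I" and u: "sect I u"
  shows "sect J u"
  unfolding sect_def
proof (intro ballI conjI)
  fix e f assume e: "e \<in> J \<inter> idems S" and f: "f \<in> J \<inter> idems S"
  then have e': "e \<in> I" "e \<in> idems S" using \<open>J \<subseteq> I\<close> by auto
  note ue = sectD[OF u e']
  have "u e \<in> carrier S" using ue I ideal_ofD(2) by blast
  then show "u e \<in> J" using eps_mem[OF J, of "u e"] ue e by auto
  show "\<epsilon> (u e) = e" by (rule ue)
  show "u (e \<cdot> f) = u e \<cdot> f" using ue(3)[of f] f \<open>J \<subseteq> I\<close> by auto
qed

text \<open>Idempotents are central, so \<open>I\<close> and its central part have the same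
  idempotents, and one function \<open>u\<close> with central values describes both a multiplier of
  \<open>I\<close> and its restriction to the central part. Together with the converse below,
  passing between the two changes no formula.\<close>

lemma sect_center:
  assumes I: "ideal_of S I" and u: "sect I u"
    and c: "\<And>e. \<lbrakk>e \<in> I; e \<in> idems S\<rbrakk> \<Longrightarrow> u e \<in> center S"
  shows "sect (center S \<inter> I) u"
  using u c by (auto simp: sect_def idems_center)

lemma sect_from_center:
  assumes I: "ideal_of S I" and u: "sect (center S \<inter> I) u"
  shows "sect I u"
  using u by (auto simp: sect_def idems_center)

text \<open>Inner multipliers detect centrality: comparing \<open>m\<close> with multiplication by
  \<open>a\<close> at \<open>e\<close> shows that \<open>m e\<close> commutes with \<open>a\<close>.
  Conversely a central value of \<open>m\<close> moves past any multiplier \<open>x\<close>, since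
  \<open>x s\<close> absorbs \<open>\<epsilon> s\<close> and so \<open>m\<close> acts on
  \<open>x s\<close> through its value at \<open>\<epsilon> s\<close>.\<close>

lemma Units_center_MM:
  assumes I: "ideal_of S I"
  shows "Units (center_monoid (MM I)) =
    {m \<in> Units (MM I). \<forall>e \<in> I \<inter> idems S. fst m e \<in> center S}"
proof -
  note sI = ideal_subsemigrp[OF I]
  interpret monoid "MM I" by (rule monoid_MM[OF sI])
  note D = subsemigrpD[OF sI]
  have cm: "carrier (center_monoid (MM I)) = {c \<in> carrier (MM I). \<forall>x \<in> carrier (MM I). c \<otimes>\<^bsub>MM I\<^esub> x = x \<otimes>\<^bsub>MM I\<^esub> c}"
    "\<And>x y. x \<otimes>\<^bsub>center_monoid (MM I)\<^esub> y = x \<otimes>\<^bsub>MM I\<^esub> y" "\<one>\<^bsub>center_monoid (MM I)\<^esub> = \<one>\<^bsub>MM I\<^esub>"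
    by (simp_all add: center_monoid_def)
  have inner: "(\<lambda>s \<in> I. a \<cdot> s, \<lambda>s \<in> I. s \<cdot> a) \<in> carrier (MM I)" if a: "a \<in> I" for a
    using a D by (auto simp: multipliers_def assoc)
  have 1: "fst m e \<in> center S" if m: "m \<in> Units (MM I)" and
    c: "\<forall>x \<in> carrier (MM I). m \<otimes>\<^bsub>MM I\<^esub> x = x \<otimes>\<^bsub>MM I\<^esub> m" and e: "e \<in> I" "e \<in> idems S" for m e
  proof -
    have u: "sect I (fst m)" by (rule Units_MM[OF sI m])
    note ue = sectD[OF u e]
    have "fst m e \<cdot> a = a \<cdot> fst m e" if a: "a \<in> I" for a
    proof -
      have x: "fst m (a \<cdot> e) = a \<cdot> fst m e"
        using fun_cong[OF arg_cong[OF bspec[OF c inner[OF a]], of fst], of e] a e ue(1) by simp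
      have "fst m (a \<cdot> e) = fst m (e \<cdot> a)" using idem_comm[of e a] a e D by simp
      also have "\<dots> = fst m e \<cdot> a"
        using Units_closed[OF m] a e by (auto simp: multipliers_def)
      finally show ?thesis using x by simp
    qed
    then have "fst m e \<in> center (S\<lparr>carrier := I\<rparr>)" using ue by (simp add: center_def)
    then show ?thesis using center_ideal[OF I] by simp
  qed
  have 2: "m \<otimes>\<^bsub>MM I\<^esub> x = x \<otimes>\<^bsub>MM I\<^esub> m" if m: "m \<in> Units (MM I)" and
    c: "\<forall>e \<in> I \<inter> idems S. fst m e \<in> center S" and x: "x \<in> carrier (MM I)" for m x
  proof -
    have u: "sect I (fst m)" by (rule Units_MM[OF sI m])
    have xm: "fst x s \<in> I" "snd x s \<in> I" "fst x (s \<cdot> t) = fst x s \<cdot> t" "snd x (s \<cdot> t) = s \<cdot> snd x t"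
      if "s \<in> I" "t \<in> I" for s t
      using x that by (auto simp: multipliers_def)
    have "fst m (fst x s) = fst x (fst m s) \<and> snd x (snd m s) = snd m (snd x s)" if s: "s \<in> I" for s
    proof -
      let ?e = "\<epsilon> s"
      have c: "s \<in> carrier S" "?e \<in> I" "?e \<in> idems S" "?e \<in> carrier S" "fst m ?e \<in> center S"
        "fst m ?e \<in> I" "fst m ?e \<in> carrier S"
        using s D c sectD(1)[OF u, of ?e] by (auto intro: center_closed)
      have mm: "fst m (a \<cdot> b) = fst m a \<cdot> b" "snd m (a \<cdot> b) = a \<cdot> snd m b" if "a \<in> I" "b \<in> I" for a b
        using Units_closed[OF m] that by (auto simp: multipliers_def)
      have xs: "fst x s \<in> I" "snd x s \<in> I" "fst x s \<in> carrier S" "snd x s \<in> carrier S"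
        using xm s D by auto
      have e1: "?e \<cdot> fst x s = fst x s" "snd x s \<cdot> ?e = snd x s"
        using xm(3)[OF s c(2)] xm(4)[OF c(2) s] idem_comm[OF c(3) xs(3)] idem_comm[OF c(3) xs(4)]
        unfolding eps_mult_left[OF c(1)] eps_mult_right[OF c(1)] by presburger+
      have ms: "fst m s = s \<cdot> fst m ?e" "snd m s = fst m ?e \<cdot> s"
        using MM_action(1)[OF sI m s] MM_action(2)[OF sI m s] center_commute[OF c(5) c(1)]
        by presburger+
      have me: "snd m ?e = fst m ?e"
        using MM_action(2)[OF sI m c(2)] eps_mult_left[OF c(7)]
        unfolding sectD(2)[OF u c(2,3)] eps_idem[OF c(3)] by simp
      have "fst m (fst x s) = fst m ?e \<cdot> fst x s"
        using mm(1)[OF c(2) xs(1)] e1 by simp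
      also have "\<dots> = fst x s \<cdot> fst m ?e" using center_commute[OF c(5) xs(3)] .
      also have "\<dots> = fst x (fst m s)" using xm(3)[OF s c(6)] ms by simp
      finally have 1: "fst m (fst x s) = fst x (fst m s)" .
      have "snd m (snd x s) = snd x s \<cdot> fst m ?e"
        using mm(2)[OF xs(2) c(2)] e1 me by simp
      also have "\<dots> = fst m ?e \<cdot> snd x s" using center_commute[OF c(5) xs(4)] by simp
      also have "\<dots> = snd x (snd m s)" using xm(4)[OF c(6) s] ms by simp
      finally show ?thesis using 1 by simp
    qed
    then show ?thesis by (auto simp: fun_eq_iff)
  qed
  show ?thesis (is "?L = ?R")
  proof
    show "?L \<subseteq> ?R"
    proof
      fix m assume m: "m \<in> ?L"
      then have mu: "m \<in> Units (MM I)" unfolding Units_def cm by blast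
      have "\<forall>x \<in> carrier (MM I). m \<otimes>\<^bsub>MM I\<^esub> x = x \<otimes>\<^bsub>MM I\<^esub> m"
        using m unfolding Units_def cm by blast
      then show "m \<in> ?R" using 1[OF mu] mu by auto
    qed
    show "?R \<subseteq> ?L"
    proof
      fix m assume m: "m \<in> ?R"
      then have mu: "m \<in> Units (MM I)" and mc: "\<forall>e \<in> I \<inter> idems S. fst m e \<in> center S" by auto
      let ?n = "inv\<^bsub>MM I\<^esub> m"
      note u = Units_MM[OF sI mu]
      have nu: "?n \<in> Units (MM I)" using mu by (rule Units_inv_Units)
      have n: "?n = mk_mult I (\<lambda>e. (fst m e)\<^sup>\<dagger>)" using mk_mult_sinv(2)[OF sI u(1)] u(2) by simp
      have nc: "\<forall>e \<in> I \<inter> idems S. fst ?n e \<in> center S"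
        using fst_mk_mult[OF sI sect_sinv[OF sI u(1)]] mc center_sinv n by auto
      have "m \<in> carrier (center_monoid (MM I))" "?n \<in> carrier (center_monoid (MM I))"
        using 2[OF mu mc] 2[OF nu nc] Units_closed[OF mu] Units_closed[OF nu] unfolding cm by blast+
      then show "m \<in> ?L"
        using Units_l_inv[OF mu] Units_r_inv[OF mu] unfolding Units_def cm by blast
    qed
  qed
qed

end

section \<open>Isomorphisms between ideals\<close>

lemma ideal_iso_appl:
  assumes "ideal_iso S I J \<phi>"
  shows "ideal_of S I" "ideal_of S J" "dom \<phi> = I" "ran \<phi> = J"
    "a \<in> I \<Longrightarrow> \<phi> a = Some (the (\<phi> a))" "a \<in> I \<Longrightarrow> the (\<phi> a) \<in> J"
    "\<lbrakk>a \<in> I; b \<in> I\<rbrakk> \<Longrightarrow> the (\<phi> (a \<cdot>\<^bsub>S\<^esub> b)) = the (\<phi> a) \<cdot>\<^bsub>S\<^esub> the (\<phi> b)"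
    "\<lbrakk>a \<in> I; b \<in> I; the (\<phi> a) = the (\<phi> b)\<rbrakk> \<Longrightarrow> a = b"
    "c \<in> J \<Longrightarrow> \<exists>a \<in> I. the (\<phi> a) = c"
    "c \<in> J \<Longrightarrow> pinv \<phi> c \<in> I" "c \<in> J \<Longrightarrow> the (\<phi> (pinv \<phi> c)) = c"
    "a \<in> I \<Longrightarrow> pinv \<phi> (the (\<phi> a)) = a"
proof -
  show 1: "ideal_of S I" "ideal_of S J" "dom \<phi> = I" "ran \<phi> = J"
    using assms by (auto simp: ideal_iso_def)
  show sm: "\<phi> a = Some (the (\<phi> a))" if "a \<in> I" for a using 1(3) that by auto
  show m: "the (\<phi> a) \<in> J" if "a \<in> I" for a
    using sm[OF that] ranI[of \<phi> a] unfolding 1(4)[symmetric] by blast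
  show "the (\<phi> (a \<cdot>\<^bsub>S\<^esub> b)) = the (\<phi> a) \<cdot>\<^bsub>S\<^esub> the (\<phi> b)" if "a \<in> I" "b \<in> I"
    using assms that by (auto simp: ideal_iso_def)
  have inj: "inj_on (\<lambda>a. the (\<phi> a)) I"
    using assms sm unfolding ideal_iso_def inj_on_def by metis
  show "a = b" if "a \<in> I" "b \<in> I" "the (\<phi> a) = the (\<phi> b)" using inj that by (auto dest: inj_onD)
  have im: "(\<lambda>a. the (\<phi> a)) ` I = J"
    using 1(3,4) by (force simp: ran_def dom_def image_iff)
  show "\<exists>a \<in> I. the (\<phi> a) = c" if "c \<in> J" using im that by auto
  show "pinv \<phi> c \<in> I" "the (\<phi> (pinv \<phi> c)) = c" if "c \<in> J"
    using that unfolding pinv_def 1(3) im[symmetric] by (auto intro: inv_into_into f_inv_into_f)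
  show "pinv \<phi> (the (\<phi> a)) = a" if "a \<in> I"
    using inv_into_f_f[OF inj that] unfolding pinv_def 1(3) .
qed

context semilattice_of_groups
begin

lemma ideal_iso_val:
  assumes \<phi>: "ideal_iso S I J \<phi>" and a: "a \<in> I"
  shows "a \<in> carrier S" "the (\<phi> a) \<in> carrier S" "the (\<phi> (a\<^sup>\<dagger>)) = (the (\<phi> a))\<^sup>\<dagger>"
    "the (\<phi> (\<epsilon> a)) = \<epsilon> (the (\<phi> a))" "a \<in> idems S \<Longrightarrow> the (\<phi> a) \<in> idems S"
    "a \<in> center S \<Longrightarrow> the (\<phi> a) \<in> center S"
proof -
  note P = ideal_iso_appl[OF \<phi>]
  note sI = subsemigrpD[OF ideal_subsemigrp[OF P(1)]]
  show c: "a \<in> carrier S" "the (\<phi> a) \<in> carrier S"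
    using a P(6)[OF a] ideal_ofD(2)[OF P(1)] ideal_ofD(2)[OF P(2)] by auto
  have a': "a\<^sup>\<dagger> \<in> I" using a sI by auto
  have "is_sinv S (the (\<phi> a)) (the (\<phi> (a\<^sup>\<dagger>)))"
    using P(7)[OF a a'] P(7)[OF a' a] P(7)[of "a \<cdot> a\<^sup>\<dagger>" a] P(7)[of "a\<^sup>\<dagger> \<cdot> a" "a\<^sup>\<dagger>"]
      a a' sI mult_sinv_mult[OF c(1)] sinv_mult_sinv[OF c(1)] P(6)[OF a'] ideal_ofD(2)[OF P(2)]
    by (auto simp: is_sinv_def simp del: mult_sinv_self sinv_mult_self)
  then show 1: "the (\<phi> (a\<^sup>\<dagger>)) = (the (\<phi> a))\<^sup>\<dagger>"
    using sinv_eqI[OF c(2)] by simp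
  show 2: "the (\<phi> (\<epsilon> a)) = \<epsilon> (the (\<phi> a))"
    unfolding idpart_def using P(7)[OF a a'] 1 by simp
  show "the (\<phi> a) \<in> idems S" if "a \<in> idems S"
    using 2 that eps_idems[OF c(2)] by simp
  show "the (\<phi> a) \<in> center S" if "a \<in> center S"
  proof -
    have "the (\<phi> a) \<cdot> y = y \<cdot> the (\<phi> a)" if y: "y \<in> J" for y
    proof -
      obtain b where b: "b \<in> I" "y = the (\<phi> b)" using P(9)[OF y] by blast
      then have "a \<cdot> b = b \<cdot> a" using \<open>a \<in> center S\<close> sI by (auto intro: center_commute)
      then show ?thesis using P(7)[OF a b(1)] P(7)[OF b(1) a] b by simp
    qed
    then have "the (\<phi> a) \<in> center (S\<lparr>carrier := J\<rparr>)"
      using P(6)[OF a] by (simp add: center_def)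
    then show ?thesis using center_ideal[OF P(2)] by simp
  qed
qed

text \<open>An ideal is recovered from its idempotents. Equality of domains and ranges can therefore
  be tested after restriction to the center, where equivalent isomorphisms coincide.\<close>

lemma ideal_eq_center:
  assumes I: "ideal_of S I" and J: "ideal_of S J" and "center S \<inter> I = center S \<inter> J"
  shows "I = J"
proof -
  have "K \<subseteq> L" if K: "ideal_of S K" and L: "ideal_of S L" and eq: "center S \<inter> K = center S \<inter> L" for K L
  proof
    fix a assume a: "a \<in> K"
    then have ac: "a \<in> carrier S" using K ideal_ofD(2) by blast
    then have "\<epsilon> a \<in> center S \<inter> K" using a eps_mem[OF K] by (simp add: idems_center)
    then show "a \<in> L" using eq eps_mem[OF L ac] by auto
  qed
  from this[OF I J assms(3)] this[OF J I assms(3)[symmetric]] show ?thesis by auto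
qed

lemma mtransport_mk_mult:
  assumes \<phi>: "ideal_iso S I J \<phi>" and u: "sect I u"
  shows "sect J (\<lambda>e. the (\<phi> (u (pinv \<phi> e))))"
    "mtransport \<phi> (mk_mult I u) = mk_mult J (\<lambda>e. the (\<phi> (u (pinv \<phi> e))))"
proof -
  note P = ideal_iso_appl[OF \<phi>]
  note V = ideal_iso_val[OF \<phi>]
  note sI = ideal_subsemigrp[OF P(1)]
  note sJ = subsemigrpD[OF ideal_subsemigrp[OF P(2)]]
  have pid: "pinv \<phi> e \<in> idems S" if e: "e \<in> J" "e \<in> idems S" for e
  proof -
    have p: "pinv \<phi> e \<in> I" "the (\<phi> (pinv \<phi> e)) = e" using P e by auto
    then have "the (\<phi> (\<epsilon> (pinv \<phi> e))) = the (\<phi> (pinv \<phi> e))"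
      using V(4)[OF p(1)] e by simp
    moreover have "\<epsilon> (pinv \<phi> e) \<in> I" using subsemigrpD(6)[OF sI] p by auto
    ultimately have "\<epsilon> (pinv \<phi> e) = pinv \<phi> e" using P(8) p(1) by blast
    then show ?thesis using eps_idems[OF V(1)[OF p(1)]] by simp
  qed
  have pm: "pinv \<phi> (a \<cdot> b) = pinv \<phi> a \<cdot> pinv \<phi> b" if "a \<in> J" "b \<in> J" for a b
  proof (rule P(8))
    show "pinv \<phi> (a \<cdot> b) \<in> I" "pinv \<phi> a \<cdot> pinv \<phi> b \<in> I"
      using that P(10) sJ subsemigrpD(4)[OF sI] by auto
    show "the (\<phi> (pinv \<phi> (a \<cdot> b))) = the (\<phi> (pinv \<phi> a \<cdot> pinv \<phi> b))"
      using that P(7,10,11) sJ by simp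
  qed
  have pe: "pinv \<phi> (\<epsilon> a) = \<epsilon> (pinv \<phi> a)" if "a \<in> J" for a
  proof (rule P(8))
    show "pinv \<phi> (\<epsilon> a) \<in> I" "\<epsilon> (pinv \<phi> a) \<in> I"
      using that P(10) sJ subsemigrpD(6)[OF sI] by auto
    show "the (\<phi> (pinv \<phi> (\<epsilon> a))) = the (\<phi> (\<epsilon> (pinv \<phi> a)))"
      using that P(10,11) sJ V(4)[of "pinv \<phi> a"] by simp
  qed
  show "sect J (\<lambda>e. the (\<phi> (u (pinv \<phi> e))))"
    unfolding sect_def
  proof (intro ballI conjI)
    fix e f assume e: "e \<in> J \<inter> idems S" and f: "f \<in> J \<inter> idems S"
    let ?p = "pinv \<phi> e" and ?q = "pinv \<phi> f"
    have p: "?p \<in> I" "?p \<in> idems S" "?q \<in> I" "?q \<in> idems S" using P(10) pid e f by auto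
    note ue = sectD[OF u p(1,2)]
    show "the (\<phi> (u ?p)) \<in> J" using ue P by blast
    show "\<epsilon> (the (\<phi> (u ?p))) = e" using V(4)[OF ue(1)] ue(2) P(11) e by auto
    show "the (\<phi> (u (pinv \<phi> (e \<cdot> f)))) = the (\<phi> (u ?p)) \<cdot> f"
      using pm[of e f] e f ue(3)[OF p(3,4)] P(7)[OF ue(1) p(3)] P(11) by auto
  qed
  have "the (\<phi> (lact (mk_mult I u) (pinv \<phi> t))) = the (\<phi> (u (pinv \<phi> (\<epsilon> t)))) \<cdot> t \<and>
    the (\<phi> (ract (pinv \<phi> t) (mk_mult I u))) = t \<cdot> the (\<phi> (u (pinv \<phi> (\<epsilon> t))))" if t: "t \<in> J" for t
  proof -
    have p: "pinv \<phi> t \<in> I" using P(10) t by auto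
    then have "u (\<epsilon> (pinv \<phi> t)) \<in> I" using sect_eps_val[OF sI u] by auto
    then show ?thesis using p pe[OF t] P(7) P(11)[OF t] by (simp add: mk_mult_def)
  qed
  then show "mtransport \<phi> (mk_mult I u) = mk_mult J (\<lambda>e. the (\<phi> (u (pinv \<phi> e))))"
    by (auto simp: mtransport_def P(4) mk_mult_def[of J] fun_eq_iff)
qed

text \<open>The image absorbs all of \<open>S\<close> and not just \<open>J\<close>: for
  \<open>b\<close> in the image, \<open>x \<cdot> b = (x \<cdot> \<epsilon> b) \<cdot> b\<close>,
  and the first factor lies in \<open>J\<close>, hence has a preimage in \<open>I\<close>.\<close>

lemma ideal_iso_restrict:
  assumes \<phi>: "ideal_iso S I J \<phi>" and K: "ideal_of S K" "K \<subseteq> I"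
  shows "ideal_iso S K ((\<lambda>a. the (\<phi> a)) ` K) (\<phi> |` K)"
proof -
  note P = ideal_iso_appl[OF \<phi>]
  have I: "ideal_of S ((\<lambda>a. the (\<phi> a)) ` K)"
    unfolding ideal_of_def
  proof (intro conjI ballI)
    show "(\<lambda>a. the (\<phi> a)) ` K \<noteq> {}" using ideal_ofD(1)[OF K(1)] by simp
    show "(\<lambda>a. the (\<phi> a)) ` K \<subseteq> carrier S" using ideal_iso_val(2)[OF \<phi>] K(2) by auto
    fix x b assume x: "x \<in> carrier S" and "b \<in> (\<lambda>a. the (\<phi> a)) ` K"
    then obtain a where a: "a \<in> K" "b = the (\<phi> a)" by blast
    have aI: "a \<in> I" "b \<in> J" "b \<in> carrier S" using a K P(6) ideal_iso_val(2)[OF \<phi>] by auto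
    have e: "\<epsilon> b \<in> J" using aI eps_mem[OF P(2)] by auto
    obtain y z where y: "y \<in> I" "the (\<phi> y) = x \<cdot> \<epsilon> b" and z: "z \<in> I" "the (\<phi> z) = \<epsilon> b \<cdot> x"
      using P(9) ideal_ofD(3,4)[OF P(2) x e] by metis
    have yz: "y \<in> carrier S" "z \<in> carrier S" using y z P(1) ideal_ofD(2) by auto
    have "x \<cdot> b = the (\<phi> (y \<cdot> a))"
      using P(7)[OF y(1) aI(1)] y a aI x eps_mult_left[OF aI(3)] by (simp add: assoc)
    then show "x \<cdot> b \<in> (\<lambda>a. the (\<phi> a)) ` K"
      using ideal_ofD(3)[OF K(1) yz(1) a(1)] by blast
    have "b \<cdot> x = the (\<phi> (a \<cdot> z))"
      using P(7)[OF aI(1) z(1)] z a aI x eps_mult_right[OF aI(3)] by (simp flip: assoc)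
    then show "b \<cdot> x \<in> (\<lambda>a. the (\<phi> a)) ` K"
      using ideal_ofD(4)[OF K(1) yz(2) a(1)] by blast
  qed
  have "ran (\<phi> |` K) = (\<lambda>a. the (\<phi> a)) ` K"
  proof -
    have "\<phi> a = Some (the (\<phi> a))" if "a \<in> K" for a using that K P(5) by auto
    then show ?thesis unfolding ran_def restrict_map_def image_def
      by (auto split: if_splits) (metis option.sel)
  qed
  moreover have "inj_on (\<phi> |` K) K"
    using inj_on_subset[of \<phi> I K] \<phi> K(2) by (auto simp: ideal_iso_def inj_on_def)
  moreover have "a \<cdot> b \<in> K" if "a \<in> K" "b \<in> K" for a b
    using that K ideal_ofD(2,3)[OF K(1)] by blast
  ultimately show ?thesis
    using I K P(3) P(7)[OF subsetD[OF K(2)] subsetD[OF K(2)]] by (auto simp: ideal_iso_def)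
qed

text \<open>To see that the domain absorbs \<open>S\<close>, an outer factor \<open>x\<close> is
  replaced by \<open>x \<cdot> \<epsilon> a\<close>, which lies in the domain of
  \<open>\<chi>\<close>, so that multiplicativity of \<open>\<chi>\<close> can be used.\<close>

lemma ideal_iso_comp:
  assumes \<phi>: "ideal_iso S I J \<phi>" and \<chi>: "ideal_iso S I' J' \<chi>"
  shows "ideal_iso S {a \<in> I'. the (\<chi> a) \<in> I} ((\<lambda>a. the (\<phi> a)) ` (I \<inter> J')) (\<phi> \<circ>\<^sub>m \<chi>)"
proof -
  note P = ideal_iso_appl[OF \<phi>] and Q = ideal_iso_appl[OF \<chi>]
  have IJ: "ideal_of S (I \<inter> J')" by (rule ideal_inter[OF P(1) Q(2)])
  let ?K = "{a \<in> I'. the (\<chi> a) \<in> I}"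
  have dom: "dom (\<phi> \<circ>\<^sub>m \<chi>) = ?K"
  proof -
    have "a \<in> dom (\<phi> \<circ>\<^sub>m \<chi>) \<longleftrightarrow> a \<in> ?K" for a
    proof (cases "a \<in> I'")
      case True
      then show ?thesis using Q(5)[OF True] P(3) by (auto simp: map_comp_def split: option.splits)
    next
      case False
      then show ?thesis using Q(3) by (auto simp: map_comp_def split: option.splits)
    qed
    then show ?thesis by blast
  qed
  have val: "the ((\<phi> \<circ>\<^sub>m \<chi>) a) = the (\<phi> (the (\<chi> a)))" "(\<phi> \<circ>\<^sub>m \<chi>) a = Some (the (\<phi> (the (\<chi> a))))"
    if "a \<in> ?K" for a
    using that Q(5)[of a] P(5)[of "the (\<chi> a)"] by (auto simp: map_comp_def split: option.splits)
  have im: "(\<lambda>a. the (\<chi> a)) ` ?K = I \<inter> J'"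
    using Q(6,9) by (force simp: image_iff)
  have ran: "ran (\<phi> \<circ>\<^sub>m \<chi>) = (\<lambda>a. the (\<phi> a)) ` (I \<inter> J')"
  proof -
    have "ran (\<phi> \<circ>\<^sub>m \<chi>) = (\<lambda>a. the (\<phi> (the (\<chi> a)))) ` ?K"
      using val dom by (auto simp: ran_def dom_def image_iff) (metis (mono_tags, lifting) mem_Collect_eq option.sel option.distinct(1))+
    then show ?thesis unfolding im[symmetric] by (simp add: image_image)
  qed
  have K: "ideal_of S ?K"
    unfolding ideal_of_def
  proof (intro conjI ballI)
    show "?K \<noteq> {}" using im ideal_ofD(1)[OF IJ] by blast
    show "?K \<subseteq> carrier S" using Q(1) ideal_ofD(2) by blast
    fix x a assume x: "x \<in> carrier S" and a: "a \<in> ?K"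
    then have ac: "a \<in> carrier S" "a \<in> I'" "the (\<chi> a) \<in> I" "\<epsilon> a \<in> I'"
      using Q(1) ideal_ofD(2) eps_mem[OF Q(1)] by auto
    have xe: "x \<cdot> \<epsilon> a \<in> I'" "\<epsilon> a \<cdot> x \<in> I'" using ideal_ofD(3,4)[OF Q(1) x ac(4)] by auto
    have "x \<cdot> a = (x \<cdot> \<epsilon> a) \<cdot> a" "a \<cdot> x = a \<cdot> (\<epsilon> a \<cdot> x)"
      using x ac eps_mult_left[OF ac(1)] eps_mult_right[OF ac(1)] assoc[of x "\<epsilon> a" a] assoc[of a "\<epsilon> a" x]
      by simp_all
    then have "the (\<chi> (x \<cdot> a)) = the (\<chi> (x \<cdot> \<epsilon> a)) \<cdot> the (\<chi> a)"
      "the (\<chi> (a \<cdot> x)) = the (\<chi> a) \<cdot> the (\<chi> (\<epsilon> a \<cdot> x))"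
      using Q(7)[OF xe(1) ac(2)] Q(7)[OF ac(2) xe(2)] by simp_all
    then show "x \<cdot> a \<in> ?K" "a \<cdot> x \<in> ?K"
      using ideal_ofD(3,4)[OF P(1) _ ac(3)] ideal_ofD(3,4)[OF Q(1) x ac(2)]
        ideal_iso_val(2)[OF \<chi> xe(1)] ideal_iso_val(2)[OF \<chi> xe(2)] by auto
  qed
  have ran_ideal: "ideal_of S ((\<lambda>a. the (\<phi> a)) ` (I \<inter> J'))"
    using ideal_iso_appl(2)[OF ideal_iso_restrict[OF \<phi> IJ]] by blast
  have "inj_on (\<phi> \<circ>\<^sub>m \<chi>) ?K"
    by (rule inj_onI) (use val P(8) Q(8) in \<open>auto\<close>)
  moreover have "the ((\<phi> \<circ>\<^sub>m \<chi>) (a \<cdot> b)) = the ((\<phi> \<circ>\<^sub>m \<chi>) a) \<cdot> the ((\<phi> \<circ>\<^sub>m \<chi>) b)"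
    if a: "a \<in> ?K" and b: "b \<in> ?K" for a b
  proof -
    have "a \<cdot> b \<in> ?K" using ideal_ofD(2,3)[OF K] a b by blast
    then show ?thesis using val(1) a b Q(7)[of a b] P(7)[of "the (\<chi> a)" "the (\<chi> b)"] by simp
  qed
  ultimately show ?thesis
    using K ran_ideal dom ran by (simp add: ideal_iso_def)
qed

lemma map_comp_the:
  assumes "ideal_iso S I J \<phi>" "ideal_iso S I' J' \<chi>" "a \<in> I'" "the (\<chi> a) \<in> I"
  shows "the ((\<phi> \<circ>\<^sub>m \<chi>) a) = the (\<phi> (the (\<chi> a)))"
  using ideal_iso_appl(5)[OF assms(2,3)] by (cases "\<chi> a") (auto simp: map_comp_def)

text \<open>An isomorphism between ideals sends central elements to central elements, so restriction
  to the center is compatible with composition of partial maps.\<close>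

lemma restrict_center_comp:
  assumes \<chi>: "ideal_iso S I J \<chi>"
  shows "(\<phi> \<circ>\<^sub>m \<chi>) |` center S = (\<phi> |` center S) \<circ>\<^sub>m (\<chi> |` center S)"
proof
  fix a
  show "((\<phi> \<circ>\<^sub>m \<chi>) |` center S) a = ((\<phi> |` center S) \<circ>\<^sub>m (\<chi> |` center S)) a"
    using ideal_iso_val(6)[OF \<chi>, of a] ideal_iso_appl(3)[OF \<chi>]
    by (cases "\<chi> a") (auto simp: restrict_map_def map_comp_def)
qed

section \<open>Equivalence up to conjugation by invertible multipliers\<close>

lemma simD:
  assumes "(\<psi>, \<phi>) \<in> sim S"
  obtains I J u where "ideal_iso S I J \<psi>" "ideal_iso S I J \<phi>" "sect J u"
    "\<And>s. s \<in> I \<Longrightarrow> the (\<psi> s) = u (\<epsilon> (the (\<phi> s))) \<cdot> the (\<phi> s) \<cdot> (u (\<epsilon> (the (\<phi> s))))\<^sup>\<dagger>"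
proof -
  from assms obtain I J I' J' m where i: "ideal_iso S I J \<psi>" "ideal_iso S I' J' \<phi>" "dom \<psi> = dom \<phi>" "ran \<psi> = ran \<phi>"
    and m: "m \<in> Units (MM (ran \<phi>))" "\<And>s. s \<in> dom \<phi> \<Longrightarrow> the (\<psi> s) = mconj (S\<lparr>carrier := ran \<phi>\<rparr>) m (the (\<phi> s))"
    by (auto simp: sim_def Sigma_monoid_def)
  have eq: "I' = I" "J' = J" "dom \<phi> = I" "ran \<phi> = J"
    using i ideal_iso_appl(3,4) by metis+
  note sJ = ideal_subsemigrp[OF ideal_iso_appl(2)[OF i(1)]]
  show thesis
  proof (rule that[OF i(1) i(2)[unfolded eq] Units_MM(1)[OF sJ m(1)[unfolded eq]]])
    fix s assume s: "s \<in> I"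
    then have "the (\<phi> s) \<in> J" using ideal_iso_appl(6)[OF i(2)] eq by auto
    then show "the (\<psi> s) = fst m (\<epsilon> (the (\<phi> s))) \<cdot> the (\<phi> s) \<cdot> (fst m (\<epsilon> (the (\<phi> s))))\<^sup>\<dagger>"
      using m(2)[unfolded eq, OF s] MM_action(4)[OF sJ m(1)[unfolded eq]] by simp
  qed
qed

lemma simI:
  assumes i: "ideal_iso S I J \<psi>" "ideal_iso S I J \<phi>" and u: "sect J u"
    and c: "\<And>s. s \<in> I \<Longrightarrow> the (\<psi> s) = u (\<epsilon> (the (\<phi> s))) \<cdot> the (\<phi> s) \<cdot> (u (\<epsilon> (the (\<phi> s))))\<^sup>\<dagger>"
  shows "(\<psi>, \<phi>) \<in> sim S"
proof -
  note P = ideal_iso_appl[OF i(2)]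
  note sJ = ideal_subsemigrp[OF P(2)]
  note m = mk_mult_sinv(1)[OF sJ u]
  have "the (\<psi> s) = mconj (S\<lparr>carrier := J\<rparr>) (mk_mult J u) (the (\<phi> s))" if s: "s \<in> I" for s
  proof -
    have "the (\<phi> s) \<in> J" "the (\<phi> s) \<in> carrier S" "\<epsilon> (the (\<phi> s)) \<in> J"
      using P(6)[OF s] subsemigrpD[OF sJ] by auto
    then show ?thesis using c[OF s] MM_action(4)[OF sJ m] fst_mk_mult[OF sJ u] by simp
  qed
  then show ?thesis
    unfolding sim_def Sigma_monoid_def using i m ideal_iso_appl(3,4)[OF i(1)] P(3,4) by auto
qed

lemma conj_eps:
  assumes "x \<in> carrier S" "y \<in> carrier S" "\<epsilon> x = \<epsilon> y"
  shows "x \<cdot> y \<cdot> x\<^sup>\<dagger> \<in> carrier S" "\<epsilon> (x \<cdot> y \<cdot> x\<^sup>\<dagger>) = \<epsilon> y"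
  using assms by (auto simp: closed intro!: eps_mult_same)

lemma sim_refl:
  assumes \<phi>: "ideal_iso S I J \<phi>" shows "(\<phi>, \<phi>) \<in> sim S"
proof (rule simI[OF \<phi> \<phi>, of "\<lambda>e. e"])
  note sJ = ideal_subsemigrp[OF ideal_iso_appl(2)[OF \<phi>]]
  show "sect J (\<lambda>e. e)" by (rule sect_idem[OF sJ])
  fix s assume "s \<in> I"
  then have "the (\<phi> s) \<in> carrier S" by (rule ideal_iso_val(2)[OF \<phi>])
  then show "the (\<phi> s) = \<epsilon> (the (\<phi> s)) \<cdot> the (\<phi> s) \<cdot> (\<epsilon> (the (\<phi> s)))\<^sup>\<dagger>" by simp
qed

text \<open>Conjugation preserves \<open>\<epsilon>\<close>, so all conjugating families are
  evaluated at the same idempotent; the identity family, pointwise inverses and pointwise products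
  then give the three properties.\<close>

lemma equiv_sim: "equiv (carrier (Sigma_monoid S)) (sim S)"
proof (rule equivI)
  show "sim S \<subseteq> carrier (Sigma_monoid S) \<times> carrier (Sigma_monoid S)"
    by (auto simp: sim_def)
  show "refl_on (carrier (Sigma_monoid S)) (sim S)"
    by (auto simp: refl_on_def Sigma_monoid_def intro: sim_refl)
  show "sym (sim S)"
  proof (rule symI)
    fix \<psi> \<phi> assume "(\<psi>, \<phi>) \<in> sim S"
    then obtain I J u where i: "ideal_iso S I J \<psi>" "ideal_iso S I J \<phi>" and u: "sect J u" and
      c: "\<And>s. s \<in> I \<Longrightarrow> the (\<psi> s) = u (\<epsilon> (the (\<phi> s))) \<cdot> the (\<phi> s) \<cdot> (u (\<epsilon> (the (\<phi> s))))\<^sup>\<dagger>"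
      by (rule simD) blast
    note sJ = ideal_subsemigrp[OF ideal_iso_appl(2)[OF i(1)]]
    show "(\<phi>, \<psi>) \<in> sim S"
    proof (rule simI[OF i(2,1) sect_sinv[OF sJ u]])
      fix s assume s: "s \<in> I"
      let ?y = "the (\<phi> s)" and ?u = "u (\<epsilon> (the (\<phi> s)))"
      have y: "?y \<in> J" "?y \<in> carrier S"
        using ideal_iso_appl(6)[OF i(2) s] ideal_iso_val(2)[OF i(2) s] by auto
      have w: "?u \<in> carrier S" "\<epsilon> ?u = \<epsilon> ?y" using sect_eps_val[OF sJ u y(1)] by auto
      have e: "\<epsilon> (the (\<psi> s)) = \<epsilon> ?y" using conj_eps[OF w(1) y(2) w(2)] c[OF s] by simp
      have "?u\<^sup>\<dagger> \<cdot> the (\<psi> s) \<cdot> (?u\<^sup>\<dagger>)\<^sup>\<dagger> = (?u\<^sup>\<dagger> \<cdot> ?u) \<cdot> ?y \<cdot> (?u\<^sup>\<dagger> \<cdot> ?u)"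
        unfolding c[OF s] using w y by (simp add: assoc closed del: sinv_mult_self mult_sinv_mult_sinv_left)
      then show "?y = (u (\<epsilon> (the (\<psi> s))))\<^sup>\<dagger> \<cdot> the (\<psi> s) \<cdot> ((u (\<epsilon> (the (\<psi> s))))\<^sup>\<dagger>)\<^sup>\<dagger>"
        unfolding e using w y by simp
    qed
  qed
  show "trans (sim S)"
  proof (rule transI)
    fix \<psi> \<phi> \<chi> assume "(\<psi>, \<phi>) \<in> sim S" and "(\<phi>, \<chi>) \<in> sim S"
    then obtain I J u I' J' v where i: "ideal_iso S I J \<psi>" "ideal_iso S I J \<phi>" and u: "sect J u" and
      c: "\<And>s. s \<in> I \<Longrightarrow> the (\<psi> s) = u (\<epsilon> (the (\<phi> s))) \<cdot> the (\<phi> s) \<cdot> (u (\<epsilon> (the (\<phi> s))))\<^sup>\<dagger>"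
      and i': "ideal_iso S I' J' \<phi>" "ideal_iso S I' J' \<chi>" and v': "sect J' v" and
      c': "\<And>s. s \<in> I' \<Longrightarrow> the (\<phi> s) = v (\<epsilon> (the (\<chi> s))) \<cdot> the (\<chi> s) \<cdot> (v (\<epsilon> (the (\<chi> s))))\<^sup>\<dagger>"
      by (metis simD)
    have eq: "I' = I" "J' = J" using ideal_iso_appl(3,4) i(2) i'(1) by metis+
    note v = v'[unfolded eq]
    note sJ = ideal_subsemigrp[OF ideal_iso_appl(2)[OF i(1)]]
    show "(\<psi>, \<chi>) \<in> sim S"
    proof (rule simI[OF i(1) i'(2)[unfolded eq] sect_mult[OF sJ u v]])
      fix s assume s: "s \<in> I"
      let ?y = "the (\<chi> s)"
      let ?u = "u (\<epsilon> ?y)" and ?v = "v (\<epsilon> ?y)"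
      have y: "?y \<in> J" "?y \<in> carrier S"
        using ideal_iso_appl(6)[OF i'(2)] ideal_iso_val(2)[OF i'(2)] s eq by auto
      have w: "?u \<in> carrier S" "\<epsilon> ?u = \<epsilon> ?y" "?v \<in> carrier S" "\<epsilon> ?v = \<epsilon> ?y"
        using sect_eps_val[OF sJ u y(1)] sect_eps_val[OF sJ v y(1)] by auto
      note p = c'[unfolded eq, OF s]
      have e: "\<epsilon> (the (\<phi> s)) = \<epsilon> ?y" using conj_eps[OF w(3) y(2) w(4)] p by simp
      show "the (\<psi> s) = ?u \<cdot> ?v \<cdot> ?y \<cdot> (?u \<cdot> ?v)\<^sup>\<dagger>"
        unfolding c[OF s] e unfolding p using w y by (simp add: assoc closed sinv_mult)
    qed
  qed
qed

lemma sim_restrict_center: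
  assumes "(\<psi>, \<phi>) \<in> sim S"
  shows "\<psi> |` center S = \<phi> |` center S"
proof -
  from assms obtain I J u where i: "ideal_iso S I J \<psi>" "ideal_iso S I J \<phi>" and u: "sect J u" and
    c: "\<And>s. s \<in> I \<Longrightarrow> the (\<psi> s) = u (\<epsilon> (the (\<phi> s))) \<cdot> the (\<phi> s) \<cdot> (u (\<epsilon> (the (\<phi> s))))\<^sup>\<dagger>"
    by (rule simD) blast
  note sJ = ideal_subsemigrp[OF ideal_iso_appl(2)[OF i(1)]]
  have "\<psi> s = \<phi> s" if s: "s \<in> center S" for s
  proof (cases "s \<in> I")
    case True
    let ?y = "the (\<phi> s)" and ?u = "u (\<epsilon> (the (\<phi> s)))"
    have y: "?y \<in> J" "?y \<in> carrier S" "?y \<in> center S"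
      using ideal_iso_appl(6)[OF i(2) True] ideal_iso_val(2,6)[OF i(2) True] s by auto
    have w: "?u \<in> carrier S" "\<epsilon> ?u = \<epsilon> ?y" using sect_eps_val[OF sJ u y(1)] by auto
    have "?u \<cdot> ?y \<cdot> ?u\<^sup>\<dagger> = ?y \<cdot> (?u \<cdot> ?u\<^sup>\<dagger>)"
      using center_commute[OF y(3) w(1)] w y(2) assoc[of ?y ?u "?u\<^sup>\<dagger>"] by simp
    then have "the (\<psi> s) = the (\<phi> s)" using c[OF True] w y by simp
    then show ?thesis using ideal_iso_appl(5)[OF i(1) True] ideal_iso_appl(5)[OF i(2) True] by simp
  next
    case False
    then have "s \<notin> dom \<psi>" "s \<notin> dom \<phi>" using ideal_iso_appl(3)[OF i(1)] ideal_iso_appl(3)[OF i(2)] by auto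
    then show ?thesis by (simp add: domIff)
  qed
  then show ?thesis by (auto simp: restrict_map_def)
qed

text \<open>If \<open>u\<close> conjugates \<phi> to \<phi>' and \<open>v\<close> conjugates \<chi>
  to \<chi>', the composites are conjugated by \<open>u\<close> times the transport of
  \<open>v\<close> along \<phi>, where \<phi> is cut down to the part of its domain that \<chi>
  reaches.\<close>

lemma sim_comp:
  assumes 1: "(\<phi>', \<phi>) \<in> sim S" and 2: "(\<chi>', \<chi>) \<in> sim S"
  shows "(\<phi>' \<circ>\<^sub>m \<chi>', \<phi> \<circ>\<^sub>m \<chi>) \<in> sim S"
proof -
  from 1 2 obtain I J u I' J' v where i: "ideal_iso S I J \<phi>'" "ideal_iso S I J \<phi>" and u: "sect J u" and
    c: "\<And>s. s \<in> I \<Longrightarrow> the (\<phi>' s) = u (\<epsilon> (the (\<phi> s))) \<cdot> the (\<phi> s) \<cdot> (u (\<epsilon> (the (\<phi> s))))\<^sup>\<dagger>"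
    and i': "ideal_iso S I' J' \<chi>'" "ideal_iso S I' J' \<chi>" and v: "sect J' v" and
    c': "\<And>s. s \<in> I' \<Longrightarrow> the (\<chi>' s) = v (\<epsilon> (the (\<chi> s))) \<cdot> the (\<chi> s) \<cdot> (v (\<epsilon> (the (\<chi> s))))\<^sup>\<dagger>"
    by (metis simD)
  note P = ideal_iso_appl[OF i(2)] and Q = ideal_iso_appl[OF i'(2)]
  note sJ = ideal_subsemigrp[OF P(2)] and sJ' = ideal_subsemigrp[OF Q(2)]
  have e: "\<epsilon> (the (\<chi>' s)) = \<epsilon> (the (\<chi> s))" "the (\<chi>' s) \<in> I \<longleftrightarrow> the (\<chi> s) \<in> I" if s: "s \<in> I'" for s
  proof -
    let ?y = "the (\<chi> s)" and ?u = "v (\<epsilon> (the (\<chi> s)))"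
    have y: "?y \<in> J'" "?y \<in> carrier S"
      using Q(6)[OF s] ideal_iso_val(2)[OF i'(2) s] by auto
    have w: "?u \<in> carrier S" "\<epsilon> ?u = \<epsilon> ?y" using sect_eps_val[OF sJ' v y(1)] by auto
    show 1: "\<epsilon> (the (\<chi>' s)) = \<epsilon> (the (\<chi> s))" using conj_eps[OF w(1) y(2) w(2)] c'[OF s] by simp
    show "the (\<chi>' s) \<in> I \<longleftrightarrow> the (\<chi> s) \<in> I"
      using 1 eps_mem[OF P(1)] y ideal_iso_val(2)[OF i'(1) s] by metis
  qed
  let ?K = "{a \<in> I'. the (\<chi> a) \<in> I}" and ?L = "(\<lambda>a. the (\<phi> a)) ` (I \<inter> J')"
  have K: "{a \<in> I'. the (\<chi>' a) \<in> I} = ?K" using e by blast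
  note c0 = ideal_iso_comp[OF i(2) i'(2)] and c1 = ideal_iso_comp[OF i(1) i'(1), unfolded K]
  have IJ: "ideal_of S (I \<inter> J')" by (rule ideal_inter[OF P(1) Q(2)])
  \<comment> \<open>Ranges of composites are compared by their central parts: there \<phi> and
    \<phi>' are the same map, and the preimage of a central element is central.\<close>
  have L': "(\<lambda>a. the (\<phi>' a)) ` (I \<inter> J') = ?L"
  proof (rule ideal_eq_center)
    show "ideal_of S ((\<lambda>a. the (\<phi>' a)) ` (I \<inter> J'))" using ideal_iso_appl(2)[OF c1] .
    show "ideal_of S ?L" using ideal_iso_appl(2)[OF c0] .
    have im: "center S \<inter> (\<lambda>a. the (f a)) ` (I \<inter> J') = (\<lambda>a. the ((f |` center S) a)) ` (center S \<inter> (I \<inter> J'))"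
      if f: "ideal_iso S I J f" for f
    proof -
      have "a \<in> center S" if a: "a \<in> I" "the (f a) \<in> center S" for a
      proof -
        have "a \<cdot> b = b \<cdot> a" if "b \<in> I" for b
          using ideal_iso_appl(8)[OF f, of "a \<cdot> b" "b \<cdot> a"] ideal_iso_appl(7)[OF f] a that
            subsemigrpD(4)[OF ideal_subsemigrp[OF P(1)]] center_commute[OF a(2)] ideal_iso_val(2)[OF f]
          by auto
        then have "a \<in> center (S\<lparr>carrier := I\<rparr>)" using a by (simp add: center_def)
        then show ?thesis using center_ideal[OF P(1)] by simp
      qed
      then show ?thesis using ideal_iso_val(6)[OF f] by (auto simp: image_iff)
    qed
    show "center S \<inter> (\<lambda>a. the (\<phi>' a)) ` (I \<inter> J') = center S \<inter> ?L"
      unfolding im[OF i(1)] im[OF i(2)] sim_restrict_center[OF 1] ..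
  qed
  note r = ideal_iso_restrict[OF i(2) IJ]
  have v1: "sect (I \<inter> J') v"
    by (rule sect_ideal_restrict[OF Q(2) IJ _ v]) auto
  define \<phi>0 where "\<phi>0 = \<phi> |` (I \<inter> J')"
  have i0: "ideal_iso S (I \<inter> J') ?L \<phi>0" using r by (simp add: \<phi>0_def)
  note R = ideal_iso_appl[OF i0]
  have L: "ideal_of S ?L" "?L \<subseteq> J" using R(2) P(6) by auto
  note v2 = mtransport_mk_mult(1)[OF i0 v1]
  have u2: "sect ?L u" by (rule sect_ideal_restrict[OF P(2) L u])
  have sL: "inverse_subsemigrp S ?L" by (rule ideal_subsemigrp[OF L(1)])
  show ?thesis
  proof (rule simI[OF c1[unfolded L'] c0 sect_mult[OF sL u2 v2]])
    fix s assume s: "s \<in> ?K"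
    then have sI: "s \<in> I'" "the (\<chi> s) \<in> I" "the (\<chi>' s) \<in> I" using e by auto
    let ?x = "the (\<chi> s)"
    have x: "?x \<in> J'" "?x \<in> carrier S" "?x \<in> I \<inter> J'" "\<epsilon> ?x \<in> I \<inter> J'" "\<epsilon> ?x \<in> I"
      using Q(6)[OF sI(1)] ideal_iso_val(2)[OF i'(2) sI(1)] sI eps_mem[OF IJ] by auto
    let ?y = "the (\<phi> ?x)"
    have y: "?y \<in> J" "?y \<in> carrier S" using P(6)[OF sI(2)] ideal_iso_val(2)[OF i(2) sI(2)] by auto
    have f0: "the (\<phi>0 a) = the (\<phi> a)" if "a \<in> I \<inter> J'" for a using that by (simp add: \<phi>0_def)
    let ?v = "v (\<epsilon> ?x)" and ?u = "u (\<epsilon> ?y)"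
    have w: "?v \<in> carrier S" "\<epsilon> ?v = \<epsilon> ?x" "?u \<in> carrier S" "\<epsilon> ?u = \<epsilon> ?y" "?v \<in> I \<inter> J'" "?v \<in> I"
      using sect_eps_val[OF sJ' v x(1)] sect_eps_val[OF sJ u y(1)] sectD(1)[OF v1 x(4)] x by auto
    have p: "pinv \<phi>0 (\<epsilon> ?y) = \<epsilon> ?x"
      using R(12)[OF x(4)] f0[OF x(4)] ideal_iso_val(4)[OF i(2) sI(2)] by simp
    have v': "the (\<phi>0 (v (pinv \<phi>0 (\<epsilon> ?y)))) = the (\<phi> ?v)" unfolding p using f0 w by simp
    have pv: "the (\<phi> ?v) \<in> carrier S" "\<epsilon> (the (\<phi> ?v)) = \<epsilon> ?y"
      using ideal_iso_val(2,4)[OF i(2) w(6)] ideal_iso_val(4)[OF i(2) sI(2)] w by auto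
    have ph: "the (\<phi> (the (\<chi>' s))) = the (\<phi> ?v) \<cdot> ?y \<cdot> (the (\<phi> ?v))\<^sup>\<dagger>"
      using c'[OF sI(1)] P(7) w(6) sI(2) subsemigrpD(4,5)[OF ideal_subsemigrp[OF P(1)]]
        ideal_iso_val(3)[OF i(2) w(6)] by simp
    have eq: "\<epsilon> (the (\<phi> (the (\<chi>' s)))) = \<epsilon> ?y"
      using conj_eps[OF pv(1) y(2) pv(2)] ph by simp
    have "the ((\<phi>' \<circ>\<^sub>m \<chi>') s) = ?u \<cdot> (the (\<phi> ?v) \<cdot> ?y \<cdot> (the (\<phi> ?v))\<^sup>\<dagger>) \<cdot> ?u\<^sup>\<dagger>"
      unfolding map_comp_the[OF i(1) i'(1) sI(1) sI(3)] c[OF sI(3)] eq by (simp only: ph)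
    also have "\<dots> = (?u \<cdot> the (\<phi> ?v)) \<cdot> ?y \<cdot> (?u \<cdot> the (\<phi> ?v))\<^sup>\<dagger>"
      using w pv y by (simp add: assoc closed sinv_mult)
    finally show "the ((\<phi>' \<circ>\<^sub>m \<chi>') s) = (u (\<epsilon> (the ((\<phi> \<circ>\<^sub>m \<chi>) s))) \<cdot>
        the (\<phi>0 (v (pinv \<phi>0 (\<epsilon> (the ((\<phi> \<circ>\<^sub>m \<chi>) s))))))) \<cdot> the ((\<phi> \<circ>\<^sub>m \<chi>) s) \<cdot>
        (u (\<epsilon> (the ((\<phi> \<circ>\<^sub>m \<chi>) s))) \<cdot> the (\<phi>0 (v (pinv \<phi>0 (\<epsilon> (the ((\<phi> \<circ>\<^sub>m \<chi>) s)))))))\<^sup>\<dagger>"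
      unfolding map_comp_the[OF i(2) i'(2) sI(1,2)] v' .
  qed
qed

lemma varsigma_mult:
  assumes "(\<phi>, \<phi>) \<in> sim S" "(\<chi>, \<chi>) \<in> sim S"
  shows "sim S `` {\<phi>} \<otimes>\<^bsub>varsigma S\<^esub> sim S `` {\<chi>} = sim S `` {\<phi> \<circ>\<^sub>m \<chi>}"
proof -
  have "sim S `` {\<phi>' \<circ>\<^sub>m \<chi>'} = sim S `` {\<phi> \<circ>\<^sub>m \<chi>}"
    if "\<phi>' \<in> sim S `` {\<phi>}" "\<chi>' \<in> sim S `` {\<chi>}" for \<phi>' \<chi>'
    using that sim_comp[of \<phi> \<phi>' \<chi> \<chi>'] equiv_class_eq[OF equiv_sim] by blast
  then have "(\<Union>\<phi>'\<in>sim S `` {\<phi>}. \<Union>\<chi>'\<in>sim S `` {\<chi>}. sim S `` {\<phi>' \<circ>\<^sub>m \<chi>'}) = sim S `` {\<phi> \<circ>\<^sub>m \<chi>}"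
    using assms by blast
  then show ?thesis by (simp add: varsigma_def Sigma_monoid_def)
qed

end

section \<open>Abstract kernels\<close>

text \<open>
  A unital partial homomorphism into partial injections is a partial action. It is applied to the
  restrictions of the isomorphisms to the center, on which inner automorphisms act trivially.
\<close>

locale partial_hom_maps = group G for G :: "('g, 'm) monoid_scheme" (structure) +
  fixes \<Gamma> :: "'g \<Rightarrow> 'a \<rightharpoonup> 'a"
  assumes inj: "\<lbrakk>g \<in> carrier G; \<Gamma> g x = Some z; \<Gamma> g y = Some z\<rbrakk> \<Longrightarrow> x = y"
    and comp_left: "\<lbrakk>g \<in> carrier G; h \<in> carrier G\<rbrakk> \<Longrightarrow>
      \<Gamma> (inv g) \<circ>\<^sub>m \<Gamma> g \<circ>\<^sub>m \<Gamma> h = \<Gamma> (inv g) \<circ>\<^sub>m \<Gamma> (g \<otimes> h)"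
    and comp_right: "\<lbrakk>g \<in> carrier G; h \<in> carrier G\<rbrakk> \<Longrightarrow>
      \<Gamma> g \<circ>\<^sub>m \<Gamma> h \<circ>\<^sub>m \<Gamma> (inv h) = \<Gamma> (g \<otimes> h) \<circ>\<^sub>m \<Gamma> (inv h)"
    and one_dom: "\<Gamma> \<one> x = Some y \<Longrightarrow> x = y" "\<Gamma> g x = Some y \<Longrightarrow> \<Gamma> \<one> x = Some x"
begin

text \<open>The left law for the pair g^-1, g shows that applying \<open>\<Gamma>\<close> at g,
  g^-1, g in turn agrees with \<open>\<Gamma> g\<close>. So \<open>y\<close> lies in the domain of
  \<open>\<Gamma> (inv g)\<close>, its image there has the same value under
  \<open>\<Gamma> g\<close> as \<open>x\<close>, and injectivity applies.\<close>

lemma inverse_map: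
  assumes g: "g \<in> carrier G" and x: "\<Gamma> g x = Some y"
  shows "\<Gamma> (inv g) y = Some x"
proof -
  have "(\<Gamma> g \<circ>\<^sub>m \<Gamma> (inv g) \<circ>\<^sub>m \<Gamma> g) x = (\<Gamma> g \<circ>\<^sub>m \<Gamma> (inv g \<otimes> g)) x"
    using comp_left[of "inv g" g] g by simp
  also have "\<dots> = Some y" using g x one_dom(2)[OF x] by (simp add: map_comp_def)
  finally obtain z where z: "\<Gamma> (inv g) y = Some z" "\<Gamma> g z = Some y"
    using x by (auto simp: map_comp_def split: option.splits)
  then show ?thesis using inj[OF g x z(2)] by simp
qed

lemma inverse_map_iff: "g \<in> carrier G \<Longrightarrow> \<Gamma> (inv g) y = Some x \<longleftrightarrow> \<Gamma> g x = Some y"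
  using inverse_map[of g x y] inverse_map[of "inv g" y x] by auto

lemma dom_map: "g \<in> carrier G \<Longrightarrow> dom (\<Gamma> g) = ran (\<Gamma> (inv g))"
  using inverse_map_iff by (auto simp: dom_def ran_def)

text \<open>The right law speaks about \<open>\<Gamma> g\<close> after \<open>\<Gamma> h\<close>
  only behind the factor \<open>\<Gamma> (inv h)\<close>. Writing \<open>x\<close> as the value of
  that factor at some \<open>y\<close> makes the law apply to \<open>x\<close>.\<close>

lemma comp_map:
  assumes g: "g \<in> carrier G" and h: "h \<in> carrier G"
    and x: "x \<in> ran (\<Gamma> (inv h))" "x \<in> ran (\<Gamma> (inv h \<otimes> inv g))"
  obtains y z where "\<Gamma> h x = Some y" "\<Gamma> g y = Some z" "\<Gamma> (g \<otimes> h) x = Some z"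
proof -
  have "x \<in> dom (\<Gamma> (g \<otimes> h))" using x(2) dom_map[of "g \<otimes> h"] g h by (simp add: inv_mult_group)
  then obtain z where z: "\<Gamma> (g \<otimes> h) x = Some z" by blast
  obtain y where y: "\<Gamma> (inv h) y = Some x" using x(1) by (auto simp: ran_def)
  have hy: "\<Gamma> h x = Some y" using inverse_map_iff[OF h] y by simp
  have "(\<Gamma> g \<circ>\<^sub>m \<Gamma> h \<circ>\<^sub>m \<Gamma> (inv h)) y = Some z"
    unfolding comp_right[OF g h] using y z by (simp add: map_comp_def)
  then have "\<Gamma> g y = Some z" using y hy by (simp add: map_comp_def)
  then show thesis using that hy z by blast
qed

lemma map_ran:
  assumes g: "g \<in> carrier G" and h: "h \<in> carrier G" and x: "\<Gamma> g x = Some y" "x \<in> ran (\<Gamma> h)"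
  shows "y \<in> ran (\<Gamma> (g \<otimes> h))"
proof -
  obtain z where z: "\<Gamma> h z = Some x" using x by (auto simp: ran_def)
  then have "\<Gamma> (inv h) x = Some z" using inverse_map[OF h] by simp
  moreover have "(\<Gamma> g \<circ>\<^sub>m \<Gamma> h \<circ>\<^sub>m \<Gamma> (inv h)) x = Some y"
    using calculation z x by (simp add: map_comp_def)
  ultimately have "\<Gamma> (g \<otimes> h) z = Some y"
    unfolding comp_right[OF g h] by (simp add: map_comp_def)
  then show ?thesis by (auto simp: ran_def)
qed

lemma image_map:
  assumes g: "g \<in> carrier G" and h: "h \<in> carrier G"
  shows "(\<lambda>x. the (\<Gamma> g x)) ` (ran (\<Gamma> (inv g)) \<inter> ran (\<Gamma> h)) = ran (\<Gamma> g) \<inter> ran (\<Gamma> (g \<otimes> h))"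
proof
  show "(\<lambda>x. the (\<Gamma> g x)) ` (ran (\<Gamma> (inv g)) \<inter> ran (\<Gamma> h)) \<subseteq> ran (\<Gamma> g) \<inter> ran (\<Gamma> (g \<otimes> h))"
  proof
    fix y assume "y \<in> (\<lambda>x. the (\<Gamma> g x)) ` (ran (\<Gamma> (inv g)) \<inter> ran (\<Gamma> h))"
    then obtain x where x: "x \<in> dom (\<Gamma> g)" "x \<in> ran (\<Gamma> h)" "y = the (\<Gamma> g x)"
      unfolding dom_map[OF g, symmetric] by blast
    then have "\<Gamma> g x = Some y" by auto
    then show "y \<in> ran (\<Gamma> g) \<inter> ran (\<Gamma> (g \<otimes> h))" using map_ran[OF g h] x(2) by (auto intro: ranI)
  qed
  show "ran (\<Gamma> g) \<inter> ran (\<Gamma> (g \<otimes> h)) \<subseteq> (\<lambda>x. the (\<Gamma> g x)) ` (ran (\<Gamma> (inv g)) \<inter> ran (\<Gamma> h))"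
  proof
    fix y assume y: "y \<in> ran (\<Gamma> g) \<inter> ran (\<Gamma> (g \<otimes> h))"
    then obtain x where x: "\<Gamma> g x = Some y" by (auto simp: ran_def)
    then have x': "\<Gamma> (inv g) y = Some x" by (rule inverse_map[OF g])
    have "x \<in> ran (\<Gamma> (inv g \<otimes> (g \<otimes> h)))"
      by (rule map_ran[OF _ _ x']) (use g h y in auto)
    then have "x \<in> ran (\<Gamma> h)" using g h by (simp flip: m_assoc)
    moreover have "x \<in> ran (\<Gamma> (inv g))" using x' by (auto simp: ran_def)
    ultimately show "y \<in> (\<lambda>x. the (\<Gamma> g x)) ` (ran (\<Gamma> (inv g)) \<inter> ran (\<Gamma> h))"
      using x by (force simp: image_iff)
  qed
qed

end

section \<open>The partial action on the center induced by an abstract kernel\<close>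

locale abs_kernel = semilattice_of_groups A + G: group G
  for A :: "'a semigrp" (structure) and G :: "('g, 'm) monoid_scheme" +
  fixes \<psi> :: "'g \<Rightarrow> ('a \<rightharpoonup> 'a) set"
  assumes partial_hom: "unital_partial_hom G (varsigma A) \<psi>"
begin

notation eps ("\<epsilon>") and sv ("_\<^sup>\<dagger>" [1000] 999)

abbreviation gmult (infixl "\<odot>" 70) where "g \<odot> h \<equiv> g \<otimes>\<^bsub>G\<^esub> h"
abbreviation ginv ("\<iota>") where "\<iota> g \<equiv> inv\<^bsub>G\<^esub> g"
abbreviation D :: "'g \<Rightarrow> 'a set" where "D \<equiv> kdom \<psi>"
abbreviation C :: "'g \<Rightarrow> 'a set" where "C \<equiv> center_dom A \<psi>"

lemma psi_class:
  assumes g: "g \<in> carrier G" and \<theta>: "\<theta> \<in> \<psi> g"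
  shows "\<psi> g = sim A `` {\<theta>}" "(\<theta>, \<theta>) \<in> sim A" "\<exists>I J. ideal_iso A I J \<theta>"
proof -
  have "\<psi> g \<in> carrier (Sigma_monoid A) // sim A"
    using partial_hom g by (auto simp: unital_partial_hom_def varsigma_def)
  then obtain \<phi> where \<phi>: "\<phi> \<in> carrier (Sigma_monoid A)" "\<psi> g = sim A `` {\<phi>}"
    by (rule quotientE)
  then have s: "(\<phi>, \<theta>) \<in> sim A" using \<theta> by auto
  then show 1: "\<psi> g = sim A `` {\<theta>}" using equiv_class_eq[OF equiv_sim] \<phi> by blast
  then show "(\<theta>, \<theta>) \<in> sim A" using \<theta> by auto
  then show "\<exists>I J. ideal_iso A I J \<theta>" by (auto simp: sim_def Sigma_monoid_def)
qed

lemma psi_nonempty: "g \<in> carrier G \<Longrightarrow> \<psi> g \<noteq> {}"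
proof -
  assume g: "g \<in> carrier G"
  have "\<psi> g \<in> carrier (Sigma_monoid A) // sim A"
    using partial_hom g by (auto simp: unital_partial_hom_def varsigma_def)
  then show ?thesis using in_quotient_imp_non_empty[OF equiv_sim] by auto
qed

definition rep :: "'g \<Rightarrow> 'a \<rightharpoonup> 'a" where "rep g = (SOME \<theta>. \<theta> \<in> \<psi> g)"

lemma rep: "g \<in> carrier G \<Longrightarrow> rep g \<in> \<psi> g"
  unfolding rep_def using psi_nonempty by (simp add: some_in_eq)

lemma psi_sim: "\<lbrakk>g \<in> carrier G; \<theta> \<in> \<psi> g; \<theta>' \<in> \<psi> g\<rbrakk> \<Longrightarrow> (\<theta>, \<theta>') \<in> sim A"
  using psi_class(1)[of g \<theta>] by blast

lemma kdom_ran: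
  assumes g: "g \<in> carrier G" and \<theta>: "\<theta> \<in> \<psi> g"
  shows "ran \<theta> = D g"
proof -
  have "ran \<theta>' = ran \<theta>" if "\<theta>' \<in> \<psi> g" for \<theta>'
    using psi_sim[OF g that \<theta>] by (simp add: sim_def)
  then have "ran ` \<psi> g = {ran \<theta>}" using \<theta> by blast
  then show ?thesis by (simp add: kdom_def)
qed

lemma psi_mult_left:
  assumes "g \<in> carrier G" "h \<in> carrier G" "\<theta> \<in> \<psi> (\<iota> g)" "\<theta>' \<in> \<psi> g" "\<chi> \<in> \<psi> h" "\<omega> \<in> \<psi> (g \<odot> h)"
  shows "(\<theta> \<circ>\<^sub>m \<theta>' \<circ>\<^sub>m \<chi>, \<theta> \<circ>\<^sub>m \<omega>) \<in> sim A"
proof -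
  have c: "\<psi> (\<iota> g) = sim A `` {\<theta>}" "\<psi> g = sim A `` {\<theta>'}" "\<psi> h = sim A `` {\<chi>}" "\<psi> (g \<odot> h) = sim A `` {\<omega>}"
    and r: "(\<theta>, \<theta>) \<in> sim A" "(\<theta>', \<theta>') \<in> sim A" "(\<chi>, \<chi>) \<in> sim A" "(\<omega>, \<omega>) \<in> sim A"
    using psi_class assms by blast+
  have "\<psi> (\<iota> g) \<otimes>\<^bsub>varsigma A\<^esub> \<psi> g \<otimes>\<^bsub>varsigma A\<^esub> \<psi> h = \<psi> (\<iota> g) \<otimes>\<^bsub>varsigma A\<^esub> \<psi> (g \<odot> h)"
    using partial_hom assms by (auto simp: unital_partial_hom_def)
  then have "sim A `` {\<theta> \<circ>\<^sub>m \<theta>' \<circ>\<^sub>m \<chi>} = sim A `` {\<theta> \<circ>\<^sub>m \<omega>}"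
    unfolding c using r by (simp add: varsigma_mult sim_comp)
  then show ?thesis using sim_comp[OF r(1) r(4)] by blast
qed

lemma psi_mult_right:
  assumes "g \<in> carrier G" "h \<in> carrier G" "\<theta> \<in> \<psi> g" "\<chi> \<in> \<psi> h" "\<chi>' \<in> \<psi> (\<iota> h)" "\<omega> \<in> \<psi> (g \<odot> h)"
  shows "(\<theta> \<circ>\<^sub>m \<chi> \<circ>\<^sub>m \<chi>', \<omega> \<circ>\<^sub>m \<chi>') \<in> sim A"
proof -
  have c: "\<psi> g = sim A `` {\<theta>}" "\<psi> h = sim A `` {\<chi>}" "\<psi> (\<iota> h) = sim A `` {\<chi>'}" "\<psi> (g \<odot> h) = sim A `` {\<omega>}"
    and r: "(\<theta>, \<theta>) \<in> sim A" "(\<chi>', \<chi>') \<in> sim A" "(\<chi>, \<chi>) \<in> sim A" "(\<omega>, \<omega>) \<in> sim A"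
    using psi_class assms by blast+
  have "\<psi> g \<otimes>\<^bsub>varsigma A\<^esub> \<psi> h \<otimes>\<^bsub>varsigma A\<^esub> \<psi> (\<iota> h) = \<psi> (g \<odot> h) \<otimes>\<^bsub>varsigma A\<^esub> \<psi> (\<iota> h)"
    using partial_hom assms by (auto simp: unital_partial_hom_def)
  then have "sim A `` {\<theta> \<circ>\<^sub>m \<chi> \<circ>\<^sub>m \<chi>'} = sim A `` {\<omega> \<circ>\<^sub>m \<chi>'}"
    unfolding c using r by (simp add: varsigma_mult sim_comp)
  then show ?thesis using sim_comp[OF r(4) r(2)] by blast
qed

text \<open>The choice made in \<open>rep\<close> disappears here, because equivalent isomorphisms
  have the same restriction to the center.\<close>

definition \<Gamma> :: "'g \<Rightarrow> 'a \<rightharpoonup> 'a" where "\<Gamma> g = rep g |` center A"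

lemma restrict_center: "\<lbrakk>g \<in> carrier G; \<theta> \<in> \<psi> g\<rbrakk> \<Longrightarrow> \<theta> |` center A = \<Gamma> g"
  unfolding \<Gamma>_def using psi_sim rep sim_restrict_center by blast

lemma unit_mem: "Some |` carrier A \<in> \<psi> \<one>\<^bsub>G\<^esub>" "ideal_iso A (carrier A) (carrier A) (Some |` carrier A)"
proof -
  have I: "ideal_of A (carrier A)" using nonempty by (auto simp: ideal_of_def closed)
  then show i: "ideal_iso A (carrier A) (carrier A) (Some |` carrier A)"
    by (auto simp: ideal_iso_def inj_on_def closed ran_def restrict_map_def split: if_splits)
  have "\<psi> \<one>\<^bsub>G\<^esub> = sim A `` {Some |` carrier A}"
    using partial_hom by (auto simp: unital_partial_hom_def varsigma_def Sigma_monoid_def)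
  then show "Some |` carrier A \<in> \<psi> \<one>\<^bsub>G\<^esub>" using sim_refl[OF i] by blast
qed

lemma Gamma_one: "\<Gamma> \<one>\<^bsub>G\<^esub> = Some |` center A"
  using restrict_center[OF G.one_closed unit_mem(1)]
  using center_closed by (simp add: Int_absorb1 subset_iff)

sublocale \<Gamma>: partial_hom_maps G \<Gamma>
proof unfold_locales
  have iso: "\<exists>I J. ideal_iso A I J (rep g)" if "g \<in> carrier G" for g
    using psi_class rep that by blast
  show "x = y" if g: "g \<in> carrier G" and "\<Gamma> g x = Some z" "\<Gamma> g y = Some z" for g x y z
  proof -
    have "rep g x = Some z" "rep g y = Some z"
      using that by (auto simp: \<Gamma>_def restrict_map_def split: if_splits)
    moreover have "inj_on (rep g) (dom (rep g))" using iso[OF g] by (auto simp: ideal_iso_def)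
    ultimately show ?thesis by (metis domI inj_onD)
  qed
  show "\<Gamma> \<one>\<^bsub>G\<^esub> x = Some x" if "\<Gamma> g x = Some y" for g x y
    using that unfolding Gamma_one by (simp add: \<Gamma>_def restrict_map_def split: if_splits)
  show "x = y" if "\<Gamma> \<one>\<^bsub>G\<^esub> x = Some y" for x y
    using that by (auto simp: Gamma_one restrict_map_def split: if_splits)
  fix g h assume g: "g \<in> carrier G" and h: "h \<in> carrier G"
  have r: "rep g \<in> \<psi> g" "rep h \<in> \<psi> h" "rep (\<iota> g) \<in> \<psi> (\<iota> g)" "rep (\<iota> h) \<in> \<psi> (\<iota> h)" "rep (g \<odot> h) \<in> \<psi> (g \<odot> h)"
    using g h rep by auto
  obtain I1 J1 I2 J2 I3 J3 I4 J4 where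
    i: "ideal_iso A I1 J1 (rep g)" "ideal_iso A I2 J2 (rep h)" "ideal_iso A I3 J3 (rep (\<iota> h))"
    "ideal_iso A I4 J4 (rep (g \<odot> h))"
    using iso g h by (metis G.inv_closed G.m_closed)
  \<comment> \<open>The laws of \<psi> hold up to equivalence; restricted to the center they become
    equations between partial maps.\<close>
  show "\<Gamma> (\<iota> g) \<circ>\<^sub>m \<Gamma> g \<circ>\<^sub>m \<Gamma> h = \<Gamma> (\<iota> g) \<circ>\<^sub>m \<Gamma> (g \<odot> h)"
    using sim_restrict_center[OF psi_mult_left[OF g h r(3,1,2,5)]]
    unfolding \<Gamma>_def restrict_center_comp[OF i(1)] restrict_center_comp[OF i(2)] restrict_center_comp[OF i(4)] .
  show "\<Gamma> g \<circ>\<^sub>m \<Gamma> h \<circ>\<^sub>m \<Gamma> (\<iota> h) = \<Gamma> (g \<odot> h) \<circ>\<^sub>m \<Gamma> (\<iota> h)"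
    using sim_restrict_center[OF psi_mult_right[OF g h r(1,2,4,5)]]
    unfolding \<Gamma>_def restrict_center_comp[OF i(2)] restrict_center_comp[OF i(3)] restrict_center_comp[OF i(4)] .
qed

text \<open>By injectivity a preimage of a central element commutes with the whole domain, and what
  is central in an ideal is central in \<open>A\<close>.\<close>

lemma ran_restrict_center:
  assumes i: "ideal_iso A I J \<theta>"
  shows "dom (\<theta> |` center A) = center A \<inter> I" "ran (\<theta> |` center A) = center A \<inter> J"
proof -
  note P = ideal_iso_appl[OF i]
  show "dom (\<theta> |` center A) = center A \<inter> I" using P(3) by auto
  show "ran (\<theta> |` center A) = center A \<inter> J"
  proof
    show "ran (\<theta> |` center A) \<subseteq> center A \<inter> J"
    proof
      fix b assume "b \<in> ran (\<theta> |` center A)"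
      then obtain a where a: "a \<in> center A" "\<theta> a = Some b"
        by (auto simp: ran_def restrict_map_def split: if_splits)
      then have "a \<in> I" using P(3) by auto
      then show "b \<in> center A \<inter> J" using a ideal_iso_val(6)[OF i, of a] P(6)[of a] by auto
    qed
    show "center A \<inter> J \<subseteq> ran (\<theta> |` center A)"
    proof
      fix b assume b: "b \<in> center A \<inter> J"
      then obtain a where a: "a \<in> I" "the (\<theta> a) = b" using P(9) by blast
      have sI: "a \<cdot> c \<in> I" "c \<cdot> a \<in> I" if "c \<in> I" for c
        using a that ideal_ofD(2,3)[OF P(1)] by auto
      have "a \<cdot> c = c \<cdot> a" if c: "c \<in> I" for c
      proof (rule P(8)[OF sI(1) sI(2)])
        show "the (\<theta> (a \<cdot> c)) = the (\<theta> (c \<cdot> a))"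
          using P(7)[OF a(1) c] P(7)[OF c a(1)] a(2) b center_commute[of b "the (\<theta> c)"] ideal_iso_val(2)[OF i c] by simp
      qed (use c in auto)
      then have "a \<in> center (A\<lparr>carrier := I\<rparr>)" using a by (simp add: center_def)
      then have "a \<in> center A" using center_ideal[OF P(1)] by simp
      then have "(\<theta> |` center A) a = Some b" using a P(5)[OF a(1)] by simp
      then show "b \<in> ran (\<theta> |` center A)" by (rule ranI)
    qed
  qed
qed

lemma D_ideal: "g \<in> carrier G \<Longrightarrow> ideal_of A (D g)"
  using psi_class(3) rep kdom_ran ideal_iso_appl(2,4) by metis

lemma C_eq: "g \<in> carrier G \<Longrightarrow> C g = center A \<inter> D g"
  unfolding center_dom_def by (rule center_ideal[OF D_ideal])

lemma ran_Gamma: "g \<in> carrier G \<Longrightarrow> ran (\<Gamma> g) = center A \<inter> D g"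
proof -
  assume g: "g \<in> carrier G"
  obtain I J where i: "ideal_iso A I J (rep g)" using psi_class(3)[OF g rep[OF g]] by blast
  then have "J = D g" using kdom_ran[OF g rep[OF g]] ideal_iso_appl(4)[OF i] by simp
  then show ?thesis using ran_restrict_center(2)[OF i] by (simp add: \<Gamma>_def)
qed

text \<open>By definition \<open>D g\<close> is a common range only. That the domain is
  \<open>D (\<iota> g)\<close> is seen on central parts, where the domain of
  \<open>\<Gamma> g\<close> is the range of \<open>\<Gamma> (\<iota> g)\<close>.\<close>

lemma psi_iso:
  assumes g: "g \<in> carrier G" and \<theta>: "\<theta> \<in> \<psi> g"
  shows "ideal_iso A (D (\<iota> g)) (D g) \<theta>"
proof -
  obtain I J where i: "ideal_iso A I J \<theta>" using psi_class(3)[OF g \<theta>] by blast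
  have J: "J = D g" using kdom_ran[OF g \<theta>] ideal_iso_appl(4)[OF i] by simp
  have "center A \<inter> I = dom (\<Gamma> g)" using ran_restrict_center(1)[OF i] restrict_center[OF g \<theta>] by simp
  also have "\<dots> = center A \<inter> D (\<iota> g)" using \<Gamma>.dom_map[OF g] ran_Gamma g by simp
  finally have "I = D (\<iota> g)"
    by (rule ideal_eq_center[OF ideal_iso_appl(1)[OF i] D_ideal[OF G.inv_closed[OF g]]])
  then show ?thesis using i J by simp
qed

lemma D_one: "D \<one>\<^bsub>G\<^esub> = carrier A"
  using kdom_ran[OF G.one_closed unit_mem(1)] ideal_iso_appl(4)[OF unit_mem(2)] by simp

lemma Gamma_dom_restrict:
  assumes g: "g \<in> carrier G" and \<theta>: "\<theta> \<in> \<psi> g"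
  shows "\<theta> |` C (\<iota> g) = \<Gamma> g"
proof -
  have "dom \<theta> = D (\<iota> g)" using ideal_iso_appl(3)[OF psi_iso[OF g \<theta>]] .
  then have "\<theta> x = None" if "x \<notin> D (\<iota> g)" for x using that by (metis domIff)
  then have "\<theta> |` C (\<iota> g) = \<theta> |` center A"
    using C_eq[of "\<iota> g"] g by (auto simp: restrict_map_def fun_eq_iff)
  then show ?thesis using restrict_center[OF g \<theta>] by simp
qed

lemma center_action_eq:
  assumes g: "g \<in> carrier G" shows "center_action A G \<psi> g = \<Gamma> g"
proof -
  have "(\<lambda>\<theta>. \<theta> |` C (\<iota> g)) ` \<psi> g = {\<Gamma> g}"
    using Gamma_dom_restrict[OF g] rep[OF g] by (auto intro: rev_image_eqI)
  then show ?thesis by (simp add: center_action_def)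
qed

lemma Gamma_val:
  assumes g: "g \<in> carrier G" and \<theta>: "\<theta> \<in> \<psi> g" and c: "c \<in> center A" "c \<in> D (\<iota> g)"
  shows "\<Gamma> g c = Some (the (\<theta> c))"
  using restrict_center[OF g \<theta>] c ideal_iso_appl(5)[OF psi_iso[OF g \<theta>] c(2)] by (metis restrict_in)

lemma ideal_C:
  assumes "g \<in> carrier G" shows "ideal_of (center_semigrp A) (C g)"
  using ideal_inter_center(1)[OF D_ideal[OF assms]] ideal_ofD[OF D_ideal[OF assms]] center_mult
  by (auto simp: ideal_of_def center_semigrp_def C_eq[OF assms] center_closed)

theorem partial_module_center:
  "partial_module G (center_semigrp A) C (center_action A G \<psi>)"
proof -
  have CR: "C g = ran (\<Gamma> g)" if "g \<in> carrier G" for g using ran_Gamma C_eq that by simp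
  have iso: "ideal_iso (center_semigrp A) (C (\<iota> g)) (C g) (\<Gamma> g)" if g: "g \<in> carrier G" for g
  proof -
    note P = ideal_iso_appl[OF psi_iso[OF g rep[OF g]]]
    have ab: "the (\<Gamma> g a) = the (rep g a)" if "a \<in> C (\<iota> g)" for a
      using Gamma_val[OF g rep[OF g], of a] that C_eq g by simp
    have 1: "the (\<Gamma> g (a \<cdot> b)) = the (\<Gamma> g a) \<cdot> the (\<Gamma> g b)" if "a \<in> C (\<iota> g)" "b \<in> C (\<iota> g)" for a b
    proof -
      have "a \<cdot> b \<in> C (\<iota> g)"
        using that C_eq g subsemigrpD(4)[OF ideal_inter_center(2)[OF D_ideal[of "\<iota> g"]]] by simp
      then show ?thesis using ab that P(7) C_eq g by simp
    qed
    have 2: "inj_on (\<Gamma> g) (C (\<iota> g))"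
    proof (rule inj_onI)
      fix x y assume "x \<in> C (\<iota> g)" "y \<in> C (\<iota> g)" and eq: "\<Gamma> g x = \<Gamma> g y"
      then obtain z where "\<Gamma> g x = Some z" using \<Gamma>.dom_map[OF g] CR g by fastforce
      then show "x = y" using \<Gamma>.inj[OF g] eq by simp
    qed
    show ?thesis
      unfolding ideal_iso_def using ideal_C g 1 2 CR \<Gamma>.dom_map[OF g]
      by (simp add: center_semigrp_def)
  qed
  show ?thesis
    unfolding partial_module_def partial_action_def
  proof (intro conjI ballI)
    show "comm_inverse_semigrp (center_semigrp A)" by (rule comm_inverse_semigrp_center)
    show "C \<one>\<^bsub>G\<^esub> = carrier (center_semigrp A)"
      using C_eq[OF G.one_closed] D_one by (auto simp: center_semigrp_def dest: center_closed)
    show "center_action A G \<psi> \<one>\<^bsub>G\<^esub> = Some |` carrier (center_semigrp A)"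
      by (simp add: center_action_eq Gamma_one center_semigrp_def)
    fix g assume g: "g \<in> carrier G"
    show "ideal_iso (center_semigrp A) (C (\<iota> g)) (C g) (center_action A G \<psi> g)"
      using iso center_action_eq g by simp
    fix h assume h: "h \<in> carrier G"
    show "(\<lambda>a. the (center_action A G \<psi> g a)) ` (C (\<iota> g) \<inter> C h) = C g \<inter> C (g \<odot> h)"
      using \<Gamma>.image_map[OF g h] g h by (simp add: CR center_action_eq)
    fix a assume a: "a \<in> C (\<iota> h) \<inter> C (\<iota> h \<odot> \<iota> g)"
    obtain y z where "\<Gamma> h a = Some y" "\<Gamma> g y = Some z" "\<Gamma> (g \<odot> h) a = Some z"
      by (rule \<Gamma>.comp_map[OF g h, of a]) (use a CR g h in auto)
    then show "the (center_action A G \<psi> g (the (center_action A G \<psi> h a))) = the (center_action A G \<psi> (g \<odot> h) a)"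
      using g h by (simp add: center_action_eq)
  qed
qed

lemma center_action_restrict:
  "\<lbrakk>g \<in> carrier G; \<theta> \<in> \<psi> g\<rbrakk> \<Longrightarrow> \<theta> |` C (\<iota> g) = center_action A G \<psi> g"
  using Gamma_dom_restrict center_action_eq by simp

end

section \<open>Twistings and associators on idempotents\<close>

context group
begin

text \<open>Both X and Y conjugate x to T, so their quotient b centralizes T. This is the source of
  centrality for associators and for the quotient of two twistings.\<close>

lemma commute_of_same_conjugation:
  assumes "T \<in> carrier G" "X \<in> carrier G" "Y \<in> carrier G" "x \<in> carrier G" "b \<in> carrier G"
    and "T \<otimes> X = X \<otimes> x" "T \<otimes> Y = Y \<otimes> x" "X = b \<otimes> Y"
  shows "b \<otimes> T = T \<otimes> b"
proof -
  have "(b \<otimes> T) \<otimes> Y = b \<otimes> (Y \<otimes> x)" using assms by (simp add: m_assoc)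
  also have "\<dots> = T \<otimes> X" using assms by (simp add: m_assoc)
  also have "\<dots> = (T \<otimes> b) \<otimes> Y" using assms by (simp add: m_assoc)
  finally show ?thesis using assms by simp
qed

text \<open>In the application p1, p2, p3 are \<theta>_g \<theta>_h w(k,l), \<theta>_g w(h,kl),
  w(g,hkl), while v, x, u are w(g,h), w(gh,k), w(ghk,l). The product p1 p2 p3 is moved to a multiple
  of v x u along two routes, which use three and two associators; comparing the central factors
  gives the cocycle identity.\<close>

lemma associator_words:
  assumes c: "p1 \<in> carrier G" "p2 \<in> carrier G" "p3 \<in> carrier G" "q \<in> carrier G" "r \<in> carrier G"
    "s \<in> carrier G" "u \<in> carrier G" "v \<in> carrier G" "x \<in> carrier G" "y \<in> carrier G" "m \<in> carrier G"
    and b: "b1 \<in> carrier G" "b2 \<in> carrier G" "b3 \<in> carrier G" "b4 \<in> carrier G" "b5 \<in> carrier G"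
    and z: "\<And>a. a \<in> carrier G \<Longrightarrow> b2 \<otimes> a = a \<otimes> b2" "\<And>a. a \<in> carrier G \<Longrightarrow> b3 \<otimes> a = a \<otimes> b3"
      "\<And>a. a \<in> carrier G \<Longrightarrow> b4 \<otimes> a = a \<otimes> b4" "\<And>a. a \<in> carrier G \<Longrightarrow> b5 \<otimes> a = a \<otimes> b5"
    and eq: "p1 \<otimes> p2 = b1 \<otimes> q \<otimes> r" "r \<otimes> p3 = b2 \<otimes> s \<otimes> u" "q \<otimes> s = b3 \<otimes> v \<otimes> x"
      "p2 \<otimes> p3 = b4 \<otimes> v \<otimes> y" "p1 \<otimes> v = v \<otimes> m" "m \<otimes> y = b5 \<otimes> x \<otimes> u"
  shows "b1 \<otimes> b2 \<otimes> b3 = b4 \<otimes> b5"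
proof -
  have "p1 \<otimes> p2 \<otimes> p3 = b1 \<otimes> q \<otimes> (r \<otimes> p3)" unfolding eq(1) using c b by (simp add: m_assoc)
  also have "\<dots> = b1 \<otimes> (q \<otimes> b2) \<otimes> s \<otimes> u" unfolding eq(2) using c b by (simp add: m_assoc)
  also have "\<dots> = b1 \<otimes> b2 \<otimes> (q \<otimes> s) \<otimes> u" unfolding z(1)[OF c(4), symmetric] using c b by (simp add: m_assoc)
  also have "\<dots> = b1 \<otimes> b2 \<otimes> b3 \<otimes> (v \<otimes> x \<otimes> u)" unfolding eq(3) using c b by (simp add: m_assoc)
  finally have 1: "p1 \<otimes> p2 \<otimes> p3 = b1 \<otimes> b2 \<otimes> b3 \<otimes> (v \<otimes> x \<otimes> u)" .
  have "p1 \<otimes> p2 \<otimes> p3 = (p1 \<otimes> b4) \<otimes> v \<otimes> y" using eq(4) c b by (simp add: m_assoc)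
  also have "\<dots> = b4 \<otimes> (p1 \<otimes> v) \<otimes> y" unfolding z(3)[OF c(1), symmetric] using c b by (simp add: m_assoc)
  also have "\<dots> = b4 \<otimes> v \<otimes> (m \<otimes> y)" unfolding eq(5) using c b by (simp add: m_assoc)
  also have "\<dots> = b4 \<otimes> (v \<otimes> b5) \<otimes> x \<otimes> u" unfolding eq(6) using c b by (simp add: m_assoc)
  also have "\<dots> = b4 \<otimes> b5 \<otimes> (v \<otimes> x \<otimes> u)" unfolding z(4)[OF c(8), symmetric] using c b by (simp add: m_assoc)
  finally show ?thesis using 1 c b by simp
qed

lemma inv_mult_cancel [simp]:
  "\<lbrakk>x \<in> carrier G; y \<in> carrier G\<rbrakk> \<Longrightarrow> inv x \<otimes> (x \<otimes> y) = y"
  "\<lbrakk>x \<in> carrier G; y \<in> carrier G\<rbrakk> \<Longrightarrow> x \<otimes> (inv x \<otimes> y) = y"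
  by (simp_all flip: m_assoc)

text \<open>Here n, f stand for the conjugators n_g and n_gh, a for \<theta>_g(n_h), and T, z for
  the values of \<theta>_g \<theta>_h and \<theta>_gh: the new twisting n a w f^-1 intertwines the
  conjugated values.\<close>

lemma twist_words_change:
  assumes "n \<in> carrier G" "a \<in> carrier G" "T \<in> carrier G" "w \<in> carrier G" "f \<in> carrier G" "z \<in> carrier G"
    and eq: "T \<otimes> w = w \<otimes> z"
  shows "(n \<otimes> (a \<otimes> T \<otimes> inv a) \<otimes> inv n) \<otimes> (n \<otimes> a \<otimes> w \<otimes> inv f) =
    (n \<otimes> a \<otimes> w \<otimes> inv f) \<otimes> (f \<otimes> z \<otimes> inv f)"
proof -
  have "(n \<otimes> (a \<otimes> T \<otimes> inv a) \<otimes> inv n) \<otimes> (n \<otimes> a \<otimes> w \<otimes> inv f) = n \<otimes> a \<otimes> (T \<otimes> w) \<otimes> inv f"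
    using assms(1-6) by (simp add: m_assoc)
  then show ?thesis unfolding eq using assms(1-6) by (simp add: m_assoc)
qed

text \<open>The conjugators cancel in pairs: n, f, i are n_g, n_gh, n_ghk, and a, k are \<theta>_g
  of n_h and n_hk. The letters c and d are \<theta>_g \<theta>_h and \<theta>_gh of n_k, exchanged
  by the twisting equation. The central factor b comes out unchanged.\<close>

lemma associator_words_change:
  assumes c: "n \<in> carrier G" "a \<in> carrier G" "c \<in> carrier G" "d \<in> carrier G" "f \<in> carrier G"
    "i \<in> carrier G" "k \<in> carrier G" "q \<in> carrier G" "s \<in> carrier G" "w \<in> carrier G" "x \<in> carrier G"
    and b: "b \<in> carrier G" "\<And>a. a \<in> carrier G \<Longrightarrow> b \<otimes> a = a \<otimes> b"
    and eq: "q \<otimes> s = b \<otimes> w \<otimes> x" "c \<otimes> w = w \<otimes> d"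
  shows "(n \<otimes> (a \<otimes> c \<otimes> q \<otimes> inv k) \<otimes> inv n) \<otimes> (n \<otimes> k \<otimes> s \<otimes> inv i) =
    b \<otimes> (n \<otimes> a \<otimes> w \<otimes> inv f) \<otimes> (f \<otimes> d \<otimes> x \<otimes> inv i)"
proof -
  have "(n \<otimes> (a \<otimes> c \<otimes> q \<otimes> inv k) \<otimes> inv n) \<otimes> (n \<otimes> k \<otimes> s \<otimes> inv i) = n \<otimes> a \<otimes> c \<otimes> (q \<otimes> s) \<otimes> inv i"
    using c by (simp add: m_assoc)
  also have "\<dots> = ((n \<otimes> a \<otimes> c) \<otimes> b) \<otimes> w \<otimes> x \<otimes> inv i" unfolding eq(1) using c b(1) by (simp add: m_assoc)
  also have "\<dots> = b \<otimes> n \<otimes> a \<otimes> (c \<otimes> w) \<otimes> x \<otimes> inv i"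
    unfolding b(2)[OF m_closed[OF m_closed[OF c(1,2)] c(3)], symmetric] using c b(1) by (simp add: m_assoc)
  also have "\<dots> = b \<otimes> (n \<otimes> a \<otimes> w \<otimes> inv f) \<otimes> (f \<otimes> d \<otimes> x \<otimes> inv i)"
    unfolding eq(2) using c b(1) by (simp add: m_assoc)
  finally show ?thesis .
qed

end

section \<open>Elements of one maximal subgroup and families of such elements\<close>

context semilattice_of_groups
begin

definition at :: "'a \<Rightarrow> 'a set" where "at e = {x \<in> carrier S. \<epsilon> x = e}"

lemma atD: "x \<in> at e \<Longrightarrow> x \<in> carrier S" "x \<in> at e \<Longrightarrow> \<epsilon> x = e"
  by (auto simp: at_def)

lemma at_mult [simp]: "\<lbrakk>x \<in> at e; y \<in> at e\<rbrakk> \<Longrightarrow> x \<cdot> y \<in> at e"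
  by (auto simp: at_def closed intro: eps_mult_same)

lemma at_sinv [simp]: "x \<in> at e \<Longrightarrow> x\<^sup>\<dagger> \<in> at e"
  by (auto simp: at_def)

lemma at_unit: "x \<in> at e \<Longrightarrow> e \<cdot> x = x" "x \<in> at e \<Longrightarrow> x \<cdot> e = x"
  by (auto simp: at_def)

lemma at_idem: "e \<in> idems S \<Longrightarrow> e \<in> at e"
  by (simp add: at_def idems_closed)

lemma at_ideal: "\<lbrakk>ideal_of S I; x \<in> at e; e \<in> I\<rbrakk> \<Longrightarrow> x \<in> I"
  using eps_mem[of I x] by (auto simp: at_def)

lemma at_restrict:
  assumes "x \<in> at e" "f \<in> idems S" shows "x \<cdot> f \<in> at (e \<cdot> f)"
  using assms eps_mult[of x f] by (auto simp: at_def closed idems_closed)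

lemma at_is_group:
  assumes "e \<in> idems S"
  shows "group (grp_at e)" "carrier (grp_at e) = at e" "\<And>x. x \<in> at e \<Longrightarrow> inv\<^bsub>grp_at e\<^esub> x = x\<^sup>\<dagger>"
  using assms by (auto simp: group_grp_at at_def inv_grp_at)

lemma at_r_cancel: "\<lbrakk>x \<in> at e; y \<in> at e; z \<in> at e; x \<cdot> z = y \<cdot> z\<rbrakk> \<Longrightarrow> x = y"
proof -
  assume a: "x \<in> at e" "y \<in> at e" "z \<in> at e" "x \<cdot> z = y \<cdot> z"
  then have "e \<in> idems S" using eps_idems[of x] by (auto simp: at_def)
  then interpret H: group "grp_at e" by (rule group_grp_at)
  show ?thesis using H.right_cancel[of z x y] a by (simp add: at_def)
qed

lemma sect_at: "\<lbrakk>inverse_subsemigrp S I; sect I u; e \<in> I; e \<in> idems S\<rbrakk> \<Longrightarrow> u e \<in> at e"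
  using sectD(1,2)[of I u e] subsemigrpD(3)[of I] by (auto simp: at_def)

lemma sectI:
  assumes I: "ideal_of S I" and "\<And>e. \<lbrakk>e \<in> I; e \<in> idems S\<rbrakk> \<Longrightarrow> u e \<in> at e"
    and "\<And>e f. \<lbrakk>e \<in> I; f \<in> I; e \<in> idems S; f \<in> idems S\<rbrakk> \<Longrightarrow> u (e \<cdot> f) = u e \<cdot> f"
  shows "sect I u"
  unfolding sect_def using assms at_ideal[OF I] atD(2) by blast

text \<open>It suffices that each value commutes with its own maximal subgroup. For arbitrary
  \<open>x\<close>, both \<open>u e \<cdot> x\<close> and \<open>x \<cdot> u e\<close> can be
  computed in the maximal subgroup at \<open>f = e \<cdot> \<epsilon> x\<close>, where
  \<open>u f\<close> and \<open>e \<cdot> x\<close> commute.\<close>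

lemma sect_central:
  assumes I: "ideal_of S I" and u: "sect I u"
    and c: "\<And>e x. \<lbrakk>e \<in> I; e \<in> idems S; x \<in> at e\<rbrakk> \<Longrightarrow> u e \<cdot> x = x \<cdot> u e"
    and e: "e \<in> I" "e \<in> idems S"
  shows "u e \<in> center S"
proof -
  note sI = ideal_subsemigrp[OF I]
  have ue: "u e \<in> at e" by (rule sect_at[OF sI u e])
  have "u e \<cdot> x = x \<cdot> u e" if x: "x \<in> carrier S" for x
  proof -
    let ?f = "e \<cdot> \<epsilon> x"
    have ec: "e \<in> carrier S" using e idems_closed by auto
    have f: "?f \<in> I" "?f \<in> idems S" using e x ideal_ofD(4)[OF I, of "\<epsilon> x" e] by auto
    have uf: "u ?f = u e \<cdot> \<epsilon> x" using sect_mult_le[OF u sI e, of "\<epsilon> x"] f x by simp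
    have xe: "e \<cdot> x \<in> at ?f" using eps_mult[of e x] e x ec by (simp add: at_def closed)
    have "u e \<cdot> x = u e \<cdot> e \<cdot> (\<epsilon> x \<cdot> x)" using at_unit(2)[OF ue] x by simp
    also have "\<dots> = u e \<cdot> (\<epsilon> x \<cdot> e) \<cdot> x"
      using idems_commute[of "\<epsilon> x" e] ec atD[OF ue] x e by (simp add: assoc closed)
    also have "\<dots> = u ?f \<cdot> (e \<cdot> x)" unfolding uf using ec atD(1)[OF ue] x by (simp add: assoc closed)
    also have "\<dots> = (e \<cdot> x) \<cdot> u ?f" by (rule c[OF f xe])
    also have "\<dots> = (x \<cdot> e) \<cdot> (u e \<cdot> \<epsilon> x)" unfolding uf using idem_comm[OF e(2) x] by simp
    also have "\<dots> = (x \<cdot> e) \<cdot> (\<epsilon> x \<cdot> u e)" using idem_comm[of "\<epsilon> x" "u e"] atD(1)[OF ue] x by simp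
    also have "\<dots> = x \<cdot> (e \<cdot> \<epsilon> x) \<cdot> u e" using ec atD(1)[OF ue] x by (simp add: assoc closed)
    also have "\<dots> = x \<cdot> (\<epsilon> x \<cdot> e) \<cdot> u e" using idems_commute[of "\<epsilon> x" e] x e by simp
    also have "\<dots> = (x \<cdot> \<epsilon> x) \<cdot> (e \<cdot> u e)" using ec atD(1)[OF ue] x by (simp add: assoc closed del: eps_mult_right)
    finally show ?thesis using at_unit(1)[OF ue] x by simp
  qed
  then show ?thesis using atD(1)[OF ue] by (simp add: center_def)
qed

end

section \<open>The induced action on central elements and on idempotents\<close>

context abs_kernel
begin

definition act :: "'g \<Rightarrow> 'a \<Rightarrow> 'a" where "act g c = the (\<Gamma> g c)"
text \<open>The idempotent \<theta>_g^-1(e), written as a right partial action. It is defined from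
  the maps of the center, so the places at which twistings are evaluated do not change with the
  representatives.\<close>

definition idr :: "'a \<Rightarrow> 'g \<Rightarrow> 'a" (infixl "\<triangleleft>" 75) where "e \<triangleleft> g = the (\<Gamma> (\<iota> g) e)"

lemma idr_eq: "e \<triangleleft> g = act (\<iota> g) e" by (simp add: idr_def act_def)

lemma act_rep:
  assumes "g \<in> carrier G" "c \<in> center A" "c \<in> D (\<iota> g)"
  shows "act g c = the (rep g c)"
  using Gamma_val[OF assms(1) rep[OF assms(1)] assms(2,3)] by (simp add: act_def)

lemma act_closed:
  assumes "g \<in> carrier G" "c \<in> center A" "c \<in> D (\<iota> g)"
  shows "act g c \<in> center A" "act g c \<in> D g"
  unfolding act_rep[OF assms]
  using ideal_iso_val(6)[OF psi_iso[OF assms(1) rep[OF assms(1)]] assms(3,2)]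
    ideal_iso_appl(6)[OF psi_iso[OF assms(1) rep[OF assms(1)]] assms(3)] .

lemma act_mult:
  assumes "g \<in> carrier G" "c \<in> center A" "c \<in> D (\<iota> g)" "d \<in> center A" "d \<in> D (\<iota> g)"
  shows "act g (c \<cdot> d) = act g c \<cdot> act g d"
proof -
  have "c \<cdot> d \<in> D (\<iota> g)" using assms D_ideal[of "\<iota> g"] center_closed by (auto intro: ideal_ofD(3))
  then show ?thesis
    using assms act_rep[OF assms(1)] ideal_iso_appl(7)[OF psi_iso[OF assms(1) rep[OF assms(1)]]]
    by (simp add: center_mult)
qed

lemma act_eps:
  assumes "g \<in> carrier G" "c \<in> center A" "c \<in> D (\<iota> g)"
  shows "\<epsilon> (act g c) = act g (\<epsilon> c)"
proof -
  have "\<epsilon> c \<in> D (\<iota> g)" "\<epsilon> c \<in> center A"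
    using assms eps_mem[OF D_ideal[of "\<iota> g"]] center_closed idems_center by auto
  then show ?thesis
    using assms act_rep[OF assms(1)] ideal_iso_val(4)[OF psi_iso[OF assms(1) rep[OF assms(1)]]] by simp
qed

lemma act_sinv:
  assumes "g \<in> carrier G" "c \<in> center A" "c \<in> D (\<iota> g)"
  shows "act g (c\<^sup>\<dagger>) = (act g c)\<^sup>\<dagger>"
proof -
  have "c\<^sup>\<dagger> \<in> D (\<iota> g)" "c\<^sup>\<dagger> \<in> center A"
    using assms subsemigrpD(5)[OF ideal_subsemigrp[OF D_ideal[of "\<iota> g"]]] center_sinv by auto
  then show ?thesis
    using assms act_rep[OF assms(1)] ideal_iso_val(3)[OF psi_iso[OF assms(1) rep[OF assms(1)]]] by simp
qed

lemma idr_closed: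
  assumes "g \<in> carrier G" "e \<in> idems A" "e \<in> D g"
  shows "e \<triangleleft> g \<in> idems A" "e \<triangleleft> g \<in> D (\<iota> g)" "e \<triangleleft> g \<in> carrier A"
proof -
  have i: "\<iota> g \<in> carrier G" "e \<in> center A" "e \<in> D (\<iota> (\<iota> g))" using assms idems_center by auto
  show "e \<triangleleft> g \<in> D (\<iota> g)" unfolding idr_eq using act_closed[OF i] by simp
  show "e \<triangleleft> g \<in> idems A" unfolding idr_eq act_rep[OF i]
    using ideal_iso_val(5)[OF psi_iso[OF i(1) rep[OF i(1)]] i(3) assms(2)] .
  then show "e \<triangleleft> g \<in> carrier A" by (rule idems_closed)
qed

lemma act_idr:
  assumes "g \<in> carrier G" "e \<in> idems A" "e \<in> D g"
  shows "act g (e \<triangleleft> g) = e"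
proof -
  have i: "\<iota> g \<in> carrier G" "e \<in> center A" "e \<in> D (\<iota> (\<iota> g))" using assms idems_center by auto
  have "\<Gamma> (\<iota> g) e = Some (e \<triangleleft> g)" unfolding idr_eq act_def Gamma_val[OF i(1) rep[OF i(1)] i(2,3)] by simp
  then show ?thesis using \<Gamma>.inverse_map_iff[OF assms(1), of e] by (simp add: act_def)
qed

lemma idr_act:
  assumes "g \<in> carrier G" "e \<in> idems A" "e \<in> D (\<iota> g)"
  shows "act g e \<triangleleft> g = e"
  using act_idr[of "\<iota> g" e] assms by (simp add: idr_eq)

lemma idr_mult:
  assumes "g \<in> carrier G" "e \<in> idems A" "e \<in> D g" "f \<in> idems A" "f \<in> D g"
  shows "(e \<cdot> f) \<triangleleft> g = (e \<triangleleft> g) \<cdot> (f \<triangleleft> g)"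
  unfolding idr_eq by (rule act_mult) (use assms idems_center in auto)

lemma act_D:
  assumes "g \<in> carrier G" "h \<in> carrier G" "c \<in> center A" "c \<in> D (\<iota> g)" "c \<in> D h"
  shows "act g c \<in> D (g \<odot> h)"
proof -
  have "\<Gamma> g c = Some (act g c)" using Gamma_val[OF assms(1) rep[OF assms(1)] assms(3,4)] by (simp add: act_def)
  then have "act g c \<in> ran (\<Gamma> (g \<odot> h))"
    by (rule \<Gamma>.map_ran[OF assms(1,2)]) (use assms ran_Gamma in auto)
  then show ?thesis using ran_Gamma assms by auto
qed

lemma idr_D:
  assumes "g \<in> carrier G" "h \<in> carrier G" "e \<in> idems A" "e \<in> D g" "e \<in> D (g \<odot> h)"
  shows "e \<triangleleft> g \<in> D h"
proof -
  have "act (\<iota> g) e \<in> D (\<iota> g \<odot> (g \<odot> h))"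
    by (rule act_D) (use assms idems_center in auto)
  then show ?thesis unfolding idr_eq using assms by (simp flip: G.m_assoc)
qed

lemma act_act:
  assumes "g \<in> carrier G" "h \<in> carrier G" "c \<in> center A" "c \<in> D (\<iota> h)" "c \<in> D (\<iota> h \<odot> \<iota> g)"
  shows "act g (act h c) = act (g \<odot> h) c"
proof -
  obtain y z where "\<Gamma> h c = Some y" "\<Gamma> g y = Some z" "\<Gamma> (g \<odot> h) c = Some z"
    by (rule \<Gamma>.comp_map[OF assms(1,2), of c]) (use assms ran_Gamma in auto)
  then show ?thesis by (simp add: act_def)
qed

lemma idr_idr:
  assumes "g \<in> carrier G" "h \<in> carrier G" "e \<in> idems A" "e \<in> D g" "e \<in> D (g \<odot> h)"
  shows "e \<triangleleft> g \<triangleleft> h = e \<triangleleft> (g \<odot> h)"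
  unfolding idr_eq using assms idems_center act_act[of "\<iota> h" "\<iota> g" e] by (simp add: G.inv_mult_group)

abbreviation P2 where "P2 g h \<equiv> D g \<inter> D (g \<odot> h)"
abbreviation P3 where "P3 g h k \<equiv> D g \<inter> (D (g \<odot> h) \<inter> D (g \<odot> h \<odot> k))"
abbreviation P4 where "P4 g h k l \<equiv> D g \<inter> (D (g \<odot> h) \<inter> (D (g \<odot> h \<odot> k) \<inter> D (g \<odot> h \<odot> k \<odot> l)))"

text \<open>These families are the 2-cochains with values in the center, each multiplier being
  replaced by its values on idempotents.\<close>

definition central2 :: "('g \<Rightarrow> 'g \<Rightarrow> 'a \<Rightarrow> 'a) \<Rightarrow> bool" where
  "central2 z \<longleftrightarrow> (\<forall>g \<in> carrier G. \<forall>h \<in> carrier G. sect (center A \<inter> P2 g h) (z g h))"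

definition central3 :: "('g \<Rightarrow> 'g \<Rightarrow> 'g \<Rightarrow> 'a \<Rightarrow> 'a) \<Rightarrow> bool" where
  "central3 b \<longleftrightarrow> (\<forall>g \<in> carrier G. \<forall>h \<in> carrier G. \<forall>k \<in> carrier G. sect (center A \<inter> P3 g h k) (b g h k))"

text \<open>The coboundary of \<open>z\<close>, evaluated at the idempotent \<open>e\<close>; for
  central families all factors are central elements of the maximal subgroup at
  \<open>e\<close>.\<close>

definition dz :: "('g \<Rightarrow> 'g \<Rightarrow> 'a \<Rightarrow> 'a) \<Rightarrow> 'g \<Rightarrow> 'g \<Rightarrow> 'g \<Rightarrow> 'a \<Rightarrow> 'a" where
  "dz z g h k e = act g (z h k (e \<triangleleft> g)) \<cdot> (z (g \<odot> h) k e)\<^sup>\<dagger> \<cdot> z g (h \<odot> k) e \<cdot> (z g h e)\<^sup>\<dagger>"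

lemma P_ideal:
  "\<lbrakk>g \<in> carrier G; h \<in> carrier G\<rbrakk> \<Longrightarrow> ideal_of A (P2 g h)"
  "\<lbrakk>g \<in> carrier G; h \<in> carrier G; k \<in> carrier G\<rbrakk> \<Longrightarrow> ideal_of A (P3 g h k)"
  "\<lbrakk>g \<in> carrier G; h \<in> carrier G; k \<in> carrier G; l \<in> carrier G\<rbrakk> \<Longrightarrow> ideal_of A (P4 g h k l)"
  by (auto intro!: ideal_inter D_ideal)

lemma central2_sect:
  assumes "central2 z" "g \<in> carrier G" "h \<in> carrier G"
  shows "sect (P2 g h) (z g h)"
    "\<lbrakk>e \<in> idems A; e \<in> P2 g h\<rbrakk> \<Longrightarrow> z g h e \<in> at e" "\<lbrakk>e \<in> idems A; e \<in> P2 g h\<rbrakk> \<Longrightarrow> z g h e \<in> center A"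
proof -
  have s: "sect (center A \<inter> P2 g h) (z g h)" using assms by (simp add: central2_def)
  note I = P_ideal(1)[OF assms(2,3)]
  show 1: "sect (P2 g h) (z g h)" by (rule sect_from_center[OF I s])
  assume e: "e \<in> idems A" "e \<in> P2 g h"
  show "z g h e \<in> at e" by (rule sect_at[OF ideal_subsemigrp[OF I] 1 e(2,1)])
  show "z g h e \<in> center A" using sectD(1)[OF s _ e(1)] e idems_center by auto
qed

lemma central2I:
  assumes "\<And>g h. \<lbrakk>g \<in> carrier G; h \<in> carrier G\<rbrakk> \<Longrightarrow> sect (P2 g h) (z g h)"
    "\<And>g h e. \<lbrakk>g \<in> carrier G; h \<in> carrier G; e \<in> idems A; e \<in> P2 g h\<rbrakk> \<Longrightarrow> z g h e \<in> center A"
  shows "central2 z"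
  unfolding central2_def by (intro ballI sect_center[OF P_ideal(1)] assms) auto

lemma central2_mult:
  assumes "central2 z" "central2 z'" shows "central2 (\<lambda>g h e. z g h e \<cdot> z' g h e)"
  using assms sect_mult ideal_inter_center(2)[OF P_ideal(1)] by (simp add: central2_def)

lemma central2_sinv:
  assumes "central2 z" shows "central2 (\<lambda>g h e. (z g h e)\<^sup>\<dagger>)"
  using assms sect_sinv ideal_inter_center(2)[OF P_ideal(1)] by (simp add: central2_def)

lemma central2_idem: "central2 (\<lambda>g h e. e)"
  using sect_idem ideal_inter_center(2)[OF P_ideal(1)] by (simp add: central2_def)

lemma at_act:
  assumes "g \<in> carrier G" "e \<in> idems A" "e \<in> D g" "c \<in> center A" "c \<in> at (e \<triangleleft> g)"
  shows "act g c \<in> at e" "act g c \<in> center A" "c \<in> D (\<iota> g)"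
proof -
  show c: "c \<in> D (\<iota> g)" by (rule at_ideal[OF _ assms(5)]) (use D_ideal idr_closed assms in auto)
  show "act g c \<in> center A" using act_closed assms c by blast
  then show "act g c \<in> at e"
    using act_eps[OF assms(1,4) c] act_idr[OF assms(1-3)] atD[OF assms(5)] center_closed by (simp add: at_def)
qed

text \<open>These are the places where the four faces of a triple are evaluated; only the face
  without \<open>g\<close> is evaluated at the translated idempotent.\<close>

lemma P3_faces:
  assumes "g \<in> carrier G" "h \<in> carrier G" "k \<in> carrier G" "e \<in> idems A" "e \<in> P3 g h k"
  shows "e \<triangleleft> g \<in> idems A" "e \<triangleleft> g \<in> P2 h k" "e \<in> P2 (g \<odot> h) k" "e \<in> P2 g (h \<odot> k)" "e \<in> P2 g h" "e \<in> D g"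
  using assms idr_closed[of g e] idr_D[of g h e] idr_D[of g "h \<odot> k" e] by (auto simp: G.m_assoc)

lemma sect_faces:
  assumes w: "\<And>g h. \<lbrakk>g \<in> carrier G; h \<in> carrier G\<rbrakk> \<Longrightarrow> sect (P2 g h) (w g h)"
    and G: "g \<in> carrier G" "h \<in> carrier G" "k \<in> carrier G"
  shows "sect (P3 g h k) (w g (h \<odot> k))" "sect (P3 g h k) (w (g \<odot> h) k)" "sect (P3 g h k) (w g h)"
proof -
  have gh: "g \<odot> h \<in> carrier G" "h \<odot> k \<in> carrier G" "g \<odot> (h \<odot> k) = g \<odot> h \<odot> k"
    using G by (auto simp: G.m_assoc)
  note I = P_ideal(2)[OF G]
  show "sect (P3 g h k) (w g (h \<odot> k))"
    by (rule sect_ideal_restrict[OF P_ideal(1)[OF G(1) gh(2)] I _ w[OF G(1) gh(2)]]) (auto simp: gh(3))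
  show "sect (P3 g h k) (w (g \<odot> h) k)"
    by (rule sect_ideal_restrict[OF P_ideal(1)[OF gh(1) G(3)] I _ w[OF gh(1) G(3)]]) auto
  show "sect (P3 g h k) (w g h)"
    by (rule sect_ideal_restrict[OF P_ideal(1)[OF G(1,2)] I _ w[OF G(1,2)]]) auto
qed

lemma dz_at:
  assumes z: "central2 z" and G: "g \<in> carrier G" "h \<in> carrier G" "k \<in> carrier G" and e: "e \<in> idems A" "e \<in> P3 g h k"
  shows "act g (z h k (e \<triangleleft> g)) \<in> at e" "act g (z h k (e \<triangleleft> g)) \<in> center A" "dz z g h k e \<in> at e" "dz z g h k e \<in> center A"
proof -
  note F = P3_faces[OF G e]
  have s: "z h k (e \<triangleleft> g) \<in> at (e \<triangleleft> g)" "z h k (e \<triangleleft> g) \<in> center A"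
    using central2_sect[OF z] F G by auto
  show a: "act g (z h k (e \<triangleleft> g)) \<in> at e" "act g (z h k (e \<triangleleft> g)) \<in> center A"
    using at_act[OF G(1) e(1) F(6) s(2,1)] by auto
  have "z (g \<odot> h) k e \<in> at e" "z g (h \<odot> k) e \<in> at e" "z g h e \<in> at e"
    "z (g \<odot> h) k e \<in> center A" "z g (h \<odot> k) e \<in> center A" "z g h e \<in> center A"
    using central2_sect[OF z] F G e by auto
  then show "dz z g h k e \<in> at e" "dz z g h k e \<in> center A"
    unfolding dz_def using a by (auto intro!: center_mult center_sinv)
qed

end

text \<open>Only statements that apply some \<theta>_g to elements that need not be central live
  here. Domains, translated idempotents and coboundaries belong to the kernel itself, so two choices
  of representatives can be compared.\<close>

locale kernel_reps = abs_kernel A G \<psi> for A :: "'a semigrp" (structure) and G :: "('g, 'm) monoid_scheme" and \<psi> +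
  fixes \<theta> :: "'g \<Rightarrow> 'a \<rightharpoonup> 'a"
  assumes reps: "g \<in> carrier G \<Longrightarrow> \<theta> g \<in> \<psi> g"
begin

abbreviation t :: "'g \<Rightarrow> 'a \<Rightarrow> 'a" where "t g a \<equiv> the (\<theta> g a)"

lemma t_iso: "g \<in> carrier G \<Longrightarrow> ideal_iso A (D (\<iota> g)) (D g) (\<theta> g)"
  using psi_iso reps by simp

lemma t_closed:
  assumes "g \<in> carrier G" "a \<in> D (\<iota> g)" shows "t g a \<in> D g" "t g a \<in> carrier A" "a \<in> carrier A"
  using ideal_iso_appl(6)[OF t_iso] ideal_iso_val(1,2)[OF t_iso] assms by auto

lemma t_mult: "\<lbrakk>g \<in> carrier G; a \<in> D (\<iota> g); b \<in> D (\<iota> g)\<rbrakk> \<Longrightarrow> t g (a \<cdot> b) = t g a \<cdot> t g b"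
  using ideal_iso_appl(7)[OF t_iso] by simp

lemma t_sinv: "\<lbrakk>g \<in> carrier G; a \<in> D (\<iota> g)\<rbrakk> \<Longrightarrow> t g (a\<^sup>\<dagger>) = (t g a)\<^sup>\<dagger>"
  using ideal_iso_val(3)[OF t_iso] by simp

lemma t_act: "\<lbrakk>g \<in> carrier G; c \<in> center A; c \<in> D (\<iota> g)\<rbrakk> \<Longrightarrow> t g c = act g c"
  using Gamma_val[OF _ reps] by (simp add: act_def)

lemma D_mult: "\<lbrakk>g \<in> carrier G; a \<in> D g; b \<in> D g\<rbrakk> \<Longrightarrow> a \<cdot> b \<in> D g"
  and D_carrier: "\<lbrakk>g \<in> carrier G; a \<in> D g\<rbrakk> \<Longrightarrow> a \<in> carrier A"
  and D_eps: "\<lbrakk>g \<in> carrier G; a \<in> carrier A\<rbrakk> \<Longrightarrow> \<epsilon> a \<in> D g \<longleftrightarrow> a \<in> D g"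
  using subsemigrpD[OF ideal_subsemigrp[OF D_ideal]] eps_mem[OF D_ideal] by auto

lemma t_eps: "\<lbrakk>g \<in> carrier G; a \<in> D (\<iota> g)\<rbrakk> \<Longrightarrow> \<epsilon> (t g a) = act g (\<epsilon> a)"
  using ideal_iso_val(4)[OF t_iso, of g a] t_act[of g "\<epsilon> a"] D_eps[of "\<iota> g" a] D_carrier[of "\<iota> g" a] by (simp add: idems_center)

lemma t_idr: "\<lbrakk>g \<in> carrier G; e \<in> idems A; e \<in> D g\<rbrakk> \<Longrightarrow> t g (e \<triangleleft> g) = e"
  using t_act[of g "e \<triangleleft> g"] idr_closed[of g e] act_idr[of g e] idems_center by simp

lemma at_t:
  assumes "g \<in> carrier G" "e \<in> idems A" "e \<in> D g" "a \<in> at (e \<triangleleft> g)"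
  shows "a \<in> D (\<iota> g)" "t g a \<in> at e"
proof -
  show a: "a \<in> D (\<iota> g)" using at_ideal[OF D_ideal assms(4)] idr_closed[OF assms(1-3)] assms by auto
  show "t g a \<in> at e"
    using t_eps[OF assms(1) a] t_closed(2)[OF assms(1) a] atD(2)[OF assms(4)] act_idr[OF assms(1-3)] by (simp add: at_def)
qed

text \<open>Each representative maps the maximal subgroup at \<open>e \<triangleleft> g\<close> onto
  the one at \<open>e\<close>. Thus an identity valid for all values of a representative holds for
  every element of that group, which is how centrality is tested.\<close>

lemma t_surj:
  assumes "g \<in> carrier G" "e \<in> idems A" "e \<in> D g" "x \<in> at e"
  obtains a where "a \<in> at (e \<triangleleft> g)" "t g a = x"
proof -
  have "x \<in> D g" by (rule at_ideal[OF D_ideal assms(4,3)]) fact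
  then obtain a where a: "a \<in> D (\<iota> g)" "t g a = x" using ideal_iso_appl(9)[OF t_iso[OF assms(1)]] by blast
  then have "act g (\<epsilon> a) = e" using t_eps[OF assms(1) a(1)] atD[OF assms(4)] by simp
  moreover have "a \<in> carrier A" "\<epsilon> a \<in> D (\<iota> g)"
    using D_carrier[of "\<iota> g" a] D_eps[of "\<iota> g" a] a assms(1) by auto
  ultimately have "\<epsilon> a = e \<triangleleft> g" using idr_act[of g "\<epsilon> a"] assms by simp
  then show thesis using that a \<open>a \<in> carrier A\<close> by (simp add: at_def)
qed

lemma sect_t:
  assumes g: "g \<in> carrier G" and K: "ideal_of A K" "K \<subseteq> D g" and J: "ideal_of A J"
    and KJ: "\<And>e. \<lbrakk>e \<in> idems A; e \<in> K\<rbrakk> \<Longrightarrow> e \<triangleleft> g \<in> J" and u: "sect J u"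
  shows "sect K (\<lambda>e. t g (u (e \<triangleleft> g)))"
proof (rule sectI[OF K(1)])
  note sJ = ideal_subsemigrp[OF J]
  fix e assume e: "e \<in> K" "e \<in> idems A"
  have eg: "e \<in> D g" using e K by auto
  have i: "e \<triangleleft> g \<in> idems A" "e \<triangleleft> g \<in> J" using idr_closed[OF g e(2) eg] KJ e by auto
  have ue: "u (e \<triangleleft> g) \<in> at (e \<triangleleft> g)" by (rule sect_at[OF sJ u i(2,1)])
  show "t g (u (e \<triangleleft> g)) \<in> at e" by (rule at_t(2)[OF g e(2) eg ue])
  fix f assume f: "f \<in> K" "f \<in> idems A"
  have fg: "f \<in> D g" using f K by auto
  have j: "f \<triangleleft> g \<in> idems A" "f \<triangleleft> g \<in> J" using idr_closed[OF g f(2) fg] KJ f by auto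
  have "u ((e \<cdot> f) \<triangleleft> g) = u (e \<triangleleft> g) \<cdot> (f \<triangleleft> g)"
    unfolding idr_mult[OF g e(2) eg f(2) fg] using sectD(3)[OF u i(2,1) j(2,1)] .
  then show "t g (u ((e \<cdot> f) \<triangleleft> g)) = t g (u (e \<triangleleft> g)) \<cdot> f"
    using t_mult[OF g at_t(1)[OF g e(2) eg ue] idr_closed(2)[OF g f(2) fg]] t_idr[OF g f(2) fg] by simp
qed

text \<open>The defining property of a twisting, taken at one idempotent and with the inverse
  cleared, so that it is an equation between two products in the maximal subgroup at
  \<open>e\<close>.\<close>

definition twists :: "('g \<Rightarrow> 'g \<Rightarrow> 'a \<Rightarrow> 'a) \<Rightarrow> bool" where
  "twists w \<longleftrightarrow> (\<forall>g \<in> carrier G. \<forall>h \<in> carrier G. sect (P2 g h) (w g h) \<and>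
     (\<forall>e \<in> idems A \<inter> P2 g h. \<forall>a \<in> at (e \<triangleleft> (g \<odot> h)). t g (t h a) \<cdot> w g h e = w g h e \<cdot> t (g \<odot> h) a))"

definition associates :: "('g \<Rightarrow> 'g \<Rightarrow> 'a \<Rightarrow> 'a) \<Rightarrow> ('g \<Rightarrow> 'g \<Rightarrow> 'g \<Rightarrow> 'a \<Rightarrow> 'a) \<Rightarrow> bool" where
  "associates w b \<longleftrightarrow> (\<forall>g \<in> carrier G. \<forall>h \<in> carrier G. \<forall>k \<in> carrier G. \<forall>e \<in> idems A \<inter> P3 g h k.
     b g h k e \<in> at e \<and> b g h k e \<in> center A \<and>
     t g (w h k (e \<triangleleft> g)) \<cdot> w g (h \<odot> k) e = b g h k e \<cdot> w g h e \<cdot> w (g \<odot> h) k e)"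

lemma twistsD:
  assumes "twists w" "g \<in> carrier G" "h \<in> carrier G"
  shows "sect (P2 g h) (w g h)" "\<lbrakk>e \<in> idems A; e \<in> P2 g h\<rbrakk> \<Longrightarrow> w g h e \<in> at e"
    "\<lbrakk>e \<in> idems A; e \<in> P2 g h; a \<in> at (e \<triangleleft> (g \<odot> h))\<rbrakk> \<Longrightarrow> t g (t h a) \<cdot> w g h e = w g h e \<cdot> t (g \<odot> h) a"
proof -
  show 1: "sect (P2 g h) (w g h)" using assms by (simp add: twists_def)
  show "w g h e \<in> at e" if "e \<in> idems A" "e \<in> P2 g h"
    by (rule sect_at[OF ideal_subsemigrp[OF P_ideal(1)[OF assms(2,3)]] 1 that(2,1)])
  show "t g (t h a) \<cdot> w g h e = w g h e \<cdot> t (g \<odot> h) a" if "e \<in> idems A" "e \<in> P2 g h" "a \<in> at (e \<triangleleft> (g \<odot> h))"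
    using assms that by (simp add: twists_def)
qed

lemma associatesD:
  assumes "associates w b" "g \<in> carrier G" "h \<in> carrier G" "k \<in> carrier G" "e \<in> idems A" "e \<in> P3 g h k"
  shows "b g h k e \<in> at e" "b g h k e \<in> center A"
     "t g (w h k (e \<triangleleft> g)) \<cdot> w g (h \<odot> k) e = b g h k e \<cdot> w g h e \<cdot> w (g \<odot> h) k e"
  using assms by (auto simp: associates_def)

lemma at_tt:
  assumes "g \<in> carrier G" "h \<in> carrier G" "e \<in> idems A" "e \<in> P2 g h" "a \<in> at (e \<triangleleft> (g \<odot> h))"
  shows "a \<in> at (e \<triangleleft> g \<triangleleft> h)" "t h a \<in> at (e \<triangleleft> g)" "t g (t h a) \<in> at e" "t (g \<odot> h) a \<in> at e"
    "a \<in> D (\<iota> h)" "t h a \<in> D (\<iota> g)" "a \<in> D (\<iota> (g \<odot> h))"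
proof -
  have e: "e \<in> D g" "e \<in> D (g \<odot> h)" using assms by auto
  have eg: "e \<triangleleft> g \<in> idems A" "e \<triangleleft> g \<in> D h" using idr_closed idr_D assms e by auto
  show a: "a \<in> at (e \<triangleleft> g \<triangleleft> h)" using idr_idr[OF assms(1-3) e] assms by simp
  show ta: "t h a \<in> at (e \<triangleleft> g)" "a \<in> D (\<iota> h)" using at_t[OF assms(2) eg a] by auto
  show "t g (t h a) \<in> at e" "t h a \<in> D (\<iota> g)" using at_t[OF assms(1,3) e(1) ta(1)] by auto
  show "t (g \<odot> h) a \<in> at e" "a \<in> D (\<iota> (g \<odot> h))" using at_t[OF _ assms(3) e(2) assms(5)] assms by auto
qed

text \<open>The associator equation solved for its central factor. In this form the dependence on
  \<open>e\<close> is visibly compatible; what has to be proved is that the value is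
  central.\<close>

definition assoc_of :: "('g \<Rightarrow> 'g \<Rightarrow> 'a \<Rightarrow> 'a) \<Rightarrow> 'g \<Rightarrow> 'g \<Rightarrow> 'g \<Rightarrow> 'a \<Rightarrow> 'a" where
  "assoc_of w g h k e = t g (w h k (e \<triangleleft> g)) \<cdot> w g (h \<odot> k) e \<cdot> (w (g \<odot> h) k e)\<^sup>\<dagger> \<cdot> (w g h e)\<^sup>\<dagger>"

lemma twist_faces:
  assumes w: "twists w" and G: "g \<in> carrier G" "h \<in> carrier G" "k \<in> carrier G" and e: "e \<in> idems A" "e \<in> P3 g h k"
  shows "t g (w h k (e \<triangleleft> g)) \<in> at e" "w g (h \<odot> k) e \<in> at e" "w (g \<odot> h) k e \<in> at e" "w g h e \<in> at e"
    "w h k (e \<triangleleft> g) \<in> D (\<iota> g)" "w h k (e \<triangleleft> g) \<in> at (e \<triangleleft> g)"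
proof -
  note F = P3_faces[OF G e]
  show 1: "w h k (e \<triangleleft> g) \<in> at (e \<triangleleft> g)" by (rule twistsD(2)[OF w G(2,3) F(1,2)])
  show "t g (w h k (e \<triangleleft> g)) \<in> at e" "w h k (e \<triangleleft> g) \<in> D (\<iota> g)" using at_t[OF G(1) e(1) F(6) 1] by auto
  show "w g (h \<odot> k) e \<in> at e" "w (g \<odot> h) k e \<in> at e" "w g h e \<in> at e"
    using twistsD(2)[OF w] F G e by auto
qed

lemma sect_assoc_of:
  assumes w: "twists w" and G: "g \<in> carrier G" "h \<in> carrier G" "k \<in> carrier G"
  shows "sect (P3 g h k) (assoc_of w g h k)"
proof -
  note I = P_ideal(2)[OF G]
  note sI = ideal_subsemigrp[OF I]
  have 1: "sect (P3 g h k) (\<lambda>e. t g (w h k (e \<triangleleft> g)))"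
    by (rule sect_t[OF G(1) I _ P_ideal(1)[OF G(2,3)] _ twistsD(1)[OF w G(2,3)]])
       (use P3_faces(2)[OF G] in blast)+
  have 2: "sect (P3 g h k) (w g (h \<odot> k))" "sect (P3 g h k) (w (g \<odot> h) k)" "sect (P3 g h k) (w g h)"
    using sect_faces[OF twistsD(1)[OF w] G] by blast+
  show ?thesis
    unfolding assoc_of_def
    by (rule sect_mult[OF sI sect_mult[OF sI sect_mult[OF sI 1 2(1)] sect_sinv[OF sI 2(2)]] sect_sinv[OF sI 2(3)]])
qed

text \<open>Both \<theta>_g w(h,k) w(g,hk) and w(g,h) w(gh,k) conjugate \<theta>_ghk(y) to
  \<theta>_g \<theta>_h \<theta>_k(y). Their quotient therefore centralizes all elements of that
  shape, and these exhaust the maximal subgroup.\<close>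

lemma associates_assoc_of:
  assumes w: "twists w"
  shows "associates w (assoc_of w)"
proof -
  have eq: "t g (w h k (e \<triangleleft> g)) \<cdot> w g (h \<odot> k) e = assoc_of w g h k e \<cdot> w g h e \<cdot> w (g \<odot> h) k e"
    "assoc_of w g h k e \<in> at e"
    if G: "g \<in> carrier G" "h \<in> carrier G" "k \<in> carrier G" and e: "e \<in> idems A" "e \<in> P3 g h k" for g h k e
  proof -
    interpret H: group "grp_at e" by (rule group_grp_at[OF e(1)])
    note H = at_is_group(2,3)[OF e(1)]
    note F = twist_faces[OF w G e]
    show "assoc_of w g h k e \<in> at e" using F by (simp add: assoc_of_def)
    show "t g (w h k (e \<triangleleft> g)) \<cdot> w g (h \<odot> k) e = assoc_of w g h k e \<cdot> w g h e \<cdot> w (g \<odot> h) k e"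
      using F(1-4)[THEN atD(2)] F(1-4)[THEN atD(1)] at_unit(1)[OF F(3)] at_unit(2)[OF F(2)]
        at_unit(2)[OF at_sinv[OF F(3)]] idems_closed[OF e(1)]
      by (simp add: assoc_of_def assoc closed)
  qed
  note sec = sect_assoc_of[OF w]
  have "assoc_of w g h k e \<in> center A" if G: "g \<in> carrier G" "h \<in> carrier G" "k \<in> carrier G"
    and e: "e \<in> idems A" "e \<in> P3 g h k" for g h k e
  proof (rule sect_central[OF P_ideal(2)[OF G] sec[OF G] _ e(2,1)])
    fix e T assume e: "e \<in> P3 g h k" "e \<in> idems A" and T: "T \<in> at e"
    interpret H: group "grp_at e" by (rule group_grp_at[OF e(2)])
    note H = at_is_group(2,3)[OF e(2)]
    note F = twist_faces[OF w G e(2,1)] and E = P3_faces[OF G e(2,1)]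
    let ?Y = "w g h e \<cdot> w (g \<odot> h) k e" and ?X = "t g (w h k (e \<triangleleft> g)) \<cdot> w g (h \<odot> k) e"
    \<comment> \<open>A prescribed \<open>T\<close> is to be of the form \<theta>_g \<theta>_h
      \<theta>_k(y). As \<open>?Y\<close> will conjugate \<theta>_ghk(y) to that element, the value
      of \<theta>_ghk at y must be \<open>T\<close> conjugated back by \<open>?Y\<close>.\<close>
    let ?x = "?Y\<^sup>\<dagger> \<cdot> T \<cdot> ?Y"
    have x: "?x \<in> at e" using F T by simp
    have eD: "e \<in> D (g \<odot> h \<odot> k)" "e \<in> D (g \<odot> (h \<odot> k))" using e G by (auto simp: G.m_assoc)
    obtain y where y: "y \<in> at (e \<triangleleft> (g \<odot> h \<odot> k))" "t (g \<odot> h \<odot> k) y = ?x"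
      by (rule t_surj[OF _ e(2) eD(1) x]) (use G in auto)
    have y': "y \<in> at (e \<triangleleft> (g \<odot> (h \<odot> k)))" "t (g \<odot> (h \<odot> k)) y = ?x" using y G by (simp_all add: G.m_assoc)
    note Y1 = at_tt[OF _ G(3) e(2) E(3) y(1), simplified G]
    note Y2 = at_tt[OF G(1) _ e(2) E(4) y'(1), simplified G]
    have ky: "t k y \<in> at (e \<triangleleft> (g \<odot> h))" using Y1(2) G by simp
    note Y3 = at_tt[OF G(1,2) e(2) E(5) ky]
    have ehk: "e \<triangleleft> g \<triangleleft> (h \<odot> k) = e \<triangleleft> (g \<odot> (h \<odot> k))"
      by (rule idr_idr) (use G e eD in auto)
    have y3: "y \<in> at (e \<triangleleft> g \<triangleleft> (h \<odot> k))" using y' ehk by simp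
    note Y4 = at_tt[OF G(2,3) E(1,2) y3]
    let ?T = "t g (t h (t k y))"
    have TY: "?T \<cdot> ?Y = ?Y \<cdot> ?x"
    proof -
      have "?T \<cdot> ?Y = (?T \<cdot> w g h e) \<cdot> w (g \<odot> h) k e" using Y3 F atD by (simp add: assoc)
      also have "\<dots> = w g h e \<cdot> (t (g \<odot> h) (t k y) \<cdot> w (g \<odot> h) k e)"
        unfolding twistsD(3)[OF w G(1,2) e(2) E(5) ky] using Y3 F atD by (simp add: assoc)
      also have "\<dots> = w g h e \<cdot> (w (g \<odot> h) k e \<cdot> ?x)"
        using twistsD(3)[OF w _ G(3) e(2) E(3) y(1)] G y(2) by simp
      also have "\<dots> = ?Y \<cdot> ?x" using F x atD assoc by simp
      finally show ?thesis .
    qed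
    have TX: "?T \<cdot> ?X = ?X \<cdot> ?x"
    proof -
      have "t g (t h (t k y) \<cdot> w h k (e \<triangleleft> g)) = t g (w h k (e \<triangleleft> g) \<cdot> t (h \<odot> k) y)"
        using twistsD(3)[OF w G(2,3) E(1,2) y3] by simp
      then have 1: "?T \<cdot> t g (w h k (e \<triangleleft> g)) = t g (w h k (e \<triangleleft> g)) \<cdot> t g (t (h \<odot> k) y)"
        using t_mult[OF G(1)] Y3(6) F(5) at_t(1)[OF G(1) e(2) E(6) Y4(4)] by simp
      have "?T \<cdot> ?X = (?T \<cdot> t g (w h k (e \<triangleleft> g))) \<cdot> w g (h \<odot> k) e" using Y3 F atD by (simp add: assoc)
      also have "\<dots> = t g (w h k (e \<triangleleft> g)) \<cdot> (t g (t (h \<odot> k) y) \<cdot> w g (h \<odot> k) e)"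
        unfolding 1 using Y2 G F atD by (simp add: assoc)
      also have "\<dots> = t g (w h k (e \<triangleleft> g)) \<cdot> (w g (h \<odot> k) e \<cdot> ?x)"
        using twistsD(3)[OF w G(1) _ e(2) E(4) y'(1)] G y'(2) by simp
      also have "\<dots> = ?X \<cdot> ?x" using F x atD assoc by simp
      finally show ?thesis .
    qed
    have Yat: "?Y \<in> at e" "?X \<in> at e" using F by auto
    have "?T \<cdot> ?Y = T \<cdot> ?Y"
      unfolding TY using Yat(1) T by (simp add: atD at_unit closed flip: assoc)
    then have "?T = T" by (rule at_r_cancel[OF Y3(3) T Yat(1)])
    moreover have "?X = assoc_of w g h k e \<cdot> ?Y"
      using eq[OF G e(2,1)] F atD assoc by simp
    ultimately show "assoc_of w g h k e \<cdot> T = T \<cdot> assoc_of w g h k e"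
      using H.commute_of_same_conjugation[of T ?X ?Y ?x "assoc_of w g h k e"] TX TY Yat x T eq(2)[OF G e(2,1)]
      unfolding H mult_grp_at by simp
  qed
  note cen = this
  show ?thesis unfolding associates_def
  proof (intro ballI conjI)
    fix g h k e assume G: "g \<in> carrier G" "h \<in> carrier G" "k \<in> carrier G" and "e \<in> idems A \<inter> P3 g h k"
    then have e: "e \<in> idems A" "e \<in> P3 g h k" by auto
    show "assoc_of w g h k e \<in> at e" by (rule eq(2)[OF G e])
    show "assoc_of w g h k e \<in> center A" by (rule cen[OF G e])
    show "t g (w h k (e \<triangleleft> g)) \<cdot> w g (h \<odot> k) e = assoc_of w g h k e \<cdot> w g h e \<cdot> w (g \<odot> h) k e"
      by (rule eq(1)[OF G e])
  qed
qed

end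

context semilattice_of_groups
begin

lemma sect_cong:
  assumes I: "inverse_subsemigrp S I" and "\<And>e. \<lbrakk>e \<in> I; e \<in> idems S\<rbrakk> \<Longrightarrow> u e = v e" and "sect I u"
  shows "sect I v"
  using assms subsemigrpD(4)[OF I] by (auto simp: sect_def)

end

context abs_kernel
begin

lemma P4_faces:
  assumes "g \<in> carrier G" "h \<in> carrier G" "k \<in> carrier G" "l \<in> carrier G" "e \<in> idems A" "e \<in> P4 g h k l"
  shows "e \<triangleleft> g \<in> idems A" "e \<triangleleft> g \<in> P3 h k l" "e \<in> P3 (g \<odot> h) k l" "e \<in> P3 g (h \<odot> k) l"
    "e \<in> P3 g h (k \<odot> l)" "e \<in> P3 g h k" "e \<in> D g" "e \<in> P2 g h"
  using assms idr_closed[of g e] idr_D[of g h e] idr_D[of g "h \<odot> k" e] idr_D[of g "h \<odot> k \<odot> l" e]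
  by (auto simp: G.m_assoc)

end

section \<open>The cocycle identity and the effect of other choices\<close>

context kernel_reps
begin

lemma associates_unique:
  assumes w: "twists w" and b: "associates w b" "associates w b'"
    and G: "g \<in> carrier G" "h \<in> carrier G" "k \<in> carrier G" and e: "e \<in> idems A" "e \<in> P3 g h k"
  shows "b g h k e = b' g h k e"
proof -
  note F = twist_faces[OF w G e] and B = associatesD[OF b(1) G e] and B' = associatesD[OF b(2) G e]
  have "b g h k e \<cdot> (w g h e \<cdot> w (g \<odot> h) k e) = b' g h k e \<cdot> (w g h e \<cdot> w (g \<odot> h) k e)"
    using B(3) B'(3) F(3,4) B(1) B'(1) atD assoc by simp
  then show ?thesis
    by (rule at_r_cancel[OF B(1) B'(1) at_mult[OF F(4) F(3)]])
qed

text \<open>The relation \<open>associates\<close> constrains \<open>b\<close> at single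
  idempotents. Compatibility between idempotents follows because \<open>b\<close> must agree with
  \<open>assoc_of w\<close>, a product of compatible families.\<close>

lemma central3_associates:
  assumes w: "twists w" and b: "associates w b"
  shows "central3 b"
  unfolding central3_def
proof (intro ballI)
  fix g h k assume G: "g \<in> carrier G" "h \<in> carrier G" "k \<in> carrier G"
  note I = P_ideal(2)[OF G]
  have "sect (P3 g h k) (b g h k)"
    by (rule sect_cong[OF ideal_subsemigrp[OF I] _ sect_assoc_of[OF w G]])
       (rule associates_unique[OF w associates_assoc_of[OF w] b G])
  then show "sect (center A \<inter> P3 g h k) (b g h k)"
    by (rule sect_center[OF I]) (rule associatesD(2)[OF b G])
qed

text \<open>The elements of \<open>associator_words\<close> are taken at the single idempotent
  \<open>e\<close>, the twistings inside \<theta>_g and \<theta>_g \<theta>_h at its translates. The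
  second claim places the translated associator in the same group.\<close>

lemma associates_cocycle:
  assumes w: "twists w" and b: "associates w b"
    and G: "g \<in> carrier G" "h \<in> carrier G" "k \<in> carrier G" "l \<in> carrier G"
    and e: "e \<in> idems A" "e \<in> P4 g h k l"
  shows "act g (b h k l (e \<triangleleft> g)) \<cdot> b g (h \<odot> k) l e \<cdot> b g h k e = b g h (k \<odot> l) e \<cdot> b (g \<odot> h) k l e"
    "act g (b h k l (e \<triangleleft> g)) \<in> at e"
proof -
  interpret H: group "grp_at e" by (rule group_grp_at[OF e(1)])
  note H = at_is_group(2,3)[OF e(1)]
  note F = P4_faces[OF G e]
  have gg: "g \<odot> h \<in> carrier G" "h \<odot> k \<in> carrier G" "k \<odot> l \<in> carrier G" "g \<odot> h \<odot> k \<in> carrier G"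
    using G by auto
  have ass: "h \<odot> k \<odot> l = h \<odot> (k \<odot> l)" "g \<odot> (h \<odot> k) = g \<odot> h \<odot> k" using G by (auto simp: G.m_assoc)
  note B1 = associatesD[OF b G(2-4) F(1,2)] and B2 = associatesD[OF b G(1) gg(2) G(4) e(1) F(4)]
    and B3 = associatesD[OF b G(1-3) e(1) F(6)] and B4 = associatesD[OF b G(1,2) gg(3) e(1) F(5)]
    and B5 = associatesD[OF b gg(1) G(3,4) e(1) F(3)]
  note T1 = twist_faces[OF w G(2-4) F(1,2)] and T2 = twist_faces[OF w G(1) gg(2) G(4) e(1) F(4)]
    and T3 = twist_faces[OF w G(1-3) e(1) F(6)] and T4 = twist_faces[OF w G(1,2) gg(3) e(1) F(5)]
    and T5 = twist_faces[OF w gg(1) G(3,4) e(1) F(3)]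
  have tb: "t g (b h k l (e \<triangleleft> g)) = act g (b h k l (e \<triangleleft> g))"
    using t_act[OF G(1) B1(2)] at_t(1)[OF G(1) e(1) F(7) B1(1)] by simp
  show b1: "act g (b h k l (e \<triangleleft> g)) \<in> at e" using at_t(2)[OF G(1) e(1) F(7) B1(1)] tb by simp
  have dd: "x \<in> D (\<iota> g)" "t g x \<in> at e" if "x \<in> at (e \<triangleleft> g)" for x using at_t[OF G(1) e(1) F(7) that] by auto
  have ii: "e \<triangleleft> g \<triangleleft> h = e \<triangleleft> (g \<odot> h)" using idr_idr[OF G(1,2) e(1)] F(8) by auto
  \<comment> \<open>This is the associator equation for the last three group elements, taken at
    \<open>e \<triangleleft> g\<close> and carried to \<open>e\<close> by the representative of
    \<open>g\<close>.\<close>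
  have e1: "t g (t h (w k l (e \<triangleleft> g \<triangleleft> h))) \<cdot> t g (w h (k \<odot> l) (e \<triangleleft> g)) =
      act g (b h k l (e \<triangleleft> g)) \<cdot> t g (w h k (e \<triangleleft> g)) \<cdot> t g (w (h \<odot> k) l (e \<triangleleft> g))"
  proof -
    have "t g (t h (w k l (e \<triangleleft> g \<triangleleft> h)) \<cdot> w h (k \<odot> l) (e \<triangleleft> g)) =
        t g (b h k l (e \<triangleleft> g) \<cdot> w h k (e \<triangleleft> g) \<cdot> w (h \<odot> k) l (e \<triangleleft> g))"
      unfolding B1(3) ..
    then show ?thesis using t_mult[OF G(1)] dd(1) T1(1-4) B1(1) tb by simp
  qed
  have e2: "t g (w (h \<odot> k) l (e \<triangleleft> g)) \<cdot> w g (h \<odot> (k \<odot> l)) e = b g (h \<odot> k) l e \<cdot> w g (h \<odot> k) e \<cdot> w (g \<odot> h \<odot> k) l e"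
    using B2(3) unfolding ass .
  have wm: "w k l (e \<triangleleft> (g \<odot> h)) \<in> at (e \<triangleleft> (g \<odot> h))" using T5(6) .
  have e5: "t g (t h (w k l (e \<triangleleft> g \<triangleleft> h))) \<cdot> w g h e = w g h e \<cdot> t (g \<odot> h) (w k l (e \<triangleleft> (g \<odot> h)))"
    unfolding ii by (rule twistsD(3)[OF w G(1,2) e(1) F(8) wm])
  have p1: "t g (t h (w k l (e \<triangleleft> g \<triangleleft> h))) \<in> at e" using dd(2) T1(1) by simp
  have cen: "c \<cdot> a = a \<cdot> c" if "c \<in> center A" "a \<in> at e" for c a
    using center_commute that atD by auto
  show "act g (b h k l (e \<triangleleft> g)) \<cdot> b g (h \<odot> k) l e \<cdot> b g h k e = b g h (k \<odot> l) e \<cdot> b (g \<odot> h) k l e"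
    by (rule H.associator_words[unfolded H(1) mult_grp_at, OF p1 dd(2)[OF T1(2)] T4(2) dd(2)[OF T1(4)] dd(2)[OF T1(3)]
        T2(4) T5(3) T3(4) T3(3) T4(3) T5(1) b1 B2(1) B3(1) B4(1) B5(1)
        cen[OF B2(2)] cen[OF B3(2)] cen[OF B4(2)] cen[OF B5(2)] e1 e2 B3(3) B4(3) e5 B5(3)])
qed

text \<open>The law of \<psi> gives an equivalence of \<theta>_g \<theta>_h \<chi> with \<theta>_gh
  \<chi>, where \<chi> belongs to h^-1. As \<chi> maps onto \<open>D (\<iota> h)\<close>, every
  \<open>a\<close> in question is a value of \<chi>, so the conjugating family also compares
  \<theta>_g \<theta>_h with \<theta>_gh at \<open>a\<close>.\<close>

lemma twists_exists: "\<exists>w. twists w"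
proof -
  have ex: "\<exists>u. sect (P2 g h) u \<and> (\<forall>e \<in> idems A \<inter> P2 g h. \<forall>a \<in> at (e \<triangleleft> (g \<odot> h)).
      t g (t h a) \<cdot> u e = u e \<cdot> t (g \<odot> h) a)" if G: "g \<in> carrier G" "h \<in> carrier G" for g h
  proof -
    let ?\<chi> = "rep (\<iota> h)"
    have gg: "g \<odot> h \<in> carrier G" "\<iota> h \<in> carrier G" using G by auto
    have i: "ideal_iso A (D h) (D (\<iota> h)) ?\<chi>" using psi_iso[OF gg(2) rep[OF gg(2)]] G by simp
    note Q = ideal_iso_appl[OF i]
    have s: "(\<theta> g \<circ>\<^sub>m \<theta> h \<circ>\<^sub>m ?\<chi>, \<theta> (g \<odot> h) \<circ>\<^sub>m ?\<chi>) \<in> sim A"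
      by (rule psi_mult_right[OF G reps[OF G(1)] reps[OF G(2)] rep[OF gg(2)] reps[OF gg(1)]])
    note c = ideal_iso_comp[OF t_iso[OF gg(1)] i]
    from s obtain I J u where i2: "ideal_iso A I J (\<theta> (g \<odot> h) \<circ>\<^sub>m ?\<chi>)" and u: "sect J u" and
      cj: "\<And>s. s \<in> I \<Longrightarrow> the ((\<theta> g \<circ>\<^sub>m \<theta> h \<circ>\<^sub>m ?\<chi>) s) = u (\<epsilon> (the ((\<theta> (g \<odot> h) \<circ>\<^sub>m ?\<chi>) s))) \<cdot>
        the ((\<theta> (g \<odot> h) \<circ>\<^sub>m ?\<chi>) s) \<cdot> (u (\<epsilon> (the ((\<theta> (g \<odot> h) \<circ>\<^sub>m ?\<chi>) s))))\<^sup>\<dagger>"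
      by (rule simD) blast
    have I: "I = {a \<in> D h. the (?\<chi> a) \<in> D (\<iota> (g \<odot> h))}"
      and J: "J = t (g \<odot> h) ` (D (\<iota> (g \<odot> h)) \<inter> D (\<iota> h))"
      using ideal_iso_appl(3,4)[OF c] ideal_iso_appl(3,4)[OF i2] by simp_all
    \<comment> \<open>The family is defined on the range of the composite. It reaches all of
      \<open>P2 g h\<close>, since a preimage under \<theta>_gh of an element there lies in the
      domain of \<theta>_h as well.\<close>
    have J2: "P2 g h \<subseteq> J"
    proof
      fix x assume x: "x \<in> P2 g h"
      then have xc: "x \<in> carrier A" using D_carrier G by auto
      have ex: "\<epsilon> x \<in> idems A" "\<epsilon> x \<in> P2 g h" "x \<in> at (\<epsilon> x)"
        using x xc D_eps[of _ x] G by (auto simp: at_def)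
      obtain a where a: "a \<in> at (\<epsilon> x \<triangleleft> (g \<odot> h))" "t (g \<odot> h) a = x"
        by (rule t_surj[OF gg(1) ex(1) _ ex(3)]) (use ex in auto)
      then show "x \<in> J" unfolding J using at_tt(5,7)[OF G ex(1,2) a(1)] by blast
    qed
    have "sect (P2 g h) u"
      by (rule sect_ideal_restrict[OF ideal_iso_appl(2)[OF i2] P_ideal(1)[OF G] J2 u])
    moreover have "t g (t h a) \<cdot> u e = u e \<cdot> t (g \<odot> h) a"
      if e: "e \<in> idems A" "e \<in> P2 g h" and a: "a \<in> at (e \<triangleleft> (g \<odot> h))" for e a
    proof -
      note T = at_tt[OF G e a]
      obtain s where s: "s \<in> D h" "the (?\<chi> s) = a" using Q(9)[OF T(5)] by blast
      have sI: "s \<in> I" using s T(7) I by auto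
      have v: "?\<chi> s = Some a" "\<theta> h a = Some (t h a)" "\<theta> g (t h a) = Some (t g (t h a))"
        "\<theta> (g \<odot> h) a = Some (t (g \<odot> h) a)"
        using Q(5)[OF s(1)] s(2) ideal_iso_appl(5)[OF t_iso] T(5-7) G by auto
      have v1: "the ((\<theta> g \<circ>\<^sub>m \<theta> h \<circ>\<^sub>m ?\<chi>) s) = t g (t h a)"
        using v(1) map_comp_simps(2)[of "\<theta> h" a, OF v(2), of "\<theta> g"] by (simp add: map_comp_def)
      have v2: "the ((\<theta> (g \<odot> h) \<circ>\<^sub>m ?\<chi>) s) = t (g \<odot> h) a"
        using v(1) by (simp add: map_comp_def)
      have ue: "u e \<in> at e" by (rule sect_at[OF ideal_subsemigrp[OF ideal_iso_appl(2)[OF i2]] u]) (use J2 e in auto)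
      have "t g (t h a) = u e \<cdot> t (g \<odot> h) a \<cdot> (u e)\<^sup>\<dagger>"
        using cj[OF sI] v1 v2 atD(2)[OF T(4)] by simp
      then show ?thesis using T(4) ue atD[OF ue] atD[OF T(4)] at_unit(2)[OF T(4)] by (simp add: assoc closed)
    qed
    ultimately show ?thesis by blast
  qed
  define w where "w g h = (SOME u. sect (P2 g h) u \<and> (\<forall>e \<in> idems A \<inter> P2 g h. \<forall>a \<in> at (e \<triangleleft> (g \<odot> h)).
      t g (t h a) \<cdot> u e = u e \<cdot> t (g \<odot> h) a))" for g h
  have "twists w"
    unfolding twists_def using someI_ex[OF ex] unfolding w_def[symmetric] by simp
  then show ?thesis by blast
qed

text \<open>Central factors slip through the twisting equation, and in the associator equation the
  four values of \<open>z\<close> can be collected in front, where they form the coboundary.\<close>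

lemma twists_scale:
  assumes w: "twists w" and b: "associates w b" and z: "central2 z"
  shows "twists (\<lambda>g h e. z g h e \<cdot> w g h e)"
    "associates (\<lambda>g h e. z g h e \<cdot> w g h e) (\<lambda>g h k e. b g h k e \<cdot> dz z g h k e)"
proof -
  show "twists (\<lambda>g h e. z g h e \<cdot> w g h e)"
    unfolding twists_def
  proof (intro ballI conjI)
    fix g h assume G: "g \<in> carrier G" "h \<in> carrier G"
    note I = ideal_subsemigrp[OF P_ideal(1)[OF G]]
    show "sect (P2 g h) (\<lambda>e. z g h e \<cdot> w g h e)"
      by (rule sect_mult[OF I central2_sect(1)[OF z G] twistsD(1)[OF w G]])
    fix e a assume "e \<in> idems A \<inter> P2 g h" and a: "a \<in> at (e \<triangleleft> (g \<odot> h))"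
    then have e: "e \<in> idems A" "e \<in> P2 g h" by auto
    note W = twistsD[OF w G] and Z = central2_sect[OF z G] and T = at_tt[OF G e a]
    have c: "z g h e \<in> carrier A" "w g h e \<in> carrier A" "t g (t h a) \<in> carrier A" "t (g \<odot> h) a \<in> carrier A"
      using W(2)[OF e] Z(2)[OF e] T atD by auto
    have "t g (t h a) \<cdot> (z g h e \<cdot> w g h e) = z g h e \<cdot> (t g (t h a) \<cdot> w g h e)"
      using center_commute[OF Z(3)[OF e] c(3)] c by (simp flip: assoc)
    then show "t g (t h a) \<cdot> (z g h e \<cdot> w g h e) = z g h e \<cdot> w g h e \<cdot> t (g \<odot> h) a"
      using W(3)[OF e a] c by (simp add: assoc)
  qed
  show "associates (\<lambda>g h e. z g h e \<cdot> w g h e) (\<lambda>g h k e. b g h k e \<cdot> dz z g h k e)"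
    unfolding associates_def
  proof (intro ballI conjI)
    fix g h k e assume G: "g \<in> carrier G" "h \<in> carrier G" "k \<in> carrier G" and "e \<in> idems A \<inter> P3 g h k"
    then have e: "e \<in> idems A" "e \<in> P3 g h k" by auto
    note B = associatesD[OF b G e] and F = twist_faces[OF w G e] and d = dz_at[OF z G e] and E = P3_faces[OF G e]
    show "b g h k e \<cdot> dz z g h k e \<in> at e" "b g h k e \<cdot> dz z g h k e \<in> center A"
      using B d by (auto intro: center_mult)
    have Z: "z h k (e \<triangleleft> g) \<in> at (e \<triangleleft> g)" "z h k (e \<triangleleft> g) \<in> center A"
      "z (g \<odot> h) k e \<in> at e" "z (g \<odot> h) k e \<in> center A" "z g (h \<odot> k) e \<in> at e" "z g (h \<odot> k) e \<in> center A"
      "z g h e \<in> at e" "z g h e \<in> center A"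
      using central2_sect[OF z] E G e by auto
    define z1 z2 z3 z4 where zd: "z1 = act g (z h k (e \<triangleleft> g))" "z2 = z g (h \<odot> k) e" "z3 = z g h e" "z4 = z (g \<odot> h) k e"
    define w1 w2 w3 w4 where wd: "w1 = t g (w h k (e \<triangleleft> g))" "w2 = w g (h \<odot> k) e" "w3 = w g h e" "w4 = w (g \<odot> h) k e"
    have za: "z1 \<in> at e" "z2 \<in> at e" "z3 \<in> at e" "z4 \<in> at e" "z1 \<in> center A" "z2 \<in> center A" "z3 \<in> center A" "z4 \<in> center A"
      using Z d by (auto simp: zd)
    have wa: "w1 \<in> at e" "w2 \<in> at e" "w3 \<in> at e" "w4 \<in> at e" using F by (auto simp: wd)
    note zc = za(1-4)[THEN atD(1)] and wc = wa[THEN atD(1)]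
    have tz: "t g (z h k (e \<triangleleft> g) \<cdot> w h k (e \<triangleleft> g)) = z1 \<cdot> w1"
      using t_mult[OF G(1)] at_t(1)[OF G(1) e(1) E(6) Z(1)] F(5) t_act[OF G(1) Z(2)] by (simp add: zd wd)
    have bc: "b g h k e \<in> carrier A" using B(1) atD by auto
    have bz: "b g h k e \<cdot> dz z g h k e = z1 \<cdot> z2 \<cdot> (z3\<^sup>\<dagger> \<cdot> z4\<^sup>\<dagger>) \<cdot> b g h k e"
    proof -
      have "z4\<^sup>\<dagger> \<cdot> z2 \<cdot> z3\<^sup>\<dagger> = z2 \<cdot> (z3\<^sup>\<dagger> \<cdot> z4\<^sup>\<dagger>)"
        using center_commute[OF center_sinv[OF za(8)], of "z2 \<cdot> z3\<^sup>\<dagger>"] zc by (simp add: assoc closed)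
      then have "dz z g h k e = z1 \<cdot> z2 \<cdot> (z3\<^sup>\<dagger> \<cdot> z4\<^sup>\<dagger>)"
        unfolding dz_def zd[symmetric] using zc by (simp add: assoc closed)
      then show ?thesis using center_commute[OF B(2)] zc closed by simp
    qed
    have "z1 \<cdot> w1 \<cdot> (z2 \<cdot> w2) = z1 \<cdot> (w1 \<cdot> z2) \<cdot> w2" using zc wc by (simp add: assoc closed)
    also have "\<dots> = z1 \<cdot> z2 \<cdot> (w1 \<cdot> w2)"
      unfolding center_commute[OF za(6) wc(1), symmetric] using zc wc by (simp add: assoc closed)
    also have "\<dots> = z1 \<cdot> z2 \<cdot> (b g h k e \<cdot> w3 \<cdot> w4)" using B(3) unfolding wd by simp
    finally have L: "z1 \<cdot> w1 \<cdot> (z2 \<cdot> w2) = z1 \<cdot> z2 \<cdot> (b g h k e \<cdot> w3 \<cdot> w4)" .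
    have k: "(z3\<^sup>\<dagger> \<cdot> z4\<^sup>\<dagger>) \<cdot> (z4 \<cdot> z3) = e"
      using za(3,4) zc at_unit idems_closed[OF e(1)] atD(2)[OF za(3)] atD(2)[OF za(4)] by (simp add: assoc closed)
    have "z3 \<cdot> w3 \<cdot> (z4 \<cdot> w4) = z4 \<cdot> (z3 \<cdot> w3) \<cdot> w4" using center_commute[OF za(8), of "z3 \<cdot> w3"] zc wc by (simp add: assoc closed)
    then have "z1 \<cdot> z2 \<cdot> (z3\<^sup>\<dagger> \<cdot> z4\<^sup>\<dagger>) \<cdot> b g h k e \<cdot> (z3 \<cdot> w3) \<cdot> (z4 \<cdot> w4)
        = z1 \<cdot> z2 \<cdot> (z3\<^sup>\<dagger> \<cdot> z4\<^sup>\<dagger>) \<cdot> (b g h k e \<cdot> (z4 \<cdot> z3)) \<cdot> w3 \<cdot> w4" using zc wc bc by (simp add: assoc closed)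
    also have "\<dots> = z1 \<cdot> z2 \<cdot> ((z3\<^sup>\<dagger> \<cdot> z4\<^sup>\<dagger>) \<cdot> (z4 \<cdot> z3)) \<cdot> b g h k e \<cdot> w3 \<cdot> w4"
      using center_commute[OF B(2), of "z4 \<cdot> z3"] zc wc bc by (simp add: assoc closed)
    also have "\<dots> = z1 \<cdot> z2 \<cdot> (b g h k e \<cdot> w3 \<cdot> w4)"
      unfolding k using zc wc bc at_unit[OF B(1)] at_unit(2)[OF za(2)] idems_closed[OF e(1)]
      by (simp add: assoc closed)
    finally have R: "z1 \<cdot> z2 \<cdot> (z3\<^sup>\<dagger> \<cdot> z4\<^sup>\<dagger>) \<cdot> b g h k e \<cdot> (z3 \<cdot> w3) \<cdot> (z4 \<cdot> w4) = z1 \<cdot> z2 \<cdot> (b g h k e \<cdot> w3 \<cdot> w4)" .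
    show "t g (z h k (e \<triangleleft> g) \<cdot> w h k (e \<triangleleft> g)) \<cdot> (z g (h \<odot> k) e \<cdot> w g (h \<odot> k) e) =
       b g h k e \<cdot> dz z g h k e \<cdot> (z g h e \<cdot> w g h e) \<cdot> (z (g \<odot> h) k e \<cdot> w (g \<odot> h) k e)"
      unfolding tz bz zd(2-4)[symmetric] wd(2-4)[symmetric] L R ..
  qed
qed

text \<open>At each idempotent both twistings conjugate a value of \<theta>_gh to the same value of
  \<theta>_g \<theta>_h; hence their quotient commutes with these values, which fill the maximal
  subgroup.\<close>

lemma twists_difference:
  assumes w: "twists w" and w': "twists w'"
  obtains z where "central2 z"
    "\<And>g h e. \<lbrakk>g \<in> carrier G; h \<in> carrier G; e \<in> idems A; e \<in> P2 g h\<rbrakk> \<Longrightarrow> w' g h e = z g h e \<cdot> w g h e"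
proof
  let ?z = "\<lambda>g h e. w' g h e \<cdot> (w g h e)\<^sup>\<dagger>"
  show eq: "w' g h e = ?z g h e \<cdot> w g h e" if "g \<in> carrier G" "h \<in> carrier G" "e \<in> idems A" "e \<in> P2 g h" for g h e
  proof -
    have "w g h e \<in> at e" "w' g h e \<in> at e" using twistsD(2) w w' that by auto
    then show ?thesis using atD at_unit(2)[of "w' g h e" e] by (simp add: assoc)
  qed
  have s: "sect (P2 g h) (?z g h)" if G: "g \<in> carrier G" "h \<in> carrier G" for g h
    using sect_mult sect_sinv twistsD(1)[OF w G] twistsD(1)[OF w' G] ideal_subsemigrp[OF P_ideal(1)[OF G]] by simp
  show "central2 ?z"
  proof (rule central2I[OF s])
    fix g h e assume G: "g \<in> carrier G" "h \<in> carrier G" and e: "e \<in> idems A" "e \<in> P2 g h"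
    show "?z g h e \<in> center A"
    proof (rule sect_central[OF P_ideal(1)[OF G] s[OF G] _ e(2,1)])
      fix e T assume e: "e \<in> P2 g h" "e \<in> idems A" and T: "T \<in> at e"
      interpret H: group "grp_at e" by (rule group_grp_at[OF e(2)])
      note H = at_is_group(2,3)[OF e(2)]
      have W: "w g h e \<in> at e" "w' g h e \<in> at e" using twistsD(2) w w' G e by auto
      \<comment> \<open>Chosen so that a preimage of \<open>x\<close> under \<theta>_gh is sent by
        \<theta>_g \<theta>_h to the given \<open>T\<close>.\<close>
      define x where "x = (w g h e)\<^sup>\<dagger> \<cdot> T \<cdot> w g h e"
      have x: "x \<in> at e" using W T by (simp add: x_def)
      obtain y where y: "y \<in> at (e \<triangleleft> (g \<odot> h))" "t (g \<odot> h) y = x"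
        by (rule t_surj[OF _ e(2) _ x, of "g \<odot> h"]) (use G e in auto)
      note Y = at_tt[OF G e(2,1) y(1)]
      note t1 = twistsD(3)[OF w G e(2,1) y(1)] and t2 = twistsD(3)[OF w' G e(2,1) y(1)]
      have "w g h e \<cdot> x = T \<cdot> w g h e"
        unfolding x_def using W(1) T atD[OF W(1)] atD[OF T] at_unit[OF T] by (simp add: assoc closed flip: assoc)
      then have "t g (t h y) = T" using t1 y(2) at_r_cancel[OF Y(3) T W(1)] by simp
      then show "?z g h e \<cdot> T = T \<cdot> ?z g h e"
        using H.commute_of_same_conjugation[of T "w' g h e" "w g h e" x "?z g h e"] t1 t2 y(2) W T x eq[OF G e(2,1)]
        unfolding H mult_grp_at by simp
    qed
  qed
qed

text \<open>New representatives are conjugates n_g \<theta>_g n_g^-1 of the old ones. The twisting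
  can be adjusted to them so that the associator stays literally the same; only a later change of
  the twisting itself produces a coboundary.\<close>

lemma twists_change_reps:
  assumes w: "twists w" and b: "associates w b" and \<theta>': "kernel_reps A G \<psi> \<theta>'"
  shows "\<exists>v. kernel_reps.twists A G \<psi> \<theta>' v \<and> kernel_reps.associates A G \<psi> \<theta>' v b"
proof -
  interpret R': kernel_reps A G \<psi> \<theta>' by (rule \<theta>')
  have "\<exists>n. sect (D g) n \<and> (\<forall>a \<in> D (\<iota> g). R'.t g a = n (\<epsilon> (t g a)) \<cdot> t g a \<cdot> (n (\<epsilon> (t g a)))\<^sup>\<dagger>)"
    if g: "g \<in> carrier G" for g
  proof -
    obtain I J u where i: "ideal_iso A I J (\<theta>' g)" "ideal_iso A I J (\<theta> g)" "sect J u"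
      "\<And>s. s \<in> I \<Longrightarrow> R'.t g s = u (\<epsilon> (t g s)) \<cdot> t g s \<cdot> (u (\<epsilon> (t g s)))\<^sup>\<dagger>"
      by (rule simD[OF psi_sim[OF g R'.reps[OF g] reps[OF g]]]) blast
    have "I = D (\<iota> g)" "J = D g"
      using ideal_iso_appl(3,4)[OF i(2)] ideal_iso_appl(3,4)[OF t_iso[OF g]] by simp_all
    then show ?thesis using i by blast
  qed
  then obtain n where n: "\<And>g. g \<in> carrier G \<Longrightarrow> sect (D g) (n g)"
    and tn: "\<And>g a. \<lbrakk>g \<in> carrier G; a \<in> D (\<iota> g)\<rbrakk> \<Longrightarrow> R'.t g a = n g (\<epsilon> (t g a)) \<cdot> t g a \<cdot> (n g (\<epsilon> (t g a)))\<^sup>\<dagger>"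
    by metis
  have na: "n g e \<in> at e" if "g \<in> carrier G" "e \<in> idems A" "e \<in> D g" for g e
    by (rule sect_at[OF ideal_subsemigrp[OF D_ideal] n]) (use that in auto)
  have tn': "R'.t g a = n g e \<cdot> t g a \<cdot> (n g e)\<^sup>\<dagger>" if "g \<in> carrier G" "e \<in> idems A" "e \<in> D g" "a \<in> at (e \<triangleleft> g)" for g e a
    using tn[of g a] at_t[OF that] atD(2)[OF at_t(2)[OF that]] that by simp
  \<comment> \<open>This is the formula forced by \<theta>'_g \<theta>'_h: n_g and \<theta>_g(n_h)
    come from the two conjugations, and n_gh is removed on the right to return to
    \<theta>'_gh.\<close>
  define v where "v g h e = n g e \<cdot> t g (n h (e \<triangleleft> g)) \<cdot> w g h e \<cdot> (n (g \<odot> h) e)\<^sup>\<dagger>" for g h e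
  have tw: "R'.twists v"
    unfolding R'.twists_def
  proof (intro ballI conjI)
    fix g h assume G: "g \<in> carrier G" "h \<in> carrier G"
    have gh: "g \<odot> h \<in> carrier G" using G by simp
    note I = P_ideal(1)[OF G]
    note sI = ideal_subsemigrp[OF I]
    have 1: "sect (P2 g h) (n g)" "sect (P2 g h) (n (g \<odot> h))"
      by (rule sect_ideal_restrict[OF D_ideal[OF G(1)] I _ n[OF G(1)]], simp)
         (rule sect_ideal_restrict[OF D_ideal[OF gh] I _ n[OF gh]], simp)
    have 2: "sect (P2 g h) (\<lambda>e. t g (n h (e \<triangleleft> g)))"
      by (rule sect_t[OF G(1) I _ D_ideal[OF G(2)] _ n[OF G(2)]]) (use idr_D G in auto)
    show "sect (P2 g h) (v g h)"
      unfolding v_def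
      by (rule sect_mult[OF sI sect_mult[OF sI sect_mult[OF sI 1(1) 2] twistsD(1)[OF w G]] sect_sinv[OF sI 1(2)]])
    fix e a assume "e \<in> idems A \<inter> P2 g h" and a: "a \<in> at (e \<triangleleft> (g \<odot> h))"
    then have e: "e \<in> idems A" "e \<in> P2 g h" "e \<in> D g" "e \<in> D (g \<odot> h)" by auto
    interpret H: group "grp_at e" by (rule group_grp_at[OF e(1)])
    note H = at_is_group(2,3)[OF e(1)]
    have eg: "e \<triangleleft> g \<in> idems A" "e \<triangleleft> g \<in> D h" using idr_closed idr_D G e by auto
    note T = at_tt[OF G e(1,2) a]
    have nh: "n h (e \<triangleleft> g) \<in> at (e \<triangleleft> g)" by (rule na[OF G(2) eg])
    have t1: "R'.t h a = n h (e \<triangleleft> g) \<cdot> t h a \<cdot> (n h (e \<triangleleft> g))\<^sup>\<dagger>" by (rule tn'[OF G(2) eg T(1)])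
    have "R'.t h a \<in> at (e \<triangleleft> g)" unfolding t1 using nh T(2) by simp
    then have "R'.t g (R'.t h a) = n g e \<cdot> t g (R'.t h a) \<cdot> (n g e)\<^sup>\<dagger>" by (rule tn'[OF G(1) e(1,3)])
    moreover have "t g (R'.t h a) = t g (n h (e \<triangleleft> g)) \<cdot> t g (t h a) \<cdot> (t g (n h (e \<triangleleft> g)))\<^sup>\<dagger>"
      unfolding t1 using at_t(1)[OF G(1) e(1,3)] nh T(2) t_mult[OF G(1)] t_sinv[OF G(1)] by simp
    ultimately have t2: "R'.t g (R'.t h a) = n g e \<cdot> (t g (n h (e \<triangleleft> g)) \<cdot> t g (t h a) \<cdot> (t g (n h (e \<triangleleft> g)))\<^sup>\<dagger>) \<cdot> (n g e)\<^sup>\<dagger>"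
      by simp
    have t3: "R'.t (g \<odot> h) a = n (g \<odot> h) e \<cdot> t (g \<odot> h) a \<cdot> (n (g \<odot> h) e)\<^sup>\<dagger>"
      by (rule tn'[OF gh e(1,4) a])
    have c: "n g e \<in> at e" "t g (n h (e \<triangleleft> g)) \<in> at e" "w g h e \<in> at e" "n (g \<odot> h) e \<in> at e"
      using na[OF G(1) e(1,3)] na[OF gh e(1,4)] at_t(2)[OF G(1) e(1,3) nh] twistsD(2)[OF w G e(1,2)] by auto
    show "R'.t g (R'.t h a) \<cdot> v g h e = v g h e \<cdot> R'.t (g \<odot> h) a"
      unfolding t2 t3 v_def
      using H.twist_words_change[unfolded H(1) mult_grp_at, OF c(1,2) T(3) c(3,4) T(4) twistsD(3)[OF w G e(1,2) a]] c
      by (simp add: H(2))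
  qed
  have "R'.associates v b"
    unfolding R'.associates_def
  proof (intro ballI conjI)
    fix g h k e assume G: "g \<in> carrier G" "h \<in> carrier G" "k \<in> carrier G" and "e \<in> idems A \<inter> P3 g h k"
    then have e: "e \<in> idems A" "e \<in> P3 g h k" by auto
    interpret H: group "grp_at e" by (rule group_grp_at[OF e(1)])
    note H = at_is_group(2,3)[OF e(1)]
    note B = associatesD[OF b G e] and F = twist_faces[OF w G e] and E = P3_faces[OF G e]
    show "b g h k e \<in> at e" "b g h k e \<in> center A" by (rule B)+
    have gg: "g \<odot> h \<in> carrier G" "h \<odot> k \<in> carrier G" "g \<odot> h \<odot> k \<in> carrier G" "g \<odot> (h \<odot> k) = g \<odot> h \<odot> k"
      using G by (auto simp: G.m_assoc)
    have eD: "e \<in> D (g \<odot> h)" "e \<in> D (g \<odot> h \<odot> k)" "e \<in> D g" using e by auto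
    have egD: "e \<triangleleft> g \<in> D h" "e \<triangleleft> g \<in> D (h \<odot> k)" using E(2) by auto
    have egh: "e \<triangleleft> g \<triangleleft> h = e \<triangleleft> (g \<odot> h)" by (rule idr_idr[OF G(1,2) e(1)]) (use e in auto)
    have eghD: "e \<triangleleft> (g \<odot> h) \<in> idems A" "e \<triangleleft> (g \<odot> h) \<in> D k"
      using idr_closed(1)[OF gg(1) e(1) eD(1)] idr_D[OF gg(1) G(3) e(1) eD(1,2)] by auto
    have nk: "n k (e \<triangleleft> (g \<odot> h)) \<in> at (e \<triangleleft> (g \<odot> h))" by (rule na[OF G(3) eghD])
    note T = at_tt[OF G(1,2) e(1) E(5) nk]
    have N: "n h (e \<triangleleft> g) \<in> at (e \<triangleleft> g)" "n (h \<odot> k) (e \<triangleleft> g) \<in> at (e \<triangleleft> g)"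
      using na[OF G(2) E(1) egD(1)] na[OF gg(2) E(1) egD(2)] by auto
    have v1: "v h k (e \<triangleleft> g) = n h (e \<triangleleft> g) \<cdot> t h (n k (e \<triangleleft> (g \<odot> h))) \<cdot> w h k (e \<triangleleft> g) \<cdot> (n (h \<odot> k) (e \<triangleleft> g))\<^sup>\<dagger>"
      by (simp add: v_def egh)
    have "v h k (e \<triangleleft> g) \<in> at (e \<triangleleft> g)" unfolding v1 using N T(2) F(6) by simp
    then have "R'.t g (v h k (e \<triangleleft> g)) = n g e \<cdot> t g (v h k (e \<triangleleft> g)) \<cdot> (n g e)\<^sup>\<dagger>"
      by (rule tn'[OF G(1) e(1) E(6)])
    moreover have "t g (v h k (e \<triangleleft> g)) = t g (n h (e \<triangleleft> g)) \<cdot> t g (t h (n k (e \<triangleleft> (g \<odot> h)))) \<cdot>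
      t g (w h k (e \<triangleleft> g)) \<cdot> (t g (n (h \<odot> k) (e \<triangleleft> g)))\<^sup>\<dagger>"
      unfolding v1 using at_t(1)[OF G(1) e(1) E(6)] N T(2) F(6) t_mult[OF G(1)] t_sinv[OF G(1)] by simp
    ultimately have t1: "R'.t g (v h k (e \<triangleleft> g)) = n g e \<cdot> (t g (n h (e \<triangleleft> g)) \<cdot> t g (t h (n k (e \<triangleleft> (g \<odot> h)))) \<cdot>
      t g (w h k (e \<triangleleft> g)) \<cdot> (t g (n (h \<odot> k) (e \<triangleleft> g)))\<^sup>\<dagger>) \<cdot> (n g e)\<^sup>\<dagger>"
      by simp
    have c: "n g e \<in> at e" "t g (n h (e \<triangleleft> g)) \<in> at e" "t (g \<odot> h) (n k (e \<triangleleft> (g \<odot> h))) \<in> at e" "n (g \<odot> h) e \<in> at e"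
      "n (g \<odot> h \<odot> k) e \<in> at e" "t g (n (h \<odot> k) (e \<triangleleft> g)) \<in> at e"
      using na[OF G(1) e(1) E(6)] na[OF gg(1) e(1) eD(1)] na[OF gg(3) e(1) eD(2)] at_t(2)[OF G(1) e(1) E(6)] N T(4) by auto
    have cen: "b g h k e \<cdot> a = a \<cdot> b g h k e" if "a \<in> at e" for a
      using center_commute[OF B(2)] that atD by auto
    show "R'.t g (v h k (e \<triangleleft> g)) \<cdot> v g (h \<odot> k) e = b g h k e \<cdot> v g h e \<cdot> v (g \<odot> h) k e"
      unfolding t1 unfolding v_def gg(4)
      using H.associator_words_change[unfolded H(1) mult_grp_at, OF c(1,2) T(3) c(3,4,5,6) F(1,2,4,3) B(1) cen B(3)
          twistsD(3)[OF w G(1,2) e(1) E(5) nk]] c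
      by (simp add: H(2))
  qed
  then show ?thesis using tw by blast
qed

end

section \<open>Obstructions\<close>

context semilattice_of_groups
begin

lemma ideal_carrier: "ideal_of S (carrier S)"
  using nonempty by (auto simp: ideal_of_def closed)

lemma ideal_prod2: "\<lbrakk>ideal_of S I; ideal_of S J\<rbrakk> \<Longrightarrow> ideal_prod S [I, J] = I \<inter> J"
  using mult_set_inter[OF ideal_subsemigrp[OF ideal_carrier], of I J] ideal_ofD(2)[of S I] ideal_ofD(2)[of S J]
  by (simp add: Int_absorb1 Int_assoc[symmetric])

lemma ideal_prod3:
  "\<lbrakk>ideal_of S I; ideal_of S J; ideal_of S L\<rbrakk> \<Longrightarrow> ideal_prod S [I, J, L] = I \<inter> (J \<inter> L)"
  using ideal_prod2[of I "J \<inter> L"] ideal_prod2[of J L] ideal_inter[of J L] by simp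

text \<open>The exponents in a coboundary are the integers 1 and -1; on an element over
  \<open>e\<close> such a power multiplies by the value at \<open>e\<close> or by its
  inverse.\<close>

lemma ract_power_mk_mult:
  assumes T: "inverse_subsemigrp S T" and u: "sect T u" and s: "s \<in> T" "\<epsilon> s = e"
  shows "ract s (mk_mult T u) = s \<cdot> u e" "ract s (mk_mult T u [^]\<^bsub>MM T\<^esub> (1::int)) = s \<cdot> u e"
    "ract s (mk_mult T u [^]\<^bsub>MM T\<^esub> (- 1::int)) = s \<cdot> (u e)\<^sup>\<dagger>"
proof -
  interpret monoid "MM T" by (rule monoid_MM[OF T])
  note c = mk_mult_closed[OF T u]
  have p: "mk_mult T u [^]\<^bsub>MM T\<^esub> (1::nat) = mk_mult T u"
    using l_one[OF c] by (simp del: mult_monoid_simps)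
  have "mk_mult T u [^]\<^bsub>MM T\<^esub> (1::int) = mk_mult T u"
    "mk_mult T u [^]\<^bsub>MM T\<^esub> (- 1::int) = mk_mult T (\<lambda>e. (u e)\<^sup>\<dagger>)"
    using p mk_mult_sinv(2)[OF T u] by (simp_all add: int_pow_def Let_def)
  then show "ract s (mk_mult T u) = s \<cdot> u e" "ract s (mk_mult T u [^]\<^bsub>MM T\<^esub> (1::int)) = s \<cdot> u e"
    "ract s (mk_mult T u [^]\<^bsub>MM T\<^esub> (- 1::int)) = s \<cdot> (u e)\<^sup>\<dagger>"
    using s by (simp_all add: mk_mult_def)
qed

lemma mk_mult_eq_iff:
  assumes T: "inverse_subsemigrp S T" and u: "sect T u" and v: "sect T v"
  shows "mk_mult T u = mk_mult T v \<longleftrightarrow> (\<forall>e \<in> T \<inter> idems S. u e = v e)"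
  using fst_mk_mult[OF T u] fst_mk_mult[OF T v] mk_mult_cong[OF T, of u v] by (metis Int_iff)

end

context kernel_reps
begin

lemma t_D:
  assumes "g \<in> carrier G" "h \<in> carrier G" "a \<in> D (\<iota> g)" "a \<in> D h"
  shows "t g a \<in> D (g \<odot> h)"
proof -
  have "\<epsilon> a \<in> D (\<iota> g)" "\<epsilon> a \<in> D h" "a \<in> carrier A"
    using D_eps[of "\<iota> g" a] D_eps[of h a] D_carrier[of h a] assms by auto
  then have "\<epsilon> (t g a) \<in> D (g \<odot> h)"
    unfolding t_eps[OF assms(1,3)] using act_D[OF assms(1,2), of "\<epsilon> a"] idems_center by simp
  then show ?thesis using D_eps t_closed assms by simp
qed

lemma twisting_twists:
  assumes W: "twisting A G \<psi> \<theta> W"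
  shows "twists (\<lambda>g h. fst (W g h))"
    "\<lbrakk>g \<in> carrier G; h \<in> carrier G\<rbrakk> \<Longrightarrow> W g h \<in> Units (MM (P2 g h))"
proof -
  have 1: "W g h \<in> Units (MM (P2 g h))"
    "\<lbrakk>a \<in> D (\<iota> h); a \<in> D (\<iota> h \<odot> \<iota> g)\<rbrakk> \<Longrightarrow> t g (t h a) = mconj (A\<lparr>carrier := P2 g h\<rparr>) (W g h) (t (g \<odot> h) a)"
    if G: "g \<in> carrier G" "h \<in> carrier G" for g h a
    using W G ideal_prod2 D_ideal unfolding twisting_def Let_def
    by (metis G.m_closed, metis G.inv_closed G.m_closed IntI)
  then show "\<lbrakk>g \<in> carrier G; h \<in> carrier G\<rbrakk> \<Longrightarrow> W g h \<in> Units (MM (P2 g h))" by blast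
  show "twists (\<lambda>g h. fst (W g h))"
    unfolding twists_def
  proof (intro ballI conjI)
    fix g h assume G: "g \<in> carrier G" "h \<in> carrier G"
    note I = P_ideal(1)[OF G]
    note sI = ideal_subsemigrp[OF I]
    note u = Units_MM[OF sI 1(1)[OF G]]
    show "sect (P2 g h) (fst (W g h))" by (rule u)
    fix e a assume "e \<in> idems A \<inter> P2 g h" and a: "a \<in> at (e \<triangleleft> (g \<odot> h))"
    then have e: "e \<in> idems A" "e \<in> P2 g h" by auto
    note T = at_tt[OF G e a]
    let ?x = "t (g \<odot> h) a" and ?u = "fst (W g h) e"
    have x: "?x \<in> P2 g h" by (rule at_ideal[OF I T(4) e(2)])
    have ue: "?u \<in> at e" by (rule sect_at[OF sI u(1) e(2,1)])
    have "t g (t h a) = mconj (A\<lparr>carrier := P2 g h\<rparr>) (W g h) ?x"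
      by (rule 1(2)[OF G T(5)]) (use T(7) G in \<open>simp add: G.inv_mult_group\<close>)
    then have "t g (t h a) = ?u \<cdot> ?x \<cdot> ?u\<^sup>\<dagger>"
      using MM_action(4)[OF sI 1(1)[OF G] x] atD(2)[OF T(4)] by simp
    then show "t g (t h a) \<cdot> ?u = ?u \<cdot> ?x"
      using T(4) ue atD[OF ue] atD[OF T(4)] at_unit(2)[OF T(4)] by (simp add: assoc closed)
  qed
qed

text \<open>A twisting is required on the product of the two domain ideals, whereas the equation for
  \<open>w\<close> is known idempotent by idempotent. An element of the domain is handled at the
  idempotent of its image.\<close>

lemma twists_twisting:
  assumes w: "twists w"
  shows "twisting A G \<psi> \<theta> (\<lambda>g h. mk_mult (P2 g h) (w g h))"
  unfolding twisting_def Let_def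
proof (intro ballI conjI)
  fix g h assume G: "g \<in> carrier G" "h \<in> carrier G"
  have gg: "g \<odot> h \<in> carrier G" "\<iota> h \<in> carrier G" "\<iota> g \<in> carrier G" "\<iota> h \<odot> \<iota> g \<in> carrier G"
    using G by auto
  note I = P_ideal(1)[OF G]
  note sI = ideal_subsemigrp[OF I]
  have p: "ideal_prod A [D g, D (g \<odot> h)] = P2 g h"
    "ideal_prod A [D (\<iota> h), D (\<iota> h \<odot> \<iota> g)] = D (\<iota> h) \<inter> D (\<iota> h \<odot> \<iota> g)"
    using ideal_prod2 D_ideal G gg by blast+
  note m = mk_mult_sinv(1)[OF sI twistsD(1)[OF w G]]
  show "mk_mult (P2 g h) (w g h) \<in> Units (MM (ideal_prod A [D g, D (g \<odot> h)]))"
    unfolding p by (rule m)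
  fix a assume "a \<in> ideal_prod A [D (\<iota> h), D (\<iota> h \<odot> \<iota> g)]"
  then have a: "a \<in> D (\<iota> h)" "a \<in> D (\<iota> (g \<odot> h))" unfolding p using G by (auto simp: G.inv_mult_group)
  let ?x = "t (g \<odot> h) a"
  \<comment> \<open>The idempotent is read off in the range. Its translate by gh is then
    \<open>\<epsilon> a\<close>, so the equation for \<open>w\<close> at \<open>e\<close> applies to
    \<open>a\<close>.\<close>
  define e where "e = \<epsilon> ?x"
  have x: "?x \<in> D g" "?x \<in> D (g \<odot> h)" "?x \<in> carrier A"
    using t_D[OF gg(1,2) a(2,1)] t_closed[OF gg(1) a(2)] G by (auto simp: G.m_assoc)
  have e: "e \<in> idems A" "e \<in> P2 g h" unfolding e_def using x D_eps[OF G(1) x(3)] D_eps[OF gg(1) x(3)] by auto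
  have ac: "a \<in> carrier A" "\<epsilon> a \<in> D (\<iota> (g \<odot> h))" using D_carrier[OF gg(2) a(1)] D_eps[of "\<iota> (g \<odot> h)" a] a(2) gg by auto
  have "e \<triangleleft> (g \<odot> h) = \<epsilon> a"
    unfolding e_def t_eps[OF gg(1) a(2)] by (rule idr_act[OF gg(1)]) (use ac in auto)
  then have ae: "a \<in> at (e \<triangleleft> (g \<odot> h))" using ac by (simp add: at_def)
  have we: "w g h e \<in> at e" by (rule twistsD(2)[OF w G e])
  note T = at_tt[OF G e ae]
  have "t g (t h a) = t g (t h a) \<cdot> w g h e \<cdot> (w g h e)\<^sup>\<dagger>"
    using T(3) we atD[OF we] atD[OF T(3)] at_unit(2)[OF T(3)] by (simp add: assoc)
  also have "\<dots> = w g h e \<cdot> ?x \<cdot> (w g h e)\<^sup>\<dagger>" using twistsD(3)[OF w G e ae] by simp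
  also have "\<dots> = mconj (A\<lparr>carrier := P2 g h\<rparr>) (mk_mult (P2 g h) (w g h)) ?x"
    using MM_action(4)[OF sI m, of ?x] x fst_mk_mult[OF sI twistsD(1)[OF w G] e(2,1)] by (simp add: e_def)
  finally show "t g (t h a) = mconj (A\<lparr>carrier := ideal_prod A [D g, D (g \<odot> h)]\<rparr>) (mk_mult (P2 g h) (w g h)) ?x"
    unfolding p .
qed

text \<open>Restriction, transport along \<theta>_g and multiplication of multipliers are turned
  into operations on values at idempotents, for both sides of the equation that defines an
  associator.\<close>

lemma associator_product:
  assumes W: "twisting A G \<psi> \<theta> W" and w: "\<And>g h. w g h = fst (W g h)"
    and G: "g \<in> carrier G" "h \<in> carrier G" "k \<in> carrier G"
    and J: "J = D (\<iota> g) \<inter> (D h \<inter> D (h \<odot> k))"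
  shows "mtransport (\<theta> g |` J) (mrestrict (W h k) J) \<otimes>\<^bsub>MM (P3 g h k)\<^esub> mrestrict (W g (h \<odot> k)) (P3 g h k) =
      mk_mult (P3 g h k) (\<lambda>e. t g (w h k (e \<triangleleft> g)) \<cdot> w g (h \<odot> k) e)" (is ?th1)
    and "sect (P3 g h k) (\<lambda>e. t g (w h k (e \<triangleleft> g)) \<cdot> w g (h \<odot> k) e)" (is ?th2)
    and "sect (P3 g h k) b \<Longrightarrow> mk_mult (P3 g h k) b \<otimes>\<^bsub>MM (P3 g h k)\<^esub> mrestrict (W g h) (P3 g h k) \<otimes>\<^bsub>MM (P3 g h k)\<^esub>
      mrestrict (W (g \<odot> h) k) (P3 g h k) = mk_mult (P3 g h k) (\<lambda>e. b e \<cdot> w g h e \<cdot> w (g \<odot> h) k e)"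
    and "sect (P3 g h k) b \<Longrightarrow> sect (P3 g h k) (\<lambda>e. b e \<cdot> w g h e \<cdot> w (g \<odot> h) k e)"
proof -
  have gg: "g \<odot> h \<in> carrier G" "h \<odot> k \<in> carrier G" "\<iota> g \<in> carrier G" using G by auto
  have tw: "twists w" using twisting_twists(1)[OF W] by (simp add: w[abs_def])
  have Wm: "W g h = mk_mult (P2 g h) (w g h)" if "g \<in> carrier G" "h \<in> carrier G" for g h
    unfolding w using Units_MM(2)[OF ideal_subsemigrp[OF P_ideal(1)[OF that]] twisting_twists(2)[OF W that]] .
  note I = P_ideal(2)[OF G]
  note sI = ideal_subsemigrp[OF I]
  have sub: "P3 g h k \<subseteq> P2 g h" "P3 g h k \<subseteq> P2 (g \<odot> h) k" "P3 g h k \<subseteq> P2 g (h \<odot> k)" "J \<subseteq> P2 h k" "J \<subseteq> D (\<iota> g)"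
    unfolding J using G by (auto simp: G.m_assoc)
  have Ji: "ideal_of A J" unfolding J by (intro ideal_inter D_ideal) (use G in auto)
  \<comment> \<open>Transport produces multipliers of the range of the restricted isomorphism, so
    this range has to be identified with \<open>P3 g h k\<close> before the product makes
    sense.\<close>
  have im: "t g ` J = P3 g h k"
  proof
    show "t g ` J \<subseteq> P3 g h k"
      using t_closed(1)[OF G(1)] t_D[OF G(1,2)] t_D[OF G(1) gg(2)] G unfolding J by (auto simp: G.m_assoc)
    show "P3 g h k \<subseteq> t g ` J"
    proof
      fix x assume x: "x \<in> P3 g h k"
      then have xc: "x \<in> carrier A" using D_carrier G by auto
      have e: "\<epsilon> x \<in> idems A" "\<epsilon> x \<in> P3 g h k" "x \<in> at (\<epsilon> x)"
        using x xc eps_mem[OF I xc] by (auto simp: at_def)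
      note F = P3_faces[OF G e(1,2)]
      obtain a where a: "a \<in> at (\<epsilon> x \<triangleleft> g)" "t g a = x" by (rule t_surj[OF G(1) e(1) F(6) e(3)])
      have "\<epsilon> x \<triangleleft> g \<in> J" unfolding J using F(2) idr_closed(2)[OF G(1) e(1) F(6)] by auto
      then show "x \<in> t g ` J" using a at_ideal[OF Ji a(1)] by auto
    qed
  qed
  have i: "ideal_iso A J (P3 g h k) (\<theta> g |` J)"
    using ideal_iso_restrict[OF t_iso[OF G(1)] Ji sub(5)] unfolding im .
  have ws: "sect J (w h k)" by (rule sect_ideal_restrict[OF P_ideal(1)[OF G(2,3)] Ji sub(4) twistsD(1)[OF tw G(2,3)]])
  have pe: "the ((\<theta> g |` J) (w h k (pinv (\<theta> g |` J) e))) = t g (w h k (e \<triangleleft> g))"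
    if e: "e \<in> P3 g h k" "e \<in> idems A" for e
  proof -
    note F = P3_faces[OF G e(2,1)]
    have eJ: "e \<triangleleft> g \<in> J" unfolding J using F(2) idr_closed(2)[OF G(1) e(2) F(6)] by auto
    then have "pinv (\<theta> g |` J) e = e \<triangleleft> g"
      using ideal_iso_appl(12)[OF i eJ] t_idr[OF G(1) e(2) F(6)] by simp
    moreover have "w h k (e \<triangleleft> g) \<in> J" using sectD(1)[OF ws eJ F(1)] .
    ultimately show ?thesis by simp
  qed
  have tr: "mtransport (\<theta> g |` J) (mrestrict (W h k) J) = mk_mult (P3 g h k) (\<lambda>e. t g (w h k (e \<triangleleft> g)))"
    unfolding Wm[OF G(2,3)] mrestrict_mk_mult[OF sub(4)] mtransport_mk_mult(2)[OF i ws]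
    by (rule mk_mult_cong[OF sI pe])
  have ts: "sect (P3 g h k) (\<lambda>e. t g (w h k (e \<triangleleft> g)))"
    by (rule sect_cong[OF sI pe mtransport_mk_mult(1)[OF i ws]])
  have sf: "sect (P3 g h k) (w g (h \<odot> k))" "sect (P3 g h k) (w (g \<odot> h) k)" "sect (P3 g h k) (w g h)"
    using sect_faces[OF twistsD(1)[OF tw] G] by blast+
  show ?th1
    unfolding tr Wm[OF G(1) gg(2)] mrestrict_mk_mult[OF sub(3)] by (rule mk_mult_mult[OF sI ts sf(1)])
  show ?th2 by (rule sect_mult[OF sI ts sf(1)])
  assume b: "sect (P3 g h k) b"
  show "mk_mult (P3 g h k) b \<otimes>\<^bsub>MM (P3 g h k)\<^esub> mrestrict (W g h) (P3 g h k) \<otimes>\<^bsub>MM (P3 g h k)\<^esub>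
      mrestrict (W (g \<odot> h) k) (P3 g h k) = mk_mult (P3 g h k) (\<lambda>e. b e \<cdot> w g h e \<cdot> w (g \<odot> h) k e)"
    unfolding Wm[OF G(1,2)] Wm[OF gg(1) G(3)] mrestrict_mk_mult[OF sub(1)] mrestrict_mk_mult[OF sub(2)]
    by (subst mk_mult_mult[OF sI b sf(3)], subst mk_mult_mult[OF sI sect_mult[OF sI b sf(3)] sf(2)], rule refl)
  show "sect (P3 g h k) (\<lambda>e. b e \<cdot> w g h e \<cdot> w (g \<odot> h) k e)"
    by (rule sect_mult[OF sI sect_mult[OF sI b sf(3)] sf(2)])
qed

lemma associator_ideals:
  assumes "g \<in> carrier G" "h \<in> carrier G" "k \<in> carrier G"
  shows "ideal_prod A [D g, D (g \<odot> h), D (g \<odot> h \<odot> k)] = P3 g h k"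
    "ideal_prod A [D (\<iota> g), D h, D (h \<odot> k)] = D (\<iota> g) \<inter> (D h \<inter> D (h \<odot> k))"
  by (rule ideal_prod3; use assms D_ideal in simp)+

lemma associator_associates:
  assumes W: "twisting A G \<psi> \<theta> W" and \<beta>: "associator A G \<psi> \<theta> W \<beta>"
  shows "associates (\<lambda>g h. fst (W g h)) (\<lambda>g h k. fst (\<beta> g h k))"
  unfolding associates_def
proof (intro ballI)
  fix g h k e assume G: "g \<in> carrier G" "h \<in> carrier G" "k \<in> carrier G" and "e \<in> idems A \<inter> P3 g h k"
  then have e: "e \<in> P3 g h k" "e \<in> idems A" by auto
  note I = P_ideal(2)[OF G]
  note sI = ideal_subsemigrp[OF I]
  define J where "J = D (\<iota> g) \<inter> (D h \<inter> D (h \<odot> k))"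
  note P = associator_product[OF W refl G J_def]
  have \<beta>1: "\<beta> g h k \<in> Units (center_monoid (MM (P3 g h k)))"
    and \<beta>2: "mtransport (\<theta> g |` J) (mrestrict (W h k) J) \<otimes>\<^bsub>MM (P3 g h k)\<^esub> mrestrict (W g (h \<odot> k)) (P3 g h k) =
      \<beta> g h k \<otimes>\<^bsub>MM (P3 g h k)\<^esub> mrestrict (W g h) (P3 g h k) \<otimes>\<^bsub>MM (P3 g h k)\<^esub> mrestrict (W (g \<odot> h) k) (P3 g h k)"
    using \<beta>[unfolded associator_def Let_def, rule_format, OF G, unfolded associator_ideals[OF G], folded J_def]
    by (rule conjunct1, rule conjunct2)
  have u: "\<beta> g h k \<in> Units (MM (P3 g h k))" "fst (\<beta> g h k) e \<in> center A"
    using \<beta>1 e unfolding Units_center_MM[OF I] by auto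
  note s = Units_MM[OF sI u(1)]
  have "mk_mult (P3 g h k) (\<lambda>e. t g (lact (W h k) (e \<triangleleft> g)) \<cdot> lact (W g (h \<odot> k)) e) =
      mk_mult (P3 g h k) (\<lambda>e. lact (\<beta> g h k) e \<cdot> lact (W g h) e \<cdot> lact (W (g \<odot> h) k) e)"
    unfolding P(1)[symmetric] P(3)[OF s(1), symmetric] \<beta>2 using s(2) by (simp del: mult_monoid_simps)
  then have "t g (lact (W h k) (e \<triangleleft> g)) \<cdot> lact (W g (h \<odot> k)) e = lact (\<beta> g h k) e \<cdot> lact (W g h) e \<cdot> lact (W (g \<odot> h) k) e"
    unfolding mk_mult_eq_iff[OF sI P(2) P(4)[OF s(1)]] using e by auto
  then show "lact (\<beta> g h k) e \<in> at e \<and> lact (\<beta> g h k) e \<in> center A \<and>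
     t g (lact (W h k) (e \<triangleleft> g)) \<cdot> lact (W g (h \<odot> k)) e = lact (\<beta> g h k) e \<cdot> lact (W g h) e \<cdot> lact (W (g \<odot> h) k) e"
    using u(2) sect_at[OF sI s(1) e] by blast
qed

lemma associates_associator:
  assumes w: "twists w" and b: "associates w b"
  shows "associator A G \<psi> \<theta> (\<lambda>g h. mk_mult (P2 g h) (w g h)) (\<lambda>g h k. mk_mult (P3 g h k) (b g h k))"
  unfolding associator_def Let_def
proof (intro ballI conjI)
  fix g h k assume G: "g \<in> carrier G" "h \<in> carrier G" "k \<in> carrier G"
  define W where "W = (\<lambda>g h. mk_mult (P2 g h) (w g h))"
  note W = twists_twisting[OF w, folded W_def]
  note I = P_ideal(2)[OF G]
  note sI = ideal_subsemigrp[OF I]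
  define J where "J = D (\<iota> g) \<inter> (D h \<inter> D (h \<odot> k))"
  note P = associator_product[OF W refl G J_def]
  have s: "sect (P3 g h k) (b g h k)"
    by (rule sect_from_center[OF I]) (use central3_associates[OF w b] G in \<open>simp add: central3_def\<close>)
  have lw: "lact (W g h) e = w g h e" if "g \<in> carrier G" "h \<in> carrier G" "e \<in> P2 g h" "e \<in> idems A" for g h e
    unfolding W_def by (rule fst_mk_mult[OF ideal_subsemigrp[OF P_ideal(1)[OF that(1,2)]] twistsD(1)[OF w that(1,2)] that(3,4)])
  have fb: "fst (mk_mult (P3 g h k) (b g h k)) e = b g h k e" if "e \<in> P3 g h k" "e \<in> idems A" for e
    by (rule fst_mk_mult[OF sI s that])
  show "mk_mult (P3 g h k) (b g h k) \<in> Units (center_monoid (MM (ideal_prod A [D g, D (g \<odot> h), D (g \<odot> h \<odot> k)])))"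
    unfolding associator_ideals[OF G] Units_center_MM[OF I]
    using mk_mult_sinv(1)[OF sI s] fb associatesD(2)[OF b G] by auto
  have "mk_mult (P3 g h k) (\<lambda>e. t g (lact (W h k) (e \<triangleleft> g)) \<cdot> lact (W g (h \<odot> k)) e) =
      mk_mult (P3 g h k) (\<lambda>e. b g h k e \<cdot> lact (W g h) e \<cdot> lact (W (g \<odot> h) k) e)"
  proof (rule mk_mult_cong[OF sI])
    fix e assume e: "e \<in> P3 g h k" "e \<in> idems A"
    note F = P3_faces[OF G e(2,1)]
    show "t g (lact (W h k) (e \<triangleleft> g)) \<cdot> lact (W g (h \<odot> k)) e = b g h k e \<cdot> lact (W g h) e \<cdot> lact (W (g \<odot> h) k) e"
      using associatesD(3)[OF b G e(2,1)] lw[OF G(2,3) F(2,1)] lw[OF G(1) _ F(4) e(2)] lw[OF G(1,2) F(5) e(2)]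
        lw[OF _ G(3) F(3) e(2)] G by simp
  qed
  then show "mtransport (\<theta> g |` ideal_prod A [D (\<iota> g), D h, D (h \<odot> k)])
        (mrestrict (mk_mult (P2 h k) (w h k)) (ideal_prod A [D (\<iota> g), D h, D (h \<odot> k)]))
      \<otimes>\<^bsub>MM (ideal_prod A [D g, D (g \<odot> h), D (g \<odot> h \<odot> k)])\<^esub>
       mrestrict (mk_mult (P2 g (h \<odot> k)) (w g (h \<odot> k))) (ideal_prod A [D g, D (g \<odot> h), D (g \<odot> h \<odot> k)]) =
     mk_mult (P3 g h k) (b g h k) \<otimes>\<^bsub>MM (ideal_prod A [D g, D (g \<odot> h), D (g \<odot> h \<odot> k)])\<^esub>
       mrestrict (mk_mult (P2 g h) (w g h)) (ideal_prod A [D g, D (g \<odot> h), D (g \<odot> h \<odot> k)])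
      \<otimes>\<^bsub>MM (ideal_prod A [D g, D (g \<odot> h), D (g \<odot> h \<odot> k)])\<^esub>
       mrestrict (mk_mult (P2 (g \<odot> h) k) (w (g \<odot> h) k)) (ideal_prod A [D g, D (g \<odot> h), D (g \<odot> h \<odot> k)])"
    unfolding associator_ideals[OF G] J_def[symmetric] P(1)[symmetric] P(3)[OF s, symmetric]
    unfolding W_def .
qed

end

section \<open>Comparison of two obstructions\<close>

context abs_kernel
begin

lemma kernel_repsI: "representatives G \<psi> \<theta> \<Longrightarrow> kernel_reps A G \<psi> \<theta>"
  by unfold_locales (simp add: representatives_def)

lemma kernel_reps_rep: "kernel_reps A G \<psi> rep"
  by unfold_locales (rule rep)

lemma obstruction_exists: "\<exists>\<beta>. obstruction A G \<psi> \<beta>"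
proof -
  interpret R: kernel_reps A G \<psi> rep by (rule kernel_reps_rep)
  obtain w where "R.twists w" using R.twists_exists ..
  then show ?thesis
    using R.twists_twisting R.associates_associator R.associates_assoc_of rep
    unfolding obstruction_def representatives_def by blast
qed

text \<open>The first obstruction is carried over to the representatives of the second without being
  changed. There the two twistings differ by a central family, and the associators by its
  coboundary.\<close>

lemma obstruction_difference:
  assumes "obstruction A G \<psi> \<beta>" "obstruction A G \<psi> \<beta>'"
  obtains z where "central2 z" "\<And>g h k e. \<lbrakk>g \<in> carrier G; h \<in> carrier G; k \<in> carrier G; e \<in> idems A; e \<in> P3 g h k\<rbrakk> \<Longrightarrow>
    fst (\<beta>' g h k) e = fst (\<beta> g h k) e \<cdot> dz z g h k e"
proof -
  obtain \<theta> W \<theta>' W' where 1: "representatives G \<psi> \<theta>" "twisting A G \<psi> \<theta> W" "associator A G \<psi> \<theta> W \<beta>"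
    "representatives G \<psi> \<theta>'" "twisting A G \<psi> \<theta>' W'" "associator A G \<psi> \<theta>' W' \<beta>'"
    using assms by (auto simp: obstruction_def)
  interpret R: kernel_reps A G \<psi> \<theta> by (rule kernel_repsI) fact
  interpret R': kernel_reps A G \<psi> \<theta>' by (rule kernel_repsI) fact
  note w' = R'.twisting_twists(1)[OF 1(5)] and b' = R'.associator_associates[OF 1(5,6)]
  obtain v where v: "R'.twists v" "R'.associates v (\<lambda>g h k. fst (\<beta> g h k))"
    using R.twists_change_reps[OF R.twisting_twists(1)[OF 1(2)] R.associator_associates[OF 1(2,3)] R'.kernel_reps_axioms]
    by blast
  obtain z where z: "central2 z"
    "\<And>g h e. \<lbrakk>g \<in> carrier G; h \<in> carrier G; e \<in> idems A; e \<in> P2 g h\<rbrakk> \<Longrightarrow> fst (W' g h) e = z g h e \<cdot> v g h e"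
    using R'.twists_difference[OF v(1) w'] by blast
  note s = R'.twists_scale[OF v z(1)]
  have "R'.associates (\<lambda>g h e. z g h e \<cdot> v g h e) (\<lambda>g h k. fst (\<beta>' g h k))"
    unfolding R'.associates_def
  proof (intro ballI)
    fix g h k e assume G: "g \<in> carrier G" "h \<in> carrier G" "k \<in> carrier G" and "e \<in> idems A \<inter> P3 g h k"
    then have e: "e \<in> idems A" "e \<in> P3 g h k" by auto
    note F = P3_faces[OF G e]
    show "lact (\<beta>' g h k) e \<in> at e \<and> lact (\<beta>' g h k) e \<in> center A \<and>
      R'.t g (z h k (e \<triangleleft> g) \<cdot> v h k (e \<triangleleft> g)) \<cdot> (z g (h \<odot> k) e \<cdot> v g (h \<odot> k) e) =
      lact (\<beta>' g h k) e \<cdot> (z g h e \<cdot> v g h e) \<cdot> (z (g \<odot> h) k e \<cdot> v (g \<odot> h) k e)"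
      using R'.associatesD[OF b' G e] z(2)[OF G(2,3) F(1,2)] z(2)[OF G(1) _ e(1) F(4)] z(2)[OF G(1,2) e(1) F(5)]
        z(2)[OF _ G(3) e(1) F(3)] G by simp
  qed
  then show thesis using that z(1) R'.associates_unique[OF s(1) _ s(2)] by blast
qed

end

section \<open>The obstruction class\<close>

context abs_kernel
begin

abbreviation "K2 g h \<equiv> center A \<inter> P2 g h"
abbreviation "K3 g h k \<equiv> center A \<inter> P3 g h k"
abbreviation "K4 g h k l \<equiv> center A \<inter> P4 g h k l"
abbreviation "Cochains \<equiv> cochains G (center_semigrp A) C"
abbreviation "\<delta> \<equiv> coboundary G (center_semigrp A) C (center_action A G \<psi>)"

lemma K_subsemigrp:
  "\<lbrakk>g \<in> carrier G; h \<in> carrier G\<rbrakk> \<Longrightarrow> inverse_subsemigrp A (K2 g h)"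
  "\<lbrakk>g \<in> carrier G; h \<in> carrier G; k \<in> carrier G\<rbrakk> \<Longrightarrow> inverse_subsemigrp A (K3 g h k)"
  "\<lbrakk>g \<in> carrier G; h \<in> carrier G; k \<in> carrier G; l \<in> carrier G\<rbrakk> \<Longrightarrow> inverse_subsemigrp A (K4 g h k l)"
  by (auto intro!: ideal_inter_center(2) P_ideal)

lemma center_prod2:
  assumes "ideal_of A I" "ideal_of A J"
  shows "ideal_prod (center_semigrp A) [center A \<inter> I, center A \<inter> J] = center A \<inter> (I \<inter> J)"
  using mult_set_inter[OF center_subsemigrp assms] by (simp add: center_semigrp_def)

lemma center_prod3:
  assumes "ideal_of A I" "ideal_of A J" "ideal_of A L"
  shows "ideal_prod (center_semigrp A) [center A \<inter> I, center A \<inter> J, center A \<inter> L] = center A \<inter> (I \<inter> (J \<inter> L))"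
  using mult_set_inter[OF center_subsemigrp assms(1) ideal_inter[OF assms(2,3)]] center_prod2[OF assms(2,3)]
  by (simp add: center_semigrp_def)

lemma center_prod4:
  assumes "ideal_of A I" "ideal_of A J" "ideal_of A L" "ideal_of A M"
  shows "ideal_prod (center_semigrp A) [center A \<inter> I, center A \<inter> J, center A \<inter> L, center A \<inter> M] =
    center A \<inter> (I \<inter> (J \<inter> (L \<inter> M)))"
  using mult_set_inter[OF center_subsemigrp assms(1) ideal_inter[OF assms(2) ideal_inter[OF assms(3,4)]]]
    center_prod3[OF assms(2-4)]
  by (simp add: center_semigrp_def)

lemma upt_small: "[1..<3] = [1::nat, 2]" "[1..<4] = [1::nat, 2, 3]" "[1..<5] = [1::nat, 2, 3, 4]"
  by (simp_all add: upt_rec)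

lemma chain_eq:
  "\<lbrakk>g \<in> carrier G; h \<in> carrier G\<rbrakk> \<Longrightarrow> chain G (center_semigrp A) C [g, h] = K2 g h"
  "\<lbrakk>g \<in> carrier G; h \<in> carrier G; k \<in> carrier G\<rbrakk> \<Longrightarrow> chain G (center_semigrp A) C [g, h, k] = K3 g h k"
  "\<lbrakk>g \<in> carrier G; h \<in> carrier G; k \<in> carrier G; l \<in> carrier G\<rbrakk> \<Longrightarrow> chain G (center_semigrp A) C [g, h, k, l] = K4 g h k l"
proof -
  assume G: "g \<in> carrier G" "h \<in> carrier G"
  have s: "map (\<lambda>i. C (gprod G (take i [g, h]))) [1..<Suc (length [g, h])] = [C g, C (g \<odot> h)]"
    using G upt_small(1) by (simp add: gprod_def numeral_2_eq_2 numeral_3_eq_3)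
  show "chain G (center_semigrp A) C [g, h] = K2 g h"
    unfolding chain_def s using center_prod2[OF D_ideal D_ideal] G by (simp add: C_eq)
next
  assume G: "g \<in> carrier G" "h \<in> carrier G" "k \<in> carrier G"
  have s: "map (\<lambda>i. C (gprod G (take i [g, h, k]))) [1..<Suc (length [g, h, k])] = [C g, C (g \<odot> h), C (g \<odot> h \<odot> k)]"
    using G upt_small(2) by (simp add: gprod_def numeral_2_eq_2 numeral_3_eq_3 eval_nat_numeral G.m_assoc)
  show "chain G (center_semigrp A) C [g, h, k] = K3 g h k"
    unfolding chain_def s using center_prod3[OF D_ideal D_ideal D_ideal] G by (simp add: C_eq)
next
  assume G: "g \<in> carrier G" "h \<in> carrier G" "k \<in> carrier G" "l \<in> carrier G"
  have s: "map (\<lambda>i. C (gprod G (take i [g, h, k, l]))) [1..<Suc (length [g, h, k, l])] =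
      [C g, C (g \<odot> h), C (g \<odot> h \<odot> k), C (g \<odot> h \<odot> k \<odot> l)]"
    using G upt_small(3) by (simp add: gprod_def eval_nat_numeral G.m_assoc)
  show "chain G (center_semigrp A) C [g, h, k, l] = K4 g h k l"
    unfolding chain_def s using center_prod4[OF D_ideal D_ideal D_ideal D_ideal] G by (simp add: C_eq)
qed

lemma chain_mult_eq: "chain_mult G (center_semigrp A) C xs = MM (chain G (center_semigrp A) C xs)"
  by (simp add: chain_mult_def center_semigrp_def)

lemma tuples_cases:
  "xs \<in> tuples G 2 \<longleftrightarrow> (\<exists>g \<in> carrier G. \<exists>h \<in> carrier G. xs = [g, h])"
  "xs \<in> tuples G 3 \<longleftrightarrow> (\<exists>g \<in> carrier G. \<exists>h \<in> carrier G. \<exists>k \<in> carrier G. xs = [g, h, k])"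
  "xs \<in> tuples G 4 \<longleftrightarrow> (\<exists>g \<in> carrier G. \<exists>h \<in> carrier G. \<exists>k \<in> carrier G. \<exists>l \<in> carrier G. xs = [g, h, k, l])"
  by (auto simp: tuples_def eval_nat_numeral length_Suc_conv)

section \<open>Cochains as families of values on idempotents\<close>

definition cochain2 :: "('g \<Rightarrow> 'g \<Rightarrow> 'a \<Rightarrow> 'a) \<Rightarrow> 'g list \<Rightarrow> 'a multiplier" where
  "cochain2 z = (\<lambda>xs \<in> tuples G 2. mk_mult (K2 (xs ! 0) (xs ! 1)) (z (xs ! 0) (xs ! 1)))"

definition cochain3 :: "('g \<Rightarrow> 'g \<Rightarrow> 'g \<Rightarrow> 'a \<Rightarrow> 'a) \<Rightarrow> 'g list \<Rightarrow> 'a multiplier" where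
  "cochain3 b = (\<lambda>xs \<in> tuples G 3. mk_mult (K3 (xs ! 0) (xs ! 1) (xs ! 2)) (b (xs ! 0) (xs ! 1) (xs ! 2)))"

lemma cochain2_apply: "\<lbrakk>g \<in> carrier G; h \<in> carrier G\<rbrakk> \<Longrightarrow> cochain2 z [g, h] = mk_mult (K2 g h) (z g h)"
  and cochain3_apply: "\<lbrakk>g \<in> carrier G; h \<in> carrier G; k \<in> carrier G\<rbrakk> \<Longrightarrow> cochain3 b [g, h, k] = mk_mult (K3 g h k) (b g h k)"
  by (auto simp: cochain2_def cochain3_def tuples_cases)

lemma cochains2: "carrier (Cochains 2) = cochain2 ` {z. central2 z}"
proof
  show "carrier (Cochains 2) \<subseteq> cochain2 ` {z. central2 z}"
  proof
    fix f assume f: "f \<in> carrier (Cochains 2)"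
    have u: "f [g, h] \<in> Units (MM (K2 g h))" if G: "g \<in> carrier G" "h \<in> carrier G" for g h
    proof -
      have "[g, h] \<in> tuples G 2" using G by (auto simp: tuples_cases)
      then have "f [g, h] \<in> Units (chain_mult G (center_semigrp A) C [g, h])"
        using f by (auto simp: cochains_def)
      then show ?thesis unfolding chain_mult_eq chain_eq(1)[OF G] .
    qed
    note s = Units_MM[OF K_subsemigrp(1) u]
    have "central2 (\<lambda>g h. fst (f [g, h]))" using s(1) by (simp add: central2_def)
    moreover have "f = cochain2 (\<lambda>g h. fst (f [g, h]))"
    proof
      fix xs
      show "f xs = cochain2 (\<lambda>g h. fst (f [g, h])) xs"
        using f s(2) by (cases "xs \<in> tuples G 2")
          (auto simp: cochain2_def cochains_def PiE_iff extensional_def tuples_cases)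
    qed
    ultimately show "f \<in> cochain2 ` {z. central2 z}" by blast
  qed
  show "cochain2 ` {z. central2 z} \<subseteq> carrier (Cochains 2)"
  proof
    fix f assume "f \<in> cochain2 ` {z. central2 z}"
    then obtain z where z: "central2 z" "f = cochain2 z" by blast
    have "mk_mult (K2 g h) (z g h) \<in> Units (MM (K2 g h))" if "g \<in> carrier G" "h \<in> carrier G" for g h
      using mk_mult_sinv(1)[OF K_subsemigrp(1)[OF that]] z(1) that by (simp add: central2_def)
    then show "f \<in> carrier (Cochains 2)"
      unfolding z(2) cochain2_def
      by (auto simp: cochains_def chain_mult_eq tuples_cases chain_eq simp del: mult_monoid_simps)
  qed
qed

lemma cochain3_closed: "central3 b \<Longrightarrow> cochain3 b \<in> carrier (Cochains 3)"
proof -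
  assume b: "central3 b"
  have "mk_mult (K3 g h k) (b g h k) \<in> Units (MM (K3 g h k))" if "g \<in> carrier G" "h \<in> carrier G" "k \<in> carrier G" for g h k
    using mk_mult_sinv(1)[OF K_subsemigrp(2)[OF that]] b that by (simp add: central3_def)
  then show ?thesis
    unfolding cochain3_def
    by (auto simp: cochains_def chain_mult_eq tuples_cases chain_eq simp del: mult_monoid_simps)
qed

text \<open>A family is arbitrary away from the idempotents of \<open>P3 g h k\<close>; only its
  values there enter the multiplier, and these are the idempotents of the central part as
  well.\<close>

lemma cochain3_eq_iff:
  assumes "central3 b" "central3 b'"
  shows "cochain3 b = cochain3 b' \<longleftrightarrow> (\<forall>g \<in> carrier G. \<forall>h \<in> carrier G. \<forall>k \<in> carrier G. \<forall>e \<in> idems A \<inter> P3 g h k.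
     b g h k e = b' g h k e)" (is "_ \<longleftrightarrow> ?R")
proof -
  have *: "mk_mult (K3 g h k) (b g h k) = mk_mult (K3 g h k) (b' g h k) \<longleftrightarrow> (\<forall>e \<in> idems A \<inter> P3 g h k. b g h k e = b' g h k e)"
    if G: "g \<in> carrier G" "h \<in> carrier G" "k \<in> carrier G" for g h k
  proof -
    have "K3 g h k \<inter> idems A = idems A \<inter> P3 g h k" using idems_center by blast
    moreover have "sect (K3 g h k) (b g h k)" "sect (K3 g h k) (b' g h k)" using assms G by (auto simp: central3_def)
    ultimately show ?thesis using mk_mult_eq_iff[OF K_subsemigrp(2)[OF G], of "b g h k" "b' g h k"] by simp
  qed
  show ?thesis
  proof
    assume eq: "cochain3 b = cochain3 b'"
    show ?R
    proof (intro ballI)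
      fix g h k e assume G: "g \<in> carrier G" "h \<in> carrier G" "k \<in> carrier G" and e: "e \<in> idems A \<inter> P3 g h k"
      have "mk_mult (K3 g h k) (b g h k) = mk_mult (K3 g h k) (b' g h k)"
        using fun_cong[OF eq, of "[g, h, k]"] cochain3_apply[OF G] by simp
      then show "b g h k e = b' g h k e" using *[OF G] e by blast
    qed
  next
    assume ?R
    then have "mk_mult (K3 g h k) (b g h k) = mk_mult (K3 g h k) (b' g h k)"
      if "g \<in> carrier G" "h \<in> carrier G" "k \<in> carrier G" for g h k using *[OF that] that by blast
    then show "cochain3 b = cochain3 b'"
      unfolding cochain3_def by (intro restrict_ext) (auto simp: tuples_cases)
  qed
qed

lemma cochain3_mult:
  assumes "central3 b" "central3 b'"
  shows "cochain3 b \<otimes>\<^bsub>Cochains 3\<^esub> cochain3 b' = cochain3 (\<lambda>g h k e. b g h k e \<cdot> b' g h k e)"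
proof -
  have "mk_mult (K3 g h k) (b g h k) \<otimes>\<^bsub>MM (K3 g h k)\<^esub> mk_mult (K3 g h k) (b' g h k) =
      mk_mult (K3 g h k) (\<lambda>e. b g h k e \<cdot> b' g h k e)"
    if "g \<in> carrier G" "h \<in> carrier G" "k \<in> carrier G" for g h k
    using mk_mult_mult[OF K_subsemigrp(2)[OF that]] assms that unfolding central3_def by blast
  then show ?thesis
    unfolding cochain3_def cochains_def monoid.simps chain_mult_eq
    by (intro restrict_ext) (auto simp: tuples_cases chain_eq simp del: mult_monoid_simps)
qed

lemma central3_mult:
  "\<lbrakk>central3 b; central3 b'\<rbrakk> \<Longrightarrow> central3 (\<lambda>g h k e. b g h k e \<cdot> b' g h k e)"
  using sect_mult K_subsemigrp(2) by (simp add: central3_def)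

lemma central3_idem: "central3 (\<lambda>g h k e. e)"
  using sect_idem K_subsemigrp(2) by (simp add: central3_def)

text \<open>On central values the choice-free action agrees with any representative, so the
  compatibility already shown for representatives carries over.\<close>

lemma sect_act:
  assumes g: "g \<in> carrier G" and K: "ideal_of A K" "K \<subseteq> D g" and J: "ideal_of A J"
    and KJ: "\<And>e. \<lbrakk>e \<in> idems A; e \<in> K\<rbrakk> \<Longrightarrow> e \<triangleleft> g \<in> J" and u: "sect (center A \<inter> J) u"
  shows "sect (center A \<inter> K) (\<lambda>e. act g (u (e \<triangleleft> g)))"
proof -
  interpret R: kernel_reps A G \<psi> rep by (rule kernel_reps_rep)
  have u': "sect J u" by (rule sect_from_center[OF J u])
  have c: "R.t g (u (e \<triangleleft> g)) = act g (u (e \<triangleleft> g)) \<and> act g (u (e \<triangleleft> g)) \<in> center A" if "e \<in> idems A" "e \<in> K" for e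
  proof -
    have e: "e \<triangleleft> g \<in> idems A" "e \<triangleleft> g \<in> J" "e \<in> D g" using idr_closed[OF g that(1)] KJ that K by auto
    have "u (e \<triangleleft> g) \<in> center A" using sectD(1)[OF u] e idems_center by auto
    moreover have "u (e \<triangleleft> g) \<in> at (e \<triangleleft> g)" by (rule sect_at[OF ideal_subsemigrp[OF J] u' e(2,1)])
    ultimately show ?thesis using at_act[OF g that(1) e(3)] R.t_act[OF g] by simp
  qed
  show ?thesis
    by (rule sect_center[OF K(1) sect_cong[OF ideal_subsemigrp[OF K(1)] _ R.sect_t[OF g K J KJ u']]])
       (use c in auto)
qed

lemma sect_faces_center:
  assumes z: "central2 z" and G: "g \<in> carrier G" "h \<in> carrier G" "k \<in> carrier G"
  shows "sect (K3 g h k) (z g (h \<odot> k))" "sect (K3 g h k) (z (g \<odot> h) k)" "sect (K3 g h k) (z g h)"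
proof -
  have s: "sect (P3 g h k) (z g (h \<odot> k))" "sect (P3 g h k) (z (g \<odot> h) k)" "sect (P3 g h k) (z g h)"
    using sect_faces[of z, OF central2_sect(1)[OF z] G] by blast+
  note I = P_ideal(2)[OF G]
  have gg: "g \<odot> h \<in> carrier G" "h \<odot> k \<in> carrier G" using G by auto
  show "sect (K3 g h k) (z g (h \<odot> k))"
    by (rule sect_center[OF I s(1)], rule central2_sect(3)[OF z G(1) gg(2)], assumption) (rule P3_faces(4)[OF G])
  show "sect (K3 g h k) (z (g \<odot> h) k)"
    by (rule sect_center[OF I s(2)], rule central2_sect(3)[OF z gg(1) G(3)], assumption) (rule P3_faces(3)[OF G])
  show "sect (K3 g h k) (z g h)"
    by (rule sect_center[OF I s(3)], rule central2_sect(3)[OF z G(1,2)], assumption) (rule P3_faces(5)[OF G])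
qed

lemma central3_dz:
  assumes z: "central2 z" shows "central3 (dz z)"
  unfolding central3_def
proof (intro ballI)
  fix g h k assume G: "g \<in> carrier G" "h \<in> carrier G" "k \<in> carrier G"
  note K = K_subsemigrp(2)[OF G] and s = sect_faces_center[OF z G]
  have "sect (K3 g h k) (\<lambda>e. act g (z h k (e \<triangleleft> g)))"
  proof (rule sect_act[OF G(1) P_ideal(2)[OF G] _ P_ideal(1)[OF G(2,3)]])
    show "sect (K2 h k) (z h k)" using z G by (simp add: central2_def)
  qed (use P3_faces(2)[OF G] in blast)+
  then show "sect (K3 g h k) (dz z g h k)"
    unfolding dz_def using sect_mult[OF K] sect_sinv[OF K] s by simp
qed

section \<open>Coboundaries of 2- and 3-cochains\<close>

lemma Gamma_pinv:
  assumes g: "g \<in> carrier G" and a: "a \<in> center A" "a \<in> D g"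
  shows "pinv (center_action A G \<psi> g) a \<in> center A" "pinv (center_action A G \<psi> g) a \<in> D (\<iota> g)"
    "act g (pinv (center_action A G \<psi> g) a) = a" "\<epsilon> (pinv (center_action A G \<psi> g) a) = \<epsilon> a \<triangleleft> g"
proof -
  let ?p = "pinv (center_action A G \<psi> g) a"
  have i: "ideal_iso (center_semigrp A) (C (\<iota> g)) (C g) (\<Gamma> g)"
    using partial_module_center g center_action_eq[OF g] by (auto simp: partial_module_def partial_action_def)
  have aC: "a \<in> C g" using a C_eq[OF g] by simp
  have "?p \<in> C (\<iota> g)" "act g ?p = a"
    unfolding center_action_eq[OF g] act_def using ideal_iso_appl(10,11)[OF i aC] by auto
  then show p: "?p \<in> center A" "?p \<in> D (\<iota> g)" "act g ?p = a" using C_eq[of "\<iota> g"] g by auto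
  have "act g (\<epsilon> ?p) = \<epsilon> a" using act_eps[OF g p(1,2)] p(3) by simp
  then show "\<epsilon> ?p = \<epsilon> a \<triangleleft> g"
    using idr_act[OF g, of "\<epsilon> ?p"] p(1,2) center_closed eps_mem[OF D_ideal[of "\<iota> g"], of ?p] g by auto
qed

text \<open>This evaluates the leading factor of a coboundary, \<theta>_g(\<theta>_g^-1(a) f): since
  \<theta>_g^-1(a) lies over \<open>e \<triangleleft> g\<close>, the multiplier contributes its
  value there, which \<theta>_g carries to an element over \<open>e\<close>.\<close>

lemma act_ract:
  assumes g: "g \<in> carrier G" and a: "a \<in> center A" "a \<in> D g" and e: "e = \<epsilon> a"
    and J: "ideal_of A J" "e \<triangleleft> g \<in> J" and u: "sect (center A \<inter> J) u"
  shows "the (center_action A G \<psi> g (ract (pinv (center_action A G \<psi> g) a) (mk_mult (center A \<inter> J) u))) =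
    a \<cdot> act g (u (e \<triangleleft> g))" "act g (u (e \<triangleleft> g)) \<in> at e" "act g (u (e \<triangleleft> g)) \<in> center A"
proof -
  let ?p = "pinv (center_action A G \<psi> g) a"
  note P = Gamma_pinv[OF g a]
  have e': "e \<in> idems A" "e \<in> D g" unfolding e using a center_closed eps_mem[OF D_ideal[OF g]] by auto
  have eg: "e \<triangleleft> g \<in> center A \<inter> J" "e \<triangleleft> g \<in> idems A" using idr_closed[OF g e'] J idems_center by auto
  have uc: "u (e \<triangleleft> g) \<in> center A" "u (e \<triangleleft> g) \<in> at (e \<triangleleft> g)"
    using sectD(1)[OF u eg] sect_at[OF ideal_inter_center(2)[OF J(1)] u eg] by auto
  show t: "act g (u (e \<triangleleft> g)) \<in> at e" "act g (u (e \<triangleleft> g)) \<in> center A"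
    using at_act[OF g e' uc] by auto
  have uD: "u (e \<triangleleft> g) \<in> D (\<iota> g)" using at_act(3)[OF g e' uc] .
  have "?p \<in> J" using eps_mem[OF J(1), of ?p] P(1,4) J(2) center_closed e by simp
  then have "ract ?p (mk_mult (center A \<inter> J) u) = ?p \<cdot> u (e \<triangleleft> g)"
    using P(1,4) e by (simp add: mk_mult_def)
  then show "the (center_action A G \<psi> g (ract ?p (mk_mult (center A \<inter> J) u))) = a \<cdot> act g (u (e \<triangleleft> g))"
    unfolding center_action_eq[OF g] using act_mult[OF g P(1,2) uc(1) uD] P(3)
    unfolding center_action_eq[OF g] by (simp add: act_def)
qed

text \<open>A coboundary uses one map for both sides of the multiplier; on a subsemigroup of the
  center right and left multiplication by a value agree.\<close>

lemma mk_mult_commI: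
  assumes T: "inverse_subsemigrp A T" "T \<subseteq> center A" and u: "\<And>e. \<lbrakk>e \<in> T; e \<in> idems A\<rbrakk> \<Longrightarrow> u e \<in> carrier A"
    and f: "\<And>a. a \<in> T \<Longrightarrow> f a = a \<cdot> u (\<epsilon> a)"
  shows "(\<lambda>a \<in> T. f a, \<lambda>a \<in> T. f a) = mk_mult T u"
proof -
  have "a \<cdot> u (\<epsilon> a) = u (\<epsilon> a) \<cdot> a" if "a \<in> T" for a
    by (rule center_commute) (use that subsemigrpD[OF T(1)] u T(2) in auto)
  then show ?thesis using f by (auto simp: mk_mult_def fun_eq_iff)
qed

lemma coboundary_act_simps:
  "coboundary_act G' B D' \<theta> 2 f [x1, x2, x3] a =
     (let fpow = (\<lambda>ys i. f ys [^]\<^bsub>chain_mult G' B D' ys\<^esub> (i :: int)) in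
      ract (ract (ract (the (\<theta> x1 (ract (pinv (\<theta> x1) a) (f [x2, x3]))))
        (fpow [x1 \<otimes>\<^bsub>G'\<^esub> x2, x3] (-1))) (fpow [x1, x2 \<otimes>\<^bsub>G'\<^esub> x3] 1)) (fpow [x1, x2] (-1)))"
  "coboundary_act G' B D' \<theta> 3 f [x1, x2, x3, x4] a =
     (let fpow = (\<lambda>ys i. f ys [^]\<^bsub>chain_mult G' B D' ys\<^esub> (i :: int)) in
      ract (ract (ract (ract (the (\<theta> x1 (ract (pinv (\<theta> x1) a) (f [x2, x3, x4]))))
        (fpow [x1 \<otimes>\<^bsub>G'\<^esub> x2, x3, x4] (-1))) (fpow [x1, x2 \<otimes>\<^bsub>G'\<^esub> x3, x4] 1))
        (fpow [x1, x2, x3 \<otimes>\<^bsub>G'\<^esub> x4] (-1))) (fpow [x1, x2, x3] 1))"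
proof -
  have u: "[1..<Suc 2] = [1::nat, 2]" "[1..<Suc 3] = [1::nat, 2, 3]"
    by (simp_all add: upt_rec)
  have p: "(-1) ^ 1 = (-1::int)" "(-1) ^ 2 = (1::int)" "(-1) ^ 3 = (-1::int)" "(-1) ^ (2 + 1) = (-1::int)"
    "(-1) ^ (3 + 1) = (1::int)"
    by simp_all
  have c: "contract G' 1 [x1, x2, x3] = [x1 \<otimes>\<^bsub>G'\<^esub> x2, x3]" "contract G' 2 [x1, x2, x3] = [x1, x2 \<otimes>\<^bsub>G'\<^esub> x3]"
    "contract G' 1 [x1, x2, x3, x4] = [x1 \<otimes>\<^bsub>G'\<^esub> x2, x3, x4]"
    "contract G' 2 [x1, x2, x3, x4] = [x1, x2 \<otimes>\<^bsub>G'\<^esub> x3, x4]"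
    "contract G' 3 [x1, x2, x3, x4] = [x1, x2, x3 \<otimes>\<^bsub>G'\<^esub> x4]"
    by (simp_all add: contract_def eval_nat_numeral)
  show "coboundary_act G' B D' \<theta> 2 f [x1, x2, x3] a =
     (let fpow = (\<lambda>ys i. f ys [^]\<^bsub>chain_mult G' B D' ys\<^esub> (i :: int)) in
      ract (ract (ract (the (\<theta> x1 (ract (pinv (\<theta> x1) a) (f [x2, x3]))))
        (fpow [x1 \<otimes>\<^bsub>G'\<^esub> x2, x3] (-1))) (fpow [x1, x2 \<otimes>\<^bsub>G'\<^esub> x3] 1)) (fpow [x1, x2] (-1)))"
    unfolding coboundary_act_def Let_def u foldl.simps p c by simp
  show "coboundary_act G' B D' \<theta> 3 f [x1, x2, x3, x4] a =
     (let fpow = (\<lambda>ys i. f ys [^]\<^bsub>chain_mult G' B D' ys\<^esub> (i :: int)) in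
      ract (ract (ract (ract (the (\<theta> x1 (ract (pinv (\<theta> x1) a) (f [x2, x3, x4]))))
        (fpow [x1 \<otimes>\<^bsub>G'\<^esub> x2, x3, x4] (-1))) (fpow [x1, x2 \<otimes>\<^bsub>G'\<^esub> x3, x4] 1))
        (fpow [x1, x2, x3 \<otimes>\<^bsub>G'\<^esub> x4] (-1))) (fpow [x1, x2, x3] 1))"
    unfolding coboundary_act_def Let_def u foldl.simps p c by simp
qed

lemma at_center_eps:
  "\<lbrakk>s \<in> at e; s \<in> center A; ideal_of A I; e \<in> I\<rbrakk> \<Longrightarrow> s \<in> center A \<inter> I \<and> \<epsilon> s = e"
  using at_ideal atD(2) by blast

text \<open>The factors act one after the other. Each partial product is again central and over
  \<open>e = \<epsilon> a\<close>, so the next multiplier is evaluated at the same \<open>e\<close>,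
  and the result is \<open>a\<close> times one product.\<close>

lemma coboundary2_act:
  assumes z: "central2 z" and G: "g \<in> carrier G" "h \<in> carrier G" "k \<in> carrier G" and a: "a \<in> K3 g h k"
  shows "coboundary_act G (center_semigrp A) C (center_action A G \<psi>) 2 (cochain2 z) [g, h, k] a = a \<cdot> dz z g h k (\<epsilon> a)"
proof -
  define e where "e = \<epsilon> a"
  have ac: "a \<in> center A" "a \<in> carrier A" "a \<in> D g" "a \<in> P3 g h k" using a center_closed by auto
  have e: "e \<in> idems A" "e \<in> P3 g h k" unfolding e_def using ac eps_mem[OF P_ideal(2)[OF G]] by auto
  note F = P3_faces[OF G e]
  have gg: "g \<odot> h \<in> carrier G" "h \<odot> k \<in> carrier G" using G by auto
  have zs: "sect (K2 g h) (z g h)" if "g \<in> carrier G" "h \<in> carrier G" for g h using z that by (simp add: central2_def)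
  define z1 where "z1 = act g (z h k (e \<triangleleft> g))"
  note r = act_ract[OF G(1) ac(1,3) e_def P_ideal(1)[OF G(2,3)] F(2) zs[OF G(2,3)], folded z1_def]
  have aa: "a \<in> at e" using ac by (simp add: at_def e_def)
  have Z: "z (g \<odot> h) k e \<in> at e" "z (g \<odot> h) k e \<in> center A" "z g (h \<odot> k) e \<in> at e" "z g (h \<odot> k) e \<in> center A"
    "z g h e \<in> at e" "z g h e \<in> center A"
    using central2_sect[OF z] F G e by auto
  note zc = Z(1,3,5)[THEN atD(1)] r(2)[THEN atD(1)]
  have s1: "a \<cdot> z1 \<in> at e" "a \<cdot> z1 \<in> center A" using aa r ac center_mult by auto
  have s2: "a \<cdot> z1 \<cdot> (z (g \<odot> h) k e)\<^sup>\<dagger> \<in> at e" "a \<cdot> z1 \<cdot> (z (g \<odot> h) k e)\<^sup>\<dagger> \<in> center A"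
    using s1 Z center_mult center_sinv by auto
  have s3: "a \<cdot> z1 \<cdot> (z (g \<odot> h) k e)\<^sup>\<dagger> \<cdot> z g (h \<odot> k) e \<in> at e" "a \<cdot> z1 \<cdot> (z (g \<odot> h) k e)\<^sup>\<dagger> \<cdot> z g (h \<odot> k) e \<in> center A"
    using s2 Z center_mult by auto
  note m1 = at_center_eps[OF s1 P_ideal(1)[OF gg(1) G(3)] F(3)]
    and m2 = at_center_eps[OF s2 P_ideal(1)[OF G(1) gg(2)] F(4)]
    and m3 = at_center_eps[OF s3 P_ideal(1)[OF G(1,2)] F(5)]
  have "coboundary_act G (center_semigrp A) C (center_action A G \<psi>) 2 (cochain2 z) [g, h, k] a =
      a \<cdot> z1 \<cdot> (z (g \<odot> h) k e)\<^sup>\<dagger> \<cdot> z g (h \<odot> k) e \<cdot> (z g h e)\<^sup>\<dagger>"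
    unfolding coboundary_act_simps Let_def chain_mult_eq chain_eq(1)[OF gg(1) G(3)] chain_eq(1)[OF G(1) gg(2)] chain_eq(1)[OF G(1,2)]
      cochain2_apply[OF gg(1) G(3)] cochain2_apply[OF G(1) gg(2)] cochain2_apply[OF G(1,2)] cochain2_apply[OF G(2,3)] r(1)
      ract_power_mk_mult(3)[OF K_subsemigrp(1)[OF gg(1) G(3)] zs[OF gg(1) G(3)] m1[THEN conjunct1] m1[THEN conjunct2]]
      ract_power_mk_mult(2)[OF K_subsemigrp(1)[OF G(1) gg(2)] zs[OF G(1) gg(2)] m2[THEN conjunct1] m2[THEN conjunct2]]
      ract_power_mk_mult(3)[OF K_subsemigrp(1)[OF G(1,2)] zs[OF G(1,2)] m3[THEN conjunct1] m3[THEN conjunct2]] ..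
  also have "\<dots> = a \<cdot> dz z g h k e"
    unfolding dz_def z1_def[symmetric] using ac zc by (simp add: assoc closed)
  finally show ?thesis by (simp add: e_def)
qed

lemma coboundary2:
  assumes z: "central2 z"
  shows "\<delta> 2 (cochain2 z) = cochain3 (dz z)"
proof
  fix xs
  show "\<delta> 2 (cochain2 z) xs = cochain3 (dz z) xs"
  proof (cases "xs \<in> tuples G 3")
    case True
    then obtain g h k where xs: "xs = [g, h, k]" and G: "g \<in> carrier G" "h \<in> carrier G" "k \<in> carrier G"
      by (auto simp: tuples_cases)
    have "mk_mult (K3 g h k) (dz z g h k) =
        (\<lambda>a \<in> K3 g h k. coboundary_act G (center_semigrp A) C (center_action A G \<psi>) 2 (cochain2 z) [g, h, k] a,
         \<lambda>a \<in> K3 g h k. coboundary_act G (center_semigrp A) C (center_action A G \<psi>) 2 (cochain2 z) [g, h, k] a)"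
    proof (rule mk_mult_commI[OF K_subsemigrp(2)[OF G], symmetric])
      show "dz z g h k e \<in> carrier A" if "e \<in> K3 g h k" "e \<in> idems A" for e
        using dz_at(3)[OF z G] that atD(1) by blast
    qed (use coboundary2_act[OF z G] in auto)
    then show ?thesis
      using True G by (simp add: coboundary_def xs cochain3_apply chain_eq)
  qed (simp add: coboundary_def cochain3_def)
qed

definition dz3 :: "('g \<Rightarrow> 'g \<Rightarrow> 'g \<Rightarrow> 'a \<Rightarrow> 'a) \<Rightarrow> 'g \<Rightarrow> 'g \<Rightarrow> 'g \<Rightarrow> 'g \<Rightarrow> 'a \<Rightarrow> 'a" where
  "dz3 b g h k l e = act g (b h k l (e \<triangleleft> g)) \<cdot> (b (g \<odot> h) k l e)\<^sup>\<dagger> \<cdot> b g (h \<odot> k) l e \<cdot> (b g h (k \<odot> l) e)\<^sup>\<dagger> \<cdot> b g h k e"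

lemma coboundary3_act:
  assumes b: "central3 b" and G: "g \<in> carrier G" "h \<in> carrier G" "k \<in> carrier G" "l \<in> carrier G" and a: "a \<in> K4 g h k l"
  shows "coboundary_act G (center_semigrp A) C (center_action A G \<psi>) 3 (cochain3 b) [g, h, k, l] a = a \<cdot> dz3 b g h k l (\<epsilon> a)"
proof -
  define e where "e = \<epsilon> a"
  have ac: "a \<in> center A" "a \<in> carrier A" "a \<in> D g" "a \<in> P4 g h k l" using a center_closed by auto
  have e: "e \<in> idems A" "e \<in> P4 g h k l" unfolding e_def using ac eps_mem[OF P_ideal(3)[OF G]] by auto
  note F = P4_faces[OF G e]
  have gg: "g \<odot> h \<in> carrier G" "h \<odot> k \<in> carrier G" "k \<odot> l \<in> carrier G" using G by auto
  have bs: "sect (K3 g h k) (b g h k)" if "g \<in> carrier G" "h \<in> carrier G" "k \<in> carrier G" for g h k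
    using b that by (simp add: central3_def)
  have be: "b g h k e \<in> at e" "b g h k e \<in> center A"
    if "g \<in> carrier G" "h \<in> carrier G" "k \<in> carrier G" "e \<in> P3 g h k" for g h k
    using sectD(1)[OF bs[OF that(1-3)] _ e(1)] sect_at[OF K_subsemigrp(2)[OF that(1-3)] bs[OF that(1-3)] _ e(1)]
      that(4) idems_center[OF e(1)] by auto
  define b1 where "b1 = act g (b h k l (e \<triangleleft> g))"
  note r = act_ract[OF G(1) ac(1,3) e_def P_ideal(2)[OF G(2-4)] F(2) bs[OF G(2-4)], folded b1_def]
  have aa: "a \<in> at e" using ac by (simp add: at_def e_def)
  note B2 = be[OF gg(1) G(3,4) F(3)] and B3 = be[OF G(1) gg(2) G(4) F(4)] and B4 = be[OF G(1,2) gg(3) F(5)]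
    and B5 = be[OF G(1-3) F(6)]
  note zc = B2(1)[THEN atD(1)] B3(1)[THEN atD(1)] B4(1)[THEN atD(1)] B5(1)[THEN atD(1)] r(2)[THEN atD(1)]
  have s1: "a \<cdot> b1 \<in> at e" "a \<cdot> b1 \<in> center A" using aa r ac center_mult by auto
  have s2: "a \<cdot> b1 \<cdot> (b (g \<odot> h) k l e)\<^sup>\<dagger> \<in> at e" "a \<cdot> b1 \<cdot> (b (g \<odot> h) k l e)\<^sup>\<dagger> \<in> center A"
    using s1 B2 center_mult center_sinv by auto
  have s3: "a \<cdot> b1 \<cdot> (b (g \<odot> h) k l e)\<^sup>\<dagger> \<cdot> b g (h \<odot> k) l e \<in> at e"
    "a \<cdot> b1 \<cdot> (b (g \<odot> h) k l e)\<^sup>\<dagger> \<cdot> b g (h \<odot> k) l e \<in> center A"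
    using s2 B3 center_mult by auto
  have s4: "a \<cdot> b1 \<cdot> (b (g \<odot> h) k l e)\<^sup>\<dagger> \<cdot> b g (h \<odot> k) l e \<cdot> (b g h (k \<odot> l) e)\<^sup>\<dagger> \<in> at e"
    "a \<cdot> b1 \<cdot> (b (g \<odot> h) k l e)\<^sup>\<dagger> \<cdot> b g (h \<odot> k) l e \<cdot> (b g h (k \<odot> l) e)\<^sup>\<dagger> \<in> center A"
    using s3 B4 center_mult center_sinv by auto
  note m1 = at_center_eps[OF s1 P_ideal(2)[OF gg(1) G(3,4)] F(3)]
    and m2 = at_center_eps[OF s2 P_ideal(2)[OF G(1) gg(2) G(4)] F(4)]
    and m3 = at_center_eps[OF s3 P_ideal(2)[OF G(1,2) gg(3)] F(5)]
    and m4 = at_center_eps[OF s4 P_ideal(2)[OF G(1-3)] F(6)]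
  have "coboundary_act G (center_semigrp A) C (center_action A G \<psi>) 3 (cochain3 b) [g, h, k, l] a =
      a \<cdot> b1 \<cdot> (b (g \<odot> h) k l e)\<^sup>\<dagger> \<cdot> b g (h \<odot> k) l e \<cdot> (b g h (k \<odot> l) e)\<^sup>\<dagger> \<cdot> b g h k e"
    unfolding coboundary_act_simps Let_def chain_mult_eq chain_eq(2)[OF gg(1) G(3,4)] chain_eq(2)[OF G(1) gg(2) G(4)]
      chain_eq(2)[OF G(1,2) gg(3)] chain_eq(2)[OF G(1-3)]
      cochain3_apply[OF gg(1) G(3,4)] cochain3_apply[OF G(1) gg(2) G(4)] cochain3_apply[OF G(1,2) gg(3)]
      cochain3_apply[OF G(1-3)] cochain3_apply[OF G(2-4)] r(1)
      ract_power_mk_mult(3)[OF K_subsemigrp(2)[OF gg(1) G(3,4)] bs[OF gg(1) G(3,4)] m1[THEN conjunct1] m1[THEN conjunct2]]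
      ract_power_mk_mult(2)[OF K_subsemigrp(2)[OF G(1) gg(2) G(4)] bs[OF G(1) gg(2) G(4)] m2[THEN conjunct1] m2[THEN conjunct2]]
      ract_power_mk_mult(3)[OF K_subsemigrp(2)[OF G(1,2) gg(3)] bs[OF G(1,2) gg(3)] m3[THEN conjunct1] m3[THEN conjunct2]]
      ract_power_mk_mult(2)[OF K_subsemigrp(2)[OF G(1-3)] bs[OF G(1-3)] m4[THEN conjunct1] m4[THEN conjunct2]] ..
  also have "\<dots> = a \<cdot> dz3 b g h k l e"
    unfolding dz3_def b1_def[symmetric] using ac zc by (simp add: assoc closed)
  finally show ?thesis by (simp add: e_def)
qed

lemma cochain3_cocycle:
  assumes b: "central3 b"
    and cocycle: "\<And>g h k l e. \<lbrakk>g \<in> carrier G; h \<in> carrier G; k \<in> carrier G; l \<in> carrier G; e \<in> idems A; e \<in> P4 g h k l\<rbrakk>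
      \<Longrightarrow> dz3 b g h k l e = e"
  shows "cochain3 b \<in> center_cocycles A G \<psi> 3"
proof -
  have "\<delta> 3 (cochain3 b) = \<one>\<^bsub>Cochains 4\<^esub>"
  proof
    fix xs
    show "\<delta> 3 (cochain3 b) xs = \<one>\<^bsub>Cochains 4\<^esub> xs"
    proof (cases "xs \<in> tuples G 4")
      case True
      then obtain g h k l where xs: "xs = [g, h, k, l]" and G: "g \<in> carrier G" "h \<in> carrier G" "k \<in> carrier G" "l \<in> carrier G"
        by (auto simp: tuples_cases)
      have "coboundary_act G (center_semigrp A) C (center_action A G \<psi>) 3 (cochain3 b) [g, h, k, l] a = a" if a: "a \<in> K4 g h k l" for a
      proof -
        have "a \<in> carrier A" "a \<in> P4 g h k l" using a center_closed by auto
        then show ?thesis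
          using coboundary3_act[OF b G a] cocycle[OF G, of "\<epsilon> a"] eps_mem[OF P_ideal(3)[OF G]] by simp
      qed
      then show ?thesis
        using True G by (simp add: coboundary_def cochains_def xs chain_eq chain_mult_eq cong: restrict_cong)
    qed (simp add: coboundary_def cochains_def)
  qed
  then show ?thesis
    using cochain3_closed[OF b] by (simp add: center_cocycles_def cocycles_def kernel_def)
qed

section \<open>The class of an obstruction\<close>

lemma obstruction_cochain:
  assumes "obstruction A G \<psi> \<beta>"
  shows "central3 (\<lambda>g h k. fst (\<beta> g h k))" "center_cochain A G \<psi> \<beta> = cochain3 (\<lambda>g h k. fst (\<beta> g h k))"
    "center_cochain A G \<psi> \<beta> \<in> center_cocycles A G \<psi> 3"
proof -
  obtain \<theta> W where 1: "representatives G \<psi> \<theta>" "twisting A G \<psi> \<theta> W" "associator A G \<psi> \<theta> W \<beta>"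
    using assms by (auto simp: obstruction_def)
  interpret R: kernel_reps A G \<psi> \<theta> by (rule kernel_repsI) fact
  note w = R.twisting_twists(1)[OF 1(2)] and b = R.associator_associates[OF 1(2,3)]
  show b3: "central3 (\<lambda>g h k. fst (\<beta> g h k))" by (rule R.central3_associates[OF w b])
  show eq: "center_cochain A G \<psi> \<beta> = cochain3 (\<lambda>g h k. fst (\<beta> g h k))"
    unfolding center_cochain_def cochain3_def
  proof (rule restrict_ext)
    fix xs assume "xs \<in> tuples G 3"
    then obtain g h k where xs: "xs = [g, h, k]" and G: "g \<in> carrier G" "h \<in> carrier G" "k \<in> carrier G"
      by (auto simp: tuples_cases)
    note I = P_ideal(2)[OF G]
    have "\<beta> g h k \<in> Units (center_monoid (MM (P3 g h k)))"
      using 1(3)[unfolded associator_def Let_def, rule_format, OF G, unfolded R.associator_ideals[OF G]] by (rule conjunct1)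
    then have "\<beta> g h k = mk_mult (P3 g h k) (fst (\<beta> g h k))"
      using Units_MM(2)[OF ideal_subsemigrp[OF I]] unfolding Units_center_MM[OF I] by blast
    then have "mrestrict (\<beta> g h k) (K3 g h k) = mk_mult (K3 g h k) (fst (\<beta> g h k))"
      using mrestrict_mk_mult[of "K3 g h k" "P3 g h k"] by (metis Int_lower2)
    then show "mrestrict (\<beta> (xs ! 0) (xs ! 1) (xs ! 2)) (chain G (center_semigrp A) C xs) =
        mk_mult (K3 (xs ! 0) (xs ! 1) (xs ! 2)) (lact (\<beta> (xs ! 0) (xs ! 1) (xs ! 2)))"
      using chain_eq(2)[OF G] by (simp add: xs)
  qed
  show "center_cochain A G \<psi> \<beta> \<in> center_cocycles A G \<psi> 3"
    unfolding eq
  proof (rule cochain3_cocycle[OF b3])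
    fix g h k l e assume G: "g \<in> carrier G" "h \<in> carrier G" "k \<in> carrier G" "l \<in> carrier G" and e: "e \<in> idems A" "e \<in> P4 g h k l"
    interpret H: group "grp_at e" by (rule group_grp_at[OF e(1)])
    note H = at_is_group(2,3)[OF e(1)]
    note c = R.associates_cocycle[OF w b G e] and F = P4_faces[OF G e]
    have gg: "g \<odot> h \<in> carrier G" "h \<odot> k \<in> carrier G" "k \<odot> l \<in> carrier G" using G by auto
    define b1 b2 b3 b4 b5 where bd: "b1 = act g (fst (\<beta> h k l) (e \<triangleleft> g))" "b2 = fst (\<beta> g (h \<odot> k) l) e" "b3 = fst (\<beta> g h k) e"
      "b4 = fst (\<beta> g h (k \<odot> l)) e" "b5 = fst (\<beta> (g \<odot> h) k l) e"
    have B: "b1 \<in> at e" "b2 \<in> at e" "b3 \<in> at e" "b4 \<in> at e" "b5 \<in> at e"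
      using R.associatesD(1)[OF b G(1) gg(2) G(4) e(1) F(4)] R.associatesD(1)[OF b G(1-3) e(1) F(6)]
        R.associatesD(1)[OF b G(1,2) gg(3) e(1) F(5)] R.associatesD(1)[OF b gg(1) G(3,4) e(1) F(3)] c(2)
      by (simp_all add: bd)
    have cb: "b3 \<in> center A" "b4 \<in> center A" "b5 \<in> center A" "b2 \<in> center A"
      using R.associatesD(2)[OF b G(1-3) e(1) F(6)] R.associatesD(2)[OF b G(1,2) gg(3) e(1) F(5)]
        R.associatesD(2)[OF b gg(1) G(3,4) e(1) F(3)] R.associatesD(2)[OF b G(1) gg(2) G(4) e(1) F(4)]
      by (simp_all add: bd)
    note bc = B[THEN atD(1)]
    \<comment> \<open>The cocycle identity separates the terms by sign, while the coboundary
      alternates them; the rest of the computation only reorders central factors.\<close>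
    have eq: "b1 \<cdot> b2 \<cdot> b3 = b4 \<cdot> b5" using c(1) by (simp add: bd)
    have "b1 \<cdot> b5\<^sup>\<dagger> \<cdot> b2 \<cdot> b4\<^sup>\<dagger> \<cdot> b3 = b1 \<cdot> (b5\<^sup>\<dagger> \<cdot> b2) \<cdot> (b4\<^sup>\<dagger> \<cdot> b3)" using bc by (simp add: assoc closed)
    also have "\<dots> = b1 \<cdot> b2 \<cdot> (b5\<^sup>\<dagger> \<cdot> b3) \<cdot> b4\<^sup>\<dagger>"
      unfolding center_commute[OF cb(4) sinv_closed[OF bc(5)], symmetric] center_commute[OF cb(1) sinv_closed[OF bc(4)], symmetric]
      using bc by (simp add: assoc closed)
    also have "\<dots> = (b1 \<cdot> b2 \<cdot> b3) \<cdot> b5\<^sup>\<dagger> \<cdot> b4\<^sup>\<dagger>"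
      unfolding center_commute[OF cb(1) sinv_closed[OF bc(5)], symmetric] using bc by (simp add: assoc closed)
    also have "\<dots> = e"
      unfolding eq using bc atD(2)[OF B(5)] atD(2)[OF B(4)] at_unit(2)[OF B(4)] at_unit[OF at_sinv[OF B(4)]] idems_closed[OF e(1)]
      by (simp add: assoc closed)
    finally show "dz3 (\<lambda>g h k. fst (\<beta> g h k)) g h k l e = e" by (simp add: dz3_def bd)
  qed
qed

lemma coboundaries3: "coboundaries G (center_semigrp A) C (center_action A G \<psi>) 3 = {cochain3 (dz z) | z. central2 z}"
proof -
  have "coboundaries G (center_semigrp A) C (center_action A G \<psi>) 3 = \<delta> 2 ` cochain2 ` {z. central2 z}"
    by (simp add: coboundaries_def cochains2)
  then show ?thesis using coboundary2 by (auto simp: image_iff)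
qed

lemma dz_mult:
  assumes z: "central2 z" "central2 y" and G: "g \<in> carrier G" "h \<in> carrier G" "k \<in> carrier G" and e: "e \<in> idems A" "e \<in> P3 g h k"
  shows "dz (\<lambda>g h e. z g h e \<cdot> y g h e) g h k e = dz z g h k e \<cdot> dz y g h k e"
proof -
  note F = P3_faces[OF G e]
  have Z: "z h k (e \<triangleleft> g) \<in> at (e \<triangleleft> g)" "z h k (e \<triangleleft> g) \<in> center A"
    "z (g \<odot> h) k e \<in> at e" "z (g \<odot> h) k e \<in> center A" "z g (h \<odot> k) e \<in> at e" "z g (h \<odot> k) e \<in> center A"
    "z g h e \<in> at e" "z g h e \<in> center A"
    using central2_sect[OF z(1)] F G e by auto
  have Y: "y h k (e \<triangleleft> g) \<in> at (e \<triangleleft> g)" "y h k (e \<triangleleft> g) \<in> center A"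
    "y (g \<odot> h) k e \<in> at e" "y (g \<odot> h) k e \<in> center A" "y g (h \<odot> k) e \<in> at e" "y g (h \<odot> k) e \<in> center A"
    "y g h e \<in> at e" "y g h e \<in> center A"
    using central2_sect[OF z(2)] F G e by auto
  define z1 z2 z3 z4 where zd: "z1 = act g (z h k (e \<triangleleft> g))" "z2 = (z (g \<odot> h) k e)\<^sup>\<dagger>" "z3 = z g (h \<odot> k) e" "z4 = (z g h e)\<^sup>\<dagger>"
  define y1 y2 y3 y4 where yd: "y1 = act g (y h k (e \<triangleleft> g))" "y2 = (y (g \<odot> h) k e)\<^sup>\<dagger>" "y3 = y g (h \<odot> k) e" "y4 = (y g h e)\<^sup>\<dagger>"
  have zc: "z1 \<in> center A" "z2 \<in> center A" "z3 \<in> center A" "z4 \<in> center A"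
    "y1 \<in> center A" "y2 \<in> center A" "y3 \<in> center A" "y4 \<in> center A"
    using dz_at(2)[OF z(1) G e] dz_at(2)[OF z(2) G e] Z Y by (simp_all add: zd yd center_sinv)
  note c = zc[THEN center_closed]
  have 1: "act g (z h k (e \<triangleleft> g) \<cdot> y h k (e \<triangleleft> g)) = z1 \<cdot> y1"
    using act_mult[OF G(1) Z(2) _ Y(2)] at_act(3)[OF G(1) e(1) F(6) Z(2,1)] at_act(3)[OF G(1) e(1) F(6) Y(2,1)] by (simp add: zd yd)
  have 2: "(z (g \<odot> h) k e \<cdot> y (g \<odot> h) k e)\<^sup>\<dagger> = z2 \<cdot> y2" "(z g h e \<cdot> y g h e)\<^sup>\<dagger> = z4 \<cdot> y4"
    using Z Y center_closed center_commute[OF zc(2) c(6)] center_commute[OF zc(4) c(8)] by (simp_all add: sinv_mult zd yd)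
  have "z1 \<cdot> y1 \<cdot> (z2 \<cdot> y2) \<cdot> (z3 \<cdot> y3) \<cdot> (z4 \<cdot> y4) = z1 \<cdot> (y1 \<cdot> z2) \<cdot> y2 \<cdot> z3 \<cdot> (y3 \<cdot> z4) \<cdot> y4"
    using c by (simp add: assoc closed)
  also have "\<dots> = z1 \<cdot> z2 \<cdot> ((y1 \<cdot> y2) \<cdot> (z3 \<cdot> z4)) \<cdot> y3 \<cdot> y4"
    unfolding center_commute[OF zc(5) c(2)] center_commute[OF zc(7) c(4)] using c by (simp add: assoc closed)
  also have "\<dots> = (z1 \<cdot> z2 \<cdot> z3 \<cdot> z4) \<cdot> (y1 \<cdot> y2 \<cdot> y3 \<cdot> y4)"
    unfolding center_commute[OF center_mult[OF zc(5,6)] closed[OF c(3,4)]] using c by (simp add: assoc closed)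
  finally show ?thesis unfolding dz_def 1 2 zd(3)[symmetric] yd(3)[symmetric] by (simp add: zd yd)
qed

lemma dz_idem:
  "\<lbrakk>g \<in> carrier G; h \<in> carrier G; k \<in> carrier G; e \<in> idems A; e \<in> P3 g h k\<rbrakk> \<Longrightarrow> dz (\<lambda>g h e. e) g h k e = e"
  using act_idr[of g e] idems_idem[of e] by (simp add: dz_def)

lemma dz_sinv:
  assumes z: "central2 z" and G: "g \<in> carrier G" "h \<in> carrier G" "k \<in> carrier G" and e: "e \<in> idems A" "e \<in> P3 g h k"
  shows "dz z g h k e \<cdot> dz (\<lambda>g h e. (z g h e)\<^sup>\<dagger>) g h k e = e"
proof -
  note F = P3_faces[OF G e]
  have "z h k (e \<triangleleft> g) \<in> at (e \<triangleleft> g)" "z (g \<odot> h) k e \<in> at e" "z g (h \<odot> k) e \<in> at e" "z g h e \<in> at e"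
    using central2_sect(2)[OF z] F G e by auto
  then have "dz (\<lambda>g h e. z g h e \<cdot> (z g h e)\<^sup>\<dagger>) g h k e = e"
    using atD act_idr[OF G(1) e(1) F(6)] idems_idem[OF e(1)] e(1) by (simp add: dz_def)
  then show ?thesis using dz_mult[OF z central2_sinv[OF z] G e] by simp
qed

lemma obstruction_class_eq:
  assumes "obstruction A G \<psi> \<beta>"
  shows "obstruction_class A G \<psi> \<beta> = {cochain3 (\<lambda>g h k e. dz z g h k e \<cdot> fst (\<beta> g h k) e) | z. central2 z}"
  unfolding obstruction_class_def r_coset_def coboundaries3 obstruction_cochain(2)[OF assms]
  using cochain3_mult[OF central3_dz obstruction_cochain(1)[OF assms]] by auto

text \<open>One inclusion is enough: for two obstructions the difference is available in both
  directions, and for the comparison with the unit cochain the inverse of the family serves for the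
  other inclusion.\<close>

lemma coset_shift:
  assumes b: "central3 b" "central3 b'" and y: "central2 y"
    and eq: "\<And>g h k e. \<lbrakk>g \<in> carrier G; h \<in> carrier G; k \<in> carrier G; e \<in> idems A; e \<in> P3 g h k\<rbrakk> \<Longrightarrow> b' g h k e = b g h k e \<cdot> dz y g h k e"
  shows "{cochain3 (\<lambda>g h k e. dz z g h k e \<cdot> b' g h k e) | z. central2 z} \<subseteq> {cochain3 (\<lambda>g h k e. dz z g h k e \<cdot> b g h k e) | z. central2 z}"
proof
  fix f assume "f \<in> {cochain3 (\<lambda>g h k e. dz z g h k e \<cdot> b' g h k e) | z. central2 z}"
  then obtain z where z: "central2 z" and f: "f = cochain3 (\<lambda>g h k e. dz z g h k e \<cdot> b' g h k e)" by blast
  have zy: "central2 (\<lambda>g h e. z g h e \<cdot> y g h e)" by (rule central2_mult[OF z y])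
  have "f = cochain3 (\<lambda>g h k e. dz (\<lambda>g h e. z g h e \<cdot> y g h e) g h k e \<cdot> b g h k e)"
    unfolding f cochain3_eq_iff[OF central3_mult[OF central3_dz[OF z] b(2)] central3_mult[OF central3_dz[OF zy] b(1)]]
  proof (intro ballI)
    fix g h k e assume G: "g \<in> carrier G" "h \<in> carrier G" "k \<in> carrier G" and "e \<in> idems A \<inter> P3 g h k"
    then have e: "e \<in> idems A" "e \<in> P3 g h k" by auto
    have "b g h k e \<in> K3 g h k" using b(1) G e sectD(1)[of "K3 g h k" "b g h k" e] idems_center by (auto simp: central3_def)
    then have c: "b g h k e \<in> center A" "b g h k e \<in> carrier A" using center_closed by auto
    note d = dz_at(3)[OF z G e, THEN atD(1)] dz_at(3)[OF y G e, THEN atD(1)]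
    show "dz z g h k e \<cdot> b' g h k e = dz (\<lambda>g h e. z g h e \<cdot> y g h e) g h k e \<cdot> b g h k e"
      unfolding eq[OF G e] dz_mult[OF z y G e] center_commute[OF c(1) d(2)] using c d by (simp add: assoc)
  qed
  then show "f \<in> {cochain3 (\<lambda>g h k e. dz z g h k e \<cdot> b g h k e) | z. central2 z}" using zy by blast
qed

lemma obstruction_class_unique:
  assumes "obstruction A G \<psi> \<beta>" "obstruction A G \<psi> \<beta>'"
  shows "obstruction_class A G \<psi> \<beta> = obstruction_class A G \<psi> \<beta>'"
proof -
  have "obstruction_class A G \<psi> \<beta> \<subseteq> obstruction_class A G \<psi> \<beta>'" if o: "obstruction A G \<psi> \<beta>" "obstruction A G \<psi> \<beta>'" for \<beta> \<beta>'
  proof -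
    obtain z where z: "central2 z" "\<And>g h k e. \<lbrakk>g \<in> carrier G; h \<in> carrier G; k \<in> carrier G; e \<in> idems A; e \<in> P3 g h k\<rbrakk> \<Longrightarrow>
        fst (\<beta> g h k) e = fst (\<beta>' g h k) e \<cdot> dz z g h k e"
      using obstruction_difference[OF o(2,1)] by blast
    show ?thesis
      unfolding obstruction_class_eq[OF o(1)] obstruction_class_eq[OF o(2)]
      by (rule coset_shift[OF obstruction_cochain(1)[OF o(2)] obstruction_cochain(1)[OF o(1)] z])
  qed
  then show ?thesis using assms by blast
qed

lemma Obs_eq: "obstruction A G \<psi> \<beta> \<Longrightarrow> obstruction_class A G \<psi> \<beta> = Obs A G \<psi>"
proof -
  assume o: "obstruction A G \<psi> \<beta>"
  then have "obstruction_class A G \<psi> ` {\<beta>. obstruction A G \<psi> \<beta>} = {obstruction_class A G \<psi> \<beta>}"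
    using obstruction_class_unique[OF o] by blast
  then show ?thesis by (simp add: Obs_def)
qed

lemma Obs_closed: "Obs A G \<psi> \<in> carrier (center_cohomology A G \<psi> 3)"
proof -
  obtain \<beta> where o: "obstruction A G \<psi> \<beta>" using obstruction_exists by blast
  show ?thesis
    unfolding Obs_eq[OF o, symmetric] obstruction_class_def center_cohomology_def cohomology_def FactGroup_def RCOSETS_def
    using obstruction_cochain(3)[OF o] by (auto simp: center_cocycles_def r_coset_def)
qed

text \<open>The unit cochain is a member of the trivial class; membership read in the coset of
  \<beta> yields that \<beta> is a coboundary. The converse is two shifts of cosets.\<close>

lemma Obs_trivial_iff:
  assumes o: "obstruction A G \<psi> \<beta>"
  shows "Obs A G \<psi> = \<one>\<^bsub>center_cohomology A G \<psi> 3\<^esub> \<longleftrightarrow> (\<exists>z. central2 z \<and>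
    (\<forall>g \<in> carrier G. \<forall>h \<in> carrier G. \<forall>k \<in> carrier G. \<forall>e \<in> idems A \<inter> P3 g h k. fst (\<beta> g h k) e = dz z g h k e))"
    (is "_ \<longleftrightarrow> ?R")
proof -
  note b = obstruction_cochain(1)[OF o]
  have one: "\<one>\<^bsub>center_cohomology A G \<psi> 3\<^esub> = {cochain3 (dz z) | z. central2 z}"
    by (simp add: center_cohomology_def cohomology_def FactGroup_def coboundaries3)
  have d1: "cochain3 (\<lambda>g h k e. dz z g h k e \<cdot> e) = cochain3 (dz z)" if z: "central2 z" for z
    unfolding cochain3_eq_iff[OF central3_mult[OF central3_dz[OF z] central3_idem] central3_dz[OF z]]
    by (intro ballI) (simp add: at_unit(2)[OF dz_at(3)[OF z]])
  \<comment> \<open>The subgroup of coboundaries is written as the coset of the unit cochain, whose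
    value at \<open>e\<close> is \<open>e\<close>, to give it the form required by
    \<open>coset_shift\<close>.\<close>
  have one': "\<one>\<^bsub>center_cohomology A G \<psi> 3\<^esub> = {cochain3 (\<lambda>g h k e. dz z g h k e \<cdot> e) | z. central2 z}"
    unfolding one by (intro Collect_cong arg_cong[where f = Ex] ext) (rule iffI; elim conjE; simp add: d1)
  have be: "fst (\<beta> g h k) e \<in> at e"
    if "g \<in> carrier G" "h \<in> carrier G" "k \<in> carrier G" "e \<in> idems A" "e \<in> P3 g h k" for g h k e
    using b that sect_at[OF K_subsemigrp(2)[OF that(1-3)], of "fst (\<beta> g h k)" e] idems_center by (auto simp: central3_def)
  show ?thesis
  proof
    assume "Obs A G \<psi> = \<one>\<^bsub>center_cohomology A G \<psi> 3\<^esub>"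
    then have eq: "{cochain3 (\<lambda>g h k e. dz z g h k e \<cdot> fst (\<beta> g h k) e) | z. central2 z} = {cochain3 (dz z) | z. central2 z}"
      unfolding one Obs_eq[OF o, symmetric] obstruction_class_eq[OF o] .
    have "cochain3 (\<lambda>g h k e. dz (\<lambda>g h e. e) g h k e \<cdot> fst (\<beta> g h k) e) \<in> {cochain3 (dz z) | z. central2 z}"
      unfolding eq[symmetric] using central2_idem by blast
    then obtain z where z: "central2 z"
      "cochain3 (\<lambda>g h k e. dz (\<lambda>g h e. e) g h k e \<cdot> fst (\<beta> g h k) e) = cochain3 (dz z)" by blast
    have "fst (\<beta> g h k) e = dz z g h k e"
      if that: "g \<in> carrier G" "h \<in> carrier G" "k \<in> carrier G" "e \<in> idems A" "e \<in> P3 g h k" for g h k e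
    proof -
      have "dz (\<lambda>g h e. e) g h k e \<cdot> fst (\<beta> g h k) e = dz z g h k e"
        using z(2)[unfolded cochain3_eq_iff[OF central3_mult[OF central3_dz[OF central2_idem] b] central3_dz[OF z(1)]],
            rule_format, OF that(1-3) IntI[OF that(4,5)]] .
      then show ?thesis unfolding dz_idem[OF that] at_unit(1)[OF be[OF that]] .
    qed
    then show ?R using z(1) by (intro exI[of _ z] conjI ballI) simp_all
  next
    assume ?R
    then obtain z where z1: "central2 z" and
      z2: "\<forall>g \<in> carrier G. \<forall>h \<in> carrier G. \<forall>k \<in> carrier G. \<forall>e \<in> idems A \<inter> P3 g h k. fst (\<beta> g h k) e = dz z g h k e"
      by (elim exE conjE)
    have z: "central2 z"
      "\<And>g h k e. \<lbrakk>g \<in> carrier G; h \<in> carrier G; k \<in> carrier G; e \<in> idems A; e \<in> P3 g h k\<rbrakk> \<Longrightarrow> fst (\<beta> g h k) e = dz z g h k e"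
      using z1 z2 by simp_all
    note z' = central2_sinv[OF z(1)]
    note i = dz_sinv[OF z(1)]
    show "Obs A G \<psi> = \<one>\<^bsub>center_cohomology A G \<psi> 3\<^esub>"
      unfolding one' Obs_eq[OF o, symmetric] obstruction_class_eq[OF o]
    proof
      show "{cochain3 (\<lambda>g h k e. dz z g h k e \<cdot> fst (\<beta> g h k) e) | z. central2 z} \<subseteq> {cochain3 (\<lambda>g h k e. dz z g h k e \<cdot> e) | z. central2 z}"
        by (rule coset_shift[OF central3_idem b z(1)]) (use z(2) dz_at(3)[OF z(1)] at_unit(1) in simp)
      show "{cochain3 (\<lambda>g h k e. dz z g h k e \<cdot> e) | z. central2 z} \<subseteq> {cochain3 (\<lambda>g h k e. dz z g h k e \<cdot> fst (\<beta> g h k) e) | z. central2 z}"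
        by (rule coset_shift[OF b central3_idem z']) (use z(2) i in simp)
    qed
  qed
qed

end

section \<open>Crossed products\<close>

context abs_kernel
begin

lemma act_one: "c \<in> center A \<Longrightarrow> act \<one>\<^bsub>G\<^esub> c = c"
  by (simp add: act_def Gamma_one)

lemma idr_one: "e \<in> idems A \<Longrightarrow> e \<triangleleft> \<one>\<^bsub>G\<^esub> = e"
  using act_one idems_center by (simp add: idr_eq)

end

text \<open>With associator 1, w(g,h) is a genuine factor system. The normalisation and \<theta>_1 =
  id make the map from a to (a,1) multiplicative and keep products with such pairs free of twisting
  factors.\<close>

locale crossed = kernel_reps +
  fixes w :: "'b \<Rightarrow> 'b \<Rightarrow> 'a \<Rightarrow> 'a"
  assumes tw: "twists w"
    and cocycle: "associates w (\<lambda>g h k e. e)"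
    and t_one: "a \<in> carrier A \<Longrightarrow> t \<one>\<^bsub>G\<^esub> a = a"
    and w_left: "\<lbrakk>g \<in> carrier G; e \<in> idems A; e \<in> D g\<rbrakk> \<Longrightarrow> w \<one>\<^bsub>G\<^esub> g e = e"
    and w_right: "\<lbrakk>g \<in> carrier G; e \<in> idems A; e \<in> D g\<rbrakk> \<Longrightarrow> w g \<one>\<^bsub>G\<^esub> e = e"
begin

text \<open>The idempotent part of the product of (a,g) and (b,h), namely
  \<theta>_g(\<theta>_g^-1(\<epsilon> a) \<epsilon> b). It uses only the idempotent parts of
  \<open>a\<close> and \<open>b\<close>, and it is where the twisting in the product is
  evaluated.\<close>

definition lv :: "'a \<Rightarrow> 'b \<Rightarrow> 'a \<Rightarrow> 'a" where
  "lv a g b = act g ((\<epsilon> a \<triangleleft> g) \<cdot> \<epsilon> b)"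

text \<open>
  The product \<open>\<theta>\<^sub>g(\<theta>\<^sub>g\<inverse>(a) b) w(g,h)\<close>, rewritten so that \<open>\<theta>\<^sub>g\<inverse>\<close> is applied to idempotents only.
\<close>

definition cmul :: "'a \<Rightarrow> 'b \<Rightarrow> 'a \<Rightarrow> 'b \<Rightarrow> 'a" where
  "cmul a g b h = a \<cdot> t g ((\<epsilon> a \<triangleleft> g) \<cdot> b) \<cdot> w g h (lv a g b)"

lemma D_elem:
  assumes "g \<in> carrier G" "a \<in> D g"
  shows "a \<in> carrier A" "\<epsilon> a \<in> idems A" "\<epsilon> a \<in> D g" "a \<in> at (\<epsilon> a)"
    "\<epsilon> a \<triangleleft> g \<in> idems A" "\<epsilon> a \<triangleleft> g \<in> D (\<iota> g)"
proof -
  show a: "a \<in> carrier A" "\<epsilon> a \<in> idems A" "\<epsilon> a \<in> D g" "a \<in> at (\<epsilon> a)"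
    using D_carrier[OF assms] D_eps assms by (auto simp: at_def)
  show "\<epsilon> a \<triangleleft> g \<in> idems A" "\<epsilon> a \<triangleleft> g \<in> D (\<iota> g)" using idr_closed[OF assms(1) a(2,3)] by auto
qed

lemma lv_facts:
  assumes G: "g \<in> carrier G" "h \<in> carrier G" and a: "a \<in> D g" and b: "b \<in> D h"
  shows "lv a g b \<in> idems A" "lv a g b \<in> P2 g h" "lv a g b \<triangleleft> g = (\<epsilon> a \<triangleleft> g) \<cdot> \<epsilon> b" "\<epsilon> a \<cdot> lv a g b = lv a g b"
    "(\<epsilon> a \<triangleleft> g) \<cdot> b \<in> at (lv a g b \<triangleleft> g)" "(\<epsilon> a \<triangleleft> g) \<cdot> \<epsilon> b \<in> idems A" "(\<epsilon> a \<triangleleft> g) \<cdot> \<epsilon> b \<in> D (\<iota> g)"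
proof -
  note A = D_elem[OF G(1) a] and B = D_elem[OF G(2) b]
  let ?f = "(\<epsilon> a \<triangleleft> g) \<cdot> \<epsilon> b"
  have ig: "\<iota> g \<in> carrier G" using G by simp
  show f: "?f \<in> idems A" "?f \<in> D (\<iota> g)"
    using A B ideal_ofD(4)[OF D_ideal[OF ig], of "\<epsilon> b" "\<epsilon> a \<triangleleft> g"] by auto
  have fh: "?f \<in> D h" using ideal_ofD(3)[OF D_ideal[OF G(2)], of "\<epsilon> a \<triangleleft> g" "\<epsilon> b"] A B idems_closed by auto
  have fc: "?f \<in> center A" using f idems_center by auto
  show e: "lv a g b \<in> idems A"
    using act_rep[OF G(1) fc f(2)] ideal_iso_val(5)[OF psi_iso[OF G(1) rep[OF G(1)]] f(2,1)] by (simp add: lv_def)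
  show p: "lv a g b \<in> P2 g h" using act_closed(2)[OF G(1) fc f(2)] act_D[OF G fc f(2) fh] by (simp add: lv_def)
  show i: "lv a g b \<triangleleft> g = ?f" unfolding lv_def by (rule idr_act[OF G(1) f])
  have ac: "\<epsilon> a \<triangleleft> g \<in> center A" using A idems_center by auto
  have "lv a g b = act g ((\<epsilon> a \<triangleleft> g) \<cdot> ?f)"
    using idems_idem[OF A(5)] A B idems_closed by (simp add: lv_def flip: assoc)
  also have "\<dots> = \<epsilon> a \<cdot> lv a g b"
    using act_mult[OF G(1) ac A(6) fc f(2)] act_idr[OF G(1) A(2,3)] by (simp add: lv_def)
  finally show "\<epsilon> a \<cdot> lv a g b = lv a g b" by simp
  show "(\<epsilon> a \<triangleleft> g) \<cdot> b \<in> at (lv a g b \<triangleleft> g)"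
    unfolding i using A B idems_closed eps_mult[of "\<epsilon> a \<triangleleft> g" b] by (simp add: at_def closed)
qed

lemma cmul_at:
  assumes G: "g \<in> carrier G" "h \<in> carrier G" and a: "a \<in> D g" and b: "b \<in> D h"
  shows "cmul a g b h \<in> at (lv a g b)" "\<epsilon> (cmul a g b h) = lv a g b" "cmul a g b h \<in> D (g \<odot> h)"
proof -
  note A = D_elem[OF G(1) a] and L = lv_facts[OF assms]
  have X: "t g ((\<epsilon> a \<triangleleft> g) \<cdot> b) \<in> at (lv a g b)" using at_t(2)[OF G(1) L(1) _ L(5)] L(2) by simp
  have W: "w g h (lv a g b) \<in> at (lv a g b)" by (rule twistsD(2)[OF tw G L(1,2)])
  have XW: "t g ((\<epsilon> a \<triangleleft> g) \<cdot> b) \<cdot> w g h (lv a g b) \<in> at (lv a g b)" using X W by simp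
  have "\<epsilon> (cmul a g b h) = lv a g b" "cmul a g b h \<in> carrier A"
    using A atD[OF X] atD[OF W] eps_mult[of a "t g ((\<epsilon> a \<triangleleft> g) \<cdot> b) \<cdot> w g h (lv a g b)"] atD[OF XW] L(4)
    by (simp_all add: cmul_def assoc closed)
  then show "cmul a g b h \<in> at (lv a g b)" "\<epsilon> (cmul a g b h) = lv a g b" by (auto simp: at_def)
  then show "cmul a g b h \<in> D (g \<odot> h)" using at_ideal[OF D_ideal, of "g \<odot> h"] L(2) G by auto
qed

text \<open>The idempotents below the idempotent part of a product are described by one condition on
  each factor. In iterated products the conditions accumulate independently of the
  bracketing.\<close>

lemma idem_le_lv:
  assumes G: "g \<in> carrier G" "h \<in> carrier G" and a: "a \<in> D g" and b: "b \<in> D h"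
    and e: "e \<in> idems A" "e \<in> D g"
  shows "e \<cdot> lv a g b = e \<longleftrightarrow> e \<cdot> \<epsilon> a = e \<and> (e \<triangleleft> g) \<cdot> \<epsilon> b = e \<triangleleft> g"
proof -
  note A = D_elem[OF G(1) a] and B = D_elem[OF G(2) b] and L = lv_facts[OF assms(1-4)]
  have ic: "lv a g b \<in> carrier A" "e \<in> carrier A" "e \<triangleleft> g \<in> carrier A" "\<epsilon> a \<triangleleft> g \<in> carrier A" "\<epsilon> a \<in> carrier A" "\<epsilon> b \<in> carrier A"
    using L A B e idems_closed idr_closed[OF G(1) e] by auto
  show ?thesis
  proof
    assume le: "e \<cdot> lv a g b = e"
    have "e \<cdot> \<epsilon> a = e \<cdot> (lv a g b \<cdot> \<epsilon> a)" using le ic by (simp flip: assoc)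
    also have "\<dots> = e" using L(4) idems_commute[OF L(1) A(2)] le by simp
    finally have 1: "e \<cdot> \<epsilon> a = e" .
    have "e \<triangleleft> g = (e \<triangleleft> g) \<cdot> ((\<epsilon> a \<triangleleft> g) \<cdot> \<epsilon> b)"
      using idr_mult[OF G(1) e L(1)] L(2,3) le by simp
    then have "(e \<triangleleft> g) \<cdot> \<epsilon> b = (e \<triangleleft> g) \<cdot> ((\<epsilon> a \<triangleleft> g) \<cdot> (\<epsilon> b \<cdot> \<epsilon> b))"
      using ic assoc[of "e \<triangleleft> g" "(\<epsilon> a \<triangleleft> g) \<cdot> \<epsilon> b" "\<epsilon> b"] by (simp add: assoc closed)
    also have "\<dots> = e \<triangleleft> g" using \<open>e \<triangleleft> g = _\<close> idems_idem[OF B(2)] by simp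
    finally show "e \<cdot> \<epsilon> a = e \<and> (e \<triangleleft> g) \<cdot> \<epsilon> b = e \<triangleleft> g" using 1 by simp
  next
    assume le: "e \<cdot> \<epsilon> a = e \<and> (e \<triangleleft> g) \<cdot> \<epsilon> b = e \<triangleleft> g"
    have "(e \<triangleleft> g) \<cdot> (\<epsilon> a \<triangleleft> g) = e \<triangleleft> g" using idr_mult[OF G(1) e A(2,3)] le by simp
    then have 1: "(e \<triangleleft> g) \<cdot> ((\<epsilon> a \<triangleleft> g) \<cdot> \<epsilon> b) = e \<triangleleft> g" using le ic by (simp flip: assoc)
    have "e = act g (e \<triangleleft> g)" using act_idr[OF G(1) e] by simp
    also have "\<dots> = act g (e \<triangleleft> g) \<cdot> act g ((\<epsilon> a \<triangleleft> g) \<cdot> \<epsilon> b)"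
      by (subst 1[symmetric], rule act_mult[OF G(1)]) (use idr_closed[OF G(1) e] L(6,7) idems_center in auto)
    finally show "e \<cdot> lv a g b = e" using act_idr[OF G(1) e] by (simp add: lv_def)
  qed
qed

text \<open>Below the idempotent part, all three factors of a product can be cut down to the same
  \<open>e\<close>. The product then becomes a word in a single maximal subgroup.\<close>

lemma cmul_restrict:
  assumes G: "g \<in> carrier G" "h \<in> carrier G" and a: "a \<in> D g" and b: "b \<in> D h"
    and e: "e \<in> idems A" "e \<in> P2 g h" "e \<cdot> lv a g b = e"
  shows "e \<cdot> cmul a g b h = (e \<cdot> a) \<cdot> t g ((e \<triangleleft> g) \<cdot> b) \<cdot> w g h e"
    "e \<cdot> a \<in> at e" "(e \<triangleleft> g) \<cdot> b \<in> at (e \<triangleleft> g)"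
proof -
  note A = D_elem[OF G(1) a] and B = D_elem[OF G(2) b] and L = lv_facts[OF assms(1-4)]
  have eg: "e \<in> D g" using e by simp
  note le = idem_le_lv[OF assms(1-5) eg, THEN iffD1, OF e(3)]
  have ei: "e \<triangleleft> g \<in> idems A" "e \<triangleleft> g \<in> D (\<iota> g)" "e \<triangleleft> g \<in> carrier A" using idr_closed[OF G(1) e(1) eg] by auto
  have ic: "lv a g b \<in> carrier A" "e \<in> carrier A" "\<epsilon> a \<triangleleft> g \<in> carrier A"
    using L A e idems_closed by auto
  show "e \<cdot> a \<in> at e" using eps_mult[of e a] le e ic A by (simp add: at_def closed)
  show "(e \<triangleleft> g) \<cdot> b \<in> at (e \<triangleleft> g)" using eps_mult[of "e \<triangleleft> g" b] le ei B by (simp add: at_def closed)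
  let ?X = "t g ((\<epsilon> a \<triangleleft> g) \<cdot> b)" and ?W = "w g h (lv a g b)"
  have X: "?X \<in> at (lv a g b)" "(\<epsilon> a \<triangleleft> g) \<cdot> b \<in> D (\<iota> g)" using at_t[OF G(1) L(1) _ L(5)] L(2) by auto
  have W: "?W \<in> at (lv a g b)" by (rule twistsD(2)[OF tw G L(1,2)])
  have "?X \<cdot> e = t g ((\<epsilon> a \<triangleleft> g) \<cdot> b \<cdot> (e \<triangleleft> g))"
    using t_mult[OF G(1) X(2) ei(2)] t_idr[OF G(1) e(1) eg] by simp
  also have "(\<epsilon> a \<triangleleft> g) \<cdot> b \<cdot> (e \<triangleleft> g) = ((e \<triangleleft> g) \<cdot> (\<epsilon> a \<triangleleft> g)) \<cdot> b"
    using idem_comm[OF ei(1), of "(\<epsilon> a \<triangleleft> g) \<cdot> b"] ic ei B by (simp add: assoc closed)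
  also have "\<dots> = (e \<triangleleft> g) \<cdot> b" using idr_mult[OF G(1) e(1) eg A(2,3)] le by simp
  finally have Xe: "?X \<cdot> e = t g ((e \<triangleleft> g) \<cdot> b)" .
  have We: "?W \<cdot> e = w g h e"
    using sectD(3)[OF twistsD(1)[OF tw G] L(2,1) e(2,1)] idems_commute[OF L(1) e(1)] e(3) by simp
  have c: "a \<in> carrier A" "?X \<in> carrier A" "?W \<in> carrier A" using A atD(1)[OF X(1)] atD(1)[OF W] by auto
  have "e \<cdot> cmul a g b h = (e \<cdot> e) \<cdot> a \<cdot> ?X \<cdot> ?W" using c ic idems_idem[OF e(1)] by (simp add: cmul_def assoc closed)
  also have "\<dots> = (e \<cdot> (e \<cdot> a)) \<cdot> (?X \<cdot> ?W)" using c ic by (simp add: assoc closed)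
  also have "\<dots> = (e \<cdot> a) \<cdot> (e \<cdot> (?X \<cdot> ?W))"
    using idem_comm[OF e(1), of "e \<cdot> a"] c ic by (simp add: assoc closed)
  also have "\<dots> = (e \<cdot> a) \<cdot> ((?X \<cdot> (e \<cdot> e)) \<cdot> ?W)"
    using idem_comm[OF e(1), of ?X] c ic idems_idem[OF e(1)] by (simp add: assoc[symmetric] closed)
  also have "\<dots> = (e \<cdot> a) \<cdot> ((?X \<cdot> e) \<cdot> (e \<cdot> ?W))" using c ic by (simp add: assoc closed)
  also have "\<dots> = (e \<cdot> a) \<cdot> ((?X \<cdot> e) \<cdot> (?W \<cdot> e))" using idem_comm[OF e(1), of ?W] c by simp
  finally show "e \<cdot> cmul a g b h = (e \<cdot> a) \<cdot> t g ((e \<triangleleft> g) \<cdot> b) \<cdot> w g h e"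
    unfolding Xe We using at_t(2)[OF G(1) e(1) eg \<open>(e \<triangleleft> g) \<cdot> b \<in> at (e \<triangleleft> g)\<close>] twistsD(2)[OF tw G e(1,2)] atD c ic
    by (simp add: assoc closed)
qed

text \<open>The two bracketings have the same idempotent part. Restricted to it, both are words in
  one group, and these agree by the twisting equation, which exchanges \<theta>_g \<theta>_h with
  \<theta>_gh, and by the associator equation with \<beta> = 1.\<close>

lemma cmul_assoc:
  assumes G: "g \<in> carrier G" "h \<in> carrier G" "k \<in> carrier G" and a: "a \<in> D g" and b: "b \<in> D h" and c: "c \<in> D k"
  shows "cmul (cmul a g b h) (g \<odot> h) c k = cmul a g (cmul b h c k) (h \<odot> k)"
proof -
  have gg: "g \<odot> h \<in> carrier G" "h \<odot> k \<in> carrier G" and ass: "g \<odot> (h \<odot> k) = g \<odot> h \<odot> k" using G by (auto simp: G.m_assoc)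
  note ab = cmul_at[OF G(1,2) a b] and bc = cmul_at[OF G(2,3) b c]
  note x = cmul_at[OF gg(1) G(3) ab(3) c] and y = cmul_at[OF G(1) gg(2) a bc(3)]
  let ?x = "cmul (cmul a g b h) (g \<odot> h) c k" and ?y = "cmul a g (cmul b h c k) (h \<odot> k)"
  let ?e = "lv (cmul a g b h) (g \<odot> h) c" and ?f = "lv a g (cmul b h c k)"
  note Lx = lv_facts[OF gg(1) G(3) ab(3) c] and Ly = lv_facts[OF G(1) gg(2) a bc(3)]
  note Lab = lv_facts[OF G(1,2) a b] and Lbc = lv_facts[OF G(2,3) b c]
  \<comment> \<open>Both conditions unfold to: \<open>e\<close> is below the idempotent part of
    \<open>a\<close>, its translate by g is below that of \<open>b\<close>, and its translate by gh
    is below that of \<open>c\<close>.\<close>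
  have le: "e \<cdot> ?e = e \<longleftrightarrow> e \<cdot> ?f = e" if e: "e \<in> idems A" "e \<in> D g" "e \<in> D (g \<odot> h)" for e
  proof -
    have i: "e \<triangleleft> g \<in> idems A" "e \<triangleleft> g \<in> D h" using idr_closed[OF G(1) e(1,2)] idr_D[OF G(1,2) e] by auto
    show ?thesis
      unfolding idem_le_lv[OF gg(1) G(3) ab(3) c e(1,3)] idem_le_lv[OF G(1) gg(2) a bc(3) e(1,2)] ab(2) bc(2)
        idem_le_lv[OF G(1,2) a b e(1,2)] idem_le_lv[OF G(2,3) b c i] idr_idr[OF G(1,2) e] by blast
  qed
  have eD: "?e \<in> D (g \<odot> h)" "?e \<in> D (g \<odot> h \<odot> k)" using Lx by auto
  \<comment> \<open>The comparison requires membership in both \<open>D g\<close> and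
    \<open>D (g \<odot> h)\<close>. Each of the two idempotent parts has one of them from its outer
    product; the other is inherited from the inner product below which it, or its translate,
    lies.\<close>
  have "?e \<cdot> lv a g b = ?e" using Lx(4) ab(2) idems_commute[OF Lab(1) Lx(1)] by simp
  then have eDg: "?e \<in> D g" using ideal_ofD(3)[OF D_ideal[OF G(1)], of ?e "lv a g b"] Lab(2) idems_closed[OF Lx(1)] by simp
  have fD: "?f \<in> D g" "?f \<in> D (g \<odot> (h \<odot> k))" using Ly by auto
  have "(?f \<triangleleft> g) \<cdot> lv b h c = ?f \<triangleleft> g"
    using idem_le_lv[OF G(1) gg(2) a bc(3) Ly(1) fD(1)] idems_idem[OF Ly(1)] bc(2) by simp
  then have "?f \<triangleleft> g \<in> D h"
    using ideal_ofD(3)[OF D_ideal[OF G(2)], of "?f \<triangleleft> g" "lv b h c"] Lbc(2) idr_closed[OF G(1) Ly(1) fD(1)] by simp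
  then have "act g (?f \<triangleleft> g) \<in> D (g \<odot> h)" using act_D[OF G(1,2)] idr_closed[OF G(1) Ly(1) fD(1)] idems_center by simp
  then have fDh: "?f \<in> D (g \<odot> h)" using act_idr[OF G(1) Ly(1) fD(1)] by simp
  have "?e \<cdot> ?f = ?e" using le[OF Lx(1) eDg eD(1)] idems_idem[OF Lx(1)] by simp
  moreover have "?f \<cdot> ?e = ?f" using le[OF Ly(1) fD(1) fDh] idems_idem[OF Ly(1)] by simp
  \<comment> \<open>Antisymmetry: each idempotent part has been shown to lie below the
    other.\<close>
  ultimately have ef: "?f = ?e" using idems_commute[OF Lx(1) Ly(1)] by simp
  define e where "e = ?e"
  have e: "e \<in> idems A" "e \<in> P3 g h k" "e \<in> P2 g h" "e \<in> P2 (g \<odot> h) k" "e \<in> P2 g (h \<odot> k)" "e \<in> D g"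
    using Lx eDg eD by (auto simp: e_def ass)
  have i: "e \<triangleleft> g \<in> idems A" "e \<triangleleft> g \<in> P2 h k" "e \<triangleleft> g \<in> D h" using P3_faces[OF G e(1,2)] by auto
  have le1: "e \<cdot> ?e = e" "e \<cdot> ?f = e" using idems_idem[OF e(1)] ef by (simp_all add: e_def)
  have ab': "e \<cdot> lv a g b = e"
    using idem_le_lv[OF gg(1) G(3) ab(3) c e(1) eD(1)[folded e_def]] le1(1) ab(2) by simp
  have bc': "(e \<triangleleft> g) \<cdot> lv b h c = e \<triangleleft> g"
    using idem_le_lv[OF G(1) gg(2) a bc(3) e(1,6)] le1(2) bc(2) by simp
  note R1 = cmul_restrict[OF gg(1) G(3) ab(3) c e(1,4) le1(1)] and R2 = cmul_restrict[OF G(1,2) a b e(1,3) ab']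
  note R3 = cmul_restrict[OF G(1) gg(2) a bc(3) e(1,5) le1(2)] and R4 = cmul_restrict[OF G(2,3) b c i(1,2) bc']
  have egh: "e \<triangleleft> g \<triangleleft> h = e \<triangleleft> (g \<odot> h)" by (rule idr_idr[OF G(1,2) e(1)]) (use e in auto)
  have c': "(e \<triangleleft> (g \<odot> h)) \<cdot> c \<in> at (e \<triangleleft> (g \<odot> h))" using R1(3) .
  note T = at_tt[OF G(1,2) e(1,3) c'] and F = twist_faces[OF tw G e(1,2)]
  have tb: "t g ((e \<triangleleft> g) \<cdot> b) \<in> at e" "(e \<triangleleft> g) \<cdot> b \<in> D (\<iota> g)" using at_t[OF G(1) e(1,6) R2(3)] by auto
  define p q where "p = e \<cdot> a" and "q = t g ((e \<triangleleft> g) \<cdot> b)"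
  define r s where "r = t g (t h ((e \<triangleleft> (g \<odot> h)) \<cdot> c))" and "s = t (g \<odot> h) ((e \<triangleleft> (g \<odot> h)) \<cdot> c)"
  have pq: "p \<in> at e" "q \<in> at e" "r \<in> at e" "s \<in> at e" using R2(2) tb T by (auto simp: p_def q_def r_def s_def)
  note cc = pq[THEN atD(1)] F(1-4)[THEN atD(1)]
  have xe: "?x = p \<cdot> q \<cdot> w g h e \<cdot> s \<cdot> w (g \<odot> h) k e"
    using R1(1) R2(1) at_unit(1)[OF x(1)] by (simp add: p_def q_def s_def e_def)
  have "t g ((e \<triangleleft> g) \<cdot> cmul b h c k) = q \<cdot> r \<cdot> t g (w h k (e \<triangleleft> g))"
    unfolding R4(1) egh using t_mult[OF G(1)] tb T F(5) D_mult[of "\<iota> g"] G by (simp add: q_def r_def)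
  then have "?y = p \<cdot> (q \<cdot> r \<cdot> t g (w h k (e \<triangleleft> g))) \<cdot> w g (h \<odot> k) e"
    using R3(1) at_unit(1)[OF y(1)] ef by (simp add: p_def e_def)
  also have "\<dots> = p \<cdot> q \<cdot> r \<cdot> (t g (w h k (e \<triangleleft> g)) \<cdot> w g (h \<odot> k) e)" using cc by (simp add: assoc closed)
  also have "\<dots> = p \<cdot> q \<cdot> r \<cdot> (w g h e \<cdot> w (g \<odot> h) k e)"
    using associatesD(3)[OF cocycle G e(1,2)] at_unit(1)[OF F(4)] by simp
  also have "\<dots> = p \<cdot> q \<cdot> (r \<cdot> w g h e) \<cdot> w (g \<odot> h) k e" using cc by (simp add: assoc closed)
  also have "\<dots> = p \<cdot> q \<cdot> (w g h e \<cdot> s) \<cdot> w (g \<odot> h) k e"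
    using twistsD(3)[OF tw G(1,2) e(1,3) c'] by (simp add: r_def s_def)
  finally show ?thesis unfolding xe using cc by (simp add: assoc closed)
qed

lemma cmul_one_left:
  assumes "h \<in> carrier G" "a \<in> carrier A" "b \<in> D h"
  shows "cmul a \<one>\<^bsub>G\<^esub> b h = a \<cdot> b" "lv a \<one>\<^bsub>G\<^esub> b = \<epsilon> a \<cdot> \<epsilon> b"
proof -
  note B = D_elem[OF assms(1,3)]
  have a: "a \<in> D \<one>\<^bsub>G\<^esub>" using assms D_one by simp
  show l: "lv a \<one>\<^bsub>G\<^esub> b = \<epsilon> a \<cdot> \<epsilon> b" using assms B idems_center act_one by (simp add: lv_def idr_one)
  have "\<epsilon> a \<cdot> \<epsilon> b \<in> D h" using lv_facts(2)[OF G.one_closed assms(1) a assms(3)] l assms(1) by simp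
  then have "w \<one>\<^bsub>G\<^esub> h (\<epsilon> a \<cdot> \<epsilon> b) = \<epsilon> (a \<cdot> b)" using w_left[OF assms(1)] assms B by (simp add: eps_mult)
  then have "cmul a \<one>\<^bsub>G\<^esub> b h = a \<cdot> (\<epsilon> a \<cdot> b) \<cdot> \<epsilon> (a \<cdot> b)"
    using assms B t_one by (simp add: cmul_def l idr_one closed)
  also have "a \<cdot> (\<epsilon> a \<cdot> b) = a \<cdot> b" using assms B assoc[of a "\<epsilon> a" b] by simp
  finally show "cmul a \<one>\<^bsub>G\<^esub> b h = a \<cdot> b" using assms B closed by simp
qed

lemma cmul_one_right:
  assumes "g \<in> carrier G" "a \<in> D g" "b \<in> carrier A"
  shows "cmul a g b \<one>\<^bsub>G\<^esub> = a \<cdot> t g ((\<epsilon> a \<triangleleft> g) \<cdot> b)"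
proof -
  have b: "b \<in> D \<one>\<^bsub>G\<^esub>" using assms D_one by simp
  note L = lv_facts[OF assms(1) G.one_closed assms(2) b] and A = D_elem[OF assms(1,2)]
  have "w g \<one>\<^bsub>G\<^esub> (lv a g b) = lv a g b" using w_right L assms by simp
  moreover have T: "t g ((\<epsilon> a \<triangleleft> g) \<cdot> b) \<in> at (lv a g b)" using at_t(2)[OF assms(1) L(1) _ L(5)] L(2) by simp
  ultimately show ?thesis
    using at_unit(2)[OF T] assoc[OF A(1) atD(1)[OF T] idems_closed[OF L(1)]] by (simp add: cmul_def)
qed

section \<open>The semigroup of pairs and its inverses\<close>

definition U :: "('a \<times> 'b) semigrp" where
  "U = \<lparr>carrier = {(a, g). g \<in> carrier G \<and> a \<in> D g},
     smult = (\<lambda>(a, g) (b, h). (cmul a g b h, g \<odot> h))\<rparr>"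

lemma U_simps [simp]:
  "(a, g) \<in> carrier U \<longleftrightarrow> g \<in> carrier G \<and> a \<in> D g" "(a, g) \<cdot>\<^bsub>U\<^esub> (b, h) = (cmul a g b h, g \<odot> h)"
  by (simp_all add: U_def)

lemma U_one: "(a, \<one>\<^bsub>G\<^esub>) \<in> carrier U \<longleftrightarrow> a \<in> carrier A"
  by (simp add: D_one)

sublocale U: semigrp U
proof
  have "\<one>\<^bsub>G\<^esub> \<in> carrier G \<and> carrier A \<noteq> {}" using nonempty by simp
  then show "carrier U \<noteq> {}" using U_one by blast
  fix x y assume "x \<in> carrier U" "y \<in> carrier U"
  then show "x \<cdot>\<^bsub>U\<^esub> y \<in> carrier U" using cmul_at(3) by (cases x; cases y) auto
next
  fix x y z assume "x \<in> carrier U" "y \<in> carrier U" "z \<in> carrier U"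
  then show "x \<cdot>\<^bsub>U\<^esub> y \<cdot>\<^bsub>U\<^esub> z = x \<cdot>\<^bsub>U\<^esub> (y \<cdot>\<^bsub>U\<^esub> z)"
    by (cases x; cases y; cases z) (simp add: cmul_assoc G.m_assoc)
qed

lemma U_idems: "x \<in> idems U \<longleftrightarrow> (\<exists>e \<in> idems A. x = (e, \<one>\<^bsub>G\<^esub>))"
proof
  assume x: "x \<in> idems U"
  obtain a g where ag: "x = (a, g)" by (cases x)
  have g: "g \<in> carrier G" "a \<in> D g" "g \<odot> g = g" "cmul a g a g = a" using x ag by (auto simp: idems_def)
  then have g1: "g = \<one>\<^bsub>G\<^esub>" by (metis G.r_cancel_one)
  then have "a \<in> carrier A" using g D_one by simp
  then have "a \<cdot> a = a" using g cmul_one_left(1)[of g a a] by (simp add: g1)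
  then show "\<exists>e \<in> idems A. x = (e, \<one>\<^bsub>G\<^esub>)" using ag g1 \<open>a \<in> carrier A\<close> by (auto simp: idems_def)
next
  assume "\<exists>e \<in> idems A. x = (e, \<one>\<^bsub>G\<^esub>)"
  then obtain e where e: "e \<in> idems A" "x = (e, \<one>\<^bsub>G\<^esub>)" by blast
  then have "e \<in> carrier A" "e \<in> D \<one>\<^bsub>G\<^esub>" using idems_closed D_one by auto
  then show "x \<in> idems U" using e cmul_one_left(1)[of "\<one>\<^bsub>G\<^esub>" e e] idems_idem[OF e(1)] by (simp add: idems_def)
qed

text \<open>The inverse of (a,g) is (b,g^-1) with b the solution of \<theta>_g(b) = a^-1
  w(g,g^-1)(e)^-1 over e = \<epsilon> a, inverses being taken in the maximal subgroup at e. This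
  cancels the twisting factor in the product with (a,g) on the left.\<close>

lemma U_inverse:
  assumes g: "g \<in> carrier G" "a \<in> D g"
  shows "\<exists>y. is_sinv U (a, g) y \<and> (a, g) \<cdot>\<^bsub>U\<^esub> y = (\<epsilon> a, \<one>\<^bsub>G\<^esub>) \<and> y \<cdot>\<^bsub>U\<^esub> (a, g) = (\<epsilon> a \<triangleleft> g, \<one>\<^bsub>G\<^esub>)"
proof -
  note A = D_elem[OF g]
  define e where "e = \<epsilon> a"
  have ig: "\<iota> g \<in> carrier G" using g by simp
  have e: "e \<in> idems A" "e \<in> D g" "e \<in> P2 g (\<iota> g)" "e \<in> carrier A" using A g D_one by (auto simp: e_def)
  have W: "w g (\<iota> g) e \<in> at e" by (rule twistsD(2)[OF tw g(1) ig e(1,3)])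
  have "a\<^sup>\<dagger> \<cdot> (w g (\<iota> g) e)\<^sup>\<dagger> \<in> at e" using A(4) W by (simp add: e_def)
  then obtain b where b: "b \<in> at (e \<triangleleft> g)" "t g b = a\<^sup>\<dagger> \<cdot> (w g (\<iota> g) e)\<^sup>\<dagger>" by (rule t_surj[OF g(1) e(1,2)])
  have bD: "b \<in> D (\<iota> g)" using at_t(1)[OF g(1) e(1,2) b(1)] .
  have eg: "e \<triangleleft> g \<in> idems A" "e \<triangleleft> g \<in> D (\<iota> g)" "e \<triangleleft> g \<in> carrier A" using idr_closed[OF g(1) e(1,2)] by auto
  have be: "\<epsilon> b = e \<triangleleft> g" "b \<in> carrier A" using atD[OF b(1)] by auto
  have gi: "e \<triangleleft> g \<triangleleft> \<iota> g = e" using act_idr[OF g(1) e(1,2)] g by (simp add: idr_eq)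
  have lv1: "lv a g b = e" using idems_idem[OF eg(1)] act_idr[OF g(1) e(1,2)] be by (simp add: lv_def flip: e_def)
  have "(e \<triangleleft> g) \<cdot> b = b" using at_unit(1)[OF b(1)] .
  then have "cmul a g b (\<iota> g) = a \<cdot> (a\<^sup>\<dagger> \<cdot> (w g (\<iota> g) e)\<^sup>\<dagger>) \<cdot> w g (\<iota> g) e"
    using lv1 b(2) by (simp add: cmul_def flip: e_def)
  also have "\<dots> = e" using A atD[OF W] idems_idem[OF e(1)] e(4) by (simp add: assoc closed flip: e_def)
  finally have xy: "(a, g) \<cdot>\<^bsub>U\<^esub> (b, \<iota> g) = (e, \<one>\<^bsub>G\<^esub>)" using g by simp
  have xyx: "(e, \<one>\<^bsub>G\<^esub>) \<cdot>\<^bsub>U\<^esub> (a, g) = (a, g)"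
    using cmul_one_left(1)[OF g(1) e(4) g(2)] at_unit(1)[OF A(4)] g by (simp add: e_def)
  have "cmul b (\<iota> g) e \<one>\<^bsub>G\<^esub> = b \<cdot> t (\<iota> g) (e \<cdot> e)"
    using cmul_one_right[OF ig bD e(4)] be gi by simp
  also have "\<dots> = b \<cdot> (e \<triangleleft> g)"
    using idems_idem[OF e(1)] t_act[OF ig idems_center[OF e(1)]] e g by (simp add: idr_eq)
  also have "\<dots> = b" using at_unit(2)[OF b(1)] .
  finally have yxy: "(b, \<iota> g) \<cdot>\<^bsub>U\<^esub> (e, \<one>\<^bsub>G\<^esub>) = (b, \<iota> g)" using ig by simp
  have y: "(b, \<iota> g) \<in> carrier U" "(a, g) \<in> carrier U" using bD g by auto
  have s: "is_sinv U (a, g) (b, \<iota> g)"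
    unfolding is_sinv_def using y U.assoc[OF y(1,2,1)] xy xyx yxy by (simp del: U_simps(2))
  \<comment> \<open>That the opposite product is idempotent follows formally from associativity. It
    remains to find its idempotent part, so no twisting factor has to be evaluated there.\<close>
  have "(b, \<iota> g) \<cdot>\<^bsub>U\<^esub> (a, g) \<in> idems U"
    using U.closed[OF y] U.assoc[OF y(1,2) U.closed[OF y]] U.assoc[OF y(2,1,2)] xy xyx by (simp add: idems_def del: U_simps(2))
  then obtain f where f: "(b, \<iota> g) \<cdot>\<^bsub>U\<^esub> (a, g) = (f, \<one>\<^bsub>G\<^esub>)" "f \<in> idems A" using U_idems by blast
  then have "f = \<epsilon> (cmul b (\<iota> g) a g)" by simp
  also have "\<dots> = lv b (\<iota> g) a" by (rule cmul_at(2)[OF ig g(1) bD g(2)])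
  also have "\<dots> = e \<triangleleft> g" using be gi idems_idem[OF e(1)] by (simp add: lv_def idr_eq flip: e_def)
  finally show ?thesis using s xy f(1) unfolding e_def by blast
qed

sublocale U: inverse_semigrp U
proof
  fix x assume x: "x \<in> carrier U"
  show "\<exists>!y. is_sinv U x y"
  proof (rule U.ex1_sinvI[OF _ x])
    obtain a g where "x = (a, g)" "g \<in> carrier G" "a \<in> D g" using x by (cases x) auto
    then show "\<exists>y. is_sinv U x y" using U_inverse[of g a] by blast
    fix y z assume "y \<in> idems U" "z \<in> idems U"
    then obtain e f where "e \<in> idems A" "f \<in> idems A" "y = (e, \<one>\<^bsub>G\<^esub>)" "z = (f, \<one>\<^bsub>G\<^esub>)" using U_idems by auto
    then show "y \<cdot>\<^bsub>U\<^esub> z = z \<cdot>\<^bsub>U\<^esub> y"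
      using cmul_one_left(1) idems_closed D_one idems_commute by simp
  qed
qed

lemma U_mult_sinv:
  assumes g: "g \<in> carrier G" "a \<in> D g"
  shows "(a, g) \<cdot>\<^bsub>U\<^esub> sinv U (a, g) = (\<epsilon> a, \<one>\<^bsub>G\<^esub>)" "sinv U (a, g) \<cdot>\<^bsub>U\<^esub> (a, g) = (\<epsilon> a \<triangleleft> g, \<one>\<^bsub>G\<^esub>)"
proof -
  have x: "(a, g) \<in> carrier U" using g by simp
  show "(a, g) \<cdot>\<^bsub>U\<^esub> sinv U (a, g) = (\<epsilon> a, \<one>\<^bsub>G\<^esub>)" "sinv U (a, g) \<cdot>\<^bsub>U\<^esub> (a, g) = (\<epsilon> a \<triangleleft> g, \<one>\<^bsub>G\<^esub>)"
    using U_inverse[OF g] U.sinv_eqI[OF x] by auto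
qed

section \<open>The E-unitary refinement and its transversal\<close>

definition pr :: "'a \<times> 'b \<Rightarrow> 'a \<times> 'b" where "pr x = (\<epsilon> (fst x), snd x)"

text \<open>The quotient by idempotent parts, realised on the elements \<open>(e, g)\<close> of \<open>U\<close> with \<open>e\<close> idempotent.\<close>

definition E :: "('a \<times> 'b) semigrp" where
  "E = \<lparr>carrier = pr ` carrier U, smult = (\<lambda>x y. pr (x \<cdot>\<^bsub>U\<^esub> y))\<rparr>"

lemma pr_simp [simp]: "pr (a, g) = (\<epsilon> a, g)" by (simp add: pr_def)

lemma carrier_E: "(e, g) \<in> carrier E \<longleftrightarrow> g \<in> carrier G \<and> e \<in> D g \<and> e \<in> idems A"
proof
  assume "(e, g) \<in> carrier E"
  then obtain a where a: "g \<in> carrier G" "a \<in> D g" "e = \<epsilon> a" by (auto simp: E_def pr_def)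
  then show "g \<in> carrier G \<and> e \<in> D g \<and> e \<in> idems A" using D_elem(2,3)[OF a(1,2)] by simp
next
  assume e: "g \<in> carrier G \<and> e \<in> D g \<and> e \<in> idems A"
  then have "(e, g) = pr (e, g)" "(e, g) \<in> carrier U" by simp_all
  then show "(e, g) \<in> carrier E" unfolding E_def by (auto simp del: U_simps pr_simp)
qed

lemma E_sub: "x \<in> carrier E \<Longrightarrow> x \<in> carrier U \<and> pr x = x"
  by (cases x) (auto simp: carrier_E)

text \<open>The idempotent part of a product depends only on the idempotent parts of the factors, so
  passing to idempotent parts is a congruence.\<close>

lemma pr_mult:
  assumes "x \<in> carrier U" "y \<in> carrier U"
  shows "pr (pr x \<cdot>\<^bsub>U\<^esub> pr y) = pr (x \<cdot>\<^bsub>U\<^esub> y)"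
proof -
  obtain a g b h where x: "x = (a, g)" "y = (b, h)" by (cases x; cases y)
  have m: "g \<in> carrier G" "h \<in> carrier G" "a \<in> D g" "b \<in> D h" using assms x by auto
  note A = D_elem[OF m(1,3)] and B = D_elem[OF m(2,4)]
  have "lv (\<epsilon> a) g (\<epsilon> b) = lv a g b" using A B by (simp add: lv_def)
  then show ?thesis using cmul_at(2)[OF m] cmul_at(2)[OF m(1,2) A(3) B(3)] x by simp
qed

lemma pr_hom: "pr \<in> shom U E"
  using pr_mult by (auto simp: shom_def E_def)

sublocale E: semigrp E
proof
  show "carrier E \<noteq> {}" using U.nonempty by (simp add: E_def)
  fix x y assume "x \<in> carrier E" "y \<in> carrier E"
  then have "x \<cdot>\<^bsub>U\<^esub> y \<in> carrier U" using E_sub U.closed by blast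
  then show "x \<cdot>\<^bsub>E\<^esub> y \<in> carrier E" by (simp add: E_def)
next
  fix x y z assume "x \<in> carrier E" "y \<in> carrier E" "z \<in> carrier E"
  then have u: "x \<in> carrier U" "y \<in> carrier U" "z \<in> carrier U" "pr x = x" "pr y = y" "pr z = z" using E_sub by auto
  have "x \<cdot>\<^bsub>E\<^esub> y \<cdot>\<^bsub>E\<^esub> z = pr (pr (x \<cdot>\<^bsub>U\<^esub> y) \<cdot>\<^bsub>U\<^esub> pr z)" using u by (simp add: E_def)
  also have "\<dots> = pr (pr x \<cdot>\<^bsub>U\<^esub> pr (y \<cdot>\<^bsub>U\<^esub> z))"
    using pr_mult[OF U.closed[OF u(1,2)] u(3)] pr_mult[OF u(1) U.closed[OF u(2,3)]] U.assoc[OF u(1-3)] by simp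
  also have "\<dots> = x \<cdot>\<^bsub>E\<^esub> (y \<cdot>\<^bsub>E\<^esub> z)" using u by (simp add: E_def)
  finally show "x \<cdot>\<^bsub>E\<^esub> y \<cdot>\<^bsub>E\<^esub> z = x \<cdot>\<^bsub>E\<^esub> (y \<cdot>\<^bsub>E\<^esub> z)" .
qed

text \<open>Multiplication by an idempotent from the left carries no twisting and is the same in
  both semigroups. This is why the inclusion of \<open>E\<close> into \<open>U\<close> preserves the
  natural order.\<close>

lemma E_mult_one:
  assumes "e \<in> idems A" "(f, g) \<in> carrier E"
  shows "(e, \<one>\<^bsub>G\<^esub>) \<cdot>\<^bsub>E\<^esub> (f, g) = (e \<cdot> f, g)" "(e, \<one>\<^bsub>G\<^esub>) \<cdot>\<^bsub>U\<^esub> (f, g) = (e \<cdot> f, g)"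
  using assms cmul_one_left(1)[of g e f] idems_closed idems_center by (auto simp: E_def carrier_E[unfolded E_def, simplified])

lemma E_idems: "x \<in> idems E \<longleftrightarrow> (\<exists>e \<in> idems A. x = (e, \<one>\<^bsub>G\<^esub>))"
proof
  assume x: "x \<in> idems E"
  obtain a g where ag: "x = (a, g)" by (cases x)
  have g: "g \<in> carrier G" "a \<in> idems A" using x ag carrier_E by (auto simp: idems_def)
  moreover have "g \<odot> g = g" using x ag by (simp add: idems_def E_def)
  then have "g = \<one>\<^bsub>G\<^esub>" using g by (metis G.r_cancel_one)
  ultimately show "\<exists>e \<in> idems A. x = (e, \<one>\<^bsub>G\<^esub>)" using ag by auto
next
  assume "\<exists>e \<in> idems A. x = (e, \<one>\<^bsub>G\<^esub>)"
  then obtain e where e: "e \<in> idems A" "x = (e, \<one>\<^bsub>G\<^esub>)" by blast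
  then have x: "(e, \<one>\<^bsub>G\<^esub>) \<in> carrier E" using carrier_E D_one idems_closed by simp
  show "x \<in> idems E" unfolding idems_def e(2) using x E_mult_one(1)[OF e(1) x] idems_idem[OF e(1)] by simp
qed

sublocale E: inverse_semigrp E
proof
  fix x assume x: "x \<in> carrier E"
  show "\<exists>!y. is_sinv E x y"
  proof (rule E.ex1_sinvI[OF _ x])
    have u: "x \<in> carrier U" "pr x = x" using x E_sub by auto
    have "is_sinv E (pr x) (pr (sinv U x))"
      using U.is_sinv_sinv[OF u(1)] shomD[OF pr_hom] U.closed u(1)
      by (simp add: is_sinv_def flip: shomD(2)[OF pr_hom])
    then show "\<exists>y. is_sinv E x y" unfolding u(2) by blast
    fix y z assume "y \<in> idems E" "z \<in> idems E"
    then obtain e f where "e \<in> idems A" "f \<in> idems A" "y = (e, \<one>\<^bsub>G\<^esub>)" "z = (f, \<one>\<^bsub>G\<^esub>)" using E_idems by auto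
    then show "y \<cdot>\<^bsub>E\<^esub> z = z \<cdot>\<^bsub>E\<^esub> y"
      using E_mult_one(1) carrier_E idems_closed D_one idems_commute by simp
  qed
qed

lemma E_mult_sinv:
  assumes "(e, g) \<in> carrier E"
  shows "(e, g) \<cdot>\<^bsub>E\<^esub> sinv E (e, g) = (e, \<one>\<^bsub>G\<^esub>)" "sinv E (e, g) \<cdot>\<^bsub>E\<^esub> (e, g) = (e \<triangleleft> g, \<one>\<^bsub>G\<^esub>)"
proof -
  have m: "g \<in> carrier G" "e \<in> D g" "e \<in> idems A" using assms carrier_E by auto
  let ?x = "(e, g)"
  have x: "?x \<in> carrier U" "pr ?x = ?x" using m by auto
  have i: "sinv E ?x = pr (sinv U ?x)"
    using U.shom_sinv[OF E.inverse_semigrp_axioms pr_hom x(1)] x(2) by simp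
  have h: "pr (?x \<cdot>\<^bsub>U\<^esub> sinv U ?x) = ?x \<cdot>\<^bsub>E\<^esub> sinv E ?x" "pr (sinv U ?x \<cdot>\<^bsub>U\<^esub> ?x) = sinv E ?x \<cdot>\<^bsub>E\<^esub> ?x"
    using shomD(2)[OF pr_hom x(1) U.sinv_closed[OF x(1)]] shomD(2)[OF pr_hom U.sinv_closed[OF x(1)] x(1)] x(2) i by simp_all
  show "?x \<cdot>\<^bsub>E\<^esub> sinv E ?x = (e, \<one>\<^bsub>G\<^esub>)" "sinv E ?x \<cdot>\<^bsub>E\<^esub> ?x = (e \<triangleleft> g, \<one>\<^bsub>G\<^esub>)"
    using U_mult_sinv[OF m(1,2)] idr_closed(1)[OF m(1,3,2)] m(3) h by simp_all
qed

definition emb :: "'a \<Rightarrow> 'a \<times> 'b" where "emb a = (a, \<one>\<^bsub>G\<^esub>)"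

lemma inv_into_emb: "a \<in> carrier A \<Longrightarrow> inv_into (carrier A) emb (a, \<one>\<^bsub>G\<^esub>) = a"
  using inv_into_f_f[of emb "carrier A" a] by (simp add: inj_on_def emb_def)

lemma ext_dom_crossed: "g \<in> carrier G \<Longrightarrow> ext_dom A E emb snd (\<lambda>x. x) g = D g"
proof -
  assume g: "g \<in> carrier G"
  have "(\<exists>s \<in> carrier E. snd s = g \<and> s \<cdot>\<^bsub>E\<^esub> sinv E s = emb (\<epsilon> a)) \<longleftrightarrow> a \<in> D g" if a: "a \<in> carrier A" for a
  proof
    assume "\<exists>s \<in> carrier E. snd s = g \<and> s \<cdot>\<^bsub>E\<^esub> sinv E s = emb (\<epsilon> a)"
    then obtain e where "(e, g) \<in> carrier E" "(e, g) \<cdot>\<^bsub>E\<^esub> sinv E (e, g) = emb (\<epsilon> a)" by auto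
    then show "a \<in> D g" using E_mult_sinv(1) carrier_E D_eps[OF g a] by (simp add: emb_def)
  next
    assume "a \<in> D g"
    then have "(\<epsilon> a, g) \<in> carrier E" using carrier_E g D_elem by simp
    then show "\<exists>s \<in> carrier E. snd s = g \<and> s \<cdot>\<^bsub>E\<^esub> sinv E s = emb (\<epsilon> a)"
      using E_mult_sinv(1) by (force simp: emb_def)
  qed
  then show ?thesis using D_carrier[OF g] by (auto simp: ext_dom_def idpart_def[symmetric] simp del: mult_sinv_self)
qed

text \<open>For \<open>a\<close> in the domain and e the image of \<open>\<epsilon> a\<close>, one
  has (e,g)(a,1) = (\<theta>_g(a),1)(e,g). Conjugation by (e,g) is thereby found without computing
  the inverse of that pair.\<close>

lemma ext_action_crossed:
  assumes g: "g \<in> carrier G"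
  shows "ext_action A G U E emb snd (\<lambda>x. x) g = \<theta> g"
proof
  fix a
  have ig: "\<iota> g \<in> carrier G" using g by simp
  note ed = ext_dom_crossed[OF ig]
  show "ext_action A G U E emb snd (\<lambda>x. x) g a = \<theta> g a"
  proof (cases "a \<in> D (\<iota> g)")
    case False
    then have "\<theta> g a = None" using ideal_iso_appl(3)[OF t_iso[OF g]] by (metis domIff)
    then show ?thesis using False ed by (simp add: ext_action_def)
  next
    case True
    note A = D_elem[OF ig True]
    let ?e = "act g (\<epsilon> a)"
    have ta: "t g a \<in> at ?e" "t g a \<in> carrier A" using t_closed[OF g True] t_eps[OF g True] by (auto simp: at_def)
    have e: "?e \<in> idems A" "?e \<in> D g" "?e \<triangleleft> g = \<epsilon> a"
      using eps_idems[OF ta(2)] t_eps[OF g True] act_closed(2)[OF g idems_center[OF A(2)] A(3)] idr_act[OF g A(2,3)] by auto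
    have s: "(?e, g) \<in> carrier E" using e g carrier_E by simp
    have the: "(THE s. s \<in> carrier E \<and> snd s = g \<and> sinv E s \<cdot>\<^bsub>E\<^esub> s = emb (\<epsilon> a)) = (?e, g)"
    proof (rule the_equality)
      show "(?e, g) \<in> carrier E \<and> snd (?e, g) = g \<and> sinv E (?e, g) \<cdot>\<^bsub>E\<^esub> (?e, g) = emb (\<epsilon> a)"
        using s E_mult_sinv(2)[OF s] e by (simp add: emb_def)
      fix x assume x: "x \<in> carrier E \<and> snd x = g \<and> sinv E x \<cdot>\<^bsub>E\<^esub> x = emb (\<epsilon> a)"
      then obtain f where f: "x = (f, g)" "(f, g) \<in> carrier E" by (cases x) auto
      then have "f \<triangleleft> g = \<epsilon> a" using x E_mult_sinv(2)[OF f(2)] by (simp add: emb_def)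
      then show "x = (?e, g)" using act_idr[OF g, of f] f carrier_E by auto
    qed
    let ?s = "(?e, g)"
    have u: "?s \<in> carrier U" "emb a \<in> carrier U" "emb (t g a) \<in> carrier U" using e g A ta D_one by (auto simp: emb_def)
    have ec: "?e \<in> carrier A" using e idems_closed by auto
    have "?s \<cdot>\<^bsub>U\<^esub> emb a = (?e \<cdot> t g (\<epsilon> a \<cdot> a), g)"
      using cmul_one_right[OF g e(2) A(1)] e g by (simp add: emb_def)
    also have "\<dots> = (t g a, g)" using A(1) at_unit(1)[OF ta(1)] by simp
    also have "\<dots> = emb (t g a) \<cdot>\<^bsub>U\<^esub> ?s"
      using cmul_one_left(1)[OF g ta(2) e(2)] at_unit(2)[OF ta(1)] g by (simp add: emb_def)
    finally have "?s \<cdot>\<^bsub>U\<^esub> emb a \<cdot>\<^bsub>U\<^esub> sinv U ?s = emb (t g a) \<cdot>\<^bsub>U\<^esub> (?s \<cdot>\<^bsub>U\<^esub> sinv U ?s)"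
      using U.assoc[OF u(3,1) U.sinv_closed[OF u(1)]] by (simp del: U_simps(2))
    also have "\<dots> = (t g a, \<one>\<^bsub>G\<^esub>)"
      using U_mult_sinv(1)[OF g e(2)] cmul_one_left(1)[OF G.one_closed ta(2)] D_one ec e(1) at_unit(2)[OF ta(1)]
      by (simp add: emb_def)
    finally have "inv_into (carrier A) emb (?s \<cdot>\<^bsub>U\<^esub> emb a \<cdot>\<^bsub>U\<^esub> sinv U ?s) = t g a"
      using inv_into_emb[OF ta(2)] by simp
    then show ?thesis
      using True ed the ideal_iso_appl(5)[OF t_iso[OF g] True]
      by (simp add: ext_action_def Let_def idpart_def[symmetric] del: mult_sinv_self U_simps(2))
  qed
qed

text \<open>The transversal is the inclusion of \<open>E\<close> into \<open>U\<close>. The map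
  \<open>emb\<close> puts \<open>a\<close> in degree 1, and both degree maps are second
  projections.\<close>

theorem crossed_product_extension:
  "has_admissible_extension TYPE('a \<times> 'b) TYPE('a \<times> 'b) A G \<psi>"
proof -
  have Dne: "\<exists>a. a \<in> D g" if "g \<in> carrier G" for g using ideal_ofD(1)[OF D_ideal[OF that]] by blast
  have snd: "snd (x \<cdot>\<^bsub>U\<^esub> y) = snd x \<odot> snd y" for x y by (cases x; cases y) simp
  have imE: "emb ` carrier A = {u \<in> carrier U. snd u = \<one>\<^bsub>G\<^esub>}"
    using U_one by (auto simp: emb_def)
  have sm: "emb \<in> smono A U"
    using D_one by (auto simp: smono_def shom_def emb_def inj_on_def cmul_one_left(1))
  have jU: "snd \<in> sepi U (semigrp_of G)"
    unfolding sepi_def shom_def semigrp_of_def using snd Dne by (force simp: U_def image_iff)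
  have 1: "gext A G U emb snd"
    unfolding gext_def using U.inverse_semigrp_axioms sm jU imE by blast
  have kE: "snd \<in> sepi E (semigrp_of G)"
  proof -
    have "\<exists>x \<in> carrier E. snd x = g" if "g \<in> carrier G" for g
    proof -
      obtain a where "a \<in> D g" using Dne[OF \<open>g \<in> carrier G\<close>] by blast
      then have "(\<epsilon> a, g) \<in> carrier E" using D_elem that carrier_E by simp
      then show ?thesis by force
    qed
    moreover have "snd x \<in> carrier G" if "x \<in> carrier E" for x using that carrier_E by (cases x) auto
    moreover have "snd (x \<cdot>\<^bsub>E\<^esub> y) = snd x \<odot> snd y" for x y using snd by (simp add: E_def pr_def)
    ultimately show ?thesis by (force simp: sepi_def shom_def semigrp_of_def image_iff)
  qed
  \<comment> \<open>Left multiplication by an idempotent keeps the degree, so an element above an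
    idempotent has degree 1; in \<open>E\<close> such elements are idempotent.\<close>
  have Eu: "E_unitary E"
    unfolding E_unitary_def
  proof (intro conjI ballI impI)
    show "inverse_semigrp E" by unfold_locales
    fix e s assume e: "e \<in> idems E" and s: "s \<in> carrier E" and le: "nat_le E e s"
    obtain f where f: "f \<in> idems E" "e = f \<cdot>\<^bsub>E\<^esub> s" using le by (auto simp: nat_le_def)
    obtain x g where x: "s = (x, g)" by (cases s)
    have m: "x \<in> idems A" "g \<in> carrier G" using s x carrier_E by auto
    have "g = \<one>\<^bsub>G\<^esub>" using e f s x m E_mult_one(1) by (auto simp: E_idems)
    then show "s \<in> idems E" using x m E_idems by auto
  qed
  have sx: "sext A E U emb pr"
    unfolding sext_def
  proof (intro conjI)
    show "inverse_semigrp U" "inverse_semigrp E" by unfold_locales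
    show "emb \<in> smono A U" by (rule sm)
    show "pr \<in> sepi U E" using pr_hom by (simp add: sepi_def E_def)
    show "inj_on pr (idems U)" by (auto simp: inj_on_def U_idems)
    have "pr u \<in> idems E \<longleftrightarrow> snd u = \<one>\<^bsub>G\<^esub>" if "u \<in> carrier U" for u
      using that E_idems D_one by (cases u) auto
    then show "emb ` carrier A = {u \<in> carrier U. pr u \<in> idems E}" using imE by auto
  qed
  have 2: "refinement A G U emb snd E pr snd"
    unfolding refinement_def using Eu sx kE by (auto simp: pr_def)
  have 3: "order_transversal U E pr (\<lambda>x. x)"
    unfolding order_transversal_def
  proof (intro conjI ballI impI)
    show "(\<lambda>x. x) \<in> carrier E \<rightarrow> carrier U" using E_sub by auto
    show "pr s = s" if "s \<in> carrier E" for s using E_sub that by auto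
    show "(\<lambda>x. x) ` idems E \<subseteq> idems U" using E_idems U_idems by auto
    fix s t' assume "s \<in> carrier E" "t' \<in> carrier E" "nat_le E s t'"
    then obtain f where f: "f \<in> idems E" "s = f \<cdot>\<^bsub>E\<^esub> t'" "t' \<in> carrier E" by (auto simp: nat_le_def)
    then have "s = f \<cdot>\<^bsub>U\<^esub> t'" using E_mult_one E_idems by (cases t') auto
    then show "nat_le U s t'" using f U_idems E_idems by (auto simp: nat_le_def)
  qed
  have 4: "\<psi> g = sim A `` {ext_action A G U E emb snd (\<lambda>x. x) g}" if "g \<in> carrier G" for g
    using psi_class(1)[OF that reps[OF that]] ext_action_crossed[OF that] by simp
  show ?thesis
    unfolding has_admissible_extension_def using 1 2 3 4 by blast
qed

end

section \<open>From a trivial obstruction to a normalised twisting\<close>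

context abs_kernel
begin

lemma associates_cong:
  assumes "kernel_reps A G \<psi> \<theta>" "kernel_reps.associates A G \<psi> \<theta> w b"
    "\<And>g h k e. \<lbrakk>g \<in> carrier G; h \<in> carrier G; k \<in> carrier G; e \<in> idems A; e \<in> P3 g h k\<rbrakk> \<Longrightarrow> b g h k e = b' g h k e"
  shows "kernel_reps.associates A G \<psi> \<theta> w b'"
proof -
  interpret kernel_reps A G \<psi> \<theta> by fact
  show ?thesis using assms(2,3) by (simp add: associates_def)
qed

text \<open>With c = w(1,1) and \<beta> = 1, the equations at (1,1,g) and (g,1,1) force w(1,g)(e) =
  c(e) and w(g,1)(e) = \<theta>_g(c(\<theta>_g^-1 e)). One central scaling by the inverse of the
  latter expression thus normalises both sides.\<close>

theorem trivial_obstruction_extension: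
  assumes triv: "Obs A G \<psi> = \<one>\<^bsub>center_cohomology A G \<psi> 3\<^esub>"
  shows "has_admissible_extension TYPE('a \<times> 'g) TYPE('a \<times> 'g) A G \<psi>"
proof -
  \<comment> \<open>The identity is a member of \<psi> at 1; choosing it there makes \<theta>_1
    trivial from the start.\<close>
  define \<theta> where "\<theta> = rep(\<one>\<^bsub>G\<^esub> := Some |` carrier A)"
  have \<theta>: "kernel_reps A G \<psi> \<theta>"
    by unfold_locales (simp add: \<theta>_def rep unit_mem(1))
  interpret kernel_reps A G \<psi> \<theta> by (rule \<theta>)
  have t1: "t \<one>\<^bsub>G\<^esub> a = a" if "a \<in> carrier A" for a using that by (simp add: \<theta>_def)
  obtain w0 where w0: "twists w0" using twists_exists by blast
  let ?b = "assoc_of w0"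
  note b0 = associates_assoc_of[OF w0]
  let ?\<beta> = "\<lambda>g h k. mk_mult (P3 g h k) (?b g h k)"
  have o: "obstruction A G \<psi> ?\<beta>"
    unfolding obstruction_def
    using twists_twisting[OF w0] associates_associator[OF w0 b0] reps by (auto simp: representatives_def)
  obtain z where z: "central2 z"
    "\<forall>g \<in> carrier G. \<forall>h \<in> carrier G. \<forall>k \<in> carrier G. \<forall>e \<in> idems A \<inter> P3 g h k. fst (?\<beta> g h k) e = dz z g h k e"
    using Obs_trivial_iff[OF o] triv by blast
  have bz: "?b g h k e = dz z g h k e" if G: "g \<in> carrier G" "h \<in> carrier G" "k \<in> carrier G" and e: "e \<in> idems A" "e \<in> P3 g h k" for g h k e
    using z(2) G e fst_mk_mult[OF ideal_subsemigrp[OF P_ideal(2)[OF G]] sect_assoc_of[OF w0 G] e(2,1)] by simp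
  \<comment> \<open>Scaling multiplies the associator by a coboundary, so the inverse of
    \<open>z\<close> cancels an associator equal to the coboundary of \<open>z\<close>.\<close>
  define y where "y = (\<lambda>g h e. (z g h e)\<^sup>\<dagger>)"
  have y: "central2 y" unfolding y_def by (rule central2_sinv[OF z(1)])
  define w1 where "w1 = (\<lambda>g h e. y g h e \<cdot> w0 g h e)"
  note s = twists_scale[OF w0 b0 y, folded w1_def]
  have zy: "?b g h k e \<cdot> dz y g h k e = e"
    if G: "g \<in> carrier G" "h \<in> carrier G" "k \<in> carrier G" and e: "e \<in> idems A" "e \<in> P3 g h k" for g h k e
    unfolding bz[OF that] y_def by (rule dz_sinv[OF z(1) that])
  have a1: "associates w1 (\<lambda>g h k e. e)" by (rule associates_cong[OF \<theta> s(2) zy])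
  have one: "\<one>\<^bsub>G\<^esub> \<in> carrier G" by simp
  define c where "c = w1 \<one>\<^bsub>G\<^esub> \<one>\<^bsub>G\<^esub>"
  have P11: "P2 \<one>\<^bsub>G\<^esub> \<one>\<^bsub>G\<^esub> = carrier A" by (simp add: D_one)
  have cs: "sect (carrier A) c" using twistsD(1)[OF s(1) one one] P11 by (simp add: c_def)
  \<comment> \<open>Since \<theta>_1 is the identity, the twisting equation at (1,1) says exactly
    that c(f) commutes with the maximal subgroup at f.\<close>
  have cc: "c e \<in> center A" if e: "e \<in> idems A" for e
  proof (rule sect_central[OF ideal_carrier cs _ _ e])
    show "e \<in> carrier A" using e idems_closed by auto
    fix f T assume f: "f \<in> carrier A" "f \<in> idems A" and T: "T \<in> at f"
    have "T \<in> at (f \<triangleleft> (\<one>\<^bsub>G\<^esub> \<odot> \<one>\<^bsub>G\<^esub>))" using T idr_one f by simp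
    from twistsD(3)[OF s(1) one one f(2) _ this] show "c f \<cdot> T = T \<cdot> c f"
      using f T atD t1 D_one by (simp add: c_def)
  qed
  have cs': "sect (center A \<inter> carrier A) c" by (rule sect_center[OF ideal_carrier cs cc])
  \<comment> \<open>Scaling by \<open>v\<close> trivialises \<open>w\<close> at \<open>(1, g)\<close> and \<open>(g, 1)\<close> and leaves the associator unchanged.\<close>
  define v where "v = (\<lambda>g (h :: 'g) e. (act g (c (e \<triangleleft> g)))\<^sup>\<dagger>)"
  have ce: "c (e \<triangleleft> g) \<in> at (e \<triangleleft> g)" "c (e \<triangleleft> g) \<in> center A" "act g (c (e \<triangleleft> g)) \<in> at e" "act g (c (e \<triangleleft> g)) \<in> center A" "c (e \<triangleleft> g) \<in> D (\<iota> g)"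
    if "g \<in> carrier G" "e \<in> idems A" "e \<in> D g" for g e
  proof -
    note i = idr_closed[OF that]
    show 1: "c (e \<triangleleft> g) \<in> center A" "c (e \<triangleleft> g) \<in> at (e \<triangleleft> g)"
      using cc[OF i(1)] sect_at[OF ideal_subsemigrp[OF ideal_carrier] cs i(3,1)] by auto
    show "act g (c (e \<triangleleft> g)) \<in> at e" "act g (c (e \<triangleleft> g)) \<in> center A" "c (e \<triangleleft> g) \<in> D (\<iota> g)" using at_act[OF that 1] by auto
  qed
  have v: "central2 v"
    unfolding central2_def
  proof (intro ballI)
    fix g h assume G: "g \<in> carrier G" "h \<in> carrier G"
    have "sect (K2 g h) (\<lambda>e. act g (c (e \<triangleleft> g)))"
      by (rule sect_act[OF G(1) P_ideal(1)[OF G] _ ideal_carrier _ cs']) (use idr_closed(3)[OF G(1)] in auto)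
    then show "sect (K2 g h) (v g h)"
      unfolding v_def by (rule sect_sinv[OF K_subsemigrp(1)[OF G]])
  qed
  define w where "w = (\<lambda>g h e. v g h e \<cdot> w1 g h e)"
  note s2 = twists_scale[OF s(1) a1 v, folded w_def]
  \<comment> \<open>The value \<open>v g h\<close> does not depend on \<open>h\<close>, so the last
    two factors of the coboundary cancel. The first two cancel because \<theta>_g \<theta>_h =
    \<theta>_gh on central elements.\<close>
  have dv: "e \<cdot> dz v g h k e = e" if G: "g \<in> carrier G" "h \<in> carrier G" "k \<in> carrier G" and e: "e \<in> idems A" "e \<in> P3 g h k" for g h k e
  proof -
    note F = P3_faces[OF G e]
    have gh: "g \<odot> h \<in> carrier G" using G by simp
    have i: "e \<triangleleft> g \<triangleleft> h = e \<triangleleft> (g \<odot> h)" by (rule idr_idr[OF G(1,2) e(1)]) (use F in auto)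
    have egh: "e \<triangleleft> g \<in> D h" "e \<in> D (g \<odot> h)" using F by auto
    note c1 = ce[OF G(2) F(1) egh(1)] and c2 = ce[OF gh e(1) egh(2)] and c3 = ce[OF G(1) e(1) F(6)]
    have "act g (v h k (e \<triangleleft> g)) = (act g (act h (c (e \<triangleleft> g \<triangleleft> h))))\<^sup>\<dagger>"
      unfolding v_def by (rule act_sinv[OF G(1) c1(4) at_act(3)[OF G(1) e(1) F(6) c1(4,3)]])
    also have "act g (act h (c (e \<triangleleft> g \<triangleleft> h))) = act (g \<odot> h) (c (e \<triangleleft> (g \<odot> h)))"
      using act_act[OF G(1,2) c1(2,5)] c2(5) G by (simp add: i G.inv_mult_group)
    finally have 1: "act g (v h k (e \<triangleleft> g)) = (act (g \<odot> h) (c (e \<triangleleft> (g \<odot> h))))\<^sup>\<dagger>" .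
    show ?thesis
      unfolding dz_def 1 unfolding v_def
      using atD[OF c2(3)] atD[OF c3(3)] idems_idem[OF e(1)] idems_closed[OF e(1)] at_unit[OF c3(3)] at_unit[OF at_sinv[OF c3(3)]]
      by (simp add: assoc closed)
  qed
  have a2: "associates w (\<lambda>g h k e. e)" by (rule associates_cong[OF \<theta> s2(2) dv])
  interpret crossed A G \<psi> \<theta> w
  proof
    show "twists w" "associates w (\<lambda>g h k e. e)" by (fact s2(1), fact a2)
    show "t \<one>\<^bsub>G\<^esub> a = a" if "a \<in> carrier A" for a using t1 that .
    fix g e assume g: "g \<in> carrier G" and e: "e \<in> idems A" "e \<in> D g"
    have ec: "e \<in> carrier A" using e idems_closed by auto
    have p: "e \<in> P3 \<one>\<^bsub>G\<^esub> \<one>\<^bsub>G\<^esub> g" "e \<in> P3 g \<one>\<^bsub>G\<^esub> \<one>\<^bsub>G\<^esub>" using e g ec D_one by auto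
    note F1 = twist_faces[OF s(1) one one g e(1) p(1)] and F2 = twist_faces[OF s(1) g one one e(1) p(2)]
    have w1e: "w1 \<one>\<^bsub>G\<^esub> g e \<in> at e" using F1 g by simp
    have "w1 \<one>\<^bsub>G\<^esub> g e \<cdot> w1 \<one>\<^bsub>G\<^esub> g e = c e \<cdot> w1 \<one>\<^bsub>G\<^esub> g e"
      using associatesD(3)[OF a1 one one g e(1) p(1)] t1 atD[OF w1e] idr_one[OF e(1)] at_unit(1)[OF F1(4)] g
      by (simp add: c_def)
    then have "w1 \<one>\<^bsub>G\<^esub> g e = c e"
      using at_r_cancel[OF w1e _ w1e, of "c e"] sect_at[OF ideal_subsemigrp[OF ideal_carrier] cs ec e(1)] by simp
    then show "w \<one>\<^bsub>G\<^esub> g e = e"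
      using atD[OF w1e] cc[OF e(1)] act_one idr_one[OF e(1)] by (simp add: w_def v_def)
    have u: "t g (c (e \<triangleleft> g)) = act g (c (e \<triangleleft> g))" using t_act[OF g ce(2,5)[OF g e]] .
    have w1g: "w1 g \<one>\<^bsub>G\<^esub> e \<in> at e" using F2 g by simp
    have "act g (c (e \<triangleleft> g)) \<cdot> w1 g \<one>\<^bsub>G\<^esub> e = w1 g \<one>\<^bsub>G\<^esub> e \<cdot> w1 g \<one>\<^bsub>G\<^esub> e"
      using associatesD(3)[OF a1 g one one e(1) p(2)] u at_unit(1)[OF w1g] g by (simp add: c_def)
    then have "act g (c (e \<triangleleft> g)) = w1 g \<one>\<^bsub>G\<^esub> e"
      by (rule at_r_cancel[OF ce(3)[OF g e] w1g w1g])
    then show "w g \<one>\<^bsub>G\<^esub> e = e" using atD[OF w1g] by (simp add: w_def v_def)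
  qed
  show ?thesis by (rule crossed_product_extension)
qed

end

section \<open>The obstruction of an admissible extension\<close>

lemma (in inverse_semigrp) conj_idem:
  assumes "s \<in> carrier S" "f \<in> idems S"
  shows "s \<cdot> f \<cdot> sinv S s \<in> idems S"
proof -
  have c: "s \<in> carrier S" "f \<in> carrier S" "sinv S s \<in> carrier S" "sinv S s \<cdot> s \<in> idems S"
    using assms idems_closed by auto
  have "s \<cdot> f \<cdot> sinv S s \<cdot> (s \<cdot> f \<cdot> sinv S s) = s \<cdot> (f \<cdot> (sinv S s \<cdot> s)) \<cdot> f \<cdot> sinv S s"
    using c by (simp add: assoc closed)
  also have "\<dots> = (s \<cdot> sinv S s \<cdot> s) \<cdot> (f \<cdot> f) \<cdot> sinv S s"
    unfolding idems_commute[OF assms(2) c(4)] using c by (simp add: assoc closed)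
  finally show ?thesis using c mult_sinv_mult idems_idem[OF assms(2)] by (simp add: idems_def closed)
qed

locale admissible = abs_kernel +
  fixes U :: "'u semigrp" and i :: "'a \<Rightarrow> 'u" and j :: "'u \<Rightarrow> 'b"
    and T :: "'s semigrp" and p :: "'u \<Rightarrow> 's" and \<kappa> :: "'s \<Rightarrow> 'b" and \<rho> :: "'s \<Rightarrow> 'u"
  assumes gext: "gext A G U i j" and refinement: "refinement A G U i j T p \<kappa>"
    and transversal: "order_transversal U T p \<rho>"
    and psi: "g \<in> carrier G \<Longrightarrow> \<psi> g = sim A `` {ext_action A G U T i \<kappa> \<rho> g}"
begin

sublocale U: inverse_semigrp U using gext by (simp add: gext_def)
sublocale T: inverse_semigrp T using refinement by (simp add: refinement_def sext_def)

lemma i_hom: "i \<in> shom A U" and i_inj: "inj_on i (carrier A)"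
  and p_hom: "p \<in> shom U T" and p_surj: "p ` carrier U = carrier T" and p_idems: "inj_on p (idems U)"
  and i_image: "i ` carrier A = {u \<in> carrier U. p u \<in> idems T}"
  and \<kappa>_hom: "\<kappa> \<in> shom T (semigrp_of G)" and j_eq: "u \<in> carrier U \<Longrightarrow> j u = \<kappa> (p u)"
  and i_image_j: "i ` carrier A = {u \<in> carrier U. j u = \<one>\<^bsub>G\<^esub>}"
  using gext refinement
  by (auto simp: gext_def refinement_def sext_def smono_def sepi_def)

lemma rho: "s \<in> carrier T \<Longrightarrow> \<rho> s \<in> carrier U" "s \<in> carrier T \<Longrightarrow> p (\<rho> s) = s"
  "s \<in> idems T \<Longrightarrow> \<rho> s \<in> idems U"
  "\<lbrakk>s \<in> carrier T; s' \<in> carrier T; nat_le T s s'\<rbrakk> \<Longrightarrow> nat_le U (\<rho> s) (\<rho> s')"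
  using transversal by (auto simp: order_transversal_def)

lemma i_simps:
  "x \<in> carrier A \<Longrightarrow> i x \<in> carrier U" "\<lbrakk>x \<in> carrier A; y \<in> carrier A\<rbrakk> \<Longrightarrow> i (x \<cdot> y) = i x \<cdot>\<^bsub>U\<^esub> i y"
  "x \<in> carrier A \<Longrightarrow> i (x\<^sup>\<dagger>) = sinv U (i x)" "\<lbrakk>x \<in> carrier A; y \<in> carrier A; i x = i y\<rbrakk> \<Longrightarrow> x = y"
  "e \<in> idems A \<Longrightarrow> i e \<in> idems U" "x \<in> carrier A \<Longrightarrow> i (\<epsilon> x) = i x \<cdot>\<^bsub>U\<^esub> sinv U (i x)"
proof -
  show 1: "x \<in> carrier A \<Longrightarrow> i x \<in> carrier U" "\<lbrakk>x \<in> carrier A; y \<in> carrier A\<rbrakk> \<Longrightarrow> i (x \<cdot> y) = i x \<cdot>\<^bsub>U\<^esub> i y" for x y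
    using shomD[OF i_hom] by auto
  show 2: "x \<in> carrier A \<Longrightarrow> i (x\<^sup>\<dagger>) = sinv U (i x)" for x
    using shom_sinv[OF U.inverse_semigrp_axioms i_hom] .
  show "\<lbrakk>x \<in> carrier A; y \<in> carrier A; i x = i y\<rbrakk> \<Longrightarrow> x = y" using i_inj by (auto dest: inj_onD)
  show "e \<in> idems A \<Longrightarrow> i e \<in> idems U" by (rule shom_idems[OF i_hom])
  show "x \<in> carrier A \<Longrightarrow> i (\<epsilon> x) = i x \<cdot>\<^bsub>U\<^esub> sinv U (i x)"
    using 1(2)[of x "x\<^sup>\<dagger>"] 2 by (simp add: idpart_def del: mult_sinv_self)
qed

lemma p_simps: "u \<in> carrier U \<Longrightarrow> p u \<in> carrier T"
  "\<lbrakk>u \<in> carrier U; v \<in> carrier U\<rbrakk> \<Longrightarrow> p (u \<cdot>\<^bsub>U\<^esub> v) = p u \<cdot>\<^bsub>T\<^esub> p v"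
  "u \<in> carrier U \<Longrightarrow> p (sinv U u) = sinv T (p u)" "u \<in> idems U \<Longrightarrow> p u \<in> idems T"
  using shomD[OF p_hom] U.shom_sinv[OF T.inverse_semigrp_axioms p_hom] U.shom_idems[OF p_hom] by auto

section \<open>Degrees, ranges and sources in the refinement\<close>

lemma kappa_simps: "s \<in> carrier T \<Longrightarrow> \<kappa> s \<in> carrier G"
  "\<lbrakk>s \<in> carrier T; s' \<in> carrier T\<rbrakk> \<Longrightarrow> \<kappa> (s \<cdot>\<^bsub>T\<^esub> s') = \<kappa> s \<odot> \<kappa> s'"
  using shomD[OF \<kappa>_hom] by (auto simp: semigrp_of_def)

text \<open>The image of \<open>A\<close> in \<open>U\<close> is described both as the elements of
  degree 1 and as the preimage of the idempotents of \<open>T\<close>; comparing the two gives the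
  claim, since \<open>p\<close> is onto.\<close>

lemma kappa_one: "s \<in> carrier T \<Longrightarrow> \<kappa> s = \<one>\<^bsub>G\<^esub> \<longleftrightarrow> s \<in> idems T"
proof -
  assume s: "s \<in> carrier T"
  then obtain u where u: "u \<in> carrier U" "s = p u" using p_surj by auto
  have "p u \<in> idems T \<longleftrightarrow> j u = \<one>\<^bsub>G\<^esub>" using i_image i_image_j u(1) by blast
  then show ?thesis using u j_eq by simp
qed

lemma kappa_sinv:
  assumes s: "s \<in> carrier T" shows "\<kappa> (sinv T s) = \<iota> (\<kappa> s)"
proof -
  have "\<kappa> (sinv T s) \<odot> \<kappa> s = \<one>\<^bsub>G\<^esub>"
    using kappa_simps(2)[of "sinv T s" s] kappa_one[of "sinv T s \<cdot>\<^bsub>T\<^esub> s"] s T.closed by simp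
  then show ?thesis using G.inv_equality[of "\<kappa> (sinv T s)" "\<kappa> s"] kappa_simps(1) s by simp
qed

text \<open>The element f = s^-1 s' has degree 1, so it is idempotent, and equality of the ranges
  gives s' = s f. Equality of the ranges once more, now written as s f s^-1 = s s^-1, yields s = s
  f.\<close>

lemma degree_range_unique:
  assumes s: "s \<in> carrier T" "s' \<in> carrier T" and eq: "\<kappa> s = \<kappa> s'" "s \<cdot>\<^bsub>T\<^esub> sinv T s = s' \<cdot>\<^bsub>T\<^esub> sinv T s'"
  shows "s = s'"
proof -
  define f where "f = sinv T s \<cdot>\<^bsub>T\<^esub> s'"
  let ?d = "sinv T s \<cdot>\<^bsub>T\<^esub> s"
  have f: "f \<in> carrier T" using s T.closed by (simp add: f_def)
  have "\<kappa> f = \<one>\<^bsub>G\<^esub>" using kappa_simps[of "sinv T s"] kappa_simps(1)[OF s(2)] kappa_sinv[OF s(1)] s eq by (simp add: f_def)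
  then have fi: "f \<in> idems T" using kappa_one f by simp
  have "s \<cdot>\<^bsub>T\<^esub> f = (s \<cdot>\<^bsub>T\<^esub> sinv T s) \<cdot>\<^bsub>T\<^esub> s'" using s by (simp add: T.assoc f_def)
  also have "\<dots> = s'" unfolding eq(2) using T.mult_sinv_mult[OF s(2)] .
  finally have sf: "s \<cdot>\<^bsub>T\<^esub> f = s'" .
  have "s' \<cdot>\<^bsub>T\<^esub> sinv T s' = s \<cdot>\<^bsub>T\<^esub> f \<cdot>\<^bsub>T\<^esub> (f \<cdot>\<^bsub>T\<^esub> sinv T s)"
    unfolding sf[symmetric] using T.sinv_mult[OF s(1) f] fi by simp
  also have "\<dots> = s \<cdot>\<^bsub>T\<^esub> f \<cdot>\<^bsub>T\<^esub> sinv T s"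
    using s f T.idems_idem[OF fi] T.assoc[of s f "f \<cdot>\<^bsub>T\<^esub> sinv T s"] T.assoc[of f f "sinv T s"] T.assoc[of s f "sinv T s"] T.closed by simp
  finally have "s = s \<cdot>\<^bsub>T\<^esub> f \<cdot>\<^bsub>T\<^esub> sinv T s \<cdot>\<^bsub>T\<^esub> s"
    using eq(2) T.mult_sinv_mult[OF s(1)] by simp
  also have "\<dots> = s \<cdot>\<^bsub>T\<^esub> (f \<cdot>\<^bsub>T\<^esub> ?d)" using s f T.closed T.assoc by simp
  also have "\<dots> = s \<cdot>\<^bsub>T\<^esub> (?d \<cdot>\<^bsub>T\<^esub> f)" using T.idems_commute[OF fi, of ?d] s by simp
  also have "\<dots> = (s \<cdot>\<^bsub>T\<^esub> sinv T s \<cdot>\<^bsub>T\<^esub> s) \<cdot>\<^bsub>T\<^esub> f" using s f T.closed T.assoc by simp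
  also have "\<dots> = s'" using T.mult_sinv_mult[OF s(1)] sf by simp
  finally show ?thesis .
qed

lemma degree_source_unique:
  assumes s: "s \<in> carrier T" "s' \<in> carrier T" and eq: "\<kappa> s = \<kappa> s'" "sinv T s \<cdot>\<^bsub>T\<^esub> s = sinv T s' \<cdot>\<^bsub>T\<^esub> s'"
  shows "s = s'"
proof -
  have "sinv T s = sinv T s'" by (rule degree_range_unique) (use s eq kappa_sinv in auto)
  then show ?thesis using s by (metis T.sinv_sinv)
qed

text \<open>On these idempotents the transversal has no freedom: \<open>p\<close> is injective on
  idempotents, so \<open>\<rho>\<close> must send \<open>q e\<close> back to
  \<open>i e\<close>.\<close>

definition q :: "'a \<Rightarrow> 's" where "q e = p (i e)"

lemma q: "e \<in> idems A \<Longrightarrow> q e \<in> idems T" "\<lbrakk>e \<in> idems A; f \<in> idems A\<rbrakk> \<Longrightarrow> q (e \<cdot> f) = q e \<cdot>\<^bsub>T\<^esub> q f"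
  "e \<in> idems A \<Longrightarrow> \<rho> (q e) = i e"
proof -
  show 1: "e \<in> idems A \<Longrightarrow> q e \<in> idems T" for e by (simp add: q_def i_simps p_simps)
  show "\<lbrakk>e \<in> idems A; f \<in> idems A\<rbrakk> \<Longrightarrow> q (e \<cdot> f) = q e \<cdot>\<^bsub>T\<^esub> q f"
    by (simp add: q_def i_simps p_simps idems_closed)
  assume e: "e \<in> idems A"
  have "p (\<rho> (q e)) = p (i e)" using rho(2)[of "q e"] 1[OF e] T.idems_closed by (simp add: q_def)
  then show "\<rho> (q e) = i e"
    using inj_onD[OF p_idems, of "\<rho> (q e)" "i e"] rho(3)[OF 1[OF e]] i_simps(5)[OF e] by simp
qed

lemma rho_eq_iff: "\<lbrakk>x \<in> idems T; e \<in> idems A\<rbrakk> \<Longrightarrow> \<rho> x = i e \<longleftrightarrow> x = q e"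
  using rho(2)[of x] q(3)[of e] T.idems_closed by (auto simp: q_def)

definition \<theta> :: "'b \<Rightarrow> 'a \<rightharpoonup> 'a" where "\<theta> g = ext_action A G U T i \<kappa> \<rho> g"

sublocale kernel_reps A G \<psi> \<theta>
proof
  fix g assume g: "g \<in> carrier G"
  \<comment> \<open>Nothing is known yet about the map read off from the extension. Since its class
    is a value of \<psi> and so not empty, it is related to some map, hence is an isomorphism of
    ideals and a member of its own class.\<close>
  obtain x where "(\<theta> g, x) \<in> sim A" using psi_nonempty[OF g] psi[OF g] by (auto simp: \<theta>_def)
  then have "(\<theta> g, \<theta> g) \<in> sim A" using sim_refl by (metis simD)
  then show "\<theta> g \<in> \<psi> g" using psi[OF g] by (simp add: \<theta>_def)
qed

lemma ext_dom_D: "g \<in> carrier G \<Longrightarrow> ext_dom A T i \<kappa> \<rho> g = D g"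
proof -
  assume g: "g \<in> carrier G"
  have "dom (\<theta> (\<iota> g)) = ext_dom A T i \<kappa> \<rho> (\<iota> (\<iota> g))" by (auto simp: \<theta>_def ext_action_def Let_def split: if_splits)
  then show ?thesis using ideal_iso_appl(3)[OF t_iso[of "\<iota> g"]] g by simp
qed

lemma D_iff:
  assumes "g \<in> carrier G" "e \<in> idems A"
  shows "e \<in> D g \<longleftrightarrow> (\<exists>s \<in> carrier T. \<kappa> s = g \<and> s \<cdot>\<^bsub>T\<^esub> sinv T s = q e)"
proof -
  have "\<rho> (s \<cdot>\<^bsub>T\<^esub> sinv T s) = i (e \<cdot> e\<^sup>\<dagger>) \<longleftrightarrow> s \<cdot>\<^bsub>T\<^esub> sinv T s = q e" if "s \<in> carrier T" for s
    using rho_eq_iff[of "s \<cdot>\<^bsub>T\<^esub> sinv T s" e] that assms idems_idem by simp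
  then show ?thesis
    unfolding ext_dom_D[OF assms(1), symmetric] ext_dom_def using idems_closed[OF assms(2)] by auto
qed

section \<open>The twisting read off from the transversal\<close>

definition \<sigma> :: "'b \<Rightarrow> 'a \<Rightarrow> 's" where
  "\<sigma> g e = (SOME s. s \<in> carrier T \<and> \<kappa> s = g \<and> s \<cdot>\<^bsub>T\<^esub> sinv T s = q e)"

definition r :: "'b \<Rightarrow> 'a \<Rightarrow> 'u" where "r g e = \<rho> (\<sigma> g e)"

lemma sigma:
  assumes "g \<in> carrier G" "e \<in> idems A" "e \<in> D g"
  shows "\<sigma> g e \<in> carrier T" "\<kappa> (\<sigma> g e) = g" "\<sigma> g e \<cdot>\<^bsub>T\<^esub> sinv T (\<sigma> g e) = q e"
proof -
  have "\<exists>s. s \<in> carrier T \<and> \<kappa> s = g \<and> s \<cdot>\<^bsub>T\<^esub> sinv T s = q e" using assms D_iff by auto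
  from someI_ex[OF this]
  show "\<sigma> g e \<in> carrier T" "\<kappa> (\<sigma> g e) = g" "\<sigma> g e \<cdot>\<^bsub>T\<^esub> sinv T (\<sigma> g e) = q e" by (auto simp: \<sigma>_def)
qed

lemma sigma_eqI:
  assumes "g \<in> carrier G" "e \<in> idems A" "e \<in> D g" "s \<in> carrier T" "\<kappa> s = g" "s \<cdot>\<^bsub>T\<^esub> sinv T s = q e"
  shows "s = \<sigma> g e"
  using degree_range_unique sigma[OF assms(1-3)] assms(4-6) by simp

lemma p_conj:
  assumes "s \<in> carrier T" "a \<in> carrier A"
  shows "\<rho> s \<cdot>\<^bsub>U\<^esub> i a \<cdot>\<^bsub>U\<^esub> sinv U (\<rho> s) \<in> carrier U"
    "p (\<rho> s \<cdot>\<^bsub>U\<^esub> i a \<cdot>\<^bsub>U\<^esub> sinv U (\<rho> s)) = s \<cdot>\<^bsub>T\<^esub> p (i a) \<cdot>\<^bsub>T\<^esub> sinv T s"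
    "\<rho> s \<cdot>\<^bsub>U\<^esub> i a \<cdot>\<^bsub>U\<^esub> sinv U (\<rho> s) \<in> i ` carrier A"
proof -
  show 1: "\<rho> s \<cdot>\<^bsub>U\<^esub> i a \<cdot>\<^bsub>U\<^esub> sinv U (\<rho> s) \<in> carrier U"
    using assms rho i_simps U.closed by simp
  show 2: "p (\<rho> s \<cdot>\<^bsub>U\<^esub> i a \<cdot>\<^bsub>U\<^esub> sinv U (\<rho> s)) = s \<cdot>\<^bsub>T\<^esub> p (i a) \<cdot>\<^bsub>T\<^esub> sinv T s"
    using assms rho i_simps U.closed by (simp add: p_simps)
  have "p (i a) \<in> idems T" using i_image assms by blast
  then show "\<rho> s \<cdot>\<^bsub>U\<^esub> i a \<cdot>\<^bsub>U\<^esub> sinv U (\<rho> s) \<in> i ` carrier A"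
    unfolding i_image using 1 2 T.conj_idem[OF assms(1)] by simp
qed

text \<open>The element chosen by the definite description is \<open>s\<close>, since degree and
  source determine it. The conjugate lies in the image of \<open>i\<close> because \<open>p\<close>
  sends it to an idempotent.\<close>

lemma i_t:
  assumes g: "g \<in> carrier G" and s: "s \<in> carrier T" "\<kappa> s = g" and a: "a \<in> carrier A" "sinv T s \<cdot>\<^bsub>T\<^esub> s = q (\<epsilon> a)"
  shows "i (t g a) = \<rho> s \<cdot>\<^bsub>U\<^esub> i a \<cdot>\<^bsub>U\<^esub> sinv U (\<rho> s)"
proof -
  have "\<epsilon> a \<in> D (\<iota> g)"
    using D_iff[of "\<iota> g" "\<epsilon> a"] g a s kappa_sinv[OF s(1)] T.sinv_closed[OF s(1)] T.sinv_sinv[OF s(1)] by auto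
  then have aD: "a \<in> ext_dom A T i \<kappa> \<rho> (\<iota> g)" using D_eps[of "\<iota> g" a] ext_dom_D[of "\<iota> g"] g a by simp
  have "(THE s. s \<in> carrier T \<and> \<kappa> s = g \<and> \<rho> (sinv T s \<cdot>\<^bsub>T\<^esub> s) = i (a \<cdot> a\<^sup>\<dagger>)) = s"
  proof (rule the_equality)
    show "s \<in> carrier T \<and> \<kappa> s = g \<and> \<rho> (sinv T s \<cdot>\<^bsub>T\<^esub> s) = i (a \<cdot> a\<^sup>\<dagger>)"
      using s a q(3)[of "\<epsilon> a"] by simp
    fix s' assume s': "s' \<in> carrier T \<and> \<kappa> s' = g \<and> \<rho> (sinv T s' \<cdot>\<^bsub>T\<^esub> s') = i (a \<cdot> a\<^sup>\<dagger>)"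
    then have "sinv T s' \<cdot>\<^bsub>T\<^esub> s' = q (\<epsilon> a)" using rho_eq_iff[of "sinv T s' \<cdot>\<^bsub>T\<^esub> s'" "\<epsilon> a"] a by simp
    then show "s' = s" using degree_source_unique s s' a by simp
  qed
  then have "t g a = inv_into (carrier A) i (\<rho> s \<cdot>\<^bsub>U\<^esub> i a \<cdot>\<^bsub>U\<^esub> sinv U (\<rho> s))"
    using aD by (simp add: \<theta>_def ext_action_def Let_def)
  then show ?thesis using f_inv_into_f[OF p_conj(3)[OF s(1) a(1)]] by simp
qed

text \<open>An element of degree g with the required source exists as the inverse of one of degree
  g^-1. Conjugation by its lift sends \<open>e \<triangleleft> g\<close> to \<open>e\<close>, so its
  range belongs to \<open>e\<close>, and uniqueness identifies it with \<sigma>_g(e).\<close>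

lemma sigma_source:
  assumes g: "g \<in> carrier G" and e: "e \<in> idems A" "e \<in> D g"
  shows "sinv T (\<sigma> g e) \<cdot>\<^bsub>T\<^esub> \<sigma> g e = q (e \<triangleleft> g)"
proof -
  let ?f = "e \<triangleleft> g"
  note f = idr_closed[OF g e]
  obtain s' where s': "s' \<in> carrier T" "\<kappa> s' = \<iota> g" "s' \<cdot>\<^bsub>T\<^esub> sinv T s' = q ?f"
    using D_iff[of "\<iota> g" ?f] f g by auto
  define s where "s = sinv T s'"
  have s: "s \<in> carrier T" "\<kappa> s = g" "sinv T s \<cdot>\<^bsub>T\<^esub> s = q ?f" using s' kappa_sinv[OF s'(1)] g by (auto simp: s_def)
  have "i e = \<rho> s \<cdot>\<^bsub>U\<^esub> i ?f \<cdot>\<^bsub>U\<^esub> sinv U (\<rho> s)"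
    using i_t[OF g s(1,2) f(3)] s(3) f(1) t_idr[OF g e] by simp
  then have "q e = s \<cdot>\<^bsub>T\<^esub> (sinv T s \<cdot>\<^bsub>T\<^esub> s) \<cdot>\<^bsub>T\<^esub> sinv T s"
    using p_conj(2)[OF s(1) f(3)] s(3) by (simp add: q_def)
  also have "\<dots> = s \<cdot>\<^bsub>T\<^esub> sinv T s" using T.mult_sinv_mult[OF s(1)] s(1) T.closed by (simp flip: T.assoc)
  finally have "s = \<sigma> g e" using sigma_eqI[OF g e s(1,2)] by simp
  then show ?thesis using s by simp
qed

lemma r_facts:
  assumes g: "g \<in> carrier G" and e: "e \<in> idems A" "e \<in> D g"
  shows "r g e \<in> carrier U" "p (r g e) = \<sigma> g e" "r g e \<cdot>\<^bsub>U\<^esub> sinv U (r g e) = i e" "sinv U (r g e) \<cdot>\<^bsub>U\<^esub> r g e = i (e \<triangleleft> g)"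
    "i e \<cdot>\<^bsub>U\<^esub> r g e = r g e" "r g e \<cdot>\<^bsub>U\<^esub> i (e \<triangleleft> g) = r g e"
proof -
  note s = sigma[OF g e] and s' = sigma_source[OF g e] and f = idr_closed[OF g e]
  show r: "r g e \<in> carrier U" "p (r g e) = \<sigma> g e" using rho s by (auto simp: r_def)
  have ii: "i e \<in> idems U" "i (e \<triangleleft> g) \<in> idems U" using i_simps(5) e f by auto
  show 1: "r g e \<cdot>\<^bsub>U\<^esub> sinv U (r g e) = i e"
    using inj_onD[OF p_idems _ U.mult_sinv_idem[OF r(1)] ii(1)] r s by (simp add: p_simps q_def)
  show 2: "sinv U (r g e) \<cdot>\<^bsub>U\<^esub> r g e = i (e \<triangleleft> g)"
    using inj_onD[OF p_idems _ U.sinv_mult_idem[OF r(1)] ii(2)] r s' by (simp add: p_simps q_def)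
  show "i e \<cdot>\<^bsub>U\<^esub> r g e = r g e" unfolding 1[symmetric] using U.mult_sinv_mult[OF r(1)] .
  show "r g e \<cdot>\<^bsub>U\<^esub> i (e \<triangleleft> g) = r g e"
    unfolding 2[symmetric] using U.mult_sinv_mult[OF r(1)] U.assoc[OF r(1) U.sinv_closed[OF r(1)] r(1)] by simp
qed

lemma i_t_at:
  assumes g: "g \<in> carrier G" and e: "e \<in> idems A" "e \<in> D g" and a: "a \<in> at (e \<triangleleft> g)"
  shows "i (t g a) = r g e \<cdot>\<^bsub>U\<^esub> i a \<cdot>\<^bsub>U\<^esub> sinv U (r g e)"
  unfolding r_def
  by (rule i_t[OF g sigma(1,2)[OF g e] atD(1)[OF a]]) (simp add: sigma_source[OF g e] atD(2)[OF a])

text \<open>The source of the first factor is the range of the second, so the product keeps the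
  range of the first factor. Its degree is the product of the degrees, and uniqueness
  applies.\<close>

lemma sigma_mult:
  assumes G: "g \<in> carrier G" "h \<in> carrier G" and e: "e \<in> idems A" "e \<in> P2 g h"
  shows "\<sigma> g e \<cdot>\<^bsub>T\<^esub> \<sigma> h (e \<triangleleft> g) = \<sigma> (g \<odot> h) e"
proof (rule sigma_eqI)
  have eg: "e \<in> D g" "e \<triangleleft> g \<in> idems A" "e \<triangleleft> g \<in> D h" using e idr_closed[OF G(1) e(1)] idr_D[OF G e(1)] by auto
  note s = sigma[OF G(1) e(1) eg(1)] and s' = sigma[OF G(2) eg(2,3)] and so = sigma_source[OF G(1) e(1) eg(1)]
  let ?s = "\<sigma> g e" and ?t = "\<sigma> h (e \<triangleleft> g)"
  show "?s \<cdot>\<^bsub>T\<^esub> ?t \<in> carrier T" "\<kappa> (?s \<cdot>\<^bsub>T\<^esub> ?t) = g \<odot> h" using s s' T.closed kappa_simps(2) by auto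
  have "?s \<cdot>\<^bsub>T\<^esub> ?t \<cdot>\<^bsub>T\<^esub> sinv T (?s \<cdot>\<^bsub>T\<^esub> ?t) = ?s \<cdot>\<^bsub>T\<^esub> (?t \<cdot>\<^bsub>T\<^esub> sinv T ?t) \<cdot>\<^bsub>T\<^esub> sinv T ?s"
    using T.sinv_mult[OF s(1) s'(1)] s(1) s'(1) T.closed by (simp add: T.assoc)
  also have "\<dots> = ?s \<cdot>\<^bsub>T\<^esub> (sinv T ?s \<cdot>\<^bsub>T\<^esub> ?s) \<cdot>\<^bsub>T\<^esub> sinv T ?s" using s'(3) so by simp
  also have "\<dots> = ?s \<cdot>\<^bsub>T\<^esub> sinv T ?s" using T.mult_sinv_mult[OF s(1)] s(1) T.closed by (simp flip: T.assoc)
  finally show "?s \<cdot>\<^bsub>T\<^esub> ?t \<cdot>\<^bsub>T\<^esub> sinv T (?s \<cdot>\<^bsub>T\<^esub> ?t) = q e" using s(3) by simp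
qed (use G e in auto)

text \<open>The only place where the transversal is required to preserve the order.\<close>

lemma r_restrict:
  assumes g: "g \<in> carrier G" and e: "e \<in> idems A" and f: "f \<in> idems A" "f \<in> D g"
  shows "r g (e \<cdot> f) = i e \<cdot>\<^bsub>U\<^esub> r g f"
proof -
  have ef: "e \<cdot> f \<in> idems A" "e \<cdot> f \<in> D g" using e f ideal_ofD(3)[OF D_ideal[OF g]] idems_closed by auto
  note s = sigma[OF g f] and qe = q(1)[OF e] and qf = q(1)[OF f(1)]
  have c: "q e \<in> carrier T" "q f \<in> carrier T" using qe qf T.idems_closed by auto
  have "q e \<cdot>\<^bsub>T\<^esub> \<sigma> g f = \<sigma> g (e \<cdot> f)"
  proof (rule sigma_eqI[OF g ef])
    show "q e \<cdot>\<^bsub>T\<^esub> \<sigma> g f \<in> carrier T" using c s T.closed by simp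
    show "\<kappa> (q e \<cdot>\<^bsub>T\<^esub> \<sigma> g f) = g" using kappa_simps(2) c s kappa_one[of "q e"] qe g by simp
    have "q e \<cdot>\<^bsub>T\<^esub> \<sigma> g f \<cdot>\<^bsub>T\<^esub> sinv T (q e \<cdot>\<^bsub>T\<^esub> \<sigma> g f) = q e \<cdot>\<^bsub>T\<^esub> (\<sigma> g f \<cdot>\<^bsub>T\<^esub> sinv T (\<sigma> g f)) \<cdot>\<^bsub>T\<^esub> q e"
      using T.sinv_mult[OF c(1) s(1)] T.sinv_idem[OF qe] c s(1) T.closed by (simp add: T.assoc)
    also have "\<dots> = (q f \<cdot>\<^bsub>T\<^esub> q e) \<cdot>\<^bsub>T\<^esub> q e" unfolding s(3) using T.idems_commute[OF qe qf] by simp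
    also have "\<dots> = q f \<cdot>\<^bsub>T\<^esub> q e" using T.idems_idem[OF qe] c by (simp add: T.assoc)
    also have "\<dots> = q (e \<cdot> f)" using T.idems_commute[OF qe qf] q(2)[OF e f(1)] by simp
    finally show "q e \<cdot>\<^bsub>T\<^esub> \<sigma> g f \<cdot>\<^bsub>T\<^esub> sinv T (q e \<cdot>\<^bsub>T\<^esub> \<sigma> g f) = q (e \<cdot> f)" .
  qed
  then have "nat_le T (\<sigma> g (e \<cdot> f)) (\<sigma> g f)" unfolding nat_le_def using qe by metis
  then have "nat_le U (r g (e \<cdot> f)) (r g f)" using rho(4)[OF sigma(1)[OF g ef] s(1)] by (simp add: r_def)
  \<comment> \<open>The order relation provides only some idempotent of \<open>U\<close>. Comparing
    ranges shows that on \<open>r g f\<close> it acts as \<open>i (e \<cdot> f)\<close>.\<close>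
  then obtain x where x: "x \<in> idems U" "r g (e \<cdot> f) = x \<cdot>\<^bsub>U\<^esub> r g f" by (auto simp: nat_le_def)
  note R = r_facts[OF g f] and Re = r_facts[OF g ef]
  have ic: "i f \<in> idems U" "i f \<in> carrier U" "i e \<in> carrier U" "x \<in> carrier U"
    using i_simps(1,5) e f x idems_closed U.idems_closed by auto
  have "i (e \<cdot> f) = x \<cdot>\<^bsub>U\<^esub> r g f \<cdot>\<^bsub>U\<^esub> (sinv U (r g f) \<cdot>\<^bsub>U\<^esub> x)"
    using Re(3) x U.sinv_mult[OF ic(4) R(1)] by simp
  also have "\<dots> = x \<cdot>\<^bsub>U\<^esub> (r g f \<cdot>\<^bsub>U\<^esub> sinv U (r g f)) \<cdot>\<^bsub>U\<^esub> x" using ic R(1) U.closed by (simp add: U.assoc)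
  also have "\<dots> = (i f \<cdot>\<^bsub>U\<^esub> x) \<cdot>\<^bsub>U\<^esub> x" unfolding R(3) using U.idems_commute[OF x(1) ic(1)] by simp
  also have "\<dots> = i f \<cdot>\<^bsub>U\<^esub> x" using U.idems_idem[OF x(1)] ic by (simp add: U.assoc)
  finally have "i (e \<cdot> f) = x \<cdot>\<^bsub>U\<^esub> i f" using U.idems_commute[OF x(1) ic(1)] by simp
  then have "i (e \<cdot> f) \<cdot>\<^bsub>U\<^esub> r g f = r g (e \<cdot> f)" using x(2) R(1,5) ic by (simp add: U.assoc)
  moreover have "i (e \<cdot> f) \<cdot>\<^bsub>U\<^esub> r g f = i e \<cdot>\<^bsub>U\<^esub> r g f"
    using i_simps(2) idems_closed e f R(1,5) ic by (simp add: U.assoc)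
  ultimately show ?thesis by simp
qed

definition w :: "'b \<Rightarrow> 'b \<Rightarrow> 'a \<Rightarrow> 'a" where
  "w g h e = inv_into (carrier A) i (r g e \<cdot>\<^bsub>U\<^esub> r h (e \<triangleleft> g) \<cdot>\<^bsub>U\<^esub> sinv U (r (g \<odot> h) e))"

lemma w_facts:
  assumes G: "g \<in> carrier G" "h \<in> carrier G" and e: "e \<in> idems A" "e \<in> P2 g h"
  shows "w g h e \<in> at e" "i (w g h e) \<cdot>\<^bsub>U\<^esub> r (g \<odot> h) e = r g e \<cdot>\<^bsub>U\<^esub> r h (e \<triangleleft> g)"
proof -
  have eg: "e \<in> D g" "e \<in> D (g \<odot> h)" "e \<triangleleft> g \<in> idems A" "e \<triangleleft> g \<in> D h"
    using e idr_closed[OF G(1) e(1)] idr_D[OF G e(1)] by auto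
  have gh: "g \<odot> h \<in> carrier G" using G by simp
  note R1 = r_facts[OF G(1) e(1) eg(1)] and R2 = r_facts[OF G(2) eg(3,4)] and R3 = r_facts[OF gh e(1) eg(2)]
  note s3 = sigma[OF gh e(1) eg(2)]
  let ?u = "r g e \<cdot>\<^bsub>U\<^esub> r h (e \<triangleleft> g) \<cdot>\<^bsub>U\<^esub> sinv U (r (g \<odot> h) e)"
  have u: "?u \<in> carrier U" "r g e \<cdot>\<^bsub>U\<^esub> r h (e \<triangleleft> g) \<in> carrier U" using R1 R2 R3 U.closed by auto
  \<comment> \<open>The last factor of \<open>?u\<close> undoes the product in \<open>T\<close>,
    leaving an idempotent; by the description of the image of \<open>i\<close>, the element
    therefore comes from \<open>A\<close>.\<close>
  have pu: "p ?u = q e" using R1 R2 R3 u sigma_mult[OF G e] s3 by (simp add: p_simps)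
  then have "?u \<in> i ` carrier A" unfolding i_image using u q(1)[OF e(1)] by simp
  then have iw: "i (w g h e) = ?u" "w g h e \<in> carrier A"
    unfolding w_def using f_inv_into_f[of ?u i "carrier A"] inv_into_into[of ?u i "carrier A"] by auto
  have "i (\<epsilon> (w g h e)) = i e"
  proof (rule inj_onD[OF p_idems])
    have "p (i (\<epsilon> (w g h e))) = q e \<cdot>\<^bsub>T\<^esub> sinv T (q e)"
      using i_simps(6)[OF iw(2)] iw pu u by (simp add: p_simps)
    then show "p (i (\<epsilon> (w g h e))) = p (i e)" using q(1)[OF e(1)] T.idems_idem by (simp add: q_def)
  qed (use i_simps(5) iw e in auto)
  then have "\<epsilon> (w g h e) = e" using i_simps(4) iw idems_closed[OF e(1)] by simp
  then show "w g h e \<in> at e" using iw by (simp add: at_def)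
  have "?u \<cdot>\<^bsub>U\<^esub> r (g \<odot> h) e = r g e \<cdot>\<^bsub>U\<^esub> (r h (e \<triangleleft> g) \<cdot>\<^bsub>U\<^esub> i (e \<triangleleft> (g \<odot> h)))"
    using R1 R2 R3 U.closed by (simp add: U.assoc)
  also have "e \<triangleleft> (g \<odot> h) = e \<triangleleft> g \<triangleleft> h" using idr_idr[OF G e(1) eg(1,2)] by simp
  finally show "i (w g h e) \<cdot>\<^bsub>U\<^esub> r (g \<odot> h) e = r g e \<cdot>\<^bsub>U\<^esub> r h (e \<triangleleft> g)" using R2(6) iw by simp
qed

lemma r_cancel:
  assumes g: "g \<in> carrier G" and e: "e \<in> idems A" "e \<in> D g" and x: "x \<in> at e" "y \<in> at e"
    and eq: "i x \<cdot>\<^bsub>U\<^esub> r g e = i y \<cdot>\<^bsub>U\<^esub> r g e"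
  shows "x = y"
proof -
  note R = r_facts[OF g e]
  have c: "x \<in> carrier A" "y \<in> carrier A" "e \<in> carrier A" using x atD idems_closed e by auto
  have "i x \<cdot>\<^bsub>U\<^esub> r g e \<cdot>\<^bsub>U\<^esub> sinv U (r g e) = i (x \<cdot> e)" "i y \<cdot>\<^bsub>U\<^esub> r g e \<cdot>\<^bsub>U\<^esub> sinv U (r g e) = i (y \<cdot> e)"
    using R c i_simps by (simp_all add: U.assoc)
  then have "i (x \<cdot> e) = i (y \<cdot> e)" unfolding eq by simp
  then show ?thesis unfolding at_unit(2)[OF x(1)] at_unit(2)[OF x(2)] by (rule i_simps(4)[OF c(1,2)])
qed

lemma twists_w: "twists w"
  unfolding twists_def
proof (intro ballI conjI)
  fix g h assume G: "g \<in> carrier G" "h \<in> carrier G"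
  have gh: "g \<odot> h \<in> carrier G" using G by simp
  show "sect (P2 g h) (w g h)"
  proof (rule sectI[OF P_ideal(1)[OF G]])
    fix e assume e: "e \<in> P2 g h" "e \<in> idems A"
    show we: "w g h e \<in> at e" by (rule w_facts(1)[OF G e(2,1)])
    fix f assume f: "f \<in> P2 g h" "f \<in> idems A"
    have ef: "e \<cdot> f \<in> idems A" "e \<cdot> f \<in> P2 g h" "f \<cdot> e = e \<cdot> f"
      using e f ideal_ofD(3)[OF P_ideal(1)[OF G], of e f] idems_closed idems_commute by auto
    have eg: "e \<in> D g" "e \<in> D (g \<odot> h)" "e \<triangleleft> g \<in> idems A" "e \<triangleleft> g \<in> D h" "f \<in> D g" "f \<triangleleft> g \<in> idems A"
      "e \<cdot> f \<in> D g" "e \<cdot> f \<in> D (g \<odot> h)"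
      using e f ef idr_closed[OF G(1)] idr_D[OF G] by auto
    have efg: "(e \<cdot> f) \<triangleleft> g = (f \<triangleleft> g) \<cdot> (e \<triangleleft> g)"
      using idr_mult[OF G(1) f(2) eg(5) e(2) eg(1)] ef(3) by simp
    have c: "e \<in> carrier A" "f \<in> carrier A" "w g h e \<in> carrier A" "e \<triangleleft> g \<in> carrier A" "f \<triangleleft> g \<in> carrier A"
      using e f eg idems_closed atD(1)[OF we] by auto
    note R1 = r_facts[OF G(1) ef(1) eg(7)] and R2 = r_facts[OF G(2) eg(3,4)] and R3 = r_facts[OF gh e(2) eg(2)]
    note R0 = r_facts[OF G(1) e(2) eg(1)]
    show "w g h (e \<cdot> f) = w g h e \<cdot> f"
    proof (rule r_cancel[OF gh ef(1) eg(8) w_facts(1)[OF G ef(1,2)] at_restrict[OF we f(2)]])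
      \<comment> \<open>Both values of the twisting are compared after multiplication by
        \<open>r (g \<odot> h) (e \<cdot> f)\<close>. The factor created by restricting
        \<open>r h\<close> is absorbed by the first factor, whose source is the translate of
        \<open>e \<cdot> f\<close>; what remains is \<open>f\<close> times the equation at
        \<open>e\<close>.\<close>
      have "i (w g h (e \<cdot> f)) \<cdot>\<^bsub>U\<^esub> r (g \<odot> h) (e \<cdot> f) = r g (e \<cdot> f) \<cdot>\<^bsub>U\<^esub> (i (f \<triangleleft> g) \<cdot>\<^bsub>U\<^esub> r h (e \<triangleleft> g))"
        using w_facts(2)[OF G ef(1,2)] efg r_restrict[OF G(2) eg(6,3,4)] by simp
      also have "\<dots> = r g (e \<cdot> f) \<cdot>\<^bsub>U\<^esub> (i ((e \<cdot> f) \<triangleleft> g) \<cdot>\<^bsub>U\<^esub> i (f \<triangleleft> g)) \<cdot>\<^bsub>U\<^esub> r h (e \<triangleleft> g)"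
        using R1 R2(1) c i_simps(1) idr_closed(3)[OF G(1) ef(1) eg(7)] U.closed by (simp flip: U.assoc)
      also have "i ((e \<cdot> f) \<triangleleft> g) \<cdot>\<^bsub>U\<^esub> i (f \<triangleleft> g) = i ((e \<cdot> f) \<triangleleft> g)"
      proof -
        have "(f \<triangleleft> g) \<cdot> (e \<triangleleft> g) \<cdot> (f \<triangleleft> g) = (f \<triangleleft> g) \<cdot> (e \<triangleleft> g)"
          using idems_commute[OF eg(6,3)] idems_idem[OF eg(6)] c by (simp add: assoc)
        then show ?thesis unfolding efg using i_simps(2)[of "(f \<triangleleft> g) \<cdot> (e \<triangleleft> g)" "f \<triangleleft> g"] c closed by simp
      qed
      also have "r g (e \<cdot> f) \<cdot>\<^bsub>U\<^esub> i ((e \<cdot> f) \<triangleleft> g) = i f \<cdot>\<^bsub>U\<^esub> r g e"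
        using R1(6) r_restrict[OF G(1) f(2) e(2) eg(1)] ef(3) by simp
      also have "i f \<cdot>\<^bsub>U\<^esub> r g e \<cdot>\<^bsub>U\<^esub> r h (e \<triangleleft> g) = i f \<cdot>\<^bsub>U\<^esub> (i (w g h e) \<cdot>\<^bsub>U\<^esub> r (g \<odot> h) e)"
        using w_facts(2)[OF G e(2,1)] R0 R2 c i_simps(1) by (simp add: U.assoc)
      also have "\<dots> = i (f \<cdot> w g h e) \<cdot>\<^bsub>U\<^esub> r (g \<odot> h) e"
        using R3(1) c i_simps by (simp add: U.assoc)
      also have "f \<cdot> w g h e = w g h e \<cdot> f \<cdot> f"
        using idem_comm[OF f(2) c(3)] idems_idem[OF f(2)] c by (simp add: assoc)
      also have "i (w g h e \<cdot> f \<cdot> f) \<cdot>\<^bsub>U\<^esub> r (g \<odot> h) e = i (w g h e \<cdot> f) \<cdot>\<^bsub>U\<^esub> r (g \<odot> h) (e \<cdot> f)"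
        using r_restrict[OF gh f(2) e(2) eg(2)] ef(3) R3(1) c i_simps(1,2) closed U.closed by (simp add: U.assoc)
      finally show "i (w g h (e \<cdot> f)) \<cdot>\<^bsub>U\<^esub> r (g \<odot> h) (e \<cdot> f) = i (w g h e \<cdot> f) \<cdot>\<^bsub>U\<^esub> r (g \<odot> h) (e \<cdot> f)" .
    qed
  qed
  fix e a assume "e \<in> idems A \<inter> P2 g h" and a: "a \<in> at (e \<triangleleft> (g \<odot> h))"
  then have e: "e \<in> idems A" "e \<in> P2 g h" "e \<in> D g" "e \<in> D (g \<odot> h)" by auto
  have eg: "e \<triangleleft> g \<in> idems A" "e \<triangleleft> g \<in> D h" using e idr_closed[OF G(1)] idr_D[OF G] by auto
  note Y = at_tt[OF G e(1,2) a] and we = w_facts[OF G e(1,2)]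
  note R1 = r_facts[OF G(1) e(1,3)] and R2 = r_facts[OF G(2) eg] and R3 = r_facts[OF gh e(1,4)]
  have c: "a \<in> carrier A" "w g h e \<in> carrier A" "t (g \<odot> h) a \<in> carrier A" "t g (t h a) \<in> carrier A"
    using Y we atD by auto
  note ic = i_simps(1)[OF c(1)] i_simps(1)[OF c(2)]
  have rr: "r g e \<cdot>\<^bsub>U\<^esub> r h (e \<triangleleft> g) \<in> carrier U" using R1 R2 U.closed by simp
  \<comment> \<open>In \<open>U\<close> the composite of the two representatives is conjugation by
    \<open>r g e\<close> times \<open>r h (e \<triangleleft> g)\<close>. This product is
    \<open>w g h e\<close> times \<open>r (g \<odot> h) e\<close>, which splits the conjugation as
    required.\<close>
  have "i (t g (t h a)) = r g e \<cdot>\<^bsub>U\<^esub> (r h (e \<triangleleft> g) \<cdot>\<^bsub>U\<^esub> i a \<cdot>\<^bsub>U\<^esub> sinv U (r h (e \<triangleleft> g))) \<cdot>\<^bsub>U\<^esub> sinv U (r g e)"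
    using i_t_at[OF G(1) e(1,3) Y(2)] i_t_at[OF G(2) eg Y(1)] by simp
  also have "\<dots> = (r g e \<cdot>\<^bsub>U\<^esub> r h (e \<triangleleft> g)) \<cdot>\<^bsub>U\<^esub> i a \<cdot>\<^bsub>U\<^esub> sinv U (r g e \<cdot>\<^bsub>U\<^esub> r h (e \<triangleleft> g))"
    using R1(1) R2(1) ic U.sinv_mult[OF R1(1) R2(1)] U.closed by (simp add: U.assoc)
  also have "\<dots> = i (w g h e) \<cdot>\<^bsub>U\<^esub> (r (g \<odot> h) e \<cdot>\<^bsub>U\<^esub> i a \<cdot>\<^bsub>U\<^esub> sinv U (r (g \<odot> h) e)) \<cdot>\<^bsub>U\<^esub> sinv U (i (w g h e))"
    unfolding we(2)[symmetric] using R3(1) ic U.sinv_mult[OF ic(2) R3(1)] U.closed by (simp add: U.assoc)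
  also have "\<dots> = i (w g h e \<cdot> t (g \<odot> h) a \<cdot> (w g h e)\<^sup>\<dagger>)"
    using i_t_at[OF gh e(1,4) a] i_simps c closed by simp
  finally have "t g (t h a) = w g h e \<cdot> t (g \<odot> h) a \<cdot> (w g h e)\<^sup>\<dagger>"
    using i_simps(4) c closed by simp
  then show "t g (t h a) \<cdot> w g h e = w g h e \<cdot> t (g \<odot> h) a"
    using c atD(2)[OF we(1)] at_unit(2)[OF Y(4)] by (simp add: assoc closed)
qed

text \<open>After multiplication by \<open>r (g \<odot> h \<odot> k) e\<close> both sides become the
  product of three lifts, of degrees g, h, k and at successive translates of \<open>e\<close>,
  bracketed in two ways.\<close>

lemma associates_w: "associates w (\<lambda>g h k e. e)"
  unfolding associates_def
proof (intro ballI conjI)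
  fix g h k e assume G: "g \<in> carrier G" "h \<in> carrier G" "k \<in> carrier G" and "e \<in> idems A \<inter> P3 g h k"
  then have e: "e \<in> idems A" "e \<in> P3 g h k" by auto
  show "e \<in> at e" "e \<in> center A" using e at_idem idems_center by auto
  note E = P3_faces[OF G e] and F = twist_faces[OF twists_w G e]
  have gg: "g \<odot> h \<in> carrier G" "h \<odot> k \<in> carrier G" "g \<odot> h \<odot> k \<in> carrier G" "g \<odot> (h \<odot> k) = g \<odot> h \<odot> k"
    using G by (auto simp: G.m_assoc)
  have eD: "e \<in> D (g \<odot> h)" "e \<in> D (g \<odot> h \<odot> k)" "e \<triangleleft> g \<in> D h" "e \<triangleleft> g \<in> D (h \<odot> k)" using e E by auto
  have egh: "e \<triangleleft> g \<triangleleft> h = e \<triangleleft> (g \<odot> h)" by (rule idr_idr[OF G(1,2) e(1) E(6) eD(1)])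
  have eghD: "e \<triangleleft> (g \<odot> h) \<in> idems A" "e \<triangleleft> (g \<odot> h) \<in> D k"
    using idr_closed(1)[OF gg(1) e(1) eD(1)] idr_D[OF gg(1) G(3) e(1) eD(1,2)] by auto
  note R1 = r_facts[OF G(1) e(1) E(6)] and R2 = r_facts[OF G(2) E(1) eD(3)] and R3 = r_facts[OF G(3) eghD]
    and R4 = r_facts[OF gg(3) e(1) eD(2)] and R5 = r_facts[OF gg(2) E(1) eD(4)] and R6 = r_facts[OF gg(1) e(1) eD(1)]
  have c: "w h k (e \<triangleleft> g) \<in> carrier A" "w g (h \<odot> k) e \<in> carrier A" "t g (w h k (e \<triangleleft> g)) \<in> carrier A"
    "w g h e \<in> carrier A" "w (g \<odot> h) k e \<in> carrier A" "e \<triangleleft> g \<in> carrier A"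
    using F atD idems_closed E by auto
  note ic = c[THEN i_simps(1)]
  have "i (t g (w h k (e \<triangleleft> g)) \<cdot> w g (h \<odot> k) e) \<cdot>\<^bsub>U\<^esub> r (g \<odot> h \<odot> k) e =
      i (t g (w h k (e \<triangleleft> g))) \<cdot>\<^bsub>U\<^esub> (i (w g (h \<odot> k) e) \<cdot>\<^bsub>U\<^esub> r (g \<odot> (h \<odot> k)) e)"
    using c ic R4(1) i_simps(2) gg(4) by (simp add: U.assoc)
  also have "\<dots> = (r g e \<cdot>\<^bsub>U\<^esub> i (w h k (e \<triangleleft> g)) \<cdot>\<^bsub>U\<^esub> sinv U (r g e)) \<cdot>\<^bsub>U\<^esub> (r g e \<cdot>\<^bsub>U\<^esub> r (h \<odot> k) (e \<triangleleft> g))"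
    unfolding w_facts(2)[OF G(1) gg(2) e(1) E(4)] using i_t_at[OF G(1) e(1) E(6) F(6)] by simp
  also have "\<dots> = r g e \<cdot>\<^bsub>U\<^esub> i (w h k (e \<triangleleft> g)) \<cdot>\<^bsub>U\<^esub> (sinv U (r g e) \<cdot>\<^bsub>U\<^esub> r g e) \<cdot>\<^bsub>U\<^esub> r (h \<odot> k) (e \<triangleleft> g)"
    using R1(1) R5(1) ic U.closed by (simp add: U.assoc)
  also have "\<dots> = r g e \<cdot>\<^bsub>U\<^esub> (i (w h k (e \<triangleleft> g) \<cdot> (e \<triangleleft> g)) \<cdot>\<^bsub>U\<^esub> r (h \<odot> k) (e \<triangleleft> g))"
    unfolding R1(4) using R1(1) R5(1) ic c i_simps(2) U.closed by (simp add: U.assoc)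
  also have "\<dots> = r g e \<cdot>\<^bsub>U\<^esub> (r h (e \<triangleleft> g) \<cdot>\<^bsub>U\<^esub> r k (e \<triangleleft> (g \<odot> h)))"
    unfolding at_unit(2)[OF F(6)] w_facts(2)[OF G(2,3) E(1,2)] egh ..
  also have "\<dots> = (r g e \<cdot>\<^bsub>U\<^esub> r h (e \<triangleleft> g)) \<cdot>\<^bsub>U\<^esub> r k (e \<triangleleft> (g \<odot> h))" using R1(1) R2(1) R3(1) by (simp add: U.assoc)
  also have "\<dots> = i (w g h e) \<cdot>\<^bsub>U\<^esub> (r (g \<odot> h) e \<cdot>\<^bsub>U\<^esub> r k (e \<triangleleft> (g \<odot> h)))"
    unfolding w_facts(2)[OF G(1,2) e(1) E(5), symmetric] using ic R6(1) R3(1) by (simp add: U.assoc)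
  also have "\<dots> = i (w g h e) \<cdot>\<^bsub>U\<^esub> (i (w (g \<odot> h) k e) \<cdot>\<^bsub>U\<^esub> r (g \<odot> h \<odot> k) e)"
    unfolding w_facts(2)[OF gg(1) G(3) e(1) E(3)] ..
  also have "\<dots> = i (w g h e \<cdot> w (g \<odot> h) k e) \<cdot>\<^bsub>U\<^esub> r (g \<odot> h \<odot> k) e"
    using c ic R4(1) i_simps(2) by (simp add: U.assoc)
  finally have "t g (w h k (e \<triangleleft> g)) \<cdot> w g (h \<odot> k) e = w g h e \<cdot> w (g \<odot> h) k e"
    by (rule r_cancel[OF gg(3) e(1) eD(2) at_mult[OF F(1,2)] at_mult[OF F(4,3)]])
  then show "t g (w h k (e \<triangleleft> g)) \<cdot> w g (h \<odot> k) e = e \<cdot> w g h e \<cdot> w (g \<odot> h) k e"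
    using at_unit(1)[OF F(4)] by simp
qed

lemma Obs_trivial: "Obs A G \<psi> = \<one>\<^bsub>center_cohomology A G \<psi> 3\<^esub>"
proof -
  let ?\<beta> = "\<lambda>g h k. mk_mult (P3 g h k) (\<lambda>e. e)"
  have o: "obstruction A G \<psi> ?\<beta>"
    unfolding obstruction_def
    using twists_twisting[OF twists_w] associates_associator[OF twists_w associates_w] reps
    by (auto simp: representatives_def)
  have "fst (?\<beta> g h k) e = dz (\<lambda>g h e. e) g h k e"
    if G: "g \<in> carrier G" "h \<in> carrier G" "k \<in> carrier G" and e: "e \<in> idems A" "e \<in> P3 g h k" for g h k e
    unfolding dz_idem[OF that]
    by (rule fst_mk_mult[OF ideal_subsemigrp[OF P_ideal(2)[OF G]] sect_idem[OF ideal_subsemigrp[OF P_ideal(2)[OF G]]] e(2,1)])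
  then show ?thesis
    unfolding Obs_trivial_iff[OF o] using central2_idem by (intro exI[of _ "\<lambda>g h e. e"]) simp
qed

end

section \<open>Existence of admissible extensions and triviality of the class\<close>

lemma (in abs_kernel) admissible_extension_trivial:
  assumes "has_admissible_extension TYPE('u) TYPE('s) A G \<psi>"
  shows "Obs A G \<psi> = \<one>\<^bsub>center_cohomology A G \<psi> 3\<^esub>"
proof -
  obtain U :: "'u semigrp" and i j and S :: "'s semigrp" and p \<kappa> \<rho> where
    "gext A G U i j" "refinement A G U i j S p \<kappa>" "order_transversal U S p \<rho>"
    "\<forall>g \<in> carrier G. \<psi> g = sim A `` {ext_action A G U S i \<kappa> \<rho> g}"
    using assms unfolding has_admissible_extension_def by blast
  then interpret admissible A G \<psi> U i j S p \<kappa> \<rho>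
    by unfold_locales simp_all
  show ?thesis by (rule Obs_trivial)
qed

text \<open>The equivalence is stated for carriers in pairs, where the crossed product lives. The
  last conjunct says that an extension over any other carrier types also forces the class to be
  trivial, so together they cover extensions of every type.\<close>

theorem theorem2p15:
  fixes A :: "'a semigrp"
    and G :: "('g, 'm) monoid_scheme"
    and \<psi> :: "'g \<Rightarrow> ('a \<rightharpoonup> 'a) set"
  assumes "abstract_kernel A G \<psi>"
  shows
    "(partial_module G (center_semigrp A) (center_dom A \<psi>) (center_action A G \<psi>) \<and>
      (\<forall>g \<in> carrier G. \<forall>\<theta> \<in> \<psi> g.
         \<theta> |` center_dom A \<psi> (inv\<^bsub>G\<^esub> g) = center_action A G \<psi> g)) \<and>
     ((\<exists>\<beta>. obstruction A G \<psi> \<beta>) \<and>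
      Obs A G \<psi> \<in> carrier (center_cohomology A G \<psi> 3) \<and>
      (\<forall>\<beta>. obstruction A G \<psi> \<beta> \<longrightarrow>
         center_cochain A G \<psi> \<beta> \<in> center_cocycles A G \<psi> 3 \<and>
         obstruction_class A G \<psi> \<beta> = Obs A G \<psi>)) \<and>
     (has_admissible_extension TYPE('a \<times> 'g) TYPE('a \<times> 'g) A G \<psi> \<longleftrightarrow>
        Obs A G \<psi> = \<one>\<^bsub>center_cohomology A G \<psi> 3\<^esub>) \<and>
     (has_admissible_extension TYPE('u) TYPE('s) A G \<psi> \<longrightarrow>
        Obs A G \<psi> = \<one>\<^bsub>center_cohomology A G \<psi> 3\<^esub>)"
proof -
  interpret semilattice_of_groups A using assms by (simp add: abstract_kernel_def)
  interpret G: group G using assms by (simp add: abstract_kernel_def)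
  interpret abs_kernel A G \<psi> using assms by unfold_locales (simp add: abstract_kernel_def)
  show ?thesis
    using partial_module_center center_action_restrict obstruction_exists Obs_closed obstruction_cochain(3) Obs_eq
      trivial_obstruction_extension admissible_extension_trivial[where 'u = "'a \<times> 'g" and 's = "'a \<times> 'g"]
      admissible_extension_trivial[where 'u = 'u and 's = 's]
    by blast
qed

end
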